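(* Let $A$ satisfy the weak correlation assumption (stated in the context), and suppose the branching is binary, i.e. $p_2=1$ and $p_k=0$ for $k\neq 2$. Then for any $\rho\in[-1,1]$ and any $\beta=\sigma+i\tau\in\mathbb{C}$, $$\lim_{t\uparrow\infty}\frac1t\log\big|\mathcal{X}_{\beta,\rho}(t)\big|=\begin{cases}1+\tfrac12(\sigma^2-\tau^2), & \beta\in\overline{B_1},\\ \sqrt2\,|\sigma|, & \beta\in\overline{B_2},\\ \tfrac12+\sigma^2, & \beta\in\overline{B_3},\end{cases}$$ in probability. (In words: the complex CREM in the weak correlation regime has the same limiting log-partition function and phase diagram as the complex random energy model.)
   Context: Tree. Let $(p_k)_{k\ge1}$ be a probability distribution on $\{1,2,\dots\}$ with $\sum_k k p_k=2$ and $K:=\sum_k k(k-1)p_k<\infty$. Consider the continuous-time Galton-Watson process started from one particle, in which each particle independently lives an exponential time of rate 1 and is then replaced by $k$ particles with probability $p_k$. Let $n(t)$ be the number of particles alive at time $t$ (so $\mathbb{E}[n(t)]=e^t$), labelled $1,\dots,n(t)$. For particles $k,l\le n(t)$ let $d(k,l)\in[0,t]$ be the time of their most recent common ancestor ($d(k,k)=t$). Weak correlation assumption. $A:[0,1]\to[0,1]$ is right-continuous, non-decreasing, and: (A1) $A(0)=0$, $A(1)=1$, $A(x)<x$ for all $x\in(0,1)$. (A2) There are $\delta_b>0$ and functions $\underline B,\overline B:[0,1]\to[0,1]$, twice differentiable on $[0,\delta_b]$ with bounded second derivatives, with $\underline B\le A\le\overline B$ on $[0,\delta_b]$ and $\overline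 B'(0)=\underline B'(0)\equiv A'(0)\equiv\sigma_b^2$. (A3) There are $\delta_e>0$ and functions $\underline C,\overline C:[0,1]\to[0,1]$, twice differentiable on $[1-\delta_e,1]$ with bounded second derivatives, with $\underline C\le A\le\overline C$ on $[1-\delta_e,1]$ and $\overline C'(1)=\underline C'(1)\equiv A'(1)\equiv\sigma_e^2$; the case $A'(1)=+\infty$ is allowed, meaning that for every $R<\infty$ there is $\varepsilon>0$ with $A(x)\le1-R(1-x)$ for all $x\in[1-\varepsilon,1]$. CREM. For time horizon $t$, conditionally on the tree, $(x_k(s))_{k\le n(t),s\in[0,t]}$ and $(z_k(s))_{k\le n(t),s\in[0,t]}$ are independent centered Gaussian processes, each with covariance $\mathbb{E}[x_k(s)x_l(s')]=tA(\min(s,s',d(k,l))/t)$; here $x_k(s)$ is the position at time $s$ of the ancestor of particle $k$. Set $y_k:=\rho x_k+\sqrt{1-\rho^2}\,z_k$, so $\mathrm{Cov}(x_k(t),y_k(t))=\rho t$. The partition function at $\beta=\sigma+i\tau$ is $\mathcal{X}_{\beta,\rho}(t):=\sum_{k=1}^{n(t)}e^{\sigma x_k(t)+i\tau y_k(t)}$. Phases. $B_2:=\{\sigma+i\tau\in\mathbb{C}:2\sigma^2>1,\ |\sigma|+|\tau|>\sqrt2\}$, $B_3:=\{\sigma+i\tau\in\mathbb{C}:2\sigma^2<1,\ \sigma^2+\tau^2>1\}$, $B_1:=\mathbb{C}\setminus\overline{B_2\cup B_3}$. *)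

theory Defs
  imports "HOL-Probability.Probability" "HOL-Library.Sublist"
begin

definition twice_diff_bounded_on :: "real set \<Rightarrow> (real \<Rightarrow> real) \<Rightarrow> (real \<Rightarrow> real) \<Rightarrow> bool" where
  "twice_diff_bounded_on I f f' \<longleftrightarrow>
     (\<exists>f''. (\<forall>x\<in>I. (f has_real_derivative f' x) (at x within I) \<and>
                   (f' has_real_derivative f'' x) (at x within I)) \<and>
            bounded (f'' ` I))"

definition slope_at_start :: "(real \<Rightarrow> real) \<Rightarrow> bool" where
  "slope_at_start A \<longleftrightarrow>
     (\<exists>\<delta> \<sigma>\<^sub>b Bl Bu Bl' Bu'. 0 < \<delta> \<and> \<delta> \<le> 1 \<and>
        Bl ` {0..1} \<subseteq> {0..1} \<and> Bu ` {0..1} \<subseteq> {0..1} \<and>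
        twice_diff_bounded_on {0..\<delta>} Bl Bl' \<and> twice_diff_bounded_on {0..\<delta>} Bu Bu' \<and>
        (\<forall>x\<in>{0..\<delta>}. Bl x \<le> A x \<and> A x \<le> Bu x) \<and>
        Bl' 0 = \<sigma>\<^sub>b\<^sup>2 \<and> Bu' 0 = \<sigma>\<^sub>b\<^sup>2 \<and>
        (A has_real_derivative \<sigma>\<^sub>b\<^sup>2) (at 0 within {0..1}))"

definition slope_at_end :: "(real \<Rightarrow> real) \<Rightarrow> bool" where
  "slope_at_end A \<longleftrightarrow>
     (\<exists>\<delta> \<sigma>\<^sub>e Cl Cu Cl' Cu'. 0 < \<delta> \<and> \<delta> \<le> 1 \<and>
        Cl ` {0..1} \<subseteq> {0..1} \<and> Cu ` {0..1} \<subseteq> {0..1} \<and>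
        twice_diff_bounded_on {1 - \<delta>..1} Cl Cl' \<and> twice_diff_bounded_on {1 - \<delta>..1} Cu Cu' \<and>
        (\<forall>x\<in>{1 - \<delta>..1}. Cl x \<le> A x \<and> A x \<le> Cu x) \<and>
        Cl' 1 = \<sigma>\<^sub>e\<^sup>2 \<and> Cu' 1 = \<sigma>\<^sub>e\<^sup>2 \<and>
        (A has_real_derivative \<sigma>\<^sub>e\<^sup>2) (at 1 within {0..1}))"

text \<open>This is the meaning of \<open>A'(1) = \<infinity>\<close>; it replaces the bounds required when the slope is finite.\<close>

definition infinite_slope_at_end :: "(real \<Rightarrow> real) \<Rightarrow> bool" where
  "infinite_slope_at_end A \<longleftrightarrow>
     (\<forall>R. \<exists>\<epsilon>. 0 < \<epsilon> \<and> \<epsilon> \<le> 1 \<and> (\<forall>x\<in>{1 - \<epsilon>..1}. A x \<le> 1 - R * (1 - x)))"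

definition weak_correlation :: "(real \<Rightarrow> real) \<Rightarrow> bool" where
  "weak_correlation A \<longleftrightarrow>
     A ` {0..1} \<subseteq> {0..1} \<and> mono_on {0..1} A \<and>
     (\<forall>x\<in>{0..<1}. continuous (at_right x) A) \<and>
     A 0 = 0 \<and> A 1 = 1 \<and> (\<forall>x\<in>{0<..<1}. A x < x) \<and>
     slope_at_start A \<and> (slope_at_end A \<or> infinite_slope_at_end A)"

text \<open>
  Particles carry Ulam-Harris labels: the initial particle is \<open>[]\<close>, and the children of \<open>u\<close> are
  \<open>u @ [i]\<close> with \<open>i < k u\<close>, where \<open>k u\<close> is the number of offspring and \<open>L u\<close> the lifetime of \<open>u\<close>.
\<close>

definition birth :: "(nat list \<Rightarrow> real) \<Rightarrow> nat list \<Rightarrow> real" where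
  "birth L u = (\<Sum>i<length u. L (take i u))"

definition alive :: "(nat list \<Rightarrow> real) \<Rightarrow> (nat list \<Rightarrow> nat) \<Rightarrow> real \<Rightarrow> nat list set" where
  "alive L k t = {u. (\<forall>i<length u. u ! i < k (take i u)) \<and> birth L u \<le> t \<and> t < birth L u + L u}"

text \<open>
  Two distinct particles alive at time \<open>t\<close> separate when the particle labelled by their longest
  common prefix dies.
\<close>

definition mrca_time :: "(nat list \<Rightarrow> real) \<Rightarrow> real \<Rightarrow> nat list \<Rightarrow> nat list \<Rightarrow> real" where
  "mrca_time L t u v =
     (if u = v then t else (let w = longest_common_prefix u v in birth L w + L w))"

definition galton_watson ::
  "'a measure \<Rightarrow> nat pmf \<Rightarrow> (nat list \<Rightarrow> 'a \<Rightarrow> real) \<Rightarrow> (nat list \<Rightarrow> 'a \<Rightarrow> nat) \<Rightarrow> bool" where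
  "galton_watson M p life offs \<longleftrightarrow>
     prob_space M \<and>
     prob_space.indep_vars M (\<lambda>_. borel \<Otimes>\<^sub>M count_space UNIV) (\<lambda>u \<omega>. (life u \<omega>, offs u \<omega>)) UNIV \<and>
     (\<forall>u. distr M (borel \<Otimes>\<^sub>M count_space UNIV) (\<lambda>\<omega>. (life u \<omega>, offs u \<omega>)) =
            density lborel (exponential_density 1) \<Otimes>\<^sub>M measure_pmf p)"

text \<open>Every finite linear combination is normally distributed; \<open>s = 0\<close> gives the point masses.\<close>

definition gaussian_process :: "'b measure \<Rightarrow> 'i set \<Rightarrow> ('i \<Rightarrow> 'b \<Rightarrow> real) \<Rightarrow> bool" where
  "gaussian_process P I X \<longleftrightarrow>
     (\<forall>i\<in>I. X i \<in> borel_measurable P) \<and>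
     (\<forall>J c. finite J \<longrightarrow> J \<subseteq> I \<longrightarrow>
        (\<exists>m s. distr P borel (\<lambda>\<eta>. \<Sum>j\<in>J. c j * X j \<eta>) =
               distr std_normal_distribution borel (\<lambda>g. m + s * g)))"

definition centered_gaussian_process ::
  "'b measure \<Rightarrow> 'i set \<Rightarrow> ('i \<Rightarrow> 'i \<Rightarrow> real) \<Rightarrow> ('i \<Rightarrow> 'b \<Rightarrow> real) \<Rightarrow> bool" where
  "centered_gaussian_process P I C X \<longleftrightarrow>
     gaussian_process P I X \<and>
     (\<forall>i\<in>I. (\<integral>\<eta>. X i \<eta> \<partial>P) = 0) \<and>
     (\<forall>i\<in>I. \<forall>j\<in>I. (\<integral>\<eta>. X i \<eta> * X j \<eta> \<partial>P) = C i j)"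

definition indep_processes ::
  "'b measure \<Rightarrow> 'i set \<Rightarrow> ('i \<Rightarrow> 'b \<Rightarrow> real) \<Rightarrow> ('i \<Rightarrow> 'b \<Rightarrow> real) \<Rightarrow> bool" where
  "indep_processes P I X Z \<longleftrightarrow>
     prob_space.indep_var P (\<Pi>\<^sub>M i\<in>I. borel) (\<lambda>\<eta>. \<lambda>i\<in>I. X i \<eta>) (\<Pi>\<^sub>M i\<in>I. borel) (\<lambda>\<eta>. \<lambda>i\<in>I. Z i \<eta>)"

definition crem_cov ::
  "(real \<Rightarrow> real) \<Rightarrow> real \<Rightarrow> (nat list \<Rightarrow> real) \<Rightarrow> nat list \<times> real \<Rightarrow> nat list \<times> real \<Rightarrow> real" where
  "crem_cov A t L = (\<lambda>(u, s) (v, s'). t * A (min (min s s') (mrca_time L t u v) / t))"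

text \<open>
  The tree lives on \<open>M\<close>. Conditioning on the tree is expressed by a probability kernel \<open>Q\<close> from \<open>M\<close>
  to \<open>S\<close>: \<open>Q \<omega>\<close> is the law of the remaining randomness given \<open>\<omega>\<close>, and the law of the whole
  model is the semidirect product of \<open>M\<close> and \<open>Q\<close>.
\<close>

definition annealed :: "'a measure \<Rightarrow> 'b measure \<Rightarrow> ('a \<Rightarrow> 'b measure) \<Rightarrow> ('a \<times> 'b) measure" where
  "annealed M S Q = M \<bind> (\<lambda>\<omega>. distr (Q \<omega>) (M \<Otimes>\<^sub>M S) (\<lambda>\<eta>. (\<omega>, \<eta>)))"

text \<open>
  In \<open>x u s\<close> and \<open>z u s\<close>, \<open>u\<close> is the label of a particle alive at the time horizon \<open>t\<close>
  and \<open>s\<close> is in \<open>[0, t]\<close>. For labels that are not alive at time \<open>t\<close> only measurability is required.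
\<close>

definition crem ::
  "(real \<Rightarrow> real) \<Rightarrow> real \<Rightarrow> 'a measure \<Rightarrow> (nat list \<Rightarrow> 'a \<Rightarrow> real) \<Rightarrow> (nat list \<Rightarrow> 'a \<Rightarrow> nat) \<Rightarrow>
   'b measure \<Rightarrow> ('a \<Rightarrow> 'b measure) \<Rightarrow>
   (nat list \<Rightarrow> real \<Rightarrow> 'a \<times> 'b \<Rightarrow> real) \<Rightarrow> (nat list \<Rightarrow> real \<Rightarrow> 'a \<times> 'b \<Rightarrow> real) \<Rightarrow> bool" where
  "crem A t M life offs S Q x z \<longleftrightarrow>
     Q \<in> measurable M (prob_algebra S) \<and>
     (\<forall>u. \<forall>s\<in>{0..t}. x u s \<in> borel_measurable (M \<Otimes>\<^sub>M S) \<and> z u s \<in> borel_measurable (M \<Otimes>\<^sub>M S)) \<and>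
     (AE \<omega> in M.
        let L = (\<lambda>u. life u \<omega>);
            I = alive L (\<lambda>u. offs u \<omega>) t \<times> {0..t};
            X = (\<lambda>(u, s) \<eta>. x u s (\<omega>, \<eta>));
            Z = (\<lambda>(u, s) \<eta>. z u s (\<omega>, \<eta>))
        in centered_gaussian_process (Q \<omega>) I (crem_cov A t L) X \<and>
           centered_gaussian_process (Q \<omega>) I (crem_cov A t L) Z \<and>
           indep_processes (Q \<omega>) I X Z)"

definition partition_function ::
  "complex \<Rightarrow> real \<Rightarrow> real \<Rightarrow> (nat list \<Rightarrow> 'a \<Rightarrow> real) \<Rightarrow> (nat list \<Rightarrow> 'a \<Rightarrow> nat) \<Rightarrow>
   (nat list \<Rightarrow> real \<Rightarrow> 'a \<times> 'b \<Rightarrow> real) \<Rightarrow> (nat list \<Rightarrow> real \<Rightarrow> 'a \<times> 'b \<Rightarrow> real) \<Rightarrow> 'a \<times> 'b \<Rightarrow> complex" where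
  "partition_function \<beta> \<rho> t life offs x z \<xi> =
     (\<Sum>u\<in>alive (\<lambda>u. life u (fst \<xi>)) (\<lambda>u. offs u (fst \<xi>)) t.
        let y = \<rho> * x u t \<xi> + sqrt (1 - \<rho>\<^sup>2) * z u t \<xi>
        in exp (complex_of_real (Re \<beta> * x u t \<xi>) + \<i> * complex_of_real (Im \<beta> * y)))"

definition phase2 :: "complex set" where
  "phase2 = {\<beta>. 2 * (Re \<beta>)\<^sup>2 > 1 \<and> \<bar>Re \<beta>\<bar> + \<bar>Im \<beta>\<bar> > sqrt 2}"

definition phase3 :: "complex set" where
  "phase3 = {\<beta>. 2 * (Re \<beta>)\<^sup>2 < 1 \<and> (Re \<beta>)\<^sup>2 + (Im \<beta>)\<^sup>2 > 1}"

definition phase1 :: "complex set" where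
  "phase1 = - closure (phase2 \<union> phase3)"

text \<open>
  The random variables may live on different probability spaces. Their measurability is part of the
  definition because \<open>measure\<close> is \<open>0\<close> on non-measurable sets.
\<close>

definition conv_in_prob :: "(real \<Rightarrow> 'c measure) \<Rightarrow> (real \<Rightarrow> 'c \<Rightarrow> real) \<Rightarrow> real \<Rightarrow> bool" where
  "conv_in_prob P f l \<longleftrightarrow>
     (\<forall>\<^sub>F t in at_top. prob_space (P t) \<and> f t \<in> borel_measurable (P t)) \<and>
     (\<forall>\<epsilon>>0. ((\<lambda>t. measure (P t) {\<xi> \<in> space (P t). \<bar>f t \<xi> - l\<bar> > \<epsilon>}) \<longlongrightarrow> 0) at_top)"

text \<open>
  HOL sets \<open>ln 0 = 0\<close>. All limits considered are at least \<open>1/2\<close>, so a vanishing partition function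
  still counts as a deviation for all \<open>\<epsilon> < 1/2\<close>, exactly as with \<open>log 0 = -\<infinity>\<close>.
\<close>

definition log_partition ::
  "complex \<Rightarrow> real \<Rightarrow> real \<Rightarrow> (nat list \<Rightarrow> 'a \<Rightarrow> real) \<Rightarrow> (nat list \<Rightarrow> 'a \<Rightarrow> nat) \<Rightarrow>
   (nat list \<Rightarrow> real \<Rightarrow> 'a \<times> 'b \<Rightarrow> real) \<Rightarrow> (nat list \<Rightarrow> real \<Rightarrow> 'a \<times> 'b \<Rightarrow> real) \<Rightarrow> 'a \<times> 'b \<Rightarrow> real" where
  "log_partition \<beta> \<rho> t life offs x z \<xi> = ln (cmod (partition_function \<beta> \<rho> t life offs x z \<xi>)) / t"

end

(*
  Almost surely the tree is finite at time t, and given the tree the particle positions are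
  realised by an independent pair of Gaussian increments for every particle.  This turns the
  annealed law into the law of a recursively defined functional of independent identically
  distributed marks on the binary tree.

  Upper bounds: Markov's inequality for the q-th moment, where 1 <= q <= 2 is chosen according to
  Re beta; the moments are propagated along the branching recursion by the inequality
  |x + y|^q <= |x|^q + linear term + 7 |y|^q.  When |Re beta| is large, fractional moments suffice.

  Lower bounds: if the first moment exceeds the fluctuations, the partition function is
  compared with its mean by conditioning on an early generation of the tree.  Otherwise
  everything except the last unit of time is frozen; the last displacements of the particles near
  the dominant height are independent and spread the sum out at the scale of its fluctuations.  Both
  anti-concentration estimates bound small ball probabilities by the characteristic function.
*)

theory Submission
  imports Defs "HOL-Real_Asymp.Real_Asymp"
begin

section \<open>Marked binary trees\<close>

text \<open>The rate of the fluctuations has two descriptions. It is the minimum over q in (0, 2] of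
  (1 + q^2 \<sigma>^2 / 2) / q, where q \<le> 2 is the range of the moment inequality. Dually it is
  the supremum over \<gamma>^2 < 2 of \<sigma> \<gamma> + 1/2 - \<gamma>^2 / 4, the rate of exp
  (\<sigma> x) at x = \<gamma> t times the square root of the number of particles there. Upper
  bounds work with q, lower bounds with \<gamma>. A Paley-Zygmund argument yields a lower bound with
  positive probability, whereas probability close to 1 is required. The gap is closed by
  independence: a product of many characteristic functions decays at a scale larger than the ball in
  question. The covariance enters through a profile \<open>B\<close> with \<open>B s \<le> s\<close>
  whose increments near time 0 have slope at most 1 up to an additive constant. A survivor receives
  whatever variance is missing to the horizon, so one \<open>B\<close> serves both horizons t and t
  - 1, and each leaf at t has exactly one more unit of variance than at t - 1. All sums are cut at
  generation n. Recursions become inductions on n, and n is taken large at fixed t.\<close>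

definition tree_space :: "'a measure \<Rightarrow> (bool list \<Rightarrow> 'a) measure" where
  "tree_space M = (\<Pi>\<^sub>M u\<in>UNIV. M)"

text \<open>Inverse of splitting a marked tree at its root; \<open>False\<close> leads into
  \<open>\<omega>0\<close> and \<open>True\<close> into \<open>\<omega>1\<close>.\<close>

definition node :: "'a \<Rightarrow> (bool list \<Rightarrow> 'a) \<Rightarrow> (bool list \<Rightarrow> 'a) \<Rightarrow> bool list \<Rightarrow> 'a" where
  "node m \<omega>0 \<omega>1 u = (case u of [] \<Rightarrow> m | i # v \<Rightarrow> if i then \<omega>1 v else \<omega>0 v)"

text \<open>Serves to freeze the first \<open>m\<close> generations while the 2^m subtrees hanging
  off them are resampled.\<close>

definition graft :: "nat \<Rightarrow> (bool list \<Rightarrow> 'a) \<Rightarrow> (bool list \<Rightarrow> bool list \<Rightarrow> 'a) \<Rightarrow> bool list \<Rightarrow> 'a" where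
  "graft m \<omega> \<eta> u = (if length u < m then \<omega> u else \<eta> (take m u) (drop m u))"

lemma prob_space_tree_space: "prob_space M \<Longrightarrow> prob_space (tree_space M)"
  unfolding tree_space_def by (rule prob_space_PiM)

lemma sets_tree_space_cong [measurable_cong]:
  "sets (tree_space M) = sets (\<Pi>\<^sub>M u\<in>UNIV. M)"
  by (simp add: tree_space_def)

lemma space_tree_space: "space (tree_space M) = {\<omega>. \<forall>u. \<omega> u \<in> space M}"
  by (auto simp: tree_space_def space_PiM PiE_iff)

lemma measurable_node [measurable (raw)]:
  assumes [measurable]: "f \<in> N \<rightarrow>\<^sub>M M" "g \<in> N \<rightarrow>\<^sub>M tree_space M" "h \<in> N \<rightarrow>\<^sub>M tree_space M"
  shows "(\<lambda>x. node (f x) (g x) (h x)) \<in> N \<rightarrow>\<^sub>M tree_space M"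
  unfolding tree_space_def
proof (rule measurable_PiM_single')
  fix u :: "bool list"
  show "(\<lambda>x. node (f x) (g x) (h x) u) \<in> N \<rightarrow>\<^sub>M M"
  proof (cases u)
    case (Cons i v)
    have "(\<lambda>\<omega>. \<omega> v) \<in> tree_space M \<rightarrow>\<^sub>M M" by (simp add: tree_space_def)
    from measurable_compose[OF assms(2) this] measurable_compose[OF assms(3) this] show ?thesis
      by (cases i) (simp_all add: Cons node_def)
  qed (use assms in \<open>simp add: node_def\<close>)
qed (use assms in \<open>auto simp: space_tree_space node_def measurable_def Pi_iff split: list.splits\<close>)

lemma measurable_subtree:
  "(\<lambda>\<omega> u. \<omega> (i # u)) \<in> tree_space M \<rightarrow>\<^sub>M tree_space M"
  unfolding tree_space_def
  by (rule measurable_PiM_single') (auto simp: space_PiM PiE_iff)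

text \<open>The branching property. A cylinder over a finite set \<open>J\<close> of nodes pulls
  back to a rectangle, because \<open>J\<close> falls apart into the root and the nodes that start
  with \<open>False\<close> or with \<open>True\<close>.\<close>

lemma distr_node:
  assumes "prob_space M"
  shows "distr (M \<Otimes>\<^sub>M (tree_space M \<Otimes>\<^sub>M tree_space M)) (tree_space M) (\<lambda>(m, \<omega>0, \<omega>1). node m \<omega>0 \<omega>1) = tree_space M"
    (is "?D = _")
proof -
  interpret M: prob_space M by fact
  interpret product_prob_space "\<lambda>_. M" "UNIV :: bool list set" by unfold_locales
  interpret T: prob_space "tree_space M" by (rule prob_space_tree_space) fact
  interpret TT: pair_prob_space "tree_space M" "tree_space M" ..
  interpret MT: pair_prob_space M "tree_space M \<Otimes>\<^sub>M tree_space M" ..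
  let ?S = "tree_space M"
  show ?thesis
    unfolding tree_space_def[of M]
  proof (rule PiM_eq, fold tree_space_def)
    fix J :: "bool list set" and E
    assume J: "finite J" "\<And>j. j \<in> J \<Longrightarrow> E j \<in> sets M"
    \<comment> \<open>Padding with the whole space covers the case that the root is not in
      \<open>J\<close>.\<close>
    define E' where "E' j = (if j \<in> J then E j else space M)" for j
    have E' [measurable]: "E' j \<in> sets M" for j using J by (auto simp: E'_def)
    let ?X = "prod_emb UNIV (\<lambda>_. M) J (\<Pi>\<^sub>E j\<in>J. E j)"
    define K where "K i = {u. i # u \<in> J}" for i
    have finK: "finite (K i)" for i
      unfolding K_def using J(1) finite_vimageI[of J "(#) i"] by (simp add: vimage_def inj_on_def)
    define Y where "Y i = prod_emb UNIV (\<lambda>_. M) (K i) (\<Pi>\<^sub>E j\<in>K i. E (i # j))" for i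
    have Y_sets: "Y i \<in> sets ?S" for i
      unfolding Y_def tree_space_def using J finK[of i] by (intro sets_PiM_I) (auto simp: K_def)
    have Xeq: "?X = {\<omega> \<in> space ?S. \<forall>j\<in>J. \<omega> j \<in> E j}"
      by (auto simp: prod_emb_def tree_space_def space_PiM PiE_iff)
    have Yeq: "Y i = {\<omega> \<in> space ?S. \<forall>j\<in>K i. \<omega> j \<in> E (i # j)}" for i
      by (auto simp: Y_def prod_emb_def tree_space_def space_PiM PiE_iff)
    have 1: "m \<in> E' [] \<and> \<omega>0 \<in> Y False \<and> \<omega>1 \<in> Y True"
      if a: "node m \<omega>0 \<omega>1 \<in> ?X" "(m, \<omega>0, \<omega>1) \<in> space (M \<Otimes>\<^sub>M (?S \<Otimes>\<^sub>M ?S))" for m \<omega>0 \<omega>1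
    proof (intro conjI)
      from a have b: "\<And>j. j \<in> J \<Longrightarrow> node m \<omega>0 \<omega>1 j \<in> E j" by (auto simp: Xeq)
      show "m \<in> E' []" using a b[of "[]"] by (auto simp: E'_def node_def space_pair_measure)
      show "\<omega>0 \<in> Y False" using a b[of "False # _"] by (auto simp: Yeq K_def node_def space_pair_measure)
      show "\<omega>1 \<in> Y True" using a b[of "True # _"] by (auto simp: Yeq K_def node_def space_pair_measure)
    qed
    have 2: "node m \<omega>0 \<omega>1 \<in> ?X \<and> (m, \<omega>0, \<omega>1) \<in> space (M \<Otimes>\<^sub>M (?S \<Otimes>\<^sub>M ?S))"
      if a: "m \<in> E' []" "\<omega>0 \<in> Y False" "\<omega>1 \<in> Y True" for m \<omega>0 \<omega>1
    proof
      have m: "m \<in> space M" using a(1) E'[of "[]"] sets.sets_into_space by blast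
      show "(m, \<omega>0, \<omega>1) \<in> space (M \<Otimes>\<^sub>M (?S \<Otimes>\<^sub>M ?S))"
        using a m by (auto simp: Yeq space_pair_measure)
      have "node m \<omega>0 \<omega>1 j \<in> E j" if "j \<in> J" for j
        using that a by (cases j) (auto simp: node_def Yeq K_def E'_def split: if_splits)
      moreover have "node m \<omega>0 \<omega>1 \<in> space ?S"
        using m a by (auto simp: space_tree_space Yeq node_def split: list.splits)
      ultimately show "node m \<omega>0 \<omega>1 \<in> ?X" by (auto simp: Xeq)
    qed
    have pre: "(\<lambda>(m, \<omega>0, \<omega>1). node m \<omega>0 \<omega>1) -` ?X \<inter> space (M \<Otimes>\<^sub>M (?S \<Otimes>\<^sub>M ?S))
      = E' [] \<times> (Y False \<times> Y True)" (is "?L = ?R")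
    proof (intro set_eqI iffI)
      fix x assume x: "x \<in> ?L"
      obtain m \<omega>0 \<omega>1 where x': "x = (m, \<omega>0, \<omega>1)" by (cases x) auto
      show "x \<in> ?R" using x 1[of m \<omega>0 \<omega>1] unfolding x' by (simp only: Int_iff vimage_eq prod.case mem_Times_iff fst_conv snd_conv)
    next
      fix x assume x: "x \<in> ?R"
      obtain m \<omega>0 \<omega>1 where x': "x = (m, \<omega>0, \<omega>1)" by (cases x) auto
      show "x \<in> ?L" using x 2[of m \<omega>0 \<omega>1] unfolding x' by (simp only: Int_iff vimage_eq prod.case mem_Times_iff fst_conv snd_conv)
    qed
    have emY: "emeasure ?S (Y i) = (\<Prod>j\<in>(#) i ` K i. emeasure M (E j))" for i
    proof -
      have "emeasure ?S (Y i) = (\<Prod>j\<in>K i. emeasure M (E (i # j)))"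
        unfolding Y_def tree_space_def using finK J by (intro emeasure_PiM_emb) (auto simp: K_def)
      then show ?thesis by (subst prod.reindex) (auto simp: inj_on_def)
    qed
    have X_sets: "?X \<in> sets ?S"
      using J unfolding tree_space_def by (intro sets_PiM_I) auto
    have "emeasure ?D ?X = emeasure (M \<Otimes>\<^sub>M (?S \<Otimes>\<^sub>M ?S)) ?L"
      using X_sets by (rule emeasure_distr[rotated]) measurable
    also have "... = emeasure M (E' []) * (emeasure ?S (Y False) * emeasure ?S (Y True))"
      unfolding pre using Y_sets
      by (subst TT.emeasure_pair_measure_Times MT.emeasure_pair_measure_Times T.emeasure_pair_measure_Times; simp)+
    also have "emeasure M (E' []) = (\<Prod>j\<in>J \<inter> {[]}. emeasure M (E j))"
      by (cases "[] \<in> J") (auto simp: E'_def M.emeasure_space_1)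
    also note emY[of False] also note emY[of True]
    also have "(\<Prod>j\<in>J \<inter> {[]}. emeasure M (E j)) * ((\<Prod>j\<in>(#) False ` K False. emeasure M (E j)) *
        (\<Prod>j\<in>(#) True ` K True. emeasure M (E j)))
      = (\<Prod>j\<in>(J \<inter> {[]}) \<union> ((#) False ` K False \<union> (#) True ` K True). emeasure M (E j))"
      using J finK by (subst prod.union_disjoint; auto)+
    also have "(J \<inter> {[]}) \<union> ((#) False ` K False \<union> (#) True ` K True) = J"
    proof (intro set_eqI iffI)
      fix j assume "j \<in> J" then show "j \<in> (J \<inter> {[]}) \<union> ((#) False ` K False \<union> (#) True ` K True)"
        by (cases j; cases "hd j") (auto simp: K_def)
    qed (auto simp: K_def)
    finally show "emeasure ?D ?X = (\<Prod>j\<in>J. emeasure M (E j))" .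
  qed simp_all
qed

lemma measurable_graft:
  "(\<lambda>(\<omega>, \<eta>). graft m \<omega> \<eta>) \<in> tree_space M \<Otimes>\<^sub>M (\<Pi>\<^sub>M v\<in>{v. length v = m}. tree_space M) \<rightarrow>\<^sub>M tree_space M"
  unfolding tree_space_def[of M]
proof (rule measurable_PiM_single', fold tree_space_def)
  fix u :: "bool list"
  show "(\<lambda>x. (case x of (\<omega>, \<eta>) \<Rightarrow> graft m \<omega> \<eta>) u)
    \<in> tree_space M \<Otimes>\<^sub>M (\<Pi>\<^sub>M v\<in>{v. length v = m}. tree_space M) \<rightarrow>\<^sub>M M"
  proof (cases "length u < m")
    case False
    then have "take m u \<in> {v. length v = m}" by simp
    then have "(\<lambda>x. snd x (take m u)) \<in> tree_space M \<Otimes>\<^sub>M (\<Pi>\<^sub>M v\<in>{v. length v = m}. tree_space M) \<rightarrow>\<^sub>M tree_space M"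
      by measurable
    then have "(\<lambda>x. snd x (take m u) (drop m u)) \<in> tree_space M \<Otimes>\<^sub>M (\<Pi>\<^sub>M v\<in>{v. length v = m}. tree_space M) \<rightarrow>\<^sub>M M"
      by (rule measurable_compose) (simp add: tree_space_def)
    with False show ?thesis by (simp add: graft_def split_beta')
  qed (auto simp: graft_def split_beta' tree_space_def)
qed (auto simp: space_pair_measure space_PiM PiE_iff graft_def space_tree_space)

text \<open>The same factorisation at generation \<open>m\<close>: a node of \<open>J\<close> either
  has depth below \<open>m\<close>, or splits uniquely into a prefix of length \<open>m\<close> and
  a node of the subtree hanging there. The marks of \<open>\<omega>\<close> from depth
  \<open>m\<close> on are discarded, so no mark is counted twice.\<close>

lemma distr_graft:
  assumes "prob_space M"
  shows "distr (tree_space M \<Otimes>\<^sub>M (\<Pi>\<^sub>M v\<in>{v. length v = m}. tree_space M)) (tree_space M) (\<lambda>(\<omega>, \<eta>). graft m \<omega> \<eta>) = tree_space M"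
    (is "?D = _")
proof -
  interpret M: prob_space M by fact
  interpret product_prob_space "\<lambda>_. M" "UNIV :: bool list set" by unfold_locales
  interpret T: prob_space "tree_space M" by (rule prob_space_tree_space) fact
  let ?V = "{v :: bool list. length v = m}"
  interpret V: product_prob_space "\<lambda>_. tree_space M" ?V by unfold_locales
  let ?S = "tree_space M" and ?P = "\<Pi>\<^sub>M v\<in>?V. tree_space M"
  interpret P: pair_prob_space ?S ?P ..
  have finV: "finite ?V" using finite_lists_length_eq[of "UNIV :: bool set" m] by simp
  show ?thesis
    unfolding tree_space_def[of M]
  proof (rule PiM_eq, fold tree_space_def)
    fix J :: "bool list set" and E
    assume J: "finite J" "\<And>j. j \<in> J \<Longrightarrow> E j \<in> sets M"
    let ?X = "prod_emb UNIV (\<lambda>_. M) J (\<Pi>\<^sub>E j\<in>J. E j)"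
    define K where "K v = {u. v @ u \<in> J}" for v
    define I where "I = {u\<in>J. length u < m}"
    have finK: "finite (K i)" for i
      unfolding K_def using J(1) finite_vimageI[of J "(@) i"] by (simp add: vimage_def inj_on_def)
    define Y where "Y v = prod_emb UNIV (\<lambda>_. M) (K v) (\<Pi>\<^sub>E j\<in>K v. E (v @ j))" for v
    define Z where "Z = prod_emb UNIV (\<lambda>_. M) I (\<Pi>\<^sub>E j\<in>I. E j)"
    have Y_sets: "Y i \<in> sets ?S" for i
      unfolding Y_def tree_space_def using J finK[of i] by (intro sets_PiM_I) (auto simp: K_def)
    have Z_sets: "Z \<in> sets ?S"
      unfolding Z_def tree_space_def using J by (intro sets_PiM_I) (auto simp: I_def)
    have Xeq: "?X = {\<omega> \<in> space ?S. \<forall>j\<in>J. \<omega> j \<in> E j}"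
      by (auto simp: prod_emb_def tree_space_def space_PiM PiE_iff)
    have Zeq: "Z = {\<omega> \<in> space ?S. \<forall>j\<in>I. \<omega> j \<in> E j}"
      by (auto simp: Z_def prod_emb_def tree_space_def space_PiM PiE_iff)
    have Yeq: "Y i = {\<omega> \<in> space ?S. \<forall>j\<in>K i. \<omega> j \<in> E (i @ j)}" for i
      by (auto simp: Y_def prod_emb_def tree_space_def space_PiM PiE_iff)
    have 1: "\<omega> \<in> Z \<and> \<eta> \<in> (\<Pi>\<^sub>E v\<in>?V. Y v)"
      if a: "graft m \<omega> \<eta> \<in> ?X" "(\<omega>, \<eta>) \<in> space (?S \<Otimes>\<^sub>M ?P)" for \<omega> \<eta>
    proof
      have b: "\<And>j. j \<in> J \<Longrightarrow> graft m \<omega> \<eta> j \<in> E j" using a by (auto simp: Xeq)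
      show "\<omega> \<in> Z" unfolding Zeq using a b by (fastforce simp: I_def graft_def space_pair_measure)
      show "\<eta> \<in> (\<Pi>\<^sub>E v\<in>?V. Y v)"
      proof (rule PiE_I)
        fix v assume v: "v \<in> ?V"
        then have "\<eta> v \<in> space ?S" using a by (auto simp: space_pair_measure space_PiM PiE_iff)
        moreover have "\<eta> v u \<in> E (v @ u)" if "u \<in> K v" for u
          using b[of "v @ u"] that v by (auto simp: K_def graft_def)
        ultimately show "\<eta> v \<in> Y v" by (auto simp: Yeq)
      qed (use a in \<open>auto simp: space_pair_measure space_PiM PiE_iff extensional_def\<close>)
    qed
    have 2: "graft m \<omega> \<eta> \<in> ?X \<and> (\<omega>, \<eta>) \<in> space (?S \<Otimes>\<^sub>M ?P)"
      if a: "\<omega> \<in> Z" "\<eta> \<in> (\<Pi>\<^sub>E v\<in>?V. Y v)" for \<omega> \<eta>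
    proof
      show s: "(\<omega>, \<eta>) \<in> space (?S \<Otimes>\<^sub>M ?P)"
        using a by (auto simp: Yeq Zeq space_pair_measure space_PiM PiE_iff)
      have "graft m \<omega> \<eta> j \<in> E j" if "j \<in> J" for j
      proof (cases "length j < m")
        case True then show ?thesis using a that by (auto simp: Zeq I_def graft_def)
      next
        case False
        then have "\<eta> (take m j) \<in> Y (take m j)" using a by (auto simp: PiE_iff)
        moreover have "drop m j \<in> K (take m j)" using that by (simp add: K_def)
        ultimately show ?thesis using False by (force simp: Yeq graft_def)
      qed
      moreover have "graft m \<omega> \<eta> \<in> space ?S"
        using measurable_space[OF measurable_graft s] by simp
      ultimately show "graft m \<omega> \<eta> \<in> ?X" by (auto simp: Xeq)
    qed
    have pre: "(\<lambda>(\<omega>, \<eta>). graft m \<omega> \<eta>) -` ?X \<inter> space (?S \<Otimes>\<^sub>M ?P) = Z \<times> (\<Pi>\<^sub>E v\<in>?V. Y v)" (is "?L = ?R")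
    proof (intro set_eqI iffI)
      fix x assume x: "x \<in> ?L"
      obtain \<omega> \<eta> where x': "x = (\<omega>, \<eta>)" by (cases x) auto
      show "x \<in> ?R" using x 1[of \<omega> \<eta>] unfolding x' by (simp only: Int_iff vimage_eq prod.case mem_Times_iff fst_conv snd_conv)
    next
      fix x assume x: "x \<in> ?R"
      obtain \<omega> \<eta> where x': "x = (\<omega>, \<eta>)" by (cases x) auto
      show "x \<in> ?L" using x 2[of \<omega> \<eta>] unfolding x' by (simp only: Int_iff vimage_eq prod.case mem_Times_iff fst_conv snd_conv)
    qed
    have "emeasure ?D ?X = emeasure (?S \<Otimes>\<^sub>M ?P) ?L"
      using J by (intro emeasure_distr measurable_graft) (auto simp: tree_space_def intro!: sets_PiM_I)
    also have "... = emeasure ?S Z * emeasure ?P (\<Pi>\<^sub>E v\<in>?V. Y v)"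
      unfolding pre using Y_sets Z_sets finV
      by (intro V.emeasure_pair_measure_Times) (auto intro!: sets_PiM_I_finite)
    also have "emeasure ?P (\<Pi>\<^sub>E v\<in>?V. Y v) = (\<Prod>v\<in>?V. emeasure ?S (Y v))"
      using Y_sets by (intro V.emeasure_PiM finV)
    also have "emeasure ?S Z = (\<Prod>j\<in>I. emeasure M (E j))"
      unfolding Z_def tree_space_def using J by (intro emeasure_PiM_emb) (auto simp: I_def)
    also have "(\<Prod>v\<in>?V. emeasure ?S (Y v)) = (\<Prod>v\<in>?V. \<Prod>j\<in>K v. emeasure M (E (v @ j)))"
    proof (rule prod.cong[OF refl])
      fix v show "emeasure ?S (Y v) = (\<Prod>j\<in>K v. emeasure M (E (v @ j)))"
        unfolding Y_def tree_space_def using finK J by (intro emeasure_PiM_emb) (auto simp: K_def)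
    qed
    also have "... = (\<Prod>(v, j)\<in>Sigma ?V K. emeasure M (E (v @ j)))"
      using finK finV by (intro prod.Sigma) auto
    also have "... = (\<Prod>j\<in>J - I. emeasure M (E j))"
      by (rule prod.reindex_bij_witness[of _ "\<lambda>j. (take m j, drop m j)" "\<lambda>(v, j). v @ j"])
         (auto simp: K_def I_def)
    also have "(\<Prod>j\<in>I. emeasure M (E j)) * (\<Prod>j\<in>J - I. emeasure M (E j)) = (\<Prod>j\<in>J. emeasure M (E j))"
      using J by (subst mult.commute, intro prod.subset_diff[symmetric]) (auto simp: I_def)
    finally show "emeasure ?D ?X = (\<Prod>j\<in>J. emeasure M (E j))" .
  qed simp_all
qed

text \<open>The nonnegative form of the branching property; the moment recursions condition on the
  root mark in this way.\<close>

lemma nn_integral_tree_space: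
  assumes "prob_space M" and [measurable]: "f \<in> borel_measurable (tree_space M)"
  shows "(\<integral>\<^sup>+\<omega>. f \<omega> \<partial>tree_space M) =
    (\<integral>\<^sup>+m. \<integral>\<^sup>+\<omega>0. \<integral>\<^sup>+\<omega>1. f (node m \<omega>0 \<omega>1) \<partial>tree_space M \<partial>tree_space M \<partial>M)"
proof -
  interpret M: prob_space M by fact
  interpret T: prob_space "tree_space M" by (rule prob_space_tree_space) fact
  interpret TT: pair_prob_space "tree_space M" "tree_space M" ..
  interpret MT: pair_prob_space M "tree_space M \<Otimes>\<^sub>M tree_space M" ..
  have "(\<integral>\<^sup>+\<omega>. f \<omega> \<partial>tree_space M) =
    (\<integral>\<^sup>+x. f (case x of (m, \<omega>0, \<omega>1) \<Rightarrow> node m \<omega>0 \<omega>1) \<partial>(M \<Otimes>\<^sub>M (tree_space M \<Otimes>\<^sub>M tree_space M)))"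
    by (subst distr_node[OF assms(1), symmetric], subst nn_integral_distr) auto
  also have "... = (\<integral>\<^sup>+m. \<integral>\<^sup>+y. f (case y of (\<omega>0, \<omega>1) \<Rightarrow> node m \<omega>0 \<omega>1) \<partial>(tree_space M \<Otimes>\<^sub>M tree_space M) \<partial>M)"
    by (subst TT.nn_integral_fst[symmetric]) (auto simp: split_beta')
  also have "... = (\<integral>\<^sup>+m. \<integral>\<^sup>+\<omega>0. \<integral>\<^sup>+\<omega>1. f (node m \<omega>0 \<omega>1) \<partial>tree_space M \<partial>tree_space M \<partial>M)"
    by (intro nn_integral_cong, subst T.nn_integral_fst[symmetric]) (auto simp: split_beta')
  finally show ?thesis .
qed

section \<open>The partition function on a marked tree\<close>

abbreviation gauss :: "real measure" where
  "gauss \<equiv> std_normal_distribution"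

abbreviation gauss2 :: "(real \<times> real) measure" where
  "gauss2 \<equiv> gauss \<Otimes>\<^sub>M gauss"

abbreviation expo :: "real measure" where
  "expo \<equiv> density lborel (exponential_density 1)"

text \<open>Lifetime and two independent standard Gaussians of one particle. The Gaussians are
  unscaled, since the variance of the displacement depends on the birth time, which is known only
  from the ancestors.\<close>

definition mark :: "(real \<times> real \<times> real) measure" where
  "mark = expo \<Otimes>\<^sub>M gauss2"

abbreviation trees :: "(bool list \<Rightarrow> real \<times> real \<times> real) measure" where
  "trees \<equiv> tree_space mark"

text \<open>Variance collected during a life that starts at \<open>b\<close> and lasts
  \<open>l\<close>. A particle that dies by \<open>T\<close> gets the increment of \<open>B\<close>;
  a survivor gets all that is missing to total variance \<open>T\<close>, whether or not
  \<open>B T\<close> equals \<open>T\<close>. This is what allows the horizon to be lowered without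
  touching \<open>B\<close>.\<close>

definition dispvar :: "real \<Rightarrow> (real \<Rightarrow> real) \<Rightarrow> real \<Rightarrow> real \<Rightarrow> real" where
  "dispvar T B b l = (if b + l \<le> T then B (b + l) else T) - B b"

definition disp :: "real \<Rightarrow> real \<Rightarrow> real \<times> real \<Rightarrow> real \<times> real" where
  "disp \<rho> v gh = (sqrt v * fst gh, sqrt v * (\<rho> * fst gh + sqrt (1 - \<rho>\<^sup>2) * snd gh))"

text \<open>The particles alive at time \<open>T\<close>, with displacements counted from the birth
  of the first particle at time \<open>b\<close>. The argument \<open>n\<close> is fuel: particles
  of generation \<open>n\<close> or later are dropped, which makes the recursion total although the
  tree may be deep.\<close>

fun leaves :: "real \<Rightarrow> (real \<Rightarrow> real) \<Rightarrow> real \<Rightarrow> nat \<Rightarrow> real \<Rightarrow> (bool list \<Rightarrow> real \<times> real \<times> real) \<Rightarrow> (real \<times> real) list" where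
  "leaves T B \<rho> 0 b \<omega> = []"
| "leaves T B \<rho> (Suc n) b \<omega> =
    (let l = fst (\<omega> []); d = disp \<rho> (dispvar T B b l) (snd (\<omega> []))
     in if T < b + l then [d]
        else map ((+) d) (leaves T B \<rho> n (b + l) (\<lambda>u. \<omega> (False # u)) @ leaves T B \<rho> n (b + l) (\<lambda>u. \<omega> (True # u))))"

definition wt :: "complex \<Rightarrow> real \<times> real \<Rightarrow> complex" where
  "wt \<beta> p = exp (complex_of_real (Re \<beta> * fst p) + \<i> * complex_of_real (Im \<beta> * snd p))"

text \<open>Keeping the starting time \<open>b\<close> general turns a subtree into an instance of
  the same object, multiplied by the weight of its ancestors.\<close>

definition part :: "real \<Rightarrow> (real \<Rightarrow> real) \<Rightarrow> real \<Rightarrow> complex \<Rightarrow> nat \<Rightarrow> real \<Rightarrow> (bool list \<Rightarrow> real \<times> real \<times> real) \<Rightarrow> complex" where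
  "part T B \<rho> \<beta> n b \<omega> = (\<Sum>p\<leftarrow>leaves T B \<rho> n b \<omega>. wt \<beta> p)"

lemma prob_space_gauss: "prob_space gauss"
  by (rule prob_space_normal_density) simp

lemma prob_space_gauss2: "prob_space gauss2"
  by (intro prob_space_pair prob_space_gauss)

lemma prob_space_expo: "prob_space expo"
  by (rule prob_space_exponential_density) simp

lemma prob_space_mark: "prob_space mark"
  unfolding mark_def by (intro prob_space_pair prob_space_gauss2 prob_space_expo)

lemma prob_space_tree: "prob_space trees"
  by (intro prob_space_tree_space prob_space_mark)

lemma sets_mark [measurable_cong]: "sets mark = sets (borel \<Otimes>\<^sub>M (borel \<Otimes>\<^sub>M borel))"
  unfolding mark_def by (intro sets_pair_measure_cong sets_density) auto

lemma space_mark [simp]: "space mark = UNIV"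
  by (simp add: mark_def space_pair_measure)

lemma space_tree [simp]: "space trees = UNIV"
  by (simp add: space_tree_space)

lemma wt_add: "wt \<beta> (p + q) = wt \<beta> p * wt \<beta> q"
  by (simp add: wt_def algebra_simps flip: exp_add)

lemma norm_wt: "norm (wt \<beta> p) = exp (Re \<beta> * fst p)"
  by (simp add: wt_def)

lemma wt_nonzero [simp]: "wt \<beta> p \<noteq> 0"
  by (simp add: wt_def)

lemma measurable_wt [measurable]: "wt \<beta> \<in> borel_measurable (borel \<Otimes>\<^sub>M borel)"
  unfolding wt_def by measurable

lemma measurable_wt' [measurable]: "wt \<beta> \<in> borel_measurable borel"
  using measurable_wt by (simp add: borel_prod)

lemma measurable_disp [measurable (raw)]:
  assumes [measurable]: "f \<in> borel_measurable M" "g \<in> M \<rightarrow>\<^sub>M borel \<Otimes>\<^sub>M borel"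
  shows "(\<lambda>x. disp \<rho> (f x) (g x)) \<in> M \<rightarrow>\<^sub>M borel \<Otimes>\<^sub>M borel"
  unfolding disp_def by measurable

lemma measurable_tree_mark: "(\<lambda>\<omega>. \<omega> u) \<in> trees \<rightarrow>\<^sub>M borel \<Otimes>\<^sub>M (borel \<Otimes>\<^sub>M borel)"
proof -
  have "(\<lambda>\<omega>. \<omega> u) \<in> trees \<rightarrow>\<^sub>M mark" by (simp add: tree_space_def)
  then show ?thesis by (simp cong: measurable_cong_sets add: sets_mark)
qed

lemma part_0 [simp]: "part T B \<rho> \<beta> 0 b \<omega> = 0"
  by (simp add: part_def)

lemma part_Suc:
  "part T B \<rho> \<beta> (Suc n) b \<omega> =
    (let l = fst (\<omega> []) in wt \<beta> (disp \<rho> (dispvar T B b l) (snd (\<omega> []))) *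
      (if T < b + l then 1
       else part T B \<rho> \<beta> n (b + l) (\<lambda>u. \<omega> (False # u)) + part T B \<rho> \<beta> n (b + l) (\<lambda>u. \<omega> (True # u))))"
  by (simp add: part_def Let_def o_def wt_add sum_list_const_mult distrib_left)

text \<open>\<open>B\<close> stands for the variance accumulated by a given time, later s \<mapsto>
  t A (s / t). The bound \<open>B s \<le> s\<close> is the weak correlation assumption in this
  scale. The horizon \<open>T\<close> is a separate parameter.\<close>

locale profile =
  fixes T :: real and B :: "real \<Rightarrow> real" and \<rho> :: real
  assumes T_nonneg: "0 \<le> T" and mono_B: "mono B" and B_0 [simp]: "B 0 = 0"
    and B_le: "\<And>s. 0 \<le> s \<Longrightarrow> B s \<le> s" and rho: "\<rho>^2 \<le> 1"
begin

lemma B_nonneg: "0 \<le> s \<Longrightarrow> 0 \<le> B s"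
  using monoD[OF mono_B, of 0 s] by simp

lemma B_le_T: "0 \<le> s \<Longrightarrow> s \<le> T \<Longrightarrow> B s \<le> T"
  using B_le[of s] by simp

lemma measurable_B [measurable]: "B \<in> borel_measurable borel"
  by (rule borel_measurable_mono[OF mono_B])

lemma measurable_dispvar [measurable (raw)]:
  assumes [measurable]: "f \<in> borel_measurable M" "g \<in> borel_measurable M"
  shows "(\<lambda>x. dispvar T B (f x) (g x)) \<in> borel_measurable M"
  unfolding dispvar_def by measurable

lemma dispvar_nonneg: "0 \<le> l \<Longrightarrow> 0 \<le> b \<Longrightarrow> b \<le> T \<Longrightarrow> 0 \<le> dispvar T B b l"
  using monoD[OF mono_B, of b "b + l"] B_le_T[of b] by (auto simp: dispvar_def)

lemma measurable_part [measurable (raw)]: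
  assumes "f \<in> borel_measurable M" "g \<in> M \<rightarrow>\<^sub>M trees"
  shows "(\<lambda>x. part T B \<rho> \<beta> n (f x) (g x)) \<in> borel_measurable M"
  using assms
proof (induction n arbitrary: f g)
  case (Suc n)
  note [measurable] = Suc.prems
  have [measurable]: "(\<lambda>x u. g x (i # u)) \<in> M \<rightarrow>\<^sub>M trees" for i
    using measurable_compose[OF Suc.prems(2) measurable_subtree] .
  have r: "(\<lambda>x. g x []) \<in> M \<rightarrow>\<^sub>M borel \<Otimes>\<^sub>M (borel \<Otimes>\<^sub>M borel)"
    using measurable_compose[OF Suc.prems(2) measurable_tree_mark] .
  have l [measurable]: "(\<lambda>x. fst (g x [])) \<in> borel_measurable M"
    by (rule measurable_compose[OF r measurable_fst])
  have s: "(\<lambda>x. snd (g x [])) \<in> M \<rightarrow>\<^sub>M borel \<Otimes>\<^sub>M borel"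
    by (rule measurable_compose[OF r measurable_snd])
  have d: "(\<lambda>x. wt \<beta> (disp \<rho> (dispvar T B (f x) (fst (g x []))) (snd (g x [])))) \<in> borel_measurable M"
    by (rule measurable_compose[OF measurable_disp[OF measurable_dispvar[OF Suc.prems(1) l] s] measurable_wt])
  have [measurable]: "(\<lambda>x. part T B \<rho> \<beta> n (f x + fst (g x [])) (\<lambda>u. g x (i # u))) \<in> borel_measurable M" for i
    by (intro Suc.IH) measurable
  show ?case
    unfolding part_Suc Let_def by (intro borel_measurable_times[OF d] measurable_If) measurable
qed simp

text \<open>The factor \<open>h\<close> carries the weight of the ancestors. The induction
  multiplies it by the weight of the root before it descends, so it has to be an arbitrary
  measurable function.\<close>

lemma measurable_prod_leaves:
  assumes K [measurable]: "K \<in> borel_measurable (borel :: complex measure)"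
    and "f \<in> borel_measurable M" "h \<in> borel_measurable M" "g \<in> M \<rightarrow>\<^sub>M trees"
  shows "(\<lambda>x. (\<Prod>p\<leftarrow>leaves T B \<rho> n (f x) (g x). K (h x * wt \<beta> p) :: real)) \<in> borel_measurable M"
  using assms(2-)
proof (induction n arbitrary: f g h)
  case (Suc n)
  note [measurable] = Suc.prems
  have [measurable]: "(\<lambda>x u. g x (i # u)) \<in> M \<rightarrow>\<^sub>M trees" for i
    using measurable_compose[OF Suc.prems(3) measurable_subtree] .
  have r: "(\<lambda>x. g x []) \<in> M \<rightarrow>\<^sub>M borel \<Otimes>\<^sub>M (borel \<Otimes>\<^sub>M borel)"
    using measurable_compose[OF Suc.prems(3) measurable_tree_mark] .
  have l [measurable]: "(\<lambda>x. fst (g x [])) \<in> borel_measurable M"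
    by (rule measurable_compose[OF r measurable_fst])
  have s: "(\<lambda>x. snd (g x [])) \<in> M \<rightarrow>\<^sub>M borel \<Otimes>\<^sub>M borel"
    by (rule measurable_compose[OF r measurable_snd])
  let ?d = "\<lambda>x. disp \<rho> (dispvar T B (f x) (fst (g x []))) (snd (g x []))"
  have eq: "(\<Prod>p\<leftarrow>leaves T B \<rho> (Suc n) (f x) (g x). K (h x * wt \<beta> p)) =
    (if T < f x + fst (g x []) then K (h x * wt \<beta> (?d x))
     else (\<Prod>p\<leftarrow>leaves T B \<rho> n (f x + fst (g x [])) (\<lambda>u. g x (False # u)). K (h x * wt \<beta> (?d x) * wt \<beta> p)) *
       (\<Prod>p\<leftarrow>leaves T B \<rho> n (f x + fst (g x [])) (\<lambda>u. g x (True # u)). K (h x * wt \<beta> (?d x) * wt \<beta> p)))" for x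
    by (simp add: Let_def o_def wt_add mult.assoc)
  have d [measurable]: "(\<lambda>x. wt \<beta> (?d x)) \<in> borel_measurable M"
    by (rule measurable_compose[OF measurable_disp[OF measurable_dispvar[OF Suc.prems(1) l] s] measurable_wt])
  have [measurable]: "(\<lambda>x. \<Prod>p\<leftarrow>leaves T B \<rho> n (f x + fst (g x [])) (\<lambda>u. g x (i # u)). K (h x * wt \<beta> (?d x) * wt \<beta> p)) \<in> borel_measurable M" for i
    by (intro Suc.IH) measurable
  show ?case
    unfolding eq by (intro measurable_If) measurable
qed simp

end

section \<open>Exponential moments of a single displacement\<close>

lemma has_bochner_integral_pair_mult:
  fixes f g :: "_ \<Rightarrow> complex"
  assumes "prob_space M1" "prob_space M2" and f: "has_bochner_integral M1 f I" and g: "has_bochner_integral M2 g J"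
  shows "has_bochner_integral (M1 \<Otimes>\<^sub>M M2) (\<lambda>x. f (fst x) * g (snd x)) (I * J)"
proof -
  interpret M1: prob_space M1 by fact
  interpret M2: prob_space M2 by fact
  interpret P: pair_prob_space M1 M2 ..
  have fi: "integrable M1 f" "(\<integral>x. f x \<partial>M1) = I" and gi: "integrable M2 g" "(\<integral>x. g x \<partial>M2) = J"
    using f g by (auto simp: has_bochner_integral_iff)
  note [measurable] = borel_measurable_integrable[OF fi(1)] borel_measurable_integrable[OF gi(1)]
  have int: "integrable (M1 \<Otimes>\<^sub>M M2) (\<lambda>x. f (fst x) * g (snd x))"
    using fi(1) gi(1) by (intro P.Fubini_integrable) (auto simp: norm_mult)
  have "(\<integral>x. f (fst x) * g (snd x) \<partial>(M1 \<Otimes>\<^sub>M M2)) = (\<integral>x. \<integral>y. f x * g y \<partial>M2 \<partial>M1)"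
    using P.integral_fst'[OF int] by simp
  also have "... = I * J" by (simp add: fi gi)
  finally show ?thesis using int by (simp add: has_bochner_integral_iff)
qed

text \<open>Shifting the variable by Re z completes the square and leaves the characteristic
  function of the normal law at Im z.\<close>

lemma gauss_mgf:
  fixes z :: complex
  shows "has_bochner_integral gauss (\<lambda>x. exp (z * x)) (exp (z^2 / 2))"
proof -
  define a b where "a = Re z" and "b = Im z"
  have z: "z = a + \<i> * b" by (simp add: a_def b_def complex_eq)
  have 1: "std_normal_density (a + x) *\<^sub>R exp (z * (a + x)) =
     exp (a^2 / 2 + \<i> * a * b) * (std_normal_density x *\<^sub>R iexp (b * x))" for x :: real
  proof -
    have "std_normal_density (a + x) = std_normal_density x * exp (- a * x - a\<^sup>2 / 2)"
      unfolding std_normal_density_def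
      by (simp add: mult_exp_exp power2_eq_square field_simps)
    then show ?thesis
      by (simp add: z scaleR_conv_of_real mult_exp_exp exp_of_real[symmetric] field_simps power2_eq_square)
  qed
  have int: "integrable lborel (\<lambda>x. std_normal_density x *\<^sub>R iexp (b * x))"
  proof -
    interpret prob_space gauss by (rule prob_space_gauss)
    have "integrable gauss (\<lambda>x. iexp (b * x))"
      by (rule integrable_const_bound[of _ 1]) auto
    then show ?thesis by (subst (asm) integrable_density) auto
  qed
  have ch: "(\<integral>x. std_normal_density x *\<^sub>R iexp (b * x) \<partial>lborel) = exp (- b\<^sup>2 / 2)"
    using fun_cong[OF char_std_normal_distribution, of b]
    by (simp add: char_def integral_density)
  have "integrable lborel (\<lambda>x. std_normal_density (a + 1 * x) *\<^sub>R exp (z * (a + 1 * x)))"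
    using integrable_mult_right[OF int, of "exp (a^2 / 2 + \<i> * a * b)"] by (simp add: 1 del: of_real_add)
  then have int2: "integrable lborel (\<lambda>x. std_normal_density x *\<^sub>R exp (z * x))"
    using lborel_integrable_real_affine_iff[of 1 "\<lambda>x. std_normal_density x *\<^sub>R exp (z * x)" a] by simp
  have "(\<integral>x. std_normal_density x *\<^sub>R exp (z * x) \<partial>lborel)
      = (\<integral>x. std_normal_density (a + x) *\<^sub>R exp (z * (a + x)) \<partial>lborel)"
    using lborel_integral_real_affine[of 1 "\<lambda>x. std_normal_density x *\<^sub>R exp (z * x)" a] by simp
  also have "... = exp (a^2 / 2 + \<i> * a * b) * exp (- b\<^sup>2 / 2)"
  proof -
    have "(\<integral>x. std_normal_density (a + x) *\<^sub>R exp (z * (a + x)) \<partial>lborel) =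
       (\<integral>x. exp (a^2 / 2 + \<i> * a * b) * (std_normal_density x *\<^sub>R iexp (b * x)) \<partial>lborel)"
      by (intro Bochner_Integration.integral_cong refl 1)
    then show ?thesis using ch by (subst (asm) integral_mult_right_zero) simp
  qed
  also have "... = exp (z^2 / 2)"
    unfolding exp_of_real[symmetric] mult_exp_exp
    by (rule arg_cong[where f = exp], rule complex_eqI) (simp_all add: z power2_eq_square)
  finally show ?thesis
    using int2 by (auto simp: has_bochner_integral_iff integrable_density integral_density)
qed

text \<open>Exponent of the mean weight per unit of variance. Its imaginary part depends on \<rho>,
  its real part (\<sigma>^2 - \<tau>^2) / 2 does not; hence the limits are free of \<rho>.\<close>

definition cumul :: "real \<Rightarrow> complex \<Rightarrow> complex" where
  "cumul \<rho> \<beta> = ((Re \<beta> + \<i> * \<rho> * Im \<beta>)^2 - (1 - \<rho>\<^sup>2) * (Im \<beta>)^2) / 2"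

lemma Re_cumul: "Re (cumul \<rho> \<beta>) = ((Re \<beta>)^2 - (Im \<beta>)\<^sup>2) / 2"
  by (simp add: cumul_def power2_eq_square algebra_simps)

lemma gauss_disp_mean:
  assumes v: "0 \<le> v" and \<rho>: "\<rho>^2 \<le> 1"
  shows "has_bochner_integral gauss2 (\<lambda>x. wt \<beta> (disp \<rho> v x)) (exp (cumul \<rho> \<beta> * v))"
proof -
  interpret N: prob_space gauss by (rule prob_space_gauss)
  interpret NN: pair_prob_space gauss gauss ..
  define z w where "z = (Re \<beta> + \<i> * \<rho> * Im \<beta>) * sqrt v" and "w = \<i> * Im \<beta> * sqrt (1 - \<rho>\<^sup>2) * sqrt v"
  have eq: "wt \<beta> (disp \<rho> v (g, h)) = exp (z * g) * exp (w * h)" for g h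
    by (simp add: wt_def disp_def z_def w_def mult_exp_exp field_simps)
  have hb: "has_bochner_integral gauss2 (\<lambda>x. exp (z * complex_of_real (fst x)) * exp (w * complex_of_real (snd x))) (exp (z^2 / 2) * exp (w^2 / 2))"
    by (rule has_bochner_integral_pair_mult[OF prob_space_gauss prob_space_gauss gauss_mgf gauss_mgf])
  have "exp (z^2 / 2) * exp (w^2 / 2) = exp (cumul \<rho> \<beta> * v)"
  proof -
    have 1: "complex_of_real (sqrt v) * complex_of_real (sqrt v) = v"
      using v by (simp flip: of_real_mult)
    have 2: "complex_of_real (sqrt (1 - \<rho>\<^sup>2)) * complex_of_real (sqrt (1 - \<rho>\<^sup>2)) = 1 - \<rho>\<^sup>2"
      using \<rho> by (simp flip: of_real_mult)
    have zz: "z^2 = (Re \<beta> + \<i> * \<rho> * Im \<beta>)^2 * v"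
      unfolding z_def power_mult_distrib by (simp add: power2_eq_square 1)
    have ww: "w^2 = - (1 - \<rho>\<^sup>2) * (Im \<beta>)^2 * v"
      unfolding w_def power_mult_distrib using 1 2 by (simp add: power2_eq_square) (simp add: algebra_simps)
    have "z^2 / 2 + w^2 / 2 = cumul \<rho> \<beta> * v"
      unfolding zz ww cumul_def by (simp add: algebra_simps add_divide_distrib diff_divide_distrib)
    then show ?thesis by (simp only: mult_exp_exp)
  qed
  moreover have "(\<lambda>x. wt \<beta> (disp \<rho> v x)) = (\<lambda>x. exp (z * complex_of_real (fst x)) * exp (w * complex_of_real (snd x)))"
    by (auto simp: eq)
  ultimately show ?thesis using hb by simp
qed

lemma gauss_disp_exp:
  assumes v: "0 \<le> v"
  shows "(\<integral>\<^sup>+x. ennreal (exp (a * fst (disp \<rho> v x))) \<partial>gauss2) = exp (a^2 / 2 * v)"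
proof -
  interpret N: prob_space gauss by (rule prob_space_gauss)
  interpret NN: pair_prob_space gauss gauss ..
  have hb: "has_bochner_integral gauss (\<lambda>g. exp (complex_of_real (a * sqrt v) * g)) (exp ((complex_of_real (a * sqrt v))^2 / 2))"
    by (rule gauss_mgf)
  have e: "exp (complex_of_real (a * sqrt v) * g) = complex_of_real (exp (a * (sqrt v * g)))" for g
    by (simp add: exp_of_real[symmetric] mult.assoc)
  have e2: "exp ((complex_of_real (a * sqrt v))^2 / 2) = complex_of_real (exp (a^2 / 2 * v))"
    using v by (simp add: exp_of_real[symmetric] power_mult_distrib flip: of_real_power)
  have "has_bochner_integral gauss (\<lambda>g. exp (a * (sqrt v * g))) (exp (a^2 / 2 * v))"
    using has_bochner_integral_Re[OF hb] by (simp only: e e2 Re_complex_of_real)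
  then have i: "integrable gauss (\<lambda>g. exp (a * (sqrt v * g)))"
     "(\<integral>g. exp (a * (sqrt v * g)) \<partial>gauss) = exp (a^2 / 2 * v)"
    by (auto simp: has_bochner_integral_iff)
  have "(\<integral>\<^sup>+x. ennreal (exp (a * fst (disp \<rho> v x))) \<partial>gauss2) =
    (\<integral>\<^sup>+g. \<integral>\<^sup>+h. ennreal (exp (a * (sqrt v * g))) \<partial>gauss \<partial>gauss)"
    by (subst N.nn_integral_fst[symmetric]) (auto simp: disp_def)
  also have "... = (\<integral>\<^sup>+g. ennreal (exp (a * (sqrt v * g))) \<partial>gauss)"
    using N.emeasure_space_1 by simp
  also have "... = ennreal (\<integral>g. exp (a * (sqrt v * g)) \<partial>gauss)"
    by (rule nn_integral_eq_integral[OF i(1)]) simp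
  finally show ?thesis by (simp add: i(2))
qed

section \<open>Moments\<close>

lemma measurable_fst_mark [measurable]: "fst \<in> borel_measurable mark"
  by measurable

lemma AE_expo: "AE l in expo. 0 \<le> l"
  by (subst AE_density) (auto simp: exponential_density_def)

lemma nn_integral_expo_exp:
  assumes "0 \<le> c"
  shows "(\<integral>\<^sup>+l. ennreal (exp (- (1 + c) * l)) \<partial>expo) = ennreal (1 / (2 + c))"
proof -
  interpret prob_space "density lborel (exponential_density (2 + c))"
    by (rule prob_space_exponential_density) (use assms in simp)
  have "(\<integral>\<^sup>+l. ennreal (exp (- (1 + c) * l)) \<partial>expo) =
    (\<integral>\<^sup>+l. ennreal (1 / (2 + c)) * ennreal (exponential_density (2 + c) l) \<partial>lborel)"
  proof (subst nn_integral_density)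
    show "(\<integral>\<^sup>+l. ennreal (exponential_density 1 l) * ennreal (exp (- (1 + c) * l)) \<partial>lborel) =
      (\<integral>\<^sup>+l. ennreal (1 / (2 + c)) * ennreal (exponential_density (2 + c) l) \<partial>lborel)"
    proof (rule nn_integral_cong)
      fix l :: real
      have "exp (- l) * exp (- (1 + c) * l) = exp (- l * (2 + c))"
        by (simp add: mult_exp_exp algebra_simps)
      then have "exponential_density 1 l * exp (- (1 + c) * l) = 1 / (2 + c) * exponential_density (2 + c) l"
        using assms by (auto simp: exponential_density_def)
      then show "ennreal (exponential_density 1 l) * ennreal (exp (- (1 + c) * l)) = ennreal (1 / (2 + c)) * ennreal (exponential_density (2 + c) l)"
        using assms by (simp add: exponential_density_nonneg flip: ennreal_mult)
    qed
  qed auto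
  also have "... = ennreal (1 / (2 + c)) * (\<integral>\<^sup>+l. 1 \<partial>density lborel (exponential_density (2 + c)))"
    by (subst nn_integral_density) (auto simp: nn_integral_cmult)
  finally show ?thesis using emeasure_space_1 by simp
qed

lemma nn_integral_mark:
  assumes [measurable]: "f \<in> borel_measurable mark"
  shows "(\<integral>\<^sup>+m. f m \<partial>mark) = (\<integral>\<^sup>+l. \<integral>\<^sup>+x. f (l, x) \<partial>gauss2 \<partial>expo)"
proof -
  interpret prob_space gauss2 by (rule prob_space_gauss2)
  show ?thesis using assms unfolding mark_def by (subst nn_integral_fst[symmetric]) auto
qed

lemma integral_mark:
  fixes f :: "_ \<Rightarrow> complex"
  assumes "integrable mark f"
  shows "(\<integral>m. f m \<partial>mark) = (\<integral>l. \<integral>x. f (l, x) \<partial>gauss2 \<partial>expo)"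
proof -
  interpret G: prob_space gauss2 by (rule prob_space_gauss2)
  interpret E: prob_space expo by (rule prob_space_expo)
  interpret pair_prob_space expo gauss2 ..
  show ?thesis using integral_fst'[OF assms[unfolded mark_def]] by (simp add: mark_def)
qed

lemma AE_mark: "AE m in mark. 0 \<le> fst m"
proof -
  interpret G: prob_space gauss2 by (rule prob_space_gauss2)
  interpret E: prob_space expo by (rule prob_space_expo)
  interpret pair_prob_space expo gauss2 ..
  have "{m \<in> space (expo \<Otimes>\<^sub>M gauss2). 0 \<le> fst m} \<in> sets (expo \<Otimes>\<^sub>M gauss2)"
    by measurable
  then show ?thesis unfolding mark_def
    by (rule AE_pair_measure) (use AE_expo in auto)
qed

lemma integral_tree_space:
  fixes f :: "_ \<Rightarrow> complex"
  assumes int: "integrable trees f"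
  shows "(\<integral>\<omega>. f \<omega> \<partial>trees) =
      (\<integral>m. \<integral>y. f (node m (fst y) (snd y)) \<partial>(trees \<Otimes>\<^sub>M trees) \<partial>mark)"
    and "integrable mark (\<lambda>m. \<integral>y. f (node m (fst y) (snd y)) \<partial>(trees \<Otimes>\<^sub>M trees))"
proof -
  interpret M: prob_space mark by (rule prob_space_mark)
  interpret T: prob_space "trees" by (rule prob_space_tree)
  interpret TT: pair_prob_space "trees" "trees" ..
  interpret MT: pair_prob_space mark "trees \<Otimes>\<^sub>M trees" ..
  have [measurable]: "f \<in> borel_measurable trees" using int by auto
  let ?F = "\<lambda>x. f (case x of (m, \<omega>0, \<omega>1) \<Rightarrow> node m \<omega>0 \<omega>1)"
  have m: "(\<lambda>(m, \<omega>0, \<omega>1). node m \<omega>0 \<omega>1) \<in> mark \<Otimes>\<^sub>M (trees \<Otimes>\<^sub>M trees) \<rightarrow>\<^sub>M trees"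
    by measurable
  have i: "integrable (mark \<Otimes>\<^sub>M (trees \<Otimes>\<^sub>M trees)) ?F"
    by (rule integrable_distr[OF m]) (simp add: distr_node[OF prob_space_mark] int)
  have "(\<integral>\<omega>. f \<omega> \<partial>trees) = (\<integral>x. ?F x \<partial>(mark \<Otimes>\<^sub>M (trees \<Otimes>\<^sub>M trees)))"
    by (subst distr_node[OF prob_space_mark, symmetric], rule integral_distr[OF m]) auto
  then show "(\<integral>\<omega>. f \<omega> \<partial>trees) =
      (\<integral>m. \<integral>y. f (node m (fst y) (snd y)) \<partial>(trees \<Otimes>\<^sub>M trees) \<partial>mark)"
    using MT.integral_fst'[OF i] by (simp add: split_beta')
  show "integrable mark (\<lambda>m. \<integral>y. f (node m (fst y) (snd y)) \<partial>(trees \<Otimes>\<^sub>M trees))"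
    using MT.integrable_fst'[OF i] by (simp add: split_beta')
qed

lemma node_simps [simp]:
  "node m \<omega>0 \<omega>1 [] = m" "node m \<omega>0 \<omega>1 (i # u) = (if i then \<omega>1 u else \<omega>0 u)"
  by (simp_all add: node_def)

lemma part_node:
  "part T B \<rho> \<beta> (Suc n) b (node (l, x) \<omega>0 \<omega>1) = wt \<beta> (disp \<rho> (dispvar T B b l) x) *
      (if T < b + l then 1 else part T B \<rho> \<beta> n (b + l) \<omega>0 + part T B \<rho> \<beta> n (b + l) \<omega>1)"
  by (simp add: part_Suc)

lemma emeasure_expo_gt: "0 \<le> r \<Longrightarrow> emeasure expo {r<..} = ennreal (exp (- r))"
proof -
  assume r: "0 \<le> r"
  interpret prob_space expo by (rule prob_space_expo)
  have "distributed expo lborel (\<lambda>x. x) (exponential_density 1)"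
    by (auto simp: distributed_def distr_id2 cong: distr_cong)
  from exponential_distributedD_gt[OF this r] have "measure expo {r<..} = exp (- r)"
    by (simp add: greaterThan_def)
  then show ?thesis by (simp add: emeasure_eq_measure)
qed

context profile
begin

text \<open>One step of the moment recursions; \<open>\<psi>\<close> bounds the contribution of a
  child born at time \<open>s\<close>. After removal of the Gaussian factor the integrand decays
  like exp (-(1 + c) l) and meets the lifetime density exp (- l), which gives 1 / (2 + c). For two
  children the factor is 2 / (2 + c) < 1, so that any \<open>c > 0\<close> makes the recursion
  contract.\<close>

lemma mark_bound:
  assumes \<psi> [measurable]: "\<psi> \<in> borel_measurable borel" and b: "0 \<le> b" "b \<le> T" and c: "0 \<le> c" and M: "0 \<le> M"
    and le: "\<And>s. b \<le> s \<Longrightarrow> s \<le> T \<Longrightarrow> 0 \<le> \<psi> s \<and> exp (a^2 / 2 * B s) * \<psi> s \<le> M * exp (- (1 + c) * s)"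
  shows "(\<integral>\<^sup>+m. (if T < b + fst m then 0
      else ennreal (exp (a * fst (disp \<rho> (dispvar T B b (fst m)) (snd m))) * \<psi> (b + fst m))) \<partial>mark)
    \<le> ennreal (M * exp (- (1 + c) * b - a\<^sup>2 / 2 * B b) / (2 + c))" (is "?L \<le> _")
proof -
  have [measurable]: "(\<lambda>x. snd x) \<in> mark \<rightarrow>\<^sub>M borel \<Otimes>\<^sub>M borel" by measurable
  have [measurable]: "(\<lambda>m. fst (disp \<rho> (dispvar T B b (fst m)) (snd m))) \<in> borel_measurable mark" by measurable
  have "?L = (\<integral>\<^sup>+l. \<integral>\<^sup>+x. (if T < b + l then 0
      else ennreal (exp (a * fst (disp \<rho> (dispvar T B b l) x)) * \<psi> (b + l))) \<partial>gauss2 \<partial>expo)"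
    by (subst nn_integral_mark) (simp_all cong: if_cong)
  also have "... \<le> (\<integral>\<^sup>+l. ennreal (M * exp (- (1 + c) * b - a\<^sup>2 / 2 * B b)) * ennreal (exp (- (1 + c) * l)) \<partial>expo)"
  proof (rule nn_integral_mono_AE, use AE_expo in eventually_elim)
    fix l :: real assume l: "0 \<le> l"
    show "(\<integral>\<^sup>+x. (if T < b + l then 0
      else ennreal (exp (a * fst (disp \<rho> (dispvar T B b l) x)) * \<psi> (b + l))) \<partial>gauss2)
      \<le> ennreal (M * exp (- (1 + c) * b - a\<^sup>2 / 2 * B b)) * ennreal (exp (- (1 + c) * l))"
    proof (cases "T < b + l")
      case False
      have v: "0 \<le> dispvar T B b l" "dispvar T B b l = B (b + l) - B b"
        using False b l monoD[OF mono_B, of b "b + l"] by (auto simp: dispvar_def)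
      have p: "0 \<le> \<psi> (b + l)" "exp (a^2 / 2 * B (b + l)) * \<psi> (b + l) \<le> M * exp (- (1 + c) * (b + l))"
        using le[of "b + l"] False l by auto
      have "(\<integral>\<^sup>+x. (if T < b + l then 0
        else ennreal (exp (a * fst (disp \<rho> (dispvar T B b l) x)) * \<psi> (b + l))) \<partial>gauss2)
        = (\<integral>\<^sup>+x. ennreal (exp (a * fst (disp \<rho> (dispvar T B b l) x))) * ennreal (\<psi> (b + l)) \<partial>gauss2)"
        using False p by (simp add: ennreal_mult)
      also have "... = (\<integral>\<^sup>+x. ennreal (exp (a * fst (disp \<rho> (dispvar T B b l) x))) \<partial>gauss2) * ennreal (\<psi> (b + l))"
        by (subst nn_integral_multc) simp_all
      also have "... = ennreal (exp (a^2 / 2 * dispvar T B b l)) * ennreal (\<psi> (b + l))"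
        by (simp only: gauss_disp_exp[OF v(1)])
      also have "... = ennreal (exp (- a\<^sup>2 / 2 * B b) * (exp (a^2 / 2 * B (b + l)) * \<psi> (b + l)))"
      proof -
        have "exp (a^2 / 2 * dispvar T B b l) * \<psi> (b + l) = exp (- a\<^sup>2 / 2 * B b) * (exp (a^2 / 2 * B (b + l)) * \<psi> (b + l))"
          unfolding mult.assoc[symmetric] mult_exp_exp v(2) by (simp add: field_simps)
        then show ?thesis by (simp only: ennreal_mult'[OF exp_ge_zero, symmetric])
      qed
      also have "... \<le> ennreal (exp (- a\<^sup>2 / 2 * B b) * (M * exp (- (1 + c) * (b + l))))"
        using p by (intro ennreal_leI mult_left_mono) auto
      also have "... = ennreal (M * exp (- (1 + c) * b - a\<^sup>2 / 2 * B b)) * ennreal (exp (- (1 + c) * l))"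
      proof -
        have "exp (- a\<^sup>2 / 2 * B b) * (M * exp (- (1 + c) * (b + l))) = M * exp (- (1 + c) * b - a\<^sup>2 / 2 * B b) * exp (- (1 + c) * l)"
          by (simp add: mult_exp_exp algebra_simps)
        then show ?thesis using M by (simp only: ennreal_mult''[OF exp_ge_zero, symmetric])
      qed
      finally show ?thesis .
    qed simp
  qed
  also have "... = ennreal (M * exp (- (1 + c) * b - a\<^sup>2 / 2 * B b)) * ennreal (1 / (2 + c))"
    by (subst nn_integral_cmult) (simp_all only: nn_integral_expo_exp[OF c], simp)
  also have "... = ennreal (M * exp (- (1 + c) * b - a\<^sup>2 / 2 * B b) / (2 + c))"
    using M c by (simp flip: ennreal_mult)
  finally show ?thesis .
qed

lemma mark_leaf_bound:
  assumes b: "0 \<le> b" "b \<le> T"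
  shows "(\<integral>\<^sup>+m. (if T < b + fst m then ennreal (exp (a * fst (disp \<rho> (dispvar T B b (fst m)) (snd m)))) else 0) \<partial>mark)
    \<le> ennreal (exp (a^2 / 2 * (T - B b)))" (is "?L \<le> _")
proof -
  interpret E: prob_space expo by (rule prob_space_expo)
  have [measurable]: "(\<lambda>x. snd x) \<in> mark \<rightarrow>\<^sub>M borel \<Otimes>\<^sub>M borel" by measurable
  have [measurable]: "(\<lambda>m. fst (disp \<rho> (dispvar T B b (fst m)) (snd m))) \<in> borel_measurable mark" by measurable
  have "?L = (\<integral>\<^sup>+l. \<integral>\<^sup>+x. (if T < b + l then ennreal (exp (a * fst (disp \<rho> (dispvar T B b l) x))) else 0) \<partial>gauss2 \<partial>expo)"
    by (subst nn_integral_mark) (simp_all cong: if_cong)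
  also have "... \<le> (\<integral>\<^sup>+l. ennreal (exp (a^2 / 2 * (T - B b))) \<partial>expo)"
  proof (rule nn_integral_mono_AE, use AE_expo in eventually_elim)
    fix l :: real assume l: "0 \<le> l"
    show "(\<integral>\<^sup>+x. (if T < b + l then ennreal (exp (a * fst (disp \<rho> (dispvar T B b l) x))) else 0) \<partial>gauss2) \<le> ennreal (exp (a^2 / 2 * (T - B b)))"
    proof (cases "T < b + l")
      case True
      then have v: "dispvar T B b l = T - B b" "0 \<le> dispvar T B b l"
        using b l dispvar_nonneg[of l b] by (auto simp: dispvar_def)
      show ?thesis using gauss_disp_exp[OF v(2), of a \<rho>] True by (simp add: v)
    qed simp
  qed
  also have "... = ennreal (exp (a^2 / 2 * (T - B b)))"
    using E.emeasure_space_1 by simp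
  finally show ?thesis .
qed

lemma nn_integral_part:
  assumes [measurable]: "F \<in> borel_measurable borel" and b: "0 \<le> b" "b \<le> T"
  shows "(\<integral>\<^sup>+\<omega>. F (part T B \<rho> \<beta> (Suc n) b \<omega>) \<partial>trees) =
    (\<integral>\<^sup>+m. (let w = wt \<beta> (disp \<rho> (dispvar T B b (fst m)) (snd m)) in
      if T < b + fst m then F w else
      (\<integral>\<^sup>+\<omega>0. \<integral>\<^sup>+\<omega>1. F (w * (part T B \<rho> \<beta> n (b + fst m) \<omega>0 + part T B \<rho> \<beta> n (b + fst m) \<omega>1)) \<partial>trees \<partial>trees)) \<partial>mark)"
proof -
  interpret T: prob_space "trees" by (rule prob_space_tree)
  have [measurable]: "(\<lambda>\<omega>. part T B \<rho> \<beta> (Suc n) b \<omega>) \<in> borel_measurable trees"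
    by (intro measurable_part) auto
  show ?thesis
    by (subst nn_integral_tree_space[OF prob_space_mark])
       (auto intro!: nn_integral_cong simp: part_node Let_def T.emeasure_space_1[simplified])
qed

end

section \<open>Power inequalities and the exact mean\<close>

lemma powr_bernoulli:
  fixes s a :: real
  assumes "0 \<le> a" "a \<le> 1" "-1 \<le> s"
  shows "(1 + s) powr a \<le> 1 + a * s"
proof (cases "s = -1")
  case False
  then show ?thesis
    using assms Youngs_inequality_0[of a "1 - a" "1 + s" 1] by (simp add: algebra_simps)
qed (use assms in auto)

text \<open>The first-order expansion behind the von Bahr--Esseen inequality.\<close>

lemma norm_add_powr_le:
  fixes x :: complex
  assumes q: "1 \<le> q" "q \<le> 2"
  shows "\<exists>w. \<forall>y. norm (x + y) powr q \<le> norm x powr q + Re (w * y) + 7 * norm y powr q"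
proof (cases "x = 0")
  case False
  \<comment> \<open>The case x = 1; the general case follows with u = y / x. For small u the square
    of norm (1 + u) is expanded and Bernoulli's inequality applied with exponent q / 2 \<le> 1. For
    norm u > 1 the right-hand side has to pay 4 norm u ^ q for the left-hand side and 2 norm u ^ q
    for a negative linear term; 7 leaves some room.\<close>
  have *: "norm (1 + u) powr q \<le> 1 + q * Re u + 7 * norm u powr q" for u :: complex
  proof (cases "norm u \<le> 1")
    case True
    have "(norm (1 + u))^2 = 1 + (2 * Re u + (norm u)^2)"
      unfolding cmod_power2 by (simp add: power2_eq_square algebra_simps)
    moreover have "norm (1 + u) powr q = ((norm (1 + u))^2) powr (q / 2)"
      by (simp add: powr_powr flip: powr_numeral)
    ultimately have "norm (1 + u) powr q = (1 + (2 * Re u + (norm u)^2)) powr (q / 2)"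
      by simp
    also have "... \<le> 1 + q / 2 * (2 * Re u + (norm u)^2)"
      using q \<open>_ = 1 + _\<close> zero_le_power2[of "norm (1 + u)"] by (intro powr_bernoulli) auto
    also have "... \<le> 1 + q * Re u + 7 * norm u powr q"
    proof -
      have "norm u powr 2 \<le> norm u powr q" using True q by (cases "u = 0") (auto intro: powr_mono' simp del: powr_numeral)
      then have "(norm u)^2 \<le> norm u powr q" by simp
      moreover have "q / 2 * (norm u)^2 \<le> 1 * (norm u)^2" using q by (intro mult_right_mono) auto
      ultimately have "q / 2 * (norm u)^2 \<le> 7 * norm u powr q" using zero_le_power2[of "norm u"] by linarith
      then show ?thesis by (simp add: algebra_simps)
    qed
    finally show ?thesis .
  next
    case False
    have "norm (1 + u) \<le> 2 * norm u" using norm_triangle_ineq[of 1 u] False by simp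
    then have "norm (1 + u) powr q \<le> (2 * norm u) powr q" using q by (intro powr_mono2) auto
    also have "... = 2 powr q * norm u powr q" by (simp add: powr_mult)
    also have "... \<le> 2 powr 2 * norm u powr q" using q by (intro mult_right_mono powr_mono) auto
    finally have 1: "norm (1 + u) powr q \<le> 4 * norm u powr q" by simp
    have "norm u powr 1 \<le> norm u powr q" using False q by (intro powr_mono) auto
    then have u: "norm u \<le> norm u powr q" by simp
    have "q * (- norm u) \<le> q * Re u" using q abs_Re_le_cmod[of u] by (intro mult_left_mono) auto
    moreover have "q * norm u \<le> 2 * norm u" using q by (intro mult_right_mono) auto
    ultimately have "q * Re u \<ge> - 2 * norm u" by simp
    with 1 u show ?thesis using powr_ge_zero[of "norm u" q] by linarith
  qed
  show ?thesis
  proof (intro exI allI)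
    fix y
    have "norm (x + y) powr q = norm x powr q * norm (1 + y / x) powr q"
    proof -
      have "x + y = x * (1 + y / x)" using False by (simp add: field_simps)
      then show ?thesis by (metis norm_mult powr_mult norm_ge_zero)
    qed
    also have "... \<le> norm x powr q * (1 + q * Re (y / x) + 7 * norm (y / x) powr q)"
      by (intro mult_left_mono *) auto
    also have "... = norm x powr q + Re (complex_of_real (q * norm x powr q) / x * y) + 7 * (norm x powr q * norm (y / x) powr q)"
    proof -
      have "Re (complex_of_real (q * norm x powr q) / x * y) = q * norm x powr q * Re (y / x)"
      proof -
        have "complex_of_real (q * norm x powr q) / x * y = (q * norm x powr q) *\<^sub>R (y / x)"
          by (simp add: scaleR_conv_of_real)
        then show ?thesis by (simp only: scaleR_complex.sel)
      qed
      then show ?thesis by (simp add: algebra_simps)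
    qed
    also have "norm x powr q * norm (y / x) powr q = norm y powr q"
      using False by (simp add: powr_mult[symmetric] norm_mult[symmetric])
    finally show "norm (x + y) powr q \<le> norm x powr q + Re (complex_of_real (q * norm x powr q) / x * y) + 7 * norm y powr q" .
  qed
next
  case True
  show ?thesis by (rule exI[of _ 0]) (simp add: True)
qed

text \<open>Expected number of particles at age \<open>r\<close> when only the generations below
  \<open>n\<close> are counted: 2^k lines of descent, each with the probability exp (- r) r^k / k!
  of exactly k deaths up to time r. Without the cut-off this is exp r.\<close>

definition poiss :: "nat \<Rightarrow> real \<Rightarrow> real" where
  "poiss n r = exp (- r) * (\<Sum>k<n. (2 * r) ^ k / fact k)"

lemma poiss_nonneg: "0 \<le> r \<Longrightarrow> 0 \<le> poiss n r"
  unfolding poiss_def by (intro mult_nonneg_nonneg sum_nonneg) auto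

lemma poiss_le: "0 \<le> r \<Longrightarrow> poiss n r \<le> exp r"
proof -
  assume r: "0 \<le> r"
  have "(\<Sum>k<n. (2 * r) ^ k / fact k) \<le> exp (2 * r)"
    unfolding exp_def using r summable_exp_generic[of "2 * r"]
    by (simp add: divide_inverse mult.commute) (rule sum_le_suminf, auto simp: mult.commute)
  then have "poiss n r \<le> exp (- r) * exp (2 * r)"
    unfolding poiss_def by (intro mult_left_mono) auto
  then show ?thesis by (simp add: mult_exp_exp)
qed

text \<open>The tail of the exponential series increases in \<open>r\<close>, so its value at
  \<open>T\<close> controls all \<open>r \<le> T\<close> at once. The threshold depends on
  \<open>T\<close>, which is harmless since \<open>n\<close> is chosen after the horizon.\<close>

lemma poiss_ge_half: "\<exists>n0. \<forall>n\<ge>n0. \<forall>r. 0 \<le> r \<and> r \<le> T \<longrightarrow> exp r / 2 \<le> poiss n r"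
proof -
  let ?f = "\<lambda>r k. (2 * r) ^ k / fact k :: real"
  have sm: "summable (?f r)" for r
    using summable_exp_generic[of "2 * r"] by (simp add: divide_inverse mult.commute)
  have ex: "(\<Sum>k. ?f r k) = exp (2 * r)" for r
    by (simp add: exp_def divide_inverse mult.commute)
  have "(\<lambda>n. \<Sum>k. ?f T (k + n)) \<longlonglongrightarrow> 0"
    by (rule suminf_exist_split2[OF sm])
  then have "\<forall>\<^sub>F n in sequentially. (\<Sum>k. ?f T (k + n)) < 1 / 2"
    by (rule order_tendstoD) simp
  then obtain n0 where n0: "\<And>n. n \<ge> n0 \<Longrightarrow> (\<Sum>k. ?f T (k + n)) < 1 / 2"
    by (auto simp: eventually_sequentially)
  have "exp r / 2 \<le> poiss n r" if "n0 \<le> n" "0 \<le> r" "r \<le> T" for n r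
  proof -
    have "(\<Sum>k. ?f r (k + n)) \<le> (\<Sum>k. ?f T (k + n))"
      using that by (intro suminf_le summable_ignore_initial_segment sm divide_right_mono power_mono) auto
    then have "(\<Sum>k. ?f r (k + n)) \<le> 1 / 2" using n0[OF that(1)] by simp
    moreover have "exp (2 * r) = (\<Sum>k. ?f r (k + n)) + (\<Sum>k<n. ?f r k)"
      using suminf_split_initial_segment[OF sm, of r n] ex[of r] by simp
    moreover have "1 \<le> exp (2 * r)" using that by simp
    ultimately have "exp (2 * r) / 2 \<le> (\<Sum>k<n. ?f r k)" by linarith
    then have "exp (- r) * (exp (2 * r) / 2) \<le> poiss n r"
      unfolding poiss_def by (intro mult_left_mono) auto
    then show ?thesis by (simp add: mult_exp_exp)
  qed
  then show ?thesis by blast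
qed

lemma measurable_poiss [measurable]: "poiss n \<in> borel_measurable borel"
  unfolding poiss_def by measurable

text \<open>Renewal equation for the first lifetime. The product of exp (- l) and exp (-(r - l)) is
  the constant exp (- r), so the integrand is a polynomial in \<open>l\<close> with the explicit
  antiderivative \<open>F\<close>.\<close>

lemma poiss_rec:
  assumes r: "0 \<le> r"
  shows "has_bochner_integral expo (\<lambda>l. if r < l then 1 else 2 * poiss n (r - l)) (poiss (Suc n) r)"
proof -
  interpret E: prob_space expo by (rule prob_space_expo)
  have 1: "has_bochner_integral expo (indicator {r<..} :: real \<Rightarrow> real) (exp (- r))"
    using emeasure_expo_gt[OF r]
    by (subst has_bochner_integral_iff) (auto simp: measure_def less_top[symmetric])
  define g where "g l = 2 * exp (- r) * (\<Sum>k<n. (2 * (r - l)) ^ k / fact k)" for l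
  define F where "F l = - exp (- r) * (\<Sum>k<n. (2 * (r - l)) ^ Suc k / fact (Suc k))" for l
  have "DERIV (\<lambda>l. (2 * (r - l)) ^ Suc k / fact (Suc k)) l :> - 2 * ((2 * (r - l)) ^ k / fact k)" for k and l :: real
  proof -
    have "DERIV (\<lambda>l. (2 * (r - l)) ^ Suc k / fact (Suc k)) l :> real (Suc k) * (2 * (r - l)) ^ k * (- 2) / fact (Suc k)"
      by (rule derivative_eq_intros refl | simp)+
    moreover have "real (Suc k) * (2 * (r - l)) ^ k * (- 2) / fact (Suc k) = - 2 * ((2 * (r - l)) ^ k / fact k)"
      by (simp add: fact_Suc del: of_nat_Suc)
    ultimately show ?thesis by (simp only:)
  qed
  then have "DERIV F l :> - exp (- r) * (\<Sum>k<n. - 2 * ((2 * (r - l)) ^ k / fact k))" for l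
    unfolding F_def by (intro DERIV_cmult DERIV_sum)
  moreover have "- exp (- r) * (\<Sum>k<n. - 2 * ((2 * (r - l)) ^ k / fact k)) = g l" for l
    unfolding g_def sum_distrib_left[symmetric] by simp
  ultimately have D: "DERIV F l :> g l" for l by simp
  have cont: "continuous_on {0..r} g"
    unfolding g_def by (intro continuous_intros) auto
  have int: "integrable lborel (\<lambda>l. indicator {0..r} l *\<^sub>R g l)"
    using borel_integrable_atLeastAtMost'[OF cont] by (simp add: set_integrable_def)
  have "(\<integral>l. indicator {0..r} l *\<^sub>R g l \<partial>lborel) = F r - F 0"
    by (rule integral_FTC_atLeastAtMost[OF r _ cont])
       (use D in \<open>auto simp: has_real_derivative_iff_has_vector_derivative[symmetric] intro: DERIV_subset\<close>)
  moreover have "F r = 0" by (simp add: F_def)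
  ultimately have 2: "has_bochner_integral lborel (\<lambda>l. indicator {0..r} l *\<^sub>R g l) (- F 0)"
    using int by (simp add: has_bochner_integral_iff)
  have 3: "exponential_density 1 l *\<^sub>R (indicator {..r} l * (2 * poiss n (r - l))) = indicator {0..r} l *\<^sub>R g l" for l
    by (auto simp: exponential_density_def g_def poiss_def mult_exp_exp split: split_indicator)
  have "has_bochner_integral lborel (\<lambda>l. exponential_density 1 l *\<^sub>R (indicator {..r} l * (2 * poiss n (r - l)))) (- F 0)"
    unfolding 3 by (rule 2)
  then have "has_bochner_integral expo (\<lambda>l. indicator {..r} l * (2 * poiss n (r - l))) (- F 0)"
    by (rule has_bochner_integral_density[rotated 3]) (auto simp: exponential_density_nonneg)
  from has_bochner_integral_add[OF 1 this]
  have "has_bochner_integral expo (\<lambda>l. if r < l then 1 else 2 * poiss n (r - l)) (exp (- r) - F 0)"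
    by (rule has_bochner_integral_cong[THEN iffD1, rotated 3]) (auto split: split_indicator)
  moreover have "exp (- r) - F 0 = poiss (Suc n) r"
    unfolding F_def poiss_def sum.lessThan_Suc_shift by (simp add: distrib_left del: power_Suc fact_Suc)
  ultimately show ?thesis by simp
qed

lemma ennreal_mult_double: "0 \<le> a \<Longrightarrow> 0 \<le> d \<Longrightarrow> ennreal a * (ennreal d + ennreal d) = ennreal (a * (2 * d))"
  by (subst ennreal_plus[symmetric]) (auto simp: ennreal_mult[symmetric])

lemma norm_diff_powr_le:
  fixes x y :: complex
  assumes "0 \<le> q" "q \<le> 2"
  shows "norm (x - y) powr q \<le> 4 * (norm x powr q + norm y powr q)"
proof -
  let ?m = "max (norm x) (norm y)"
  have "norm (x - y) \<le> 2 * ?m" using norm_triangle_ineq4[of x y] by simp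
  then have "norm (x - y) powr q \<le> (2 * ?m) powr q" using assms by (intro powr_mono2) auto
  also have "... = 2 powr q * ?m powr q" by (simp add: powr_mult)
  also have "... \<le> 2 powr 2 * ?m powr q" using assms by (intro mult_right_mono powr_mono) auto
  also have "?m powr q \<le> norm x powr q + norm y powr q" by (auto simp: max_def)
  finally show ?thesis by simp
qed

context profile
begin

text \<open>Expectation of \<open>part\<close>, as \<open>part_mean\<close> shows. Seen from time
  \<open>b\<close> every leaf has the same variance \<open>T - B b\<close>, so the mean is the
  expected number of leaves times one Gaussian factor.\<close>

definition mean :: "complex \<Rightarrow> nat \<Rightarrow> real \<Rightarrow> complex" where
  "mean \<beta> n b = exp (cumul \<rho> \<beta> * (T - B b)) * poiss n (T - b)"

lemma norm_mean: "b \<le> T \<Longrightarrow> norm (mean \<beta> n b) = exp (((Re \<beta>)^2 - (Im \<beta>)\<^sup>2) / 2 * (T - B b)) * poiss n (T - b)"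
  by (simp add: mean_def norm_mult Re_cumul poiss_nonneg)

lemma measurable_mean [measurable]: "mean \<beta> n \<in> borel_measurable borel"
  unfolding mean_def by measurable

lemma measurable_wtdisp [measurable]:
  "(\<lambda>m. wt \<beta> (disp \<rho> (dispvar T B b (fst m)) (snd m))) \<in> borel_measurable mark"
proof -
  have [measurable]: "(\<lambda>x. snd x) \<in> mark \<rightarrow>\<^sub>M borel \<Otimes>\<^sub>M borel" by measurable
  show ?thesis by measurable
qed

text \<open>A crude estimate that provides integrability. Rate 2 in time is the case c = 1 of
  \<open>mark_bound\<close>: the children return 2 * 3 / 3 = 2, the leaf adds 1, and the constant 3
  reproduces itself.\<close>

lemma nn_integral_norm_part:
  assumes b: "0 \<le> b" "b \<le> T"
  shows "(\<integral>\<^sup>+\<omega>. ennreal (norm (part T B \<rho> \<beta> n b \<omega>)) \<partial>trees) \<le> ennreal (3 * exp ((Re \<beta>)^2 / 2 * (T - B b) + 2 * (T - b)))"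
  using b
proof (induction n arbitrary: b)
  case (Suc n)
  interpret T: prob_space "trees" by (rule prob_space_tree)
  note b = Suc.prems
  let ?p = "\<lambda>b. part T B \<rho> \<beta> n b"
  let ?w = "\<lambda>m. wt \<beta> (disp \<rho> (dispvar T B b (fst m)) (snd m))"
  let ?C = "\<lambda>b. 3 * exp ((Re \<beta>)^2 / 2 * (T - B b) + 2 * (T - b))"
  have [measurable]: "?p b \<in> borel_measurable trees" for b by (intro measurable_part) auto
  have "(\<integral>\<^sup>+\<omega>. ennreal (norm (part T B \<rho> \<beta> (Suc n) b \<omega>)) \<partial>trees) =
    (\<integral>\<^sup>+m. (if T < b + fst m then ennreal (norm (?w m)) else
      (\<integral>\<^sup>+\<omega>0. \<integral>\<^sup>+\<omega>1. ennreal (norm (?w m * (?p (b + fst m) \<omega>0 + ?p (b + fst m) \<omega>1))) \<partial>trees \<partial>trees)) \<partial>mark)"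
    using b by (subst nn_integral_part[where F = "\<lambda>x. ennreal (norm x)"]) (auto simp: Let_def)
  also have "... \<le> (\<integral>\<^sup>+m. (if T < b + fst m then ennreal (exp (Re \<beta> * fst (disp \<rho> (dispvar T B b (fst m)) (snd m)))) else 0)
      + (if T < b + fst m then 0 else ennreal (exp (Re \<beta> * fst (disp \<rho> (dispvar T B b (fst m)) (snd m))) * (2 * ?C (b + fst m)))) \<partial>mark)"
  proof (rule nn_integral_mono_AE, use AE_mark in eventually_elim)
    fix m :: "real \<times> real \<times> real" assume m: "0 \<le> fst m"
    show "(if T < b + fst m then ennreal (norm (?w m)) else
      (\<integral>\<^sup>+\<omega>0. \<integral>\<^sup>+\<omega>1. ennreal (norm (?w m * (?p (b + fst m) \<omega>0 + ?p (b + fst m) \<omega>1))) \<partial>trees \<partial>trees))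
      \<le> (if T < b + fst m then ennreal (exp (Re \<beta> * fst (disp \<rho> (dispvar T B b (fst m)) (snd m)))) else 0)
      + (if T < b + fst m then 0 else ennreal (exp (Re \<beta> * fst (disp \<rho> (dispvar T B b (fst m)) (snd m))) * (2 * ?C (b + fst m))))"
    proof (cases "T < b + fst m")
      case False
      let ?X = "?p (b + fst m)" and ?D = "?C (b + fst m)"
      have IH: "(\<integral>\<^sup>+\<omega>. ennreal (norm (?X \<omega>)) \<partial>trees) \<le> ennreal ?D"
        using False b m by (intro Suc.IH) auto
      have "(\<integral>\<^sup>+\<omega>0. \<integral>\<^sup>+\<omega>1. ennreal (norm (?w m * (?X \<omega>0 + ?X \<omega>1))) \<partial>trees \<partial>trees)
        \<le> (\<integral>\<^sup>+\<omega>0. \<integral>\<^sup>+\<omega>1. ennreal (norm (?w m)) * (ennreal (norm (?X \<omega>0)) + ennreal (norm (?X \<omega>1))) \<partial>trees \<partial>trees)"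
        by (intro nn_integral_mono)
           (auto simp: norm_mult norm_triangle_ineq simp flip: ennreal_mult ennreal_plus intro!: ennreal_leI mult_left_mono)
      also have "... = ennreal (norm (?w m)) * ((\<integral>\<^sup>+\<omega>. ennreal (norm (?X \<omega>)) \<partial>trees) + (\<integral>\<^sup>+\<omega>. ennreal (norm (?X \<omega>)) \<partial>trees))"
        using T.emeasure_space_1 by (simp add: nn_integral_cmult nn_integral_add)
      also have "... \<le> ennreal (norm (?w m)) * (ennreal ?D + ennreal ?D)"
        by (intro mult_left_mono add_mono IH) auto
      also have "... = ennreal (norm (?w m) * (2 * ?D))"
        by (rule ennreal_mult_double) auto
      finally show ?thesis using False by (simp add: norm_wt)
    qed (simp add: norm_wt)
  qed
  also have "... = (\<integral>\<^sup>+m. (if T < b + fst m then ennreal (exp (Re \<beta> * fst (disp \<rho> (dispvar T B b (fst m)) (snd m)))) else 0) \<partial>mark)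
      + (\<integral>\<^sup>+m. (if T < b + fst m then 0 else ennreal (exp (Re \<beta> * fst (disp \<rho> (dispvar T B b (fst m)) (snd m))) * (2 * ?C (b + fst m)))) \<partial>mark)"
  proof (rule nn_integral_add)
    have "(\<lambda>m. norm (?w m)) \<in> borel_measurable mark" by measurable
    then have [measurable]: "(\<lambda>m. exp (Re \<beta> * fst (disp \<rho> (dispvar T B b (fst m)) (snd m)))) \<in> borel_measurable mark"
      by (simp add: norm_wt)
    show "(\<lambda>m. if T < b + fst m then ennreal (exp (Re \<beta> * fst (disp \<rho> (dispvar T B b (fst m)) (snd m)))) else 0) \<in> borel_measurable mark"
      by measurable
    show "(\<lambda>m. if T < b + fst m then 0 else ennreal (exp (Re \<beta> * fst (disp \<rho> (dispvar T B b (fst m)) (snd m))) * (2 * ?C (b + fst m)))) \<in> borel_measurable mark"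
      by measurable
  qed
  also have "... \<le> ennreal (exp ((Re \<beta>)^2 / 2 * (T - B b))) + ennreal ((6 * exp ((Re \<beta>)^2 / 2 * T + 2 * T)) * exp (- (1 + 1) * b - (Re \<beta>)\<^sup>2 / 2 * B b) / (2 + 1))"
    using b by (intro add_mono mark_leaf_bound mark_bound) (auto simp: mult_exp_exp field_simps)
  also have "... \<le> ennreal (?C b)"
  proof -
    have "exp ((Re \<beta>)^2 / 2 * (T - B b)) \<le> exp ((Re \<beta>)^2 / 2 * (T - B b) + 2 * (T - b))"
      using b by simp
    moreover have "(6 * exp ((Re \<beta>)^2 / 2 * T + 2 * T)) * exp (- (1 + 1) * b - (Re \<beta>)\<^sup>2 / 2 * B b) / (2 + 1)
      = 2 * exp ((Re \<beta>)^2 / 2 * (T - B b) + 2 * (T - b))"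
      by (simp add: mult_exp_exp field_simps)
    ultimately show ?thesis by (simp flip: ennreal_plus)
  qed
  finally show ?case .
qed simp

lemma integrable_part: "0 \<le> b \<Longrightarrow> b \<le> T \<Longrightarrow> integrable trees (part T B \<rho> \<beta> n b)"
proof (rule integrableI_bounded)
  show "part T B \<rho> \<beta> n b \<in> borel_measurable trees" by (intro measurable_part) auto
  assume "0 \<le> b" "b \<le> T"
  from nn_integral_norm_part[OF this]
  show "(\<integral>\<^sup>+\<omega>. ennreal (norm (part T B \<rho> \<beta> n b \<omega>)) \<partial>trees) < \<infinity>"
    by (rule le_less_trans) simp
qed

text \<open>The integrand of \<open>root_mean\<close> is the conditional mean given the root mark.
  Its law is the source of randomness that one generation adds in the recursion for the q-th
  moments.\<close>

lemma
  assumes b: "0 \<le> b" "b \<le> T"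
  shows part_mean: "(\<integral>\<omega>. part T B \<rho> \<beta> n b \<omega> \<partial>trees) = mean \<beta> n b"
    and root_mean: "has_bochner_integral mark
      (\<lambda>m. wt \<beta> (disp \<rho> (dispvar T B b (fst m)) (snd m)) * (if T < b + fst m then 1 else 2 * mean \<beta> n (b + fst m)))
      (mean \<beta> (Suc n) b)"
proof -
  have step: "has_bochner_integral mark
      (\<lambda>m. wt \<beta> (disp \<rho> (dispvar T B b (fst m)) (snd m)) * (if T < b + fst m then 1 else 2 * mean \<beta> n (b + fst m)))
      (mean \<beta> (Suc n) b) \<and> (\<integral>\<omega>. part T B \<rho> \<beta> (Suc n) b \<omega> \<partial>trees) = mean \<beta> (Suc n) b"
    if b: "0 \<le> b" "b \<le> T" and IH: "\<And>b. 0 \<le> b \<Longrightarrow> b \<le> T \<Longrightarrow> (\<integral>\<omega>. part T B \<rho> \<beta> n b \<omega> \<partial>trees) = mean \<beta> n b" for n b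
  proof -
    interpret M: prob_space mark by (rule prob_space_mark)
    interpret T: prob_space "trees" by (rule prob_space_tree)
    interpret TT: pair_prob_space "trees" "trees" ..
    let ?TT = "trees \<Otimes>\<^sub>M trees"
    let ?Y = "\<lambda>m. wt \<beta> (disp \<rho> (dispvar T B b (fst m)) (snd m)) * (if T < b + fst m then 1 else 2 * mean \<beta> n (b + fst m))"
    let ?I = "\<lambda>m. \<integral>y. part T B \<rho> \<beta> (Suc n) b (node m (fst y) (snd y)) \<partial>?TT"
    have Y [measurable]: "?Y \<in> borel_measurable mark" by measurable
    have eq: "?I m = ?Y m" if "0 \<le> fst m" for m
    proof -
      obtain l x where Pair: "m = (l, x)" by (metis surj_pair)
      have "?I m = (\<integral>y. wt \<beta> (disp \<rho> (dispvar T B b l) x) * (if T < b + l then 1 else part T B \<rho> \<beta> n (b + l) (fst y) + part T B \<rho> \<beta> n (b + l) (snd y)) \<partial>?TT)"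
        by (simp add: Pair part_node)
      also have "... = wt \<beta> (disp \<rho> (dispvar T B b l) x) * (if T < b + l then 1 else 2 * mean \<beta> n (b + l))"
      proof (cases "T < b + l")
        case False
        then have bl: "0 \<le> b + l" "b + l \<le> T" using that b Pair by auto
        let ?p = "part T B \<rho> \<beta> n (b + l)"
        have hp: "has_bochner_integral trees ?p (mean \<beta> n (b + l))"
          using integrable_part[OF bl] IH[OF bl] by (simp add: has_bochner_integral_iff)
        have h1: "has_bochner_integral trees (\<lambda>_. 1 :: complex) 1"
          by (simp add: has_bochner_integral_iff T.prob_space[simplified])
        have "has_bochner_integral ?TT (\<lambda>y. ?p (fst y) * 1 + 1 * ?p (snd y)) (mean \<beta> n (b + l) * 1 + 1 * mean \<beta> n (b + l))"
          by (intro has_bochner_integral_add has_bochner_integral_pair_mult hp h1 prob_space_tree)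
        then show ?thesis using False by (simp add: has_bochner_integral_iff)
      next
        case True
        then show ?thesis using TT.P.prob_space by (simp add: space_pair_measure)
      qed
      finally show ?thesis by (simp add: Pair)
    qed
    then have AE: "AE m in mark. ?I m = ?Y m" using AE_mark by auto
    have int: "integrable trees (part T B \<rho> \<beta> (Suc n) b)" by (rule integrable_part) fact+
    have intY: "integrable mark ?Y"
      by (rule integrable_cong_AE_imp[OF integral_tree_space(2)[OF int]]) (use AE in auto)
    have valY: "(\<integral>m. ?Y m \<partial>mark) = mean \<beta> (Suc n) b"
    proof -
      have "(\<integral>m. ?Y m \<partial>mark) = (\<integral>l. \<integral>x. ?Y (l, x) \<partial>gauss2 \<partial>expo)"
        by (rule integral_mark[OF intY])
      also have "... = (\<integral>l. exp (cumul \<rho> \<beta> * (T - B b)) * complex_of_real (if T - b < l then 1 else 2 * poiss n (T - b - l)) \<partial>expo)"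
      proof (rule integral_cong_AE)
        show "AE l in expo. (\<integral>x. ?Y (l, x) \<partial>gauss2) = exp (cumul \<rho> \<beta> * (T - B b)) * complex_of_real (if T - b < l then 1 else 2 * poiss n (T - b - l))"
          using AE_expo
        proof eventually_elim
          fix l :: real assume l: "0 \<le> l"
          have v: "0 \<le> dispvar T B b l" using l b by (intro dispvar_nonneg) auto
          have "(\<integral>x. ?Y (l, x) \<partial>gauss2) = (\<integral>x. wt \<beta> (disp \<rho> (dispvar T B b l) x) \<partial>gauss2) * (if T < b + l then 1 else 2 * mean \<beta> n (b + l))"
            by simp
          also have "(\<integral>x. wt \<beta> (disp \<rho> (dispvar T B b l) x) \<partial>gauss2) = exp (cumul \<rho> \<beta> * dispvar T B b l)"
            using gauss_disp_mean[OF v rho] by (simp add: has_bochner_integral_iff)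
          finally show "(\<integral>x. ?Y (l, x) \<partial>gauss2) = exp (cumul \<rho> \<beta> * (T - B b)) * complex_of_real (if T - b < l then 1 else 2 * poiss n (T - b - l))"
            by (auto simp: dispvar_def mean_def mult_exp_exp algebra_simps)
        qed
        show "(\<lambda>l. \<integral>x. ?Y (l, x) \<partial>gauss2) \<in> borel_measurable expo"
        proof -
          interpret G: prob_space gauss2 by (rule prob_space_gauss2)
          show ?thesis using Y unfolding mark_def by measurable
        qed
      qed simp
      also have "... = exp (cumul \<rho> \<beta> * (T - B b)) * (\<integral>l. complex_of_real (if T - b < l then 1 else 2 * poiss n (T - b - l)) \<partial>expo)"
        by (rule integral_mult_right_zero)
      also have "(\<integral>l. complex_of_real (if T - b < l then 1 else 2 * poiss n (T - b - l)) \<partial>expo) = complex_of_real (poiss (Suc n) (T - b))"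
        using poiss_rec[of "T - b" n] b by (subst integral_complex_of_real) (simp add: has_bochner_integral_iff)
      finally show ?thesis by (simp add: mean_def)
    qed
    have "(\<integral>\<omega>. part T B \<rho> \<beta> (Suc n) b \<omega> \<partial>trees) = (\<integral>m. ?I m \<partial>mark)"
      by (rule integral_tree_space(1)[OF int])
    also have "... = (\<integral>m. ?Y m \<partial>mark)"
      using AE borel_measurable_integrable[OF integral_tree_space(2)[OF int]] by (intro integral_cong_AE) auto
    finally show ?thesis using intY valY by (simp add: has_bochner_integral_iff)
  qed
  have *: "(\<integral>\<omega>. part T B \<rho> \<beta> n b \<omega> \<partial>trees) = mean \<beta> n b" if "0 \<le> b" "b \<le> T" for n b
    using that
  proof (induction n arbitrary: b)
    case 0 then show ?case by (simp add: mean_def poiss_def)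
  next
    case (Suc n) then show ?case using step[of b n] by blast
  qed
  from *[OF b] show "(\<integral>\<omega>. part T B \<rho> \<beta> n b \<omega> \<partial>trees) = mean \<beta> n b" .
  show "has_bochner_integral mark
      (\<lambda>m. wt \<beta> (disp \<rho> (dispvar T B b (fst m)) (snd m)) * (if T < b + fst m then 1 else 2 * mean \<beta> n (b + fst m)))
      (mean \<beta> (Suc n) b)"
    using step[OF b *] by blast
qed

end

lemma nn_integral_le_lebesgue:
  assumes "integrable M G" "\<And>x. 0 \<le> G x" "(\<integral>x. G x \<partial>M) \<le> r"
  shows "(\<integral>\<^sup>+x. ennreal (G x) \<partial>M) \<le> ennreal r"
  using assms by (subst nn_integral_eq_integral) (auto intro: ennreal_leI)

lemma integrable_nn_bound:
  assumes [measurable]: "f \<in> borel_measurable M" and "\<And>x. 0 \<le> f x" and "(\<integral>\<^sup>+x. ennreal (f x) \<partial>M) \<le> ennreal r" "0 \<le> r"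
  shows "integrable M f" "(\<integral>x. f x \<partial>M) \<le> (r :: real)"
proof -
  show i: "integrable M f"
    by (rule integrableI_bounded) (use assms in \<open>auto intro: le_less_trans\<close>)
  have "ennreal (\<integral>x. f x \<partial>M) \<le> ennreal r"
    using nn_integral_eq_integral[OF i] assms by auto
  then show "(\<integral>x. f x \<partial>M) \<le> r" using assms by simp
qed

text \<open>The expansion is made around \<open>a + m\<close>, where the linear term is centered and
  integrates to 0. The constant 28 is 7 * 4, the 4 coming from splitting norm (Y - m) ^ q.\<close>

lemma (in prob_space) expectation_norm_powr_le:
  fixes Y :: "_ \<Rightarrow> complex"
  assumes q: "1 \<le> q" "q \<le> 2" and Y: "has_bochner_integral M Y m"
    and R: "(\<integral>\<^sup>+x. ennreal (norm (Y x) powr q) \<partial>M) \<le> ennreal R" "0 \<le> R"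
  shows "(\<integral>\<^sup>+x. ennreal (norm (a + Y x) powr q) \<partial>M) \<le> ennreal (norm (a + m) powr q + 28 * (R + norm m powr q))"
proof -
  obtain w where w: "\<And>y. norm (a + m + y) powr q \<le> norm (a + m) powr q + Re (w * y) + 7 * norm y powr q"
    using norm_add_powr_le[OF q, of "a + m"] by blast
  have iY: "integrable M Y" "(\<integral>x. Y x \<partial>M) = m" using Y by (auto simp: has_bochner_integral_iff)
  have [measurable]: "Y \<in> borel_measurable M" using iY by auto
  define Z where "Z x = Re (w * (Y x - m))" for x
  define G where "G x = norm (a + m) powr q + Z x + 28 * (norm (Y x) powr q + norm m powr q)" for x
  have le: "norm (a + Y x) powr q \<le> G x" for x
    using w[of "Y x - m"] norm_diff_powr_le[of q "Y x" m] q by (simp add: G_def Z_def)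
  have iq: "integrable M (\<lambda>x. norm (Y x) powr q)" "(\<integral>x. norm (Y x) powr q \<partial>M) \<le> R"
    by (rule integrable_nn_bound; (fact R)?; measurable?; simp)+
  have i1: "integrable M (\<lambda>x. w * (Y x - m))" using iY by (intro integrable_mult_right Bochner_Integration.integrable_diff) auto
  have v1: "(\<integral>x. w * (Y x - m) \<partial>M) = 0" using iY by (simp add: prob_space)
  have iZ: "integrable M Z" "(\<integral>x. Z x \<partial>M) = 0"
    unfolding Z_def using i1 by (auto simp only: integral_Re[OF i1] v1 zero_complex.sel intro: integrable_Re)
  have iG: "integrable M G"
    unfolding G_def by (intro Bochner_Integration.integrable_add integrable_mult_right iZ iq) auto
  have "(\<integral>x. G x \<partial>M) = norm (a + m) powr q + 28 * ((\<integral>x. norm (Y x) powr q \<partial>M) + norm m powr q)"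
    unfolding G_def using iZ iq by (simp add: prob_space)
  also have "... \<le> norm (a + m) powr q + 28 * (R + norm m powr q)" using iq by simp
  finally have "(\<integral>\<^sup>+x. ennreal (G x) \<partial>M) \<le> ennreal (norm (a + m) powr q + 28 * (R + norm m powr q))"
    using le by (intro nn_integral_le_lebesgue iG) (auto intro: order_trans[OF powr_ge_zero])
  then show ?thesis
    by (rule order_trans[rotated]) (intro nn_integral_mono ennreal_leI le)
qed

context profile
begin

text \<open>Hypothesis \<open>le\<close> compares with the e^s particles expected at time
  \<open>s\<close>: the q-th powers of what they contribute on average, displacement up to
  \<open>s\<close> and mean from \<open>s\<close> on, sum to at most \<open>M\<close> exp (- c s).
  \<open>leT\<close> is the same requirement for the leaves. The shift \<open>a\<close> strengthens
  the induction: while one subtree is averaged, the other one is part of the shift.\<close>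

theorem q_moment:
  assumes q: "1 \<le> q" "q \<le> 2" and c: "0 < c" "c \<le> 1" and M: "0 \<le> M" and b0: "0 \<le> b0"
    and le: "\<And>s. b0 \<le> s \<Longrightarrow> s \<le> T \<Longrightarrow>
      exp (q * (T - s) + (q * Re \<beta>)^2 / 2 * B s + q * (((Re \<beta>)^2 - (Im \<beta>)\<^sup>2) / 2 * (T - B s))) \<le> M * exp (- (1 + c) * s)"
    and leT: "exp ((q * Re \<beta>)^2 / 2 * T) \<le> M * exp (- (1 + c) * T)"
    and b: "b0 \<le> b" "b \<le> T"
  shows "(\<integral>\<^sup>+\<omega>. ennreal (norm (a + part T B \<rho> \<beta> n b \<omega>) powr q) \<partial>trees)
    \<le> ennreal (norm (a + mean \<beta> n b) powr q + 500 / c * (M * exp (- (1 + c) * b - (q * Re \<beta>)\<^sup>2 / 2 * B b)))"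
  using b
proof (induction n arbitrary: a b)
  case 0
  interpret T: prob_space "trees" by (rule prob_space_tree)
  show ?case using M c T.emeasure_space_1 by (simp add: mean_def poiss_def ennreal_leI)
next
  case (Suc n)
  interpret T: prob_space "trees" by (rule prob_space_tree)
  interpret Mk: prob_space mark by (rule prob_space_mark)
  have b: "0 \<le> b" "b \<le> T" and b0b: "b0 \<le> b" using Suc.prems b0 by auto
  define \<kappa> where "\<kappa> = (q * Re \<beta>)^2 / 2"
  define R where "R s = M * exp (- (1 + c) * s - \<kappa> * B s)" for s
  have R0: "0 \<le> R s" for s using M by (simp add: R_def)
  let ?p = "\<lambda>b. part T B \<rho> \<beta> n b"
  \<comment> \<open>The two children return 2 D / (2 + c), which is 1000 / (c (2 + c)) times R, and
    the root adds 28 * (3 + 1) = 112 times R. For c \<le> 1 both together are at most 500 / c times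
    R, so the constant 500 / c reproduces itself.\<close>
  define D where "D s = 500 / c * R s" for s
  have D0: "0 \<le> D s" for s using R0 c by (simp add: D_def)
  have [measurable]: "D \<in> borel_measurable borel" unfolding D_def R_def by measurable
  define w where "w m = wt \<beta> (disp \<rho> (dispvar T B b (fst m)) (snd m))" for m
  have w [measurable]: "w \<in> borel_measurable mark" unfolding w_def by measurable
  have w0: "w m \<noteq> 0" for m by (simp add: w_def)
  have wq: "norm (w m) powr q = exp ((q * Re \<beta>) * fst (disp \<rho> (dispvar T B b (fst m)) (snd m)))" for m
    by (simp add: w_def norm_wt powr_def)
  define Y where "Y m = w m * (if T < b + fst m then 1 else 2 * mean \<beta> n (b + fst m))" for m
  have Y: "has_bochner_integral mark Y (mean \<beta> (Suc n) b)"
    unfolding Y_def w_def by (rule root_mean[OF b])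
  have [measurable]: "Y \<in> borel_measurable mark" unfolding Y_def by measurable
  have [measurable]: "?p b \<in> borel_measurable trees" for b by (intro measurable_part) auto
  have mean_le: "norm (mean \<beta> k s) powr q \<le> R s" if "b0 \<le> s" "s \<le> T" for k s
  proof -
    have "norm (mean \<beta> k s) powr q \<le> (exp (((Re \<beta>)^2 - (Im \<beta>)\<^sup>2) / 2 * (T - B s)) * exp (T - s)) powr q"
      using that q by (intro powr_mono2) (auto simp: norm_mean poiss_le poiss_nonneg zero_le_mult_iff)
    also have "... = exp (- \<kappa> * B s) * exp (q * (T - s) + \<kappa> * B s + q * (((Re \<beta>)^2 - (Im \<beta>)\<^sup>2) / 2 * (T - B s)))"
      by (simp add: powr_def mult_exp_exp algebra_simps)
    also have "... \<le> exp (- \<kappa> * B s) * (M * exp (- (1 + c) * s))"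
      using le[OF that] by (intro mult_left_mono) (auto simp: \<kappa>_def)
    also have "... = R s" by (simp add: R_def mult_exp_exp algebra_simps)
    finally show ?thesis .
  qed
  \<comment> \<open>A leaf contributes at most R; the doubled mean contributes at most 2^q \<le> 4
    times R before \<open>mark_bound\<close> divides by 2 + c.\<close>
  have Yq: "(\<integral>\<^sup>+m. ennreal (norm (Y m) powr q) \<partial>mark) \<le> ennreal (3 * R b)"
  proof -
    have "(\<integral>\<^sup>+m. ennreal (norm (Y m) powr q) \<partial>mark) =
      (\<integral>\<^sup>+m. (if T < b + fst m then ennreal (exp ((q * Re \<beta>) * fst (disp \<rho> (dispvar T B b (fst m)) (snd m)))) else 0)
        + (if T < b + fst m then 0 else ennreal (exp ((q * Re \<beta>) * fst (disp \<rho> (dispvar T B b (fst m)) (snd m))) * (norm (2 * mean \<beta> n (b + fst m)) powr q))) \<partial>mark)"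
      by (intro nn_integral_cong) (auto simp: Y_def norm_mult powr_mult wq)
    also have "... = (\<integral>\<^sup>+m. (if T < b + fst m then ennreal (exp ((q * Re \<beta>) * fst (disp \<rho> (dispvar T B b (fst m)) (snd m)))) else 0) \<partial>mark)
      + (\<integral>\<^sup>+m. (if T < b + fst m then 0 else ennreal (exp ((q * Re \<beta>) * fst (disp \<rho> (dispvar T B b (fst m)) (snd m))) * (norm (2 * mean \<beta> n (b + fst m)) powr q))) \<partial>mark)"
      unfolding wq[symmetric] by (rule nn_integral_add) measurable
    also have "... \<le> ennreal (exp ((q * Re \<beta>)^2 / 2 * (T - B b))) + ennreal ((4 * M) * exp (- (1 + c) * b - (q * Re \<beta>)\<^sup>2 / 2 * B b) / (2 + c))"
    proof (intro add_mono mark_leaf_bound mark_bound b)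
      fix s assume s: "b \<le> s" "s \<le> T"
      have "norm (2 * mean \<beta> n s) powr q = 2 powr q * norm (mean \<beta> n s) powr q"
        by (simp add: norm_mult powr_mult)
      also have "... \<le> 2 powr 2 * R s"
        using q s b0b mean_le by (intro mult_mono powr_mono) auto
      finally have "exp (\<kappa> * B s) * norm (2 * mean \<beta> n s) powr q \<le> exp (\<kappa> * B s) * (4 * R s)"
        by (intro mult_left_mono) auto
      also have "... = 4 * M * exp (- (1 + c) * s)" by (simp add: R_def mult_exp_exp)
      finally show "0 \<le> norm (2 * mean \<beta> n s) powr q \<and> exp ((q * Re \<beta>)^2 / 2 * B s) * norm (2 * mean \<beta> n s) powr q \<le> 4 * M * exp (- (1 + c) * s)"
        by (simp add: \<kappa>_def)
    qed (use c M in auto)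
    also have "... \<le> ennreal (R b) + ennreal (2 * R b)"
    proof (intro add_mono ennreal_leI)
      have "exp ((q * Re \<beta>)^2 / 2 * (T - B b)) = exp (- \<kappa> * B b) * exp ((q * Re \<beta>)^2 / 2 * T)"
        by (simp add: \<kappa>_def mult_exp_exp right_diff_distrib)
      also have "... \<le> exp (- \<kappa> * B b) * (M * exp (- (1 + c) * T))"
        by (intro mult_left_mono leT) auto
      also have "... \<le> exp (- \<kappa> * B b) * (M * exp (- (1 + c) * b))"
        using b c M by (intro mult_left_mono) (auto simp: mult_left_mono)
      also have "... = R b" by (simp add: R_def mult_exp_exp algebra_simps)
      finally show "exp ((q * Re \<beta>)^2 / 2 * (T - B b)) \<le> R b" .
      have "(4 * M) * exp (- (1 + c) * b - (q * Re \<beta>)\<^sup>2 / 2 * B b) / (2 + c) = 4 / (2 + c) * R b"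
        by (simp add: R_def \<kappa>_def)
      also have "... \<le> 2 * R b" using c by (intro mult_right_mono R0) (simp add: field_simps)
      finally show "(4 * M) * exp (- (1 + c) * b - (q * Re \<beta>)\<^sup>2 / 2 * B b) / (2 + c) \<le> 2 * R b" .
    qed
    also have "... = ennreal (3 * R b)" using R0 by (simp flip: ennreal_plus)
    finally show ?thesis .
  qed
  \<comment> \<open>The subtrees are replaced by their means one after the other: for fixed
    \<open>\<omega>0\<close> the first subtree belongs to the shift of the second, afterwards the
    mean of the second belongs to the shift of the first. Each replacement costs D once, multiplied
    by the weight of the root.\<close>
  have inner: "(\<integral>\<^sup>+\<omega>0. \<integral>\<^sup>+\<omega>1. ennreal (norm (a + w m * (?p s \<omega>0 + ?p s \<omega>1)) powr q) \<partial>trees \<partial>trees)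
      \<le> ennreal (norm (a + w m * (2 * mean \<beta> n s)) powr q) + ennreal (norm (w m) powr q * (2 * D s))"
    if s: "b0 \<le> s" "s \<le> T" for m s
  proof -
    have eq: "norm (a + w m * (x + y)) powr q = norm (w m) powr q * norm ((a / w m + x) + y) powr q" for x y
    proof -
      have "a + w m * (x + y) = w m * ((a / w m + x) + y)" using w0[of m] by (simp add: field_simps)
      then show ?thesis by (metis norm_mult powr_mult norm_ge_zero)
    qed
    have IH: "(\<integral>\<^sup>+\<omega>. ennreal (norm (a' + ?p s \<omega>) powr q) \<partial>trees) \<le> ennreal (norm (a' + mean \<beta> n s) powr q + D s)" for a'
      using Suc.IH[OF s, of a'] by (simp add: D_def R_def \<kappa>_def)
    have "(\<integral>\<^sup>+\<omega>0. \<integral>\<^sup>+\<omega>1. ennreal (norm (a + w m * (?p s \<omega>0 + ?p s \<omega>1)) powr q) \<partial>trees \<partial>trees)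
      = (\<integral>\<^sup>+\<omega>0. ennreal (norm (w m) powr q) * (\<integral>\<^sup>+\<omega>1. ennreal (norm ((a / w m + ?p s \<omega>0) + ?p s \<omega>1) powr q) \<partial>trees) \<partial>trees)"
      by (simp add: eq ennreal_mult nn_integral_cmult)
    also have "... \<le> (\<integral>\<^sup>+\<omega>0. ennreal (norm (w m) powr q) * ennreal (norm ((a / w m + ?p s \<omega>0) + mean \<beta> n s) powr q + D s) \<partial>trees)"
      by (intro nn_integral_mono mult_left_mono IH) auto
    also have "... = ennreal (norm (w m) powr q) * ((\<integral>\<^sup>+\<omega>0. ennreal (norm ((a / w m + mean \<beta> n s) + ?p s \<omega>0) powr q) \<partial>trees) + ennreal (D s))"
      using D0 T.emeasure_space_1 by (simp add: nn_integral_cmult nn_integral_add ennreal_plus algebra_simps)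
    also have "... \<le> ennreal (norm (w m) powr q) * (ennreal (norm ((a / w m + mean \<beta> n s) + mean \<beta> n s) powr q + D s) + ennreal (D s))"
      by (intro mult_left_mono add_mono IH) auto
    also have "... = ennreal (norm (w m) powr q * norm ((a / w m + mean \<beta> n s) + mean \<beta> n s) powr q) + ennreal (norm (w m) powr q * (2 * D s))"
    proof -
      have "ennreal k * (ennreal (x + d) + ennreal d) = ennreal (k * x) + ennreal (k * (2 * d))" if "0 \<le> k" "0 \<le> x" "0 \<le> d" for k x d :: real
      proof -
        have "ennreal (x + d) + ennreal d = ennreal (x + d + d)" using that by (intro ennreal_plus[symmetric]) auto
        moreover have "ennreal k * ennreal (x + d + d) = ennreal (k * (x + d + d))" using that by (intro ennreal_mult[symmetric]) auto
        moreover have "ennreal (k * x) + ennreal (k * (2 * d)) = ennreal (k * x + k * (2 * d))" using that by (intro ennreal_plus[symmetric]) auto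
        moreover have "k * (x + d + d) = k * x + k * (2 * d)" by (simp add: algebra_simps)
        ultimately show ?thesis by (simp only:)
      qed
      then show ?thesis using D0 by simp
    qed
    also have "norm (w m) powr q * norm ((a / w m + mean \<beta> n s) + mean \<beta> n s) powr q = norm (a + w m * (2 * mean \<beta> n s)) powr q"
      by (simp only: mult_2 eq[of "mean \<beta> n s" "mean \<beta> n s"])
    finally show ?thesis .
  qed
  have "(\<integral>\<^sup>+\<omega>. ennreal (norm (a + part T B \<rho> \<beta> (Suc n) b \<omega>) powr q) \<partial>trees)
    = (\<integral>\<^sup>+m. (if T < b + fst m then ennreal (norm (a + w m) powr q) else
      (\<integral>\<^sup>+\<omega>0. \<integral>\<^sup>+\<omega>1. ennreal (norm (a + w m * (?p (b + fst m) \<omega>0 + ?p (b + fst m) \<omega>1)) powr q) \<partial>trees \<partial>trees)) \<partial>mark)"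
    using b by (subst nn_integral_part[where F = "\<lambda>x. ennreal (norm (a + x) powr q)"]) (auto simp: Let_def w_def cong: if_cong)
  also have "... \<le> (\<integral>\<^sup>+m. ennreal (norm (a + Y m) powr q) + (if T < b + fst m then 0 else ennreal (norm (w m) powr q * (2 * D (b + fst m)))) \<partial>mark)"
  proof (rule nn_integral_mono_AE, use AE_mark in eventually_elim)
    fix m :: "real \<times> real \<times> real" assume m: "0 \<le> fst m"
    show "(if T < b + fst m then ennreal (norm (a + w m) powr q) else
      (\<integral>\<^sup>+\<omega>0. \<integral>\<^sup>+\<omega>1. ennreal (norm (a + w m * (?p (b + fst m) \<omega>0 + ?p (b + fst m) \<omega>1)) powr q) \<partial>trees \<partial>trees))
      \<le> ennreal (norm (a + Y m) powr q) + (if T < b + fst m then 0 else ennreal (norm (w m) powr q * (2 * D (b + fst m))))"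
      using inner[of "b + fst m" m] m b0b by (auto simp: Y_def)
  qed
  also have "... = (\<integral>\<^sup>+m. ennreal (norm (a + Y m) powr q) \<partial>mark) + (\<integral>\<^sup>+m. (if T < b + fst m then 0 else ennreal (norm (w m) powr q * (2 * D (b + fst m)))) \<partial>mark)"
    by (rule nn_integral_add) measurable
  also have "... \<le> ennreal (norm (a + mean \<beta> (Suc n) b) powr q + 28 * (3 * R b + norm (mean \<beta> (Suc n) b) powr q))
      + ennreal ((1000 / c * M) * exp (- (1 + c) * b - (q * Re \<beta>)\<^sup>2 / 2 * B b) / (2 + c))"
  proof (rule add_mono)
    show "(\<integral>\<^sup>+m. ennreal (norm (a + Y m) powr q) \<partial>mark) \<le> ennreal (norm (a + mean \<beta> (Suc n) b) powr q + 28 * (3 * R b + norm (mean \<beta> (Suc n) b) powr q))"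
      using R0 by (intro Mk.expectation_norm_powr_le q Y Yq) auto
    show "(\<integral>\<^sup>+m. (if T < b + fst m then 0 else ennreal (norm (w m) powr q * (2 * D (b + fst m)))) \<partial>mark) \<le>
      ennreal ((1000 / c * M) * exp (- (1 + c) * b - (q * Re \<beta>)\<^sup>2 / 2 * B b) / (2 + c))"
      unfolding wq
    proof (rule mark_bound)
      fix s
      have "exp (\<kappa> * B s) * (2 * D s) = 1000 / c * M * exp (- (1 + c) * s)"
        by (simp add: D_def R_def mult_exp_exp)
      then show "0 \<le> 2 * D s \<and> exp ((q * Re \<beta>)^2 / 2 * B s) * (2 * D s) \<le> 1000 / c * M * exp (- (1 + c) * s)"
        using D0[of s] by (simp add: \<kappa>_def)
    qed (use b c M in auto)
  qed
  also have "... \<le> ennreal (norm (a + mean \<beta> (Suc n) b) powr q + 28 * (4 * R b)) + ennreal (1000 / (c * (2 + c)) * R b)"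
  proof (rule add_mono[OF ennreal_leI ennreal_leI])
    show "norm (a + mean \<beta> (Suc n) b) powr q + 28 * (3 * R b + norm (mean \<beta> (Suc n) b) powr q) \<le> norm (a + mean \<beta> (Suc n) b) powr q + 28 * (4 * R b)"
      using mean_le[OF b0b b(2), of "Suc n"] by simp
  qed (simp add: R_def \<kappa>_def)
  also have "... = ennreal (norm (a + mean \<beta> (Suc n) b) powr q + (28 * (4 * R b) + 1000 / (c * (2 + c)) * R b))"
  proof -
    have "0 \<le> norm (a + mean \<beta> (Suc n) b) powr q + 28 * (4 * R b)" "0 \<le> 1000 / (c * (2 + c)) * R b"
      using R0[of b] c by auto
    from ennreal_plus[OF this] show ?thesis by (simp only: add.assoc)
  qed
  also have "... \<le> ennreal (norm (a + mean \<beta> (Suc n) b) powr q + D b)"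
  proof (intro ennreal_leI add_left_mono)
    have "112 + 1000 / (c * (2 + c)) \<le> 500 / c"
    proof -
      have "500 / c - 1000 / (c * (2 + c)) = 500 / (2 + c)"
      proof -
        have "500 / c = 500 * (2 + c) / (c * (2 + c))"
          by (rule mult_divide_mult_cancel_right[symmetric]) (use c in simp)
        then have "500 / c - 1000 / (c * (2 + c)) = (500 * (2 + c) - 1000) / (c * (2 + c))"
          by (simp only: diff_divide_distrib)
        also have "500 * (2 + c) - 1000 = c * 500" by simp
        also have "c * 500 / (c * (2 + c)) = 500 / (2 + c)" using c by (intro mult_divide_mult_cancel_left) simp
        finally show ?thesis .
      qed
      moreover have "112 \<le> 500 / (2 + c)" using c by (simp add: field_simps)
      ultimately show ?thesis by linarith
    qed
    from mult_right_mono[OF this R0] show "28 * (4 * R b) + 1000 / (c * (2 + c)) * R b \<le> D b"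
      by (simp add: D_def algebra_simps)
  qed
  finally show ?case by (simp add: D_def R_def \<kappa>_def)
qed

end

section \<open>Upper tail\<close>

lemma (in prob_space) markov_powr:
  fixes X :: "_ \<Rightarrow> complex"
  assumes [measurable]: "X \<in> borel_measurable M" and le: "(\<integral>\<^sup>+x. ennreal (norm (X x) powr q) \<partial>M) \<le> ennreal R"
    and q: "0 < q" and a: "0 < a" and R: "0 \<le> R"
  shows "measure M {x \<in> space M. a \<le> norm (X x)} \<le> R / a powr q"
proof -
  have "{x \<in> space M. a \<le> norm (X x)} \<subseteq> {x \<in> space M. 1 \<le> ennreal (1 / a powr q) * ennreal (norm (X x) powr q)}"
  proof safe
    fix x assume "a \<le> norm (X x)"
    then have "a powr q \<le> norm (X x) powr q" using q a by (intro powr_mono2) auto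
    then have "1 \<le> 1 / a powr q * norm (X x) powr q" using a by (simp add: field_simps)
    then have "ennreal 1 \<le> ennreal (1 / a powr q * norm (X x) powr q)" by (rule ennreal_leI)
    also have "... = ennreal (1 / a powr q) * ennreal (norm (X x) powr q)" by (rule ennreal_mult) auto
    finally show "1 \<le> ennreal (1 / a powr q) * ennreal (norm (X x) powr q)" by (simp only: ennreal_1)
  qed
  then have "emeasure M {x \<in> space M. a \<le> norm (X x)} \<le> emeasure M {x \<in> space M. 1 \<le> ennreal (1 / a powr q) * ennreal (norm (X x) powr q)}"
    by (rule emeasure_mono) measurable
  also have "... \<le> ennreal (1 / a powr q) * (\<integral>\<^sup>+x. ennreal (norm (X x) powr q) * indicator (space M) x \<partial>M)"
    using nn_integral_Markov_inequality[where u = "\<lambda>x. ennreal (norm (X x) powr q)" and M = M and A = "space M" and c = "ennreal (1 / a powr q)"] by simp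
  also have "(\<integral>\<^sup>+x. ennreal (norm (X x) powr q) * indicator (space M) x \<partial>M) = (\<integral>\<^sup>+x. ennreal (norm (X x) powr q) \<partial>M)"
    by (intro nn_integral_cong) auto
  also have "ennreal (1 / a powr q) * \<dots> \<le> ennreal (1 / a powr q) * ennreal R" by (intro mult_left_mono le) auto
  also have "... = ennreal (R / a powr q)" using R by (simp flip: ennreal_mult)
  finally show ?thesis using R by (simp add: emeasure_eq_measure)
qed

text \<open>The minimiser over 0 < q \<le> 2 of (1 + q^2 \<sigma>^2 / 2) / q. The free minimum lies
  at sqrt 2 / \<bar>\<sigma>\<bar>, which is below 2 exactly when 2 \<sigma>^2 > 1. The minimal
  value is \<open>fluct_rate\<close>.\<close>

definition crit_exp :: "real \<Rightarrow> real" where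
  "crit_exp \<sigma> = (if 2 * \<sigma>^2 \<le> 1 then 2 else sqrt 2 / \<bar>\<sigma>\<bar>)"

definition fluct_rate :: "real \<Rightarrow> real" where
  "fluct_rate \<sigma> = (if 2 * \<sigma>^2 \<le> 1 then 1 / 2 + \<sigma>^2 else sqrt 2 * \<bar>\<sigma>\<bar>)"

lemma abs_pos_of_sq: "\<not> 2 * \<sigma>^2 \<le> 1 \<Longrightarrow> 0 < \<bar>\<sigma> :: real\<bar>"
  by auto

lemma crit_exp_pos: "0 < crit_exp \<sigma>"
  using abs_pos_of_sq[of \<sigma>] by (auto simp: crit_exp_def)

lemma sqrt2_less_iff: "\<bar>\<sigma>\<bar> < sqrt 2 \<longleftrightarrow> \<sigma>\<^sup>2 < 2" for \<sigma> :: real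
  using real_sqrt_less_iff[of "\<sigma>^2" 2] by simp

lemma crit_exp_le_2: "crit_exp \<sigma> \<le> 2"
proof -
  have "sqrt 2 / \<bar>\<sigma>\<bar> \<le> 2" if "\<not> 2 * \<sigma>^2 \<le> 1"
  proof -
    have "sqrt 2 \<le> sqrt (4 * \<sigma>^2)" using that by (intro real_sqrt_le_mono) simp
    also have "... = 2 * \<bar>\<sigma>\<bar>" by (simp add: real_sqrt_mult)
    finally show ?thesis using abs_pos_of_sq[OF that] by (simp add: pos_divide_le_eq mult.commute)
  qed
  then show ?thesis by (simp add: crit_exp_def)
qed

lemma crit_exp_ge_1: "\<sigma>^2 \<le> 2 \<Longrightarrow> 1 \<le> crit_exp \<sigma>"
  using real_sqrt_le_iff[of "\<sigma>^2" 2] abs_pos_of_sq[of \<sigma>] by (auto simp: crit_exp_def pos_le_divide_eq simp del: zero_less_abs_iff)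

lemma crit_exp_gt_1: "\<sigma>^2 < 2 \<Longrightarrow> 1 < crit_exp \<sigma>"
  using real_sqrt_less_iff[of "\<sigma>^2" 2] abs_pos_of_sq[of \<sigma>] by (auto simp: crit_exp_def pos_less_divide_eq simp del: zero_less_abs_iff)

lemma crit_exp_fluct: "1 + (crit_exp \<sigma> * \<sigma>)^2 / 2 = crit_exp \<sigma> * fluct_rate \<sigma>"
  by (auto simp: crit_exp_def fluct_rate_def power_mult_distrib power_divide field_simps power2_eq_square)

context profile
begin

lemma measurable_part_0 [measurable]: "part T B \<rho> \<beta> n b \<in> borel_measurable trees"
  by (intro measurable_part) auto

lemma moment_bound:
  assumes q: "1 \<le> q" "q \<le> 2" and T: "1 \<le> T"
    and l1: "1 + ((Re \<beta>)^2 - (Im \<beta>)\<^sup>2) / 2 \<le> l" and l2: "1 + (q * Re \<beta>)^2 / 2 \<le> q * l"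
  shows "(\<integral>\<^sup>+\<omega>. ennreal (norm (part T B \<rho> \<beta> n 0 \<omega>) powr q) \<partial>trees) \<le> ennreal ((1 + 1500 * T) * exp (q * l * T))"
proof -
  define c' where "c' = ((Re \<beta>)^2 - (Im \<beta>)\<^sup>2) / 2"
  define \<kappa> where "\<kappa> = (q * Re \<beta>)^2 / 2"
  \<comment> \<open>The total time is cut into T - s, s - b and b with rates q + q c', 1 + q c' and
    1 + \<kappa>, each at most q l. Nonnegativity of the middle piece is \<open>B s \<le> s\<close>;
    its rate is dominated by the first one because q \<ge> 1.\<close>
  have main: "s + q * (T - s) + \<kappa> * b + q * (c' * (T - b)) \<le> q * l * T" if "0 \<le> b" "b \<le> s" "s \<le> T" for s b
  proof -
    have 1: "q + q * c' \<le> q * l" using l1 q mult_left_mono[OF l1, of q] by (simp add: c'_def algebra_simps)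
    have "s + q * (T - s) + \<kappa> * b + q * (c' * (T - b)) = (T - s) * (q + q * c') + (s - b) * (1 + q * c') + b * (1 + \<kappa>)"
      by (simp add: algebra_simps)
    also have "... \<le> (T - s) * (q * l) + (s - b) * (q * l) + b * (q * l)"
      using that 1 q l2 by (intro add_mono mult_left_mono) (auto simp: \<kappa>_def)
    also have "... = q * l * T" by (simp add: algebra_simps)
    finally show ?thesis .
  qed
  have key: "exp y \<le> 3 * exp (q * l * T) * exp (- (1 + 1 / T) * s)" if "s + y \<le> q * l * T" "0 \<le> s" "s \<le> T" for s y
  proof -
    have "s / T \<le> 1" using that T by simp
    have "exp y \<le> exp (q * l * T + (1 - s / T) - s)" using that \<open>s / T \<le> 1\<close> by simp
    also have "... = exp 1 * exp (q * l * T) * exp (- (1 + 1 / T) * s)" by (simp add: mult_exp_exp algebra_simps)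
    also have "... \<le> 3 * exp (q * l * T) * exp (- (1 + 1 / T) * s)" using exp_le by (intro mult_right_mono) auto
    finally show ?thesis .
  qed
  have "(\<integral>\<^sup>+\<omega>. ennreal (norm (0 + part T B \<rho> \<beta> n 0 \<omega>) powr q) \<partial>trees)
    \<le> ennreal (norm (0 + mean \<beta> n 0) powr q + 500 / (1 / T) * ((3 * exp (q * l * T)) * exp (- (1 + 1 / T) * 0 - (q * Re \<beta>)\<^sup>2 / 2 * B 0)))"
  proof (rule q_moment[where b0 = 0 and M = "3 * exp (q * l * T)"])
    fix s assume s: "0 \<le> s" "s \<le> T"
    show "exp (q * (T - s) + (q * Re \<beta>)^2 / 2 * B s + q * (((Re \<beta>)^2 - (Im \<beta>)\<^sup>2) / 2 * (T - B s))) \<le> 3 * exp (q * l * T) * exp (- (1 + 1 / T) * s)"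
      using main[of "B s" s] s B_nonneg[of s] B_le[of s] by (intro key) (auto simp: \<kappa>_def c'_def)
  next
    show "exp ((q * Re \<beta>)^2 / 2 * T) \<le> 3 * exp (q * l * T) * exp (- (1 + 1 / T) * T)"
      using main[of T T] T by (intro key) (auto simp: \<kappa>_def)
  qed (use q T in auto)
  also have "... \<le> ennreal ((1 + 1500 * T) * exp (q * l * T))"
  proof (rule ennreal_leI)
    have "norm (mean \<beta> n 0) powr q \<le> (exp (c' * T) * exp T) powr q"
      using q T by (intro powr_mono2) (auto simp: norm_mean poiss_le poiss_nonneg zero_le_mult_iff c'_def)
    also have "... = exp (q * T + q * (c' * T))" by (simp add: powr_def mult_exp_exp algebra_simps)
    also have "... \<le> exp (q * l * T)" using main[of 0 0] T by simp
    finally show "norm (0 + mean \<beta> n 0) powr q + 500 / (1 / T) * ((3 * exp (q * l * T)) * exp (- (1 + 1 / T) * 0 - (q * Re \<beta>)\<^sup>2 / 2 * B 0))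
      \<le> (1 + 1500 * T) * exp (q * l * T)" by (simp add: algebra_simps)
  qed
  finally show ?thesis by simp
qed

lemma part_of_real: "part T B \<rho> (complex_of_real \<gamma>) n b \<omega> = complex_of_real (\<Sum>p\<leftarrow>leaves T B \<rho> n b \<omega>. exp (\<gamma> * fst p))"
proof -
  have "wt (complex_of_real \<gamma>) p = complex_of_real (exp (\<gamma> * fst p))" for p
    by (simp add: wt_def flip: of_real_mult exp_of_real)
  then have "(\<Sum>p\<leftarrow>xs. wt (complex_of_real \<gamma>) p) = complex_of_real (\<Sum>p\<leftarrow>xs. exp (\<gamma> * fst p))" for xs
    by (induction xs) auto
  then show ?thesis unfolding part_def .
qed

lemma sum_list_exp_nonneg: "0 \<le> (\<Sum>p\<leftarrow>xs. exp (f p :: real))"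
  by (rule sum_list_nonneg) auto

lemma nn_integral_part_of_real:
  "(\<integral>\<^sup>+\<omega>. ennreal (norm (part T B \<rho> (complex_of_real \<gamma>) n 0 \<omega>)) \<partial>trees) \<le> ennreal (exp (T * (1 + \<gamma>^2 / 2)))"
proof -
  let ?p = "part T B \<rho> (complex_of_real \<gamma>) n 0"
  have eq: "norm (?p \<omega>) = Re (?p \<omega>)" for \<omega>
    by (simp add: part_of_real sum_list_exp_nonneg)
  have "(\<integral>\<^sup>+\<omega>. ennreal (norm (?p \<omega>)) \<partial>trees) = ennreal (\<integral>\<omega>. norm (?p \<omega>) \<partial>trees)"
    by (intro nn_integral_eq_integral integrable_norm integrable_part T_nonneg) auto
  also have "(\<integral>\<omega>. norm (?p \<omega>) \<partial>trees) = Re (mean (complex_of_real \<gamma>) n 0)"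
    unfolding eq using integrable_part[of 0 "complex_of_real \<gamma>" n] T_nonneg by (simp add: integral_Re part_mean)
  also have "... \<le> exp (T * (1 + \<gamma>^2 / 2))"
  proof -
    have "Re (mean (complex_of_real \<gamma>) n 0) \<le> norm (mean (complex_of_real \<gamma>) n 0)" by (rule complex_Re_le_cmod)
    also have "... \<le> exp (\<gamma>^2 / 2 * T) * exp T"
      using T_nonneg by (auto simp: norm_mean intro!: mult_left_mono poiss_le)
    also have "... = exp (T * (1 + \<gamma>^2 / 2))" by (simp add: mult_exp_exp algebra_simps)
    finally show ?thesis .
  qed
  finally show ?thesis by (simp add: ennreal_leI)
qed

text \<open>Powers with exponent at most 1 are subadditive, so no cancellation is lost track of: the
  sum is compared with the positive partition function at the real parameter q Re \<beta>.\<close>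

lemma norm_part_powr_le:
  assumes q: "0 < q" "q \<le> 1"
  shows "norm (part T B \<rho> \<beta> n b \<omega>) powr q \<le> norm (part T B \<rho> (complex_of_real (q * Re \<beta>)) n b \<omega>)"
proof -
  have sub: "(x + y) powr q \<le> x powr q + y powr q" if "0 \<le> x" "0 \<le> y" for x y :: real
  proof (cases "x + y = 0")
    case False
    then have p: "0 < x + y" using that by simp
    have 1: "u \<le> u powr q" if "0 \<le> u" "u \<le> 1" for u :: real
      using powr_mono'[of q 1 u] q that by (cases "u = 0") auto
    have "1 = x / (x + y) + y / (x + y)" using False by (simp add: add_divide_distrib[symmetric])
    also have "... \<le> (x / (x + y)) powr q + (y / (x + y)) powr q"
      using that p by (intro add_mono 1) auto
    also have "... = (x powr q + y powr q) / (x + y) powr q"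
      using that p by (simp add: powr_divide add_divide_distrib)
    finally show ?thesis using p by (simp add: field_simps)
  qed (use that in auto)
  have "norm (\<Sum>p\<leftarrow>xs. wt \<beta> p) powr q \<le> (\<Sum>p\<leftarrow>xs. exp (q * Re \<beta> * fst p))" for xs
  proof (induction xs)
    case (Cons p xs)
    have "norm (\<Sum>p\<leftarrow>p # xs. wt \<beta> p) powr q \<le> (norm (wt \<beta> p) + norm (\<Sum>p\<leftarrow>xs. wt \<beta> p)) powr q"
      using q by (auto intro!: powr_mono2 norm_triangle_ineq)
    also have "... \<le> norm (wt \<beta> p) powr q + norm (\<Sum>p\<leftarrow>xs. wt \<beta> p) powr q" by (intro sub) auto
    also have "norm (wt \<beta> p) powr q = exp (q * Re \<beta> * fst p)" by (simp add: norm_wt powr_def)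
    finally show ?case using Cons.IH by simp
  qed simp
  then show ?thesis
    unfolding part_of_real norm_of_real abs_of_nonneg[OF sum_list_exp_nonneg] unfolding part_def .
qed

text \<open>Markov's inequality at the critical exponent. For (Re \<beta>)^2 < 2 this exponent is at
  least 1 and the moment is compared with the mean; for larger Re \<beta> it is at most 1 and
  subadditivity replaces the comparison with the complex mean.\<close>

theorem upper_tail:
  assumes T: "1 \<le> T" and \<epsilon>: "0 < \<epsilon>"
    and l: "(Re \<beta>)^2 < 2 \<Longrightarrow> 1 + ((Re \<beta>)^2 - (Im \<beta>)\<^sup>2) / 2 \<le> l" "fluct_rate (Re \<beta>) \<le> l"
  shows "measure trees {\<omega>. exp (T * (l + \<epsilon>)) \<le> norm (part T B \<rho> \<beta> n 0 \<omega>)}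
    \<le> (1 + 1500 * T) * exp (- crit_exp (Re \<beta>) * \<epsilon> * T)"
proof -
  interpret P: prob_space "trees" by (rule prob_space_tree)
  define q where "q = crit_exp (Re \<beta>)"
  have q: "0 < q" "q \<le> 2" by (simp_all add: q_def crit_exp_pos crit_exp_le_2)
  have ql: "1 + (q * Re \<beta>)^2 / 2 \<le> q * l"
    unfolding q_def crit_exp_fluct using l(2) crit_exp_pos by (intro mult_left_mono) (auto simp: less_imp_le)
  have "(\<integral>\<^sup>+\<omega>. ennreal (norm (part T B \<rho> \<beta> n 0 \<omega>) powr q) \<partial>trees) \<le> ennreal ((1 + 1500 * T) * exp (q * l * T))"
  proof (cases "(Re \<beta>)^2 < 2")
    case True
    then show ?thesis using q crit_exp_ge_1[of "Re \<beta>"] l T ql by (intro moment_bound) (auto simp: q_def)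
  next
    case False
    then have "sqrt 2 \<le> \<bar>Re \<beta>\<bar>" using sqrt2_less_iff[of "Re \<beta>"] by linarith
    then have q1: "q \<le> 1" using False abs_pos_of_sq[of "Re \<beta>"] by (auto simp: q_def crit_exp_def pos_divide_le_eq simp del: zero_less_abs_iff)
    have "(\<integral>\<^sup>+\<omega>. ennreal (norm (part T B \<rho> \<beta> n 0 \<omega>) powr q) \<partial>trees)
      \<le> (\<integral>\<^sup>+\<omega>. ennreal (norm (part T B \<rho> (complex_of_real (q * Re \<beta>)) n 0 \<omega>)) \<partial>trees)"
      using q q1 by (intro nn_integral_mono ennreal_leI norm_part_powr_le)
    also have "... \<le> ennreal (exp (T * (1 + (q * Re \<beta>)^2 / 2)))" by (rule nn_integral_part_of_real)
    also have "... \<le> ennreal ((1 + 1500 * T) * exp (q * l * T))"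
    proof (rule ennreal_leI)
      have "exp (T * (1 + (q * Re \<beta>)^2 / 2)) \<le> 1 * exp (q * l * T)"
        using ql T mult_left_mono[OF ql, of T] by (simp add: algebra_simps)
      also have "... \<le> (1 + 1500 * T) * exp (q * l * T)" using T by (intro mult_right_mono) auto
      finally show "exp (T * (1 + (q * Re \<beta>)^2 / 2)) \<le> (1 + 1500 * T) * exp (q * l * T)" .
    qed
    finally show ?thesis .
  qed
  then have "measure trees {\<omega> \<in> space trees. exp (T * (l + \<epsilon>)) \<le> norm (part T B \<rho> \<beta> n 0 \<omega>)}
    \<le> (1 + 1500 * T) * exp (q * l * T) / exp (T * (l + \<epsilon>)) powr q"
    using T q by (intro P.markov_powr) auto
  also have "... = (1 + 1500 * T) * exp (- q * \<epsilon> * T)"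
    by (simp add: powr_def exp_minus field_simps exp_add[symmetric])
  finally show ?thesis by (simp add: q_def)
qed

end

section \<open>Anti-concentration\<close>

text \<open>The plane is paired with itself by Re (\<xi> x), without conjugation: multiplying
  \<open>X\<close> by a complex weight w then amounts to replacing \<open>\<xi>\<close> by
  \<open>\<xi> * w\<close>.\<close>

definition cf :: "'a measure \<Rightarrow> ('a \<Rightarrow> complex) \<Rightarrow> complex \<Rightarrow> complex" where
  "cf M X \<xi> = (\<integral>x. iexp (Re (\<xi> * X x)) \<partial>M)"

text \<open>Nonnegative quadratic forms on the plane, possibly of rank one: for real \<beta> all
  weights lie on a line. For the estimates below a lower bound on the trace is enough.\<close>

definition qform :: "(complex \<Rightarrow> real) \<Rightarrow> bool" where
  "qform Q \<longleftrightarrow> (\<forall>\<xi>. 0 \<le> Q \<xi>) \<and>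
     (\<exists>a b c. \<forall>\<xi>. Q \<xi> = a * (Re \<xi>)^2 + 2 * b * (Re \<xi> * Im \<xi>) + c * (Im \<xi>)^2)"

definition qtrace :: "(complex \<Rightarrow> real) \<Rightarrow> real" where
  "qtrace Q = Q 1 + Q \<i>"

lemma qform_nonneg: "qform Q \<Longrightarrow> 0 \<le> Q \<xi>"
  by (simp add: qform_def)

lemma qtrace_nonneg: "qform Q \<Longrightarrow> 0 \<le> qtrace Q"
  by (simp add: qtrace_def qform_nonneg)

lemma qform_zero: "qform (\<lambda>_. 0)"
  unfolding qform_def by (intro conjI exI[of _ 0]) auto

lemma qform_add:
  assumes "qform P" "qform Q" shows "qform (\<lambda>\<xi>. P \<xi> + Q \<xi>)"
proof -
  obtain a b c a' b' c' where "\<forall>\<xi>. P \<xi> = a * (Re \<xi>)^2 + 2 * b * (Re \<xi> * Im \<xi>) + c * (Im \<xi>)^2"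
    "\<forall>\<xi>. Q \<xi> = a' * (Re \<xi>)^2 + 2 * b' * (Re \<xi> * Im \<xi>) + c' * (Im \<xi>)^2"
    using assms unfolding qform_def by metis
  then have "\<forall>\<xi>. P \<xi> + Q \<xi> = (a + a') * (Re \<xi>)^2 + 2 * (b + b') * (Re \<xi> * Im \<xi>) + (c + c') * (Im \<xi>)^2"
    by (simp add: algebra_simps)
  with assms show ?thesis unfolding qform_def by (metis add_nonneg_nonneg)
qed

text \<open>Multiplication by w is a similarity of the plane with ratio norm w, so the trace is
  scaled by the square of that ratio.\<close>

lemma qform_mult:
  assumes "qform Q" shows "qform (\<lambda>\<xi>. Q (\<xi> * w))" "qtrace (\<lambda>\<xi>. Q (\<xi> * w)) = (norm w)^2 * qtrace Q"
proof -
  obtain a b c where Q: "\<And>\<xi>. Q \<xi> = a * (Re \<xi>)^2 + 2 * b * (Re \<xi> * Im \<xi>) + c * (Im \<xi>)^2"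
    using assms unfolding qform_def by metis
  define x y where "x = Re w" and "y = Im w"
  have "Q (\<xi> * w) = (a * x^2 + 2 * b * x * y + c * y^2) * (Re \<xi>)^2
    + 2 * (- a * x * y + b * (x^2 - y\<^sup>2) + c * x * y) * (Re \<xi> * Im \<xi>)
    + (a * y^2 - 2 * b * x * y + c * x^2) * (Im \<xi>)^2" for \<xi>
    unfolding Q by (simp add: x_def y_def power2_eq_square algebra_simps)
  with assms show "qform (\<lambda>\<xi>. Q (\<xi> * w))"
    unfolding qform_def by blast
  show "qtrace (\<lambda>\<xi>. Q (\<xi> * w)) = (norm w)^2 * qtrace Q"
    unfolding qtrace_def Q cmod_power2 by (simp add: power2_eq_square algebra_simps)
qed

lemma qform_sum:
  assumes "\<And>i. i \<in> I \<Longrightarrow> qform (Q i)"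
  shows "qform (\<lambda>\<xi>. \<Sum>i\<in>I. Q i \<xi>)" "qtrace (\<lambda>\<xi>. \<Sum>i\<in>I. Q i \<xi>) = (\<Sum>i\<in>I. qtrace (Q i))"
proof -
  show "qform (\<lambda>\<xi>. \<Sum>i\<in>I. Q i \<xi>)"
    using assms by (induction I rule: infinite_finite_induct) (auto intro: qform_zero qform_add)
qed (simp add: qtrace_def sum.distrib)

section \<open>Small ball probabilities by Gaussian smoothing\<close>

lemma gauss_shifted_exp:
  assumes s: "0 < s"
  shows "(\<integral>\<^sup>+x. ennreal (exp (- ((x + \<mu>)^2 / (2 * s^2)))) \<partial>gauss) \<le> ennreal s"
proof -
  have "(\<integral>\<^sup>+x. ennreal (exp (- ((x + \<mu>)^2 / (2 * s^2)))) \<partial>gauss)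
    = (\<integral>\<^sup>+x. ennreal (std_normal_density x) * ennreal (exp (- ((x + \<mu>)^2 / (2 * s^2)))) \<partial>lborel)"
    by (subst nn_integral_density) auto
  also have "... \<le> (\<integral>\<^sup>+x. ennreal s * ennreal (normal_density (- \<mu>) s x) \<partial>lborel)"
  proof (rule nn_integral_mono)
    fix x
    have "std_normal_density x \<le> 1 / sqrt (2 * pi)"
      unfolding std_normal_density_def by (simp add: field_simps)
    then have "std_normal_density x * exp (- ((x + \<mu>)^2 / (2 * s^2))) \<le> 1 / sqrt (2 * pi) * exp (- ((x + \<mu>)^2 / (2 * s^2)))"
      by (intro mult_right_mono) auto
    also have "... = s * normal_density (- \<mu>) s x"
      using s by (simp add: normal_density_def real_sqrt_mult)
    finally show "ennreal (std_normal_density x) * ennreal (exp (- ((x + \<mu>)^2 / (2 * s^2)))) \<le> ennreal s * ennreal (normal_density (- \<mu>) s x)"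
      using s by (simp add: ennreal_leI flip: ennreal_mult)
  qed
  also have "... = ennreal s * (\<integral>\<^sup>+x. 1 \<partial>density lborel (normal_density (- \<mu>) s))"
    by (subst nn_integral_density) (auto simp: nn_integral_cmult)
  also have "... = ennreal s"
    using prob_space.emeasure_space_1[OF prob_space_normal_density[OF s, of "- \<mu>"]] by simp
  finally show ?thesis .
qed

text \<open>One of the two diagonal entries is at least \<theta> / 2. The integral over that
  coordinate is taken first, for a fixed value of the other one; after completing the square it is a
  one-dimensional Gaussian integral, bounded uniformly in the shift.\<close>

lemma gauss_qform:
  assumes Q: "qform Q" and \<theta>: "0 < \<theta>" "\<theta> \<le> qtrace Q" and r: "0 < r"
  shows "(\<integral>\<^sup>+x. ennreal (exp (- Q (Complex (fst x) (snd x) / complex_of_real r))) \<partial>gauss2) \<le> ennreal (r / sqrt \<theta>)"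
proof -
  interpret N: prob_space gauss by (rule prob_space_gauss)
  interpret NN: pair_prob_space gauss gauss ..
  obtain a b c where Qd: "\<And>\<xi>. Q \<xi> = a * (Re \<xi>)^2 + 2 * b * (Re \<xi> * Im \<xi>) + c * (Im \<xi>)^2"
    using Q unfolding qform_def by metis
  have Q0: "0 \<le> a * u^2 + 2 * b * (u * v) + c * v^2" for u v
    using qform_nonneg[OF Q, of "Complex u v"] by (simp add: Qd)
  have ac: "\<theta> \<le> a + c" using \<theta> by (simp add: qtrace_def Qd)
  have Qr: "Q (Complex u v / complex_of_real r) = (a * u^2 + 2 * b * (u * v) + c * v^2) / r^2" for u v
    using r by (simp add: Qd power_divide add_divide_distrib) (simp add: power2_eq_square)
  \<comment> \<open>Nonnegativity at the minimiser u = - b v / k says that the Schur complement is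
    nonnegative, so it may be dropped.\<close>
  have sq: "\<And>k u v w. 0 < k \<Longrightarrow> (\<And>u v. 0 \<le> k * u^2 + 2 * b * (u * v) + w * v^2) \<Longrightarrow>
      k * (u + b * v / k)^2 \<le> k * u^2 + 2 * b * (u * v) + w * v^2"
  proof -
    fix k u v w :: real assume k: "0 < k" and nn: "\<And>u v. 0 \<le> k * u^2 + 2 * b * (u * v) + w * v^2"
    have "0 \<le> k * (- b * v / k)^2 + 2 * b * ((- b * v / k) * v) + w * v^2" by (rule nn)
    also have "... = w * v^2 - (b * v)\<^sup>2 / k" using k by (simp add: power2_eq_square field_simps)
    finally have "(b * v)^2 / k \<le> w * v^2" by simp
    moreover have "k * (u + b * v / k)^2 = k * u^2 + 2 * b * (u * v) + (b * v)^2 / k"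
      using k by (simp add: power2_eq_square field_simps)
    ultimately show "k * (u + b * v / k)^2 \<le> k * u^2 + 2 * b * (u * v) + w * v^2" by simp
  qed
  have one: "(\<integral>\<^sup>+u. ennreal (exp (- (k * (u + \<mu>)^2 / r^2))) \<partial>gauss) \<le> ennreal (r / sqrt \<theta>)"
    if k: "\<theta> / 2 \<le> k" for k \<mu>
  proof -
    define s where "s = r / sqrt (2 * k)"
    have k0: "0 < k" using k \<theta> by simp
    have s: "0 < s" using k0 r by (simp add: s_def)
    have "2 * s^2 = r^2 / k" using k0 by (simp add: s_def power_divide)
    then have "k * (u + \<mu>)^2 / r^2 = (u + \<mu>)^2 / (2 * s^2)" for u
      by simp
    then have "(\<integral>\<^sup>+u. ennreal (exp (- (k * (u + \<mu>)^2 / r^2))) \<partial>gauss) \<le> ennreal s"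
      using gauss_shifted_exp[OF s, of \<mu>] by simp
    also have "... \<le> ennreal (r / sqrt \<theta>)"
      unfolding s_def using k \<theta> r by (intro ennreal_leI divide_left_mono real_sqrt_le_mono mult_pos_pos) auto
    finally show ?thesis .
  qed
  let ?f = "\<lambda>u v. ennreal (exp (- ((a * u^2 + 2 * b * (u * v) + c * v^2) / r^2)))"
  have "(\<integral>\<^sup>+x. ennreal (exp (- Q (Complex (fst x) (snd x) / complex_of_real r))) \<partial>gauss2) = (\<integral>\<^sup>+x. ?f (fst x) (snd x) \<partial>gauss2)"
    by (simp only: Qr)
  also have "... \<le> ennreal (r / sqrt \<theta>)"
  proof (cases "\<theta> / 2 \<le> a")
    case True
    then have a0: "0 < a" using \<theta> by simp
    have "(\<integral>\<^sup>+x. ?f (fst x) (snd x) \<partial>gauss2) = (\<integral>\<^sup>+v. \<integral>\<^sup>+u. ?f u v \<partial>gauss \<partial>gauss)"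
      by (subst NN.nn_integral_snd[symmetric]) auto
    also have "... \<le> (\<integral>\<^sup>+v. ennreal (r / sqrt \<theta>) \<partial>gauss)"
    proof (rule nn_integral_mono)
      fix v
      have "(\<integral>\<^sup>+u. ?f u v \<partial>gauss) \<le> (\<integral>\<^sup>+u. ennreal (exp (- (a * (u + b * v / a)^2 / r^2))) \<partial>gauss)"
        using sq[OF a0 Q0] by (intro nn_integral_mono ennreal_leI) (auto intro!: divide_right_mono)
      also have "... \<le> ennreal (r / sqrt \<theta>)" by (rule one[OF True])
      finally show "(\<integral>\<^sup>+u. ?f u v \<partial>gauss) \<le> ennreal (r / sqrt \<theta>)" .
    qed
    also have "... = ennreal (r / sqrt \<theta>)" using N.emeasure_space_1 by simp
    finally show ?thesis .
  next
    case False
    then have c: "\<theta> / 2 \<le> c" using ac by simp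
    then have c0: "0 < c" using \<theta> by simp
    have "(\<integral>\<^sup>+x. ?f (fst x) (snd x) \<partial>gauss2) = (\<integral>\<^sup>+u. \<integral>\<^sup>+v. ?f u v \<partial>gauss \<partial>gauss)"
      by (subst N.nn_integral_fst[symmetric]) auto
    also have "... \<le> (\<integral>\<^sup>+v. ennreal (r / sqrt \<theta>) \<partial>gauss)"
    proof (rule nn_integral_mono)
      fix u
      have Q0': "0 \<le> c * v^2 + 2 * b * (v * u) + a * u^2" for u v
        using Q0[of u v] by (simp add: algebra_simps)
      have "(\<integral>\<^sup>+v. ?f u v \<partial>gauss) \<le> (\<integral>\<^sup>+v. ennreal (exp (- (c * (v + b * u / c)^2 / r^2))) \<partial>gauss)"
      proof (intro nn_integral_mono ennreal_leI)
        fix v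
        have "c * (v + b * u / c)^2 \<le> a * u^2 + 2 * b * (u * v) + c * v^2"
          using sq[OF c0 Q0', of v u] by (simp add: algebra_simps)
        then show "exp (- ((a * u^2 + 2 * b * (u * v) + c * v^2) / r^2)) \<le> exp (- (c * (v + b * u / c)^2 / r^2))"
          by (simp add: divide_right_mono)
      qed
      also have "... \<le> ennreal (r / sqrt \<theta>)" by (rule one[OF c])
      finally show "(\<integral>\<^sup>+v. ?f u v \<partial>gauss) \<le> ennreal (r / sqrt \<theta>)" .
    qed
    also have "... = ennreal (r / sqrt \<theta>)" using N.emeasure_space_1 by simp
    finally show ?thesis .
  qed
  finally show ?thesis .
qed

lemma gauss_second_moment: "(\<integral>\<^sup>+x. ennreal (x^2) \<partial>gauss) = 1"
  using std_normal_distribution_even_moments[of 1]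
  by (subst nn_integral_eq_integral) (auto simp: fact_numeral)

lemma measurable_Complex [measurable (raw)]:
  assumes [measurable]: "f \<in> borel_measurable M" "g \<in> borel_measurable M"
  shows "(\<lambda>x. Complex (f x) (g x)) \<in> borel_measurable M"
  unfolding Complex_eq by measurable

text \<open>The decay of \<open>f\<close> is known for norm \<xi> \<le> R. Elsewhere
  \<open>f \<le> 1\<close> is combined with Chebyshev's inequality; the 2 is the second moment of a
  standard Gaussian vector of the plane.\<close>

lemma gauss_anticoncentration:
  assumes [measurable]: "f \<in> borel_measurable borel" and f1: "\<And>\<xi>. f \<xi> \<le> 1"
    and Q: "qform Q" and \<theta>: "0 < \<theta>" "\<theta> \<le> qtrace Q" and r: "0 < r" and R: "0 < R"
    and le: "\<And>\<xi>. norm \<xi> \<le> R \<Longrightarrow> f \<xi> \<le> exp (- Q \<xi>)"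
  shows "(\<integral>\<^sup>+x. ennreal (f (Complex (fst x) (snd x) / complex_of_real r)) \<partial>gauss2) \<le> ennreal (r / sqrt \<theta> + 2 / (R * r)^2)"
proof -
  interpret N: prob_space gauss by (rule prob_space_gauss)
  interpret NN: pair_prob_space gauss gauss ..
  obtain a b c where Qd: "\<And>\<xi>. Q \<xi> = a * (Re \<xi>)^2 + 2 * b * (Re \<xi> * Im \<xi>) + c * (Im \<xi>)^2"
    using Q unfolding qform_def by metis
  have [measurable]: "Q \<in> borel_measurable borel" unfolding Qd[abs_def] by measurable
  let ?z = "\<lambda>x. Complex (fst x) (snd x) / complex_of_real r"
  have "(\<integral>\<^sup>+x. ennreal (f (?z x)) \<partial>gauss2)
    \<le> (\<integral>\<^sup>+x. ennreal (exp (- Q (?z x))) + ennreal (1 / (R * r)^2) * (ennreal ((fst x)^2) + ennreal ((snd x)^2)) \<partial>gauss2)"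
  proof (rule nn_integral_mono)
    fix x
    show "ennreal (f (?z x)) \<le> ennreal (exp (- Q (?z x))) + ennreal (1 / (R * r)^2) * (ennreal ((fst x)^2) + ennreal ((snd x)^2))"
    proof (cases "norm (?z x) \<le> R")
      case True
      then have "ennreal (f (?z x)) \<le> ennreal (exp (- Q (?z x)))" by (intro ennreal_leI le)
      then show ?thesis by (rule order_trans) simp
    next
      case False
      then have "R < norm (Complex (fst x) (snd x)) / r" using r by (simp add: norm_divide)
      then have "R * r < norm (Complex (fst x) (snd x))" using r by (simp add: field_simps)
      then have "(R * r)^2 \<le> (norm (Complex (fst x) (snd x)))^2" using R r by (intro power_mono) auto
      then have "1 \<le> 1 / (R * r)^2 * ((fst x)^2 + (snd x)^2)"
        using R r by (simp add: cmod_power2 field_simps)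
      then have "ennreal 1 \<le> ennreal (1 / (R * r)^2 * ((fst x)^2 + (snd x)^2))" by (rule ennreal_leI)
      also have "... = ennreal (1 / (R * r)^2) * (ennreal ((fst x)^2) + ennreal ((snd x)^2))"
        by (simp only: ennreal_plus[OF zero_le_power2 zero_le_power2, symmetric], rule ennreal_mult) auto
      finally have "ennreal (f (?z x)) \<le> ennreal (1 / (R * r)^2) * (ennreal ((fst x)^2) + ennreal ((snd x)^2))"
        using ennreal_leI[OF f1[of "?z x"]] by (rule order_trans[rotated])
      then show ?thesis by (rule order_trans) simp
    qed
  qed
  also have "... = (\<integral>\<^sup>+x. ennreal (exp (- Q (?z x))) \<partial>gauss2) + ennreal (1 / (R * r)^2) * ((\<integral>\<^sup>+x. ennreal ((fst x)^2) \<partial>gauss2) + (\<integral>\<^sup>+x. ennreal ((snd x)^2) \<partial>gauss2))"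
    by (simp add: nn_integral_add nn_integral_cmult)
  also have "(\<integral>\<^sup>+x. ennreal ((fst x)^2) \<partial>gauss2) = 1"
    using N.emeasure_space_1 by (subst N.nn_integral_fst[symmetric]) (auto simp: gauss_second_moment)
  also have "(\<integral>\<^sup>+x. ennreal ((snd x)^2) \<partial>gauss2) = 1"
    using N.emeasure_space_1 by (subst N.nn_integral_fst[symmetric]) (auto simp: gauss_second_moment)
  also have "(\<integral>\<^sup>+x. ennreal (exp (- Q (?z x))) \<partial>gauss2) + ennreal (1 / (R * r)^2) * (1 + 1) \<le> ennreal (r / sqrt \<theta>) + ennreal (1 / (R * r)^2) * (1 + 1)"
    by (intro add_mono gauss_qform Q \<theta> r) auto
  also have "... = ennreal (r / sqrt \<theta> + 2 / (R * r)^2)"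
  proof -
    have "ennreal (1 / (R * r)^2) * (1 + 1) = ennreal (2 / (R * r)^2)"
      using ennreal_mult''[of 2 "1 / (R * r)^2"] by simp
    then show ?thesis using r \<theta> by (subst ennreal_plus) auto
  qed
  finally show ?thesis .
qed

text \<open>The indicator of the ball is at most twice the function exp (- norm x ^ 2 / (2 r^2)),
  since sqrt e \<le> 2. That function is itself the average of the characters x \<mapsto> iexp (Re
  (\<xi> x)) over a Gaussian \<xi> of scale 1 / r, and Fubini's theorem brings in
  \<open>cf\<close>.\<close>

lemma (in prob_space) small_ball_le:
  fixes X :: "'a \<Rightarrow> complex"
  assumes [measurable]: "X \<in> borel_measurable M" and r: "0 < r"
  shows "ennreal (measure M {x \<in> space M. norm (X x) \<le> r}) \<le>
    2 * (\<integral>\<^sup>+g. ennreal (norm (cf M X (Complex (fst g) (snd g) / complex_of_real r))) \<partial>gauss2)"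
proof -
  interpret G: prob_space gauss2 by (rule prob_space_gauss2)
  interpret P: pair_prob_space M gauss2 ..
  let ?F = "\<lambda>x g. iexp (Re (Complex (fst g) (snd g) / complex_of_real r * X x))"
  have inner: "(\<integral>g. ?F x g \<partial>gauss2) = complex_of_real (exp (- ((norm (X x) / r)^2 / 2)))" for x
  proof -
    let ?z = "\<i> * (Re (X x) / r)" and ?w = "- \<i> * (Im (X x) / r)"
    have "has_bochner_integral gauss2 (\<lambda>g. exp (?z * complex_of_real (fst g)) * exp (?w * complex_of_real (snd g))) (exp (?z\<^sup>2 / 2) * exp (?w\<^sup>2 / 2))"
      by (rule has_bochner_integral_pair_mult[OF prob_space_gauss prob_space_gauss gauss_mgf gauss_mgf])
    moreover have "exp (?z * complex_of_real (fst g)) * exp (?w * complex_of_real (snd g)) = ?F x g" for g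
      unfolding mult_exp_exp by (rule arg_cong[where f = exp]) (use r in \<open>simp add: field_simps\<close>)
    moreover have "exp (?z\<^sup>2 / 2) * exp (?w\<^sup>2 / 2) = complex_of_real (exp (- ((norm (X x) / r)^2 / 2)))"
    proof -
      have "?z\<^sup>2 / 2 + ?w\<^sup>2 / 2 = complex_of_real (- ((norm (X x) / r)^2 / 2))"
        unfolding power_divide cmod_power2 by (simp add: power_mult_distrib power_divide add_divide_distrib)
      then show ?thesis by (simp only: mult_exp_exp exp_of_real)
    qed
    ultimately show ?thesis by (simp only: has_bochner_integral_iff)
  qed
  have int: "integrable (M \<Otimes>\<^sub>M gauss2) (\<lambda>(x, g). ?F x g)"
    by (rule P.integrable_const_bound[of _ 1]) (auto simp: split_beta')
  have "measure M {x \<in> space M. norm (X x) \<le> r} = (\<integral>x. indicator {x \<in> space M. norm (X x) \<le> r} x \<partial>M)"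
    by simp
  also have "... \<le> (\<integral>x. 2 * exp (- ((norm (X x) / r)^2 / 2)) \<partial>M)"
  proof (rule integral_mono)
    show "integrable M (\<lambda>x. 2 * exp (- ((norm (X x) / r)^2 / 2)))"
      by (rule integrable_const_bound[of _ 2]) auto
    show "integrable M (indicator {x \<in> space M. norm (X x) \<le> r} :: 'a \<Rightarrow> real)"
      by (rule integrable_const_bound[of _ 1]) auto
    fix x
    have "1 \<le> 2 * exp (- ((norm (X x) / r)^2 / 2))" if "norm (X x) \<le> r"
    proof -
      have "(norm (X x) / r)^2 \<le> 1\<^sup>2" using that r by (intro power_mono) auto
      then have "- (1 / 2) \<le> - ((norm (X x) / r)^2 / 2)" by simp
      then have "exp (- (1 / 2)) \<le> exp (- ((norm (X x) / r)^2 / 2))" by (simp only: exp_le_cancel_iff)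
      moreover have "1 / 2 \<le> exp (- (1 / 2 :: real))" using exp_ge_add_one_self[of "- (1/2)"] by simp
      ultimately show ?thesis by linarith
    qed
    then show "indicator {x \<in> space M. norm (X x) \<le> r} x \<le> 2 * exp (- ((norm (X x) / r)^2 / 2))"
      by (auto split: split_indicator)
  qed
  also have "... = 2 * Re (\<integral>x. \<integral>g. ?F x g \<partial>gauss2 \<partial>M)"
    by (simp only: inner integral_complex_of_real integral_mult_right_zero Re_complex_of_real)
  also have "(\<integral>x. \<integral>g. ?F x g \<partial>gauss2 \<partial>M) = (\<integral>g. cf M X (Complex (fst g) (snd g) / complex_of_real r) \<partial>gauss2)"
    using P.Fubini_integral[OF int] by (simp only: cf_def)
  also have "2 * Re \<dots> \<le> 2 * norm (\<integral>g. cf M X (Complex (fst g) (snd g) / complex_of_real r) \<partial>gauss2)"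
    using complex_Re_le_cmod by (intro mult_left_mono) auto
  finally have "ennreal (measure M {x \<in> space M. norm (X x) \<le> r}) \<le> ennreal (2 * norm (\<integral>g. cf M X (Complex (fst g) (snd g) / complex_of_real r) \<partial>gauss2))"
    by (rule ennreal_leI)
  also have "... = 2 * ennreal (norm (\<integral>g. cf M X (Complex (fst g) (snd g) / complex_of_real r) \<partial>gauss2))"
    by (simp add: ennreal_mult)
  also have "... \<le> 2 * (\<integral>\<^sup>+g. ennreal (norm (cf M X (Complex (fst g) (snd g) / complex_of_real r))) \<partial>gauss2)"
    by (intro mult_left_mono integral_norm_bound_ennreal P.integrable_snd[OF int, folded cf_def]) auto
  finally show ?thesis .
qed

section \<open>Decay of characteristic functions near the origin\<close>

lemma (in prob_space) norm_cf_le_1: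
  assumes [measurable]: "X \<in> borel_measurable M"
  shows "norm (cf M X \<xi>) \<le> 1"
proof -
  have "norm (cf M X \<xi>) \<le> (\<integral>x. norm (iexp (Re (\<xi> * X x))) \<partial>M)"
    unfolding cf_def by (rule integral_norm_bound)
  then show ?thesis by (simp add: prob_space)
qed

lemma (in prob_space) measurable_cf [measurable]:
  assumes [measurable]: "X \<in> borel_measurable M"
  shows "cf M X \<in> borel_measurable borel"
  unfolding cf_def[abs_def] by measurable

lemma cos_le_quadratic:
  fixes y :: real assumes "\<bar>y\<bar> \<le> 1" shows "cos y \<le> 1 - y\<^sup>2 / 4"
proof -
  have "(\<Sum>k\<le>3. (\<i> * complex_of_real y) ^ k / fact k) = Complex (1 - y\<^sup>2 / 2) (y - y ^ 3 / 6)"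
    by (simp add: numeral_3_eq_3 complex_eq_iff fact_numeral power2_eq_square)
  then have "norm (iexp y - Complex (1 - y\<^sup>2 / 2) (y - y ^ 3 / 6)) \<le> \<bar>y\<bar> ^ 4 / 24"
    using iexp_approx1[of y 3] by (simp add: fact_numeral)
  then have "\<bar>Re (iexp y - Complex (1 - y\<^sup>2 / 2) (y - y ^ 3 / 6))\<bar> \<le> \<bar>y\<bar> ^ 4 / 24"
    using abs_Re_le_cmod order_trans by blast
  then have "\<bar>cos y - (1 - y\<^sup>2 / 2)\<bar> \<le> \<bar>y\<bar> ^ 4 / 24" by (simp add: Re_exp)
  then have 1: "cos y \<le> 1 - y\<^sup>2 / 2 + \<bar>y\<bar> ^ 4 / 24" by linarith
  have "\<bar>y\<bar> ^ 4 = y^2 * y^2" by (simp add: power2_eq_square power4_eq_xxxx abs_mult[symmetric])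
  also have "... \<le> y^2 * 1" using assms by (intro mult_left_mono) (auto simp: abs_square_le_1)
  finally show ?thesis using 1 zero_le_power2[of y] by linarith
qed

text \<open>
  Symmetrisation: the modulus of the characteristic function near the origin is controlled by the
  truncated second moments of the difference of two independent copies.
\<close>

lemma (in prob_space) cf_nondegenerate:
  fixes X :: "'a \<Rightarrow> complex"
  assumes [measurable]: "X \<in> borel_measurable M" and K: "0 < K"
  obtains Q where "qform Q"
    "qtrace Q = (\<integral>z. (if norm (X (fst z) - X (snd z)) \<le> K then (norm (X (fst z) - X (snd z)))\<^sup>2 else 0) \<partial>(M \<Otimes>\<^sub>M M)) / 8"
    "\<And>\<xi>. norm \<xi> \<le> 1 / K \<Longrightarrow> norm (cf M X \<xi>) \<le> exp (- Q \<xi>)"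
proof -
  interpret P: pair_prob_space M M ..
  \<comment> \<open>Pairs at distance above \<open>K\<close> are set to 0, where the quadratic bound
    on the cosine reads cos \<le> 1. This keeps the argument of the cosine within [-1, 1] for norm
    \<xi> \<le> 1 / K.\<close>
  define D where "D z = (if norm (X (fst z) - X (snd z)) \<le> K then X (fst z) - X (snd z) else 0)" for z
  have [measurable]: "D \<in> borel_measurable (M \<Otimes>\<^sub>M M)" unfolding D_def[abs_def] by measurable
  have DK: "norm (D z) \<le> K" for z using K by (simp add: D_def)
  \<comment> \<open>The factor 1 / 8 consists of 1 / 4 from the cosine and 1 / 2 from taking the
    root of the squared modulus. The sign of b comes from Re (\<xi> D) = Re \<xi> Re D - Im \<xi> Im
    D.\<close>
  define a b c where "a = (\<integral>z. (Re (D z))^2 \<partial>(M \<Otimes>\<^sub>M M)) / 8"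
    and "b = - (\<integral>z. Re (D z) * Im (D z) \<partial>(M \<Otimes>\<^sub>M M)) / 8" and "c = (\<integral>z. (Im (D z))^2 \<partial>(M \<Otimes>\<^sub>M M)) / 8"
  have bnd: "\<bar>Re (D z)\<bar> \<le> K" "\<bar>Im (D z)\<bar> \<le> K" for z
    using abs_Re_le_cmod[of "D z"] abs_Im_le_cmod[of "D z"] DK[of z] by auto
  have i: "integrable (M \<Otimes>\<^sub>M M) (\<lambda>z. (Re (D z))^2)" "integrable (M \<Otimes>\<^sub>M M) (\<lambda>z. Re (D z) * Im (D z))"
    "integrable (M \<Otimes>\<^sub>M M) (\<lambda>z. (Im (D z))^2)"
  proof -
    have "norm ((Re (D z))^2) \<le> K * K" "norm (Re (D z) * Im (D z)) \<le> K * K" "norm ((Im (D z))^2) \<le> K * K" for z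
      using mult_mono[OF bnd(1)[of z] bnd(1)[of z]] mult_mono[OF bnd(1)[of z] bnd(2)[of z]] mult_mono[OF bnd(2)[of z] bnd(2)[of z]] K
      by (auto simp: power2_eq_square abs_mult)
    then show "integrable (M \<Otimes>\<^sub>M M) (\<lambda>z. (Re (D z))^2)" "integrable (M \<Otimes>\<^sub>M M) (\<lambda>z. Re (D z) * Im (D z))"
      "integrable (M \<Otimes>\<^sub>M M) (\<lambda>z. (Im (D z))^2)"
      by (intro P.integrable_const_bound[of _ "K * K"] AE_I2; measurable; blast)+
  qed
  define Q where "Q \<xi> = a * (Re \<xi>)^2 + 2 * b * (Re \<xi> * Im \<xi>) + c * (Im \<xi>)^2" for \<xi>
  have eqd: "(Re (\<xi> * D z))^2 = (Re (D z))^2 * (Re \<xi>)^2 - 2 * (Re (D z) * Im (D z)) * (Re \<xi> * Im \<xi>) + (Im (D z))^2 * (Im \<xi>)^2" for \<xi> z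
    by (simp add: power2_eq_square algebra_simps)
  have iQ: "integrable (M \<Otimes>\<^sub>M M) (\<lambda>z. (Re (\<xi> * D z))^2)" for \<xi>
    unfolding eqd using i by (intro Bochner_Integration.integrable_add Bochner_Integration.integrable_diff integrable_mult_left integrable_mult_right)
  have Q: "Q \<xi> = (\<integral>z. (Re (\<xi> * D z))^2 \<partial>(M \<Otimes>\<^sub>M M)) / 8" for \<xi>
    unfolding eqd using i by (simp add: Q_def a_def b_def c_def add_divide_distrib diff_divide_distrib)
  have "qform Q"
    unfolding qform_def
  proof (intro conjI allI)
    show "0 \<le> Q \<xi>" for \<xi> unfolding Q by (intro divide_nonneg_pos integral_nonneg_AE) auto
    show "\<exists>a b c. \<forall>\<xi>. Q \<xi> = a * (Re \<xi>)^2 + 2 * b * (Re \<xi> * Im \<xi>) + c * (Im \<xi>)^2"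
      unfolding Q_def by blast
  qed
  moreover have "qtrace Q = (\<integral>z. (if norm (X (fst z) - X (snd z)) \<le> K then (norm (X (fst z) - X (snd z)))\<^sup>2 else 0) \<partial>(M \<Otimes>\<^sub>M M)) / 8"
  proof -
    have "qtrace Q = (\<integral>z. (Re (D z))^2 + (Im (D z))^2 \<partial>(M \<Otimes>\<^sub>M M)) / 8"
      using i by (simp add: qtrace_def Q_def a_def c_def)
    also have "(\<lambda>z. (Re (D z))^2 + (Im (D z))^2) = (\<lambda>z. if norm (X (fst z) - X (snd z)) \<le> K then (norm (X (fst z) - X (snd z)))\<^sup>2 else 0)"
      by (auto simp: D_def cmod_power2 fun_eq_iff)
    finally show ?thesis .
  qed
  moreover have "norm (cf M X \<xi>) \<le> exp (- Q \<xi>)" if \<xi>: "norm \<xi> \<le> 1 / K" for \<xi>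
  proof -
    have ii: "has_bochner_integral M (\<lambda>x. iexp (Re (\<xi> * X x))) (cf M X \<xi>)"
      unfolding cf_def by (rule has_bochner_integral_integrable, rule integrable_const_bound[of _ 1]) auto
    have "has_bochner_integral M (\<lambda>x. cnj (iexp (Re (\<xi> * X x)))) (cnj (cf M X \<xi>))"
      by (rule has_bochner_integral_bounded_linear[OF bounded_linear_cnj ii])
    from has_bochner_integral_pair_mult[OF prob_space_axioms prob_space_axioms ii this]
    have 1: "has_bochner_integral (M \<Otimes>\<^sub>M M) (\<lambda>z. iexp (Re (\<xi> * X (fst z))) * cnj (iexp (Re (\<xi> * X (snd z))))) (cf M X \<xi> * cnj (cf M X \<xi>))" .
    have "Re (iexp (Re (\<xi> * X (fst z))) * cnj (iexp (Re (\<xi> * X (snd z))))) = cos (Re (\<xi> * (X (fst z) - X (snd z))))" for z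
    proof -
      have "Re (iexp u * cnj (iexp v)) = cos (u - v)" for u v :: real
        by (simp add: Re_exp Im_exp cos_diff)
      then show ?thesis by (simp only: right_diff_distrib minus_complex.sel)
    qed
    with has_bochner_integral_Re[OF 1]
    have 2: "has_bochner_integral (M \<Otimes>\<^sub>M M) (\<lambda>z. cos (Re (\<xi> * (X (fst z) - X (snd z))))) (Re (cf M X \<xi> * cnj (cf M X \<xi>)))"
      by simp
    have "(norm (cf M X \<xi>))^2 = Re (cf M X \<xi> * cnj (cf M X \<xi>))"
      by (simp add: complex_mult_cnj cmod_power2)
    also have "... = (\<integral>z. cos (Re (\<xi> * (X (fst z) - X (snd z)))) \<partial>(M \<Otimes>\<^sub>M M))"
      using 2 by (simp add: has_bochner_integral_iff)
    also have "... \<le> (\<integral>z. 1 - (Re (\<xi> * D z))\<^sup>2 / 4 \<partial>(M \<Otimes>\<^sub>M M))"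
    proof (rule integral_mono)
      fix z
      have "\<bar>Re (\<xi> * D z)\<bar> \<le> norm \<xi> * norm (D z)" by (metis abs_Re_le_cmod norm_mult)
      also have "... \<le> 1 / K * K" using \<xi> K DK by (intro mult_mono) auto
      finally have "\<bar>Re (\<xi> * D z)\<bar> \<le> 1" using K by simp
      then show "cos (Re (\<xi> * (X (fst z) - X (snd z)))) \<le> 1 - (Re (\<xi> * D z))\<^sup>2 / 4"
        using cos_le_quadratic[of "Re (\<xi> * D z)"] by (auto simp: D_def)
    qed (use 2 iQ[of \<xi>] in \<open>auto simp: has_bochner_integral_iff\<close>)
    also have "... = 1 - 2 * Q \<xi>"
      using iQ[of \<xi>] by (simp add: Q P.prob_space)
    also have "... \<le> exp (- (2 * Q \<xi>))" using exp_ge_add_one_self[of "- (2 * Q \<xi>)"] by simp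
    also have "... = (exp (- Q \<xi>))^2" by (simp add: power2_eq_square mult_exp_exp)
    finally show ?thesis by (rule power2_le_imp_le) simp
  qed
  ultimately show ?thesis by (rule that)
qed

text \<open>Two independent copies, one of size at most m / 16 and one of size at least m / 4,
  differ by at least 3 m / 16. \<open>hi\<close> ensures that truncation at K m removes at most half
  of these pairs.\<close>

lemma (in prob_space) cf_nondegenerate_two_scales:
  fixes X :: "'a \<Rightarrow> complex"
  assumes X [measurable]: "X \<in> borel_measurable M" and m: "0 < m" and K: "0 < K" and c: "0 < c1" "0 < c2"
    and lo: "c1 \<le> measure M {x \<in> space M. norm (X x) \<le> m / 16}"
    and mid: "c2 \<le> measure M {x \<in> space M. m / 4 \<le> norm (X x)}"
    and hi: "measure M {x \<in> space M. K * m / 2 \<le> norm (X x)} \<le> c1 * c2 / 4"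
  obtains Q where "qform Q" "c1 * c2 / 1000 * m^2 \<le> qtrace Q"
    "\<And>\<xi>. norm \<xi> \<le> 1 / (K * m) \<Longrightarrow> norm (cf M X \<xi>) \<le> exp (- Q \<xi>)"
proof -
  interpret P: pair_prob_space M M ..
  have Km: "0 < K * m" using K m by simp
  from cf_nondegenerate[OF X Km] obtain Q where Q: "qform Q"
    "qtrace Q = (\<integral>z. (if norm (X (fst z) - X (snd z)) \<le> K * m then (norm (X (fst z) - X (snd z)))\<^sup>2 else 0) \<partial>(M \<Otimes>\<^sub>M M)) / 8"
    "\<And>\<xi>. norm \<xi> \<le> 1 / (K * m) \<Longrightarrow> norm (cf M X \<xi>) \<le> exp (- Q \<xi>)" by blast
  define L where "L = {x \<in> space M. norm (X x) \<le> m / 16}"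
  define U where "U = {x \<in> space M. m / 4 \<le> norm (X x)}"
  define V where "V = {x \<in> space M. K * m / 2 \<le> norm (X x)}"
  have [measurable]: "L \<in> sets M" "U \<in> sets M" "V \<in> sets M" unfolding L_def U_def V_def by measurable
  \<comment> \<open>On \<open>W\<close> the difference of the coordinates lies between 3 m / 16 and
    K m.\<close>
  define W where "W = L \<times> U - (V \<times> space M \<union> space M \<times> V)"
  have times: "measure (M \<Otimes>\<^sub>M M) (A \<times> C) = measure M A * measure M C" if "A \<in> sets M" "C \<in> sets M" for A C
    using that by (simp add: measure_def emeasure_pair_measure_Times enn2real_mult)
  have W [measurable]: "W \<in> sets (M \<Otimes>\<^sub>M M)" unfolding W_def by measurable
  have "c1 * c2 \<le> measure M L * measure M U" using lo mid c unfolding L_def U_def by (intro mult_mono) auto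
  also have "... = measure (M \<Otimes>\<^sub>M M) (L \<times> U)" by (rule times[symmetric]) measurable
  also have "... \<le> measure (M \<Otimes>\<^sub>M M) (W \<union> (V \<times> space M \<union> space M \<times> V))"
    unfolding W_def by (intro P.finite_measure_mono) auto
  also have "... \<le> measure (M \<Otimes>\<^sub>M M) W + (measure (M \<Otimes>\<^sub>M M) (V \<times> space M) + measure (M \<Otimes>\<^sub>M M) (space M \<times> V))"
    by (intro order_trans[OF measure_Un_le] add_left_mono measure_Un_le) measurable
  also have "measure (M \<Otimes>\<^sub>M M) (V \<times> space M) = measure M V * measure M (space M)" by (rule times) measurable
  also have "measure (M \<Otimes>\<^sub>M M) (space M \<times> V) = measure M (space M) * measure M V" by (rule times) measurable
  finally have "c1 * c2 \<le> measure (M \<Otimes>\<^sub>M M) W + 2 * measure M V" by (simp add: prob_space)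
  with hi have W_ge: "c1 * c2 / 2 \<le> measure (M \<Otimes>\<^sub>M M) W" by (simp add: V_def)
  have "(3 * m / 16)^2 * (c1 * c2 / 2) \<le> (3 * m / 16)^2 * measure (M \<Otimes>\<^sub>M M) W"
    by (intro mult_left_mono W_ge) simp
  also have "... = (\<integral>z. (3 * m / 16)^2 * indicator W z \<partial>(M \<Otimes>\<^sub>M M))" by simp
  also have "... \<le> (\<integral>z. (if norm (X (fst z) - X (snd z)) \<le> K * m then (norm (X (fst z) - X (snd z)))\<^sup>2 else 0) \<partial>(M \<Otimes>\<^sub>M M))"
  proof (rule integral_mono)
    show "integrable (M \<Otimes>\<^sub>M M) (\<lambda>z. if norm (X (fst z) - X (snd z)) \<le> K * m then (norm (X (fst z) - X (snd z)))\<^sup>2 else 0)"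
      by (rule P.integrable_const_bound[of _ "(K * m)^2"]) (auto intro!: power_mono)
    fix z
    show "(3 * m / 16)^2 * indicator W z \<le> (if norm (X (fst z) - X (snd z)) \<le> K * m then (norm (X (fst z) - X (snd z)))\<^sup>2 else 0)"
    proof (cases "z \<in> W")
      case True
      then have z: "norm (X (fst z)) \<le> m / 16" "m / 4 \<le> norm (X (snd z))"
        "norm (X (fst z)) < K * m / 2" "norm (X (snd z)) < K * m / 2"
        by (auto simp: W_def L_def U_def V_def)
      have "norm (X (fst z) - X (snd z)) \<le> K * m" using norm_triangle_ineq4[of "X (fst z)" "X (snd z)"] z by simp
      moreover have "3 * m / 16 \<le> norm (X (fst z) - X (snd z))"
        using norm_triangle_ineq2[of "X (snd z)" "X (fst z)"] z by (simp add: norm_minus_commute)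
      then have "(3 * m / 16)^2 \<le> (norm (X (fst z) - X (snd z)))^2" using m by (intro power_mono) auto
      ultimately show ?thesis using True by simp
    qed simp
  next
    show "integrable (M \<Otimes>\<^sub>M M) (\<lambda>z. (3 * m / 16)^2 * indicator W z)"
      by (rule P.integrable_const_bound[of _ "(3 * m / 16)^2"]) (auto split: split_indicator)
  qed
  finally have "(3 * m / 16)^2 * (c1 * c2 / 2) / 8 \<le> qtrace Q"
    unfolding Q(2) by (rule divide_right_mono) simp
  \<comment> \<open>The computed constant is 9 / 4096, rounded down to 1 / 1000.\<close>
  moreover have "c1 * c2 / 1000 * m^2 \<le> (3 * m / 16)^2 * (c1 * c2 / 2) / 8"
  proof -
    have "(3 * m / 16)^2 = 9 / 256 * m^2" by (simp add: power2_eq_square)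
    then have 1: "(3 * m / 16)^2 * (c1 * c2 / 2) / 8 = (c1 * c2 * m^2) * (9 / 4096)"
      by (simp only:) simp
    have 2: "c1 * c2 / 1000 * m^2 = (c1 * c2 * m^2) * (1 / 1000)" by simp
    have "0 \<le> c1 * c2 * m^2" using c by simp
    then show ?thesis unfolding 1 2 by (intro mult_left_mono) auto
  qed
  ultimately have "c1 * c2 / 1000 * m^2 \<le> qtrace Q" by (rule order_trans[rotated])
  then show ?thesis by (rule that[OF Q(1) _ Q(3)])
qed

section \<open>Lower bound at the scale of the mean\<close>

text \<open>Slope at most 1 on a window of fixed length. The additive 1 absorbs the error of
  replacing t A (s / t) by its tangent at 0, which is small on such a window once t is
  large.\<close>

definition flat_on :: "(real \<Rightarrow> real) \<Rightarrow> real \<Rightarrow> bool" where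
  "flat_on B C \<longleftrightarrow> (\<forall>b s. 0 \<le> b \<and> b \<le> s \<and> s \<le> C \<longrightarrow> B s - B b \<le> s - b + 1)"

lemma flat_on_mono: "flat_on B C \<Longrightarrow> C' \<le> C \<Longrightarrow> flat_on B C'"
  by (auto simp: flat_on_def)

lemma measure_expo_Ioc: "0 \<le> k \<Longrightarrow> measure expo {k<..k + 1} = exp (- k) - exp (- (k + 1))"
proof -
  assume k: "0 \<le> k"
  interpret E: prob_space expo by (rule prob_space_expo)
  have 1: "measure expo {r<..} = exp (- r)" if "0 \<le> r" for r
    using emeasure_expo_gt[OF that] by (simp add: measure_def)
  have "{k<..k + 1} = {k<..} - {k + 1<..}" by auto
  then have "measure expo {k<..k + 1} = measure expo {k<..} - measure expo {k + 1<..}"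
    by (simp only:) (rule E.finite_measure_Diff, auto)
  then show ?thesis using k by (simp add: 1)
qed

lemma norm_add_powr_le4:
  fixes x y :: complex
  assumes "0 \<le> q" "q \<le> 2"
  shows "norm (x + y) powr q \<le> 4 * (norm x powr q + norm y powr q)"
  using norm_diff_powr_le[OF assms, of x "- y"] by simp

text \<open>Paley-Zygmund with a q-th moment in place of the second. The mean of norm X is cut at m
  / 4 and at R m; the low part is at most m / 4 and the high part at most m / 8, so at least m / 8
  comes from the middle, where norm X \<le> R m.\<close>

lemma (in prob_space) mid_scale:
  fixes X :: "'a \<Rightarrow> complex"
  assumes X: "integrable M X" and m: "0 < m" and q: "1 < q" and K: "0 \<le> K"
    and mean: "m / 2 \<le> norm (expectation X)"
    and le: "(\<integral>\<^sup>+x. ennreal (norm (X x) powr q) \<partial>M) \<le> ennreal (K * m powr q)"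
  shows "1 / (8 * (8 * (1 + K)) powr (1 / (q - 1))) \<le> measure M {x \<in> space M. m / 4 \<le> norm (X x)}"
proof -
  \<comment> \<open>Chosen such that R ^ (q - 1) = 8 (1 + K), which makes the high part at most m K
    / (8 (1 + K)).\<close>
  define R where "R = (8 * (1 + K)) powr (1 / (q - 1))"
  have R: "0 < R" using K by (simp add: R_def)
  have Rq: "R powr (q - 1) = 8 * (1 + K)" using q K by (simp add: R_def powr_powr)
  have [measurable]: "X \<in> borel_measurable M" using X by auto
  let ?A = "{x \<in> space M. m / 4 \<le> norm (X x)}"
  have iq: "integrable M (\<lambda>x. norm (X x) powr q)" "(\<integral>x. norm (X x) powr q \<partial>M) \<le> K * m powr q"
    by (rule integrable_nn_bound[OF _ _ le]; use K in simp)+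
  have pt: "norm (X x) \<le> m / 4 + R * m * indicator ?A x + norm (X x) powr q / (R * m) powr (q - 1)" if "x \<in> space M" for x
  proof (cases "m / 4 \<le> norm (X x)")
    case False
    then show ?thesis using that by (simp add: add_increasing2)
  next
    case True
    show ?thesis
    proof (cases "norm (X x) \<le> R * m")
      case le: True
      have "0 \<le> m / 4 + norm (X x) powr q / (R * m) powr (q - 1)" using m by (intro add_nonneg_nonneg) auto
      then show ?thesis using le True that by simp
    next
      case False
      then have "(R * m) powr (q - 1) \<le> norm (X x) powr (q - 1)" using R m q by (intro powr_mono2) auto
      moreover have "norm (X x) powr q = norm (X x) * norm (X x) powr (q - 1)"
        using False R m by (subst powr_mult_base) auto
      ultimately have "norm (X x) \<le> norm (X x) powr q / (R * m) powr (q - 1)"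
        using R m by (simp add: field_simps mult_left_mono)
      moreover have "0 \<le> m / 4 + R * m * indicator ?A x" using R m by (intro add_nonneg_nonneg) auto
      ultimately show ?thesis by linarith
    qed
  qed
  have "m / 2 \<le> (\<integral>x. norm (X x) \<partial>M)" using mean integral_norm_bound[of M X] by linarith
  also have "... \<le> (\<integral>x. m / 4 + R * m * indicator ?A x + norm (X x) powr q / (R * m) powr (q - 1) \<partial>M)"
    using X iq pt by (intro integral_mono Bochner_Integration.integrable_add) (auto simp: less_top[symmetric])
  also have "... = m / 4 + R * m * measure M ?A + (\<integral>x. norm (X x) powr q \<partial>M) / (R * m) powr (q - 1)"
    using iq by (subst Bochner_Integration.integral_add, (auto simp: less_top[symmetric] prob_space)[2])+ (auto simp: prob_space)
  also have "(\<integral>x. norm (X x) powr q \<partial>M) / (R * m) powr (q - 1) \<le> K * m powr q / (R * m) powr (q - 1)"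
    using iq by (intro divide_right_mono) auto
  also have "K * m powr q / (R * m) powr (q - 1) = m * (K / (8 * (1 + K)))"
  proof -
    have "m powr q = m * m powr (q - 1)" using m by (subst powr_mult_base) auto
    then show ?thesis using R m K by (simp add: powr_mult Rq)
  qed
  also have "m * (K / (8 * (1 + K))) \<le> m * (1 / 8)"
    using m K by (intro mult_left_mono) (auto simp: field_simps)
  finally have "m * (1 / 8) \<le> m * (R * measure M ?A)" by (simp add: algebra_simps)
  then have "1 / 8 \<le> R * measure M ?A" using m by (simp only: mult_le_cancel_left_pos)
  then show ?thesis unfolding R_def[symmetric] using R by (simp add: field_simps)
qed

context profile
begin

text \<open>Modulus of the mean without cut-off of the generations; the scale in which a subtree
  started at time \<open>b\<close> is measured.\<close>

definition full_mean :: "complex \<Rightarrow> real \<Rightarrow> real" where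
  "full_mean \<beta> b = exp (((Re \<beta>)^2 - (Im \<beta>)\<^sup>2) / 2 * (T - B b) + (T - b))"

lemma full_mean_pos: "0 < full_mean \<beta> b"
  by (simp add: full_mean_def)

lemma full_mean_powr: "full_mean \<beta> b powr q = exp (q * (((Re \<beta>)^2 - (Im \<beta>)\<^sup>2) / 2 * (T - B b) + (T - b)))"
  by (simp add: full_mean_def powr_def)

lemma norm_mean_le: "b \<le> T \<Longrightarrow> norm (mean \<beta> n b) \<le> full_mean \<beta> b"
  by (simp add: norm_mean full_mean_def exp_add poiss_le)

text \<open>\<open>q_moment\<close> started at \<open>b\<close>, expressed in the scale of the mean.
  \<open>\<kappa>\<close> is the rate per unit of variance at which the q-th moment of a weight
  outgrows the q-th power of its mean; \<open>c2\<close> says that branching compensates it with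
  room to spare.\<close>

lemma local_moment:
  assumes q: "1 < q" "q \<le> 2" and c: "0 < c" "c \<le> 1" and \<kappa>: "\<kappa> = (q * Re \<beta>)^2 / 2 - q * (((Re \<beta>)^2 - (Im \<beta>)\<^sup>2) / 2)"
    and c1: "2 * c \<le> q - 1" and c2: "2 * c + \<kappa> \<le> q - 1"
    and C: "C + C / c < T" and flat: "flat_on B (C + C / c)" and b: "0 \<le> b" "b \<le> C"
  shows "(\<integral>\<^sup>+\<omega>. ennreal (norm (part T B \<rho> \<beta> n b \<omega>) powr q) \<partial>trees)
    \<le> ennreal ((1 + 500 / c * exp 1) * full_mean \<beta> b powr q)"
proof -
  define c' where "c' = ((Re \<beta>)^2 - (Im \<beta>)\<^sup>2) / 2"
  define \<kappa>0 where "\<kappa>0 = (q * Re \<beta>)^2 / 2"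
  have \<kappa>: "\<kappa> = \<kappa>0 - q * c'" using \<kappa> by (simp add: c'_def \<kappa>0_def)
  have C0: "0 \<le> C" using b by simp
  have bT: "b \<le> T" using b C c C0 by (smt (verit) divide_nonneg_pos)
  \<comment> \<open>Normalised such that the bound of \<open>q_moment\<close> at time
    \<open>b\<close> becomes e times the q-th power of \<open>full_mean\<close>; the e pays for the
    1 in \<open>far\<close>.\<close>
  define M where "M = exp (1 + q * T + q * c' * T + ((1 + c - q) * b + \<kappa> * B b))"
  \<comment> \<open>From \<open>B s \<le> s\<close> alone the variance between \<open>b\<close> and
    \<open>s\<close> can be as large as s, more than s - b. On the window up to C + C / c flatness
    excludes this. Beyond it, s - b is so long that the slack c (s - b) covers the surplus b \<le>
    C.\<close>
  have far: "\<kappa> * (y - B b) \<le> 1 + (q - 1 - c) * (s - b)" if s: "b \<le> s" "s \<le> T" and y: "B b \<le> y" "y \<le> s"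
    and close: "s \<le> C + C / c \<Longrightarrow> y - B b \<le> s - b + 1" for s y
  proof (cases "\<kappa> \<le> 0")
    case True
    then have "\<kappa> * (y - B b) \<le> 0" using y by (simp add: mult_nonpos_nonneg)
    moreover have "0 \<le> (q - 1 - c) * (s - b)" using c1 c s by (intro mult_nonneg_nonneg) auto
    ultimately show ?thesis by simp
  next
    case False
    then have k: "0 < \<kappa>" "\<kappa> \<le> 1" using c2 c q by auto
    show ?thesis
    proof (cases "s \<le> C + C / c")
      case True
      have "\<kappa> * (y - B b) \<le> \<kappa> * (s - b + 1)" using close[OF True] k by (intro mult_left_mono) auto
      also have "... = \<kappa> * (s - b) + \<kappa>" by (simp add: algebra_simps)
      also have "... \<le> (q - 1 - c) * (s - b) + 1" using k c2 c s by (intro add_mono mult_right_mono) auto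
      finally show ?thesis by simp
    next
      case False
      then have "C / c \<le> s - b" using b by simp
      then have cs: "C \<le> c * (s - b)" using c by (simp add: field_simps)
      have "\<kappa> * (y - B b) \<le> \<kappa> * s" using y k B_nonneg[of b] b by (intro mult_left_mono) auto
      also have "... = \<kappa> * (s - b) + \<kappa> * b" by (simp add: algebra_simps)
      also have "... \<le> (q - 1 - 2 * c) * (s - b) + 1 * C" using k c2 s b by (intro add_mono mult_right_mono mult_mono) auto
      also have "... \<le> (q - 1 - 2 * c) * (s - b) + c * (s - b)" using cs by simp
      also have "... \<le> 1 + (q - 1 - c) * (s - b)" by (simp add: algebra_simps)
      finally show ?thesis .
    qed
  qed
  have key: "exp (q * (T - s) + \<kappa>0 * y + q * (c' * (T - y))) \<le> M * exp (- (1 + c) * s)"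
    if s: "b \<le> s" "s \<le> T" and y: "B b \<le> y" "y \<le> s" and close: "s \<le> C + C / c \<Longrightarrow> y - B b \<le> s - b + 1" for s y
    using far[OF s y close] unfolding M_def mult_exp_exp by (simp add: \<kappa> algebra_simps)
  have "(\<integral>\<^sup>+\<omega>. ennreal (norm (0 + part T B \<rho> \<beta> n b \<omega>) powr q) \<partial>trees)
    \<le> ennreal (norm (0 + mean \<beta> n b) powr q + 500 / c * (M * exp (- (1 + c) * b - (q * Re \<beta>)\<^sup>2 / 2 * B b)))"
  proof (rule q_moment[where b0 = b])
    fix s assume s: "b \<le> s" "s \<le> T"
    show "exp (q * (T - s) + (q * Re \<beta>)^2 / 2 * B s + q * (((Re \<beta>)^2 - (Im \<beta>)\<^sup>2) / 2 * (T - B s))) \<le> M * exp (- (1 + c) * s)"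
      using key[OF s, of "B s"] s b flat monoD[OF mono_B, of b s] B_le[of s] by (simp add: flat_on_def c'_def \<kappa>0_def)
  next
    have "B b \<le> T" using B_le_T[of b] b bT by simp
    then show "exp ((q * Re \<beta>)^2 / 2 * T) \<le> M * exp (- (1 + c) * T)"
      using key[of T T] bT C by (simp add: \<kappa>0_def)
  qed (use q c b bT in \<open>auto simp: M_def\<close>)
  also have "... \<le> ennreal ((1 + 500 / c * exp 1) * full_mean \<beta> b powr q)"
  proof (rule ennreal_leI)
    have "norm (mean \<beta> n b) powr q \<le> full_mean \<beta> b powr q"
      using q by (intro powr_mono2 norm_mean_le bT) auto
    moreover have "M * exp (- (1 + c) * b - (q * Re \<beta>)\<^sup>2 / 2 * B b) = exp 1 * full_mean \<beta> b powr q"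
      unfolding full_mean_powr M_def mult_exp_exp \<kappa> c'_def[symmetric] \<kappa>0_def[symmetric] by (simp add: algebra_simps)
    ultimately show "norm (0 + mean \<beta> n b) powr q + 500 / c * (M * exp (- (1 + c) * b - (q * Re \<beta>)\<^sup>2 / 2 * B b))
      \<le> (1 + 500 / c * exp 1) * full_mean \<beta> b powr q"
      by (simp add: algebra_simps)
  qed
  finally show ?thesis by simp
qed

text \<open>A first lifetime in (k, k + 1] delays all branching, and the q-th moment restricted to
  this event is smaller by exp (- k). The second condition in \<open>k\<close> is what Markov's
  inequality at level 1 / 16 needs in order to lose at most half of the event. The lifetime is
  bounded above so that the children start where \<open>local_moment\<close> applies.\<close>

lemma low_scale:
  assumes q: "1 < q" "q \<le> 2" and c: "0 < c" "c \<le> 1" and \<kappa>: "\<kappa> = (q * Re \<beta>)^2 / 2 - q * (((Re \<beta>)^2 - (Im \<beta>)\<^sup>2) / 2)"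
    and c1: "2 * c \<le> q - 1" and c2: "2 * c + \<kappa> \<le> q - 1"
    and k: "0 \<le> k" "exp k \<ge> 2 * 16 powr q * (8 * (1 + 500 / c * exp 1) * exp 1)"
    and C: "(C + k + 1) + (C + k + 1) / c < T" and flat: "flat_on B ((C + k + 1) + (C + k + 1) / c)" and b: "0 \<le> b" "b \<le> C"
  shows "(exp (- k) - exp (- (k + 1))) / 2 \<le> measure trees {\<omega>. norm (part T B \<rho> \<beta> (Suc n) b \<omega>) \<le> full_mean \<beta> b / 16}"
proof -
  interpret P: prob_space "trees" by (rule prob_space_tree)
  interpret G: prob_space gauss2 by (rule prob_space_gauss2)
  interpret E: prob_space expo by (rule prob_space_expo)
  \<comment> \<open>Latest birth time of the children, given a first lifetime of at most k +
    1.\<close>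
  define C1 where "C1 = C + k + 1"
  have C1: "C1 + C1 / c < T" "flat_on B (C1 + C1 / c)" using C flat by (simp_all add: C1_def)
  have C10: "0 \<le> C1" using b k by (simp add: C1_def)
  have C1T: "C1 < T" "C1 \<le> C1 + C1 / c" using C1 C10 c by (smt (verit) divide_nonneg_pos)+
  have bT: "b \<le> T" using b C1T k by (simp add: C1_def)
  define I where "I = {k<..k + 1}"
  define A where "A = 8 * (1 + 500 / c * exp 1)"
  have A0: "0 < A" using c by (simp add: A_def add_pos_pos)
  let ?M = "full_mean \<beta> b"
  let ?p = "\<lambda>n b. part T B \<rho> \<beta> n b"
  have [measurable]: "(\<lambda>\<omega>. fst (\<omega> [])) \<in> borel_measurable trees"
    by (rule measurable_compose[OF measurable_tree_mark measurable_fst])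
  have bd: "(\<integral>\<^sup>+\<omega>. indicator I (fst (\<omega> [])) * ennreal (norm (?p (Suc n) b \<omega>) powr q) \<partial>trees)
    \<le> ennreal (A * exp 1 * exp (- k) * ?M powr q) * emeasure expo I"
  proof -
    let ?J = "\<lambda>l x. \<integral>\<^sup>+\<omega>0. \<integral>\<^sup>+\<omega>1. indicator I l * ennreal (norm (?p (Suc n) b (node (l, x) \<omega>0 \<omega>1)) powr q) \<partial>trees \<partial>trees"
    have "(\<integral>\<^sup>+\<omega>. indicator I (fst (\<omega> [])) * ennreal (norm (?p (Suc n) b \<omega>) powr q) \<partial>trees)
      = (\<integral>\<^sup>+m. ?J (fst m) (snd m) \<partial>mark)"
      by (subst nn_integral_tree_space[OF prob_space_mark]) (auto simp: I_def)
    also have "... \<le> (\<integral>\<^sup>+m. indicator I (fst m) * (ennreal (norm (wt \<beta> (disp \<rho> (dispvar T B b (fst m)) (snd m))) powr q) * ennreal (A * full_mean \<beta> (b + fst m) powr q)) \<partial>mark)"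
    proof (rule nn_integral_mono)
      fix m :: "real \<times> real \<times> real"
      obtain l x where m: "m = (l, x)" by (metis surj_pair)
      let ?w = "wt \<beta> (disp \<rho> (dispvar T B b l) x)"
      show "?J (fst m) (snd m) \<le> indicator I (fst m) * (ennreal (norm (wt \<beta> (disp \<rho> (dispvar T B b (fst m)) (snd m))) powr q) * ennreal (A * full_mean \<beta> (b + fst m) powr q))"
      proof (cases "l \<in> I")
        case True
        then have bl: "0 \<le> b + l" "b + l \<le> C1" using b k by (auto simp: I_def C1_def)
        have "\<not> T < b + l" using bl C1T by simp
        then have "?J l x \<le> (\<integral>\<^sup>+\<omega>0. \<integral>\<^sup>+\<omega>1. ennreal (norm ?w powr q) * (4 * (ennreal (norm (?p n (b + l) \<omega>0) powr q) + ennreal (norm (?p n (b + l) \<omega>1) powr q))) \<partial>trees \<partial>trees)"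
        proof (intro nn_integral_mono)
          fix \<omega>0 \<omega>1
          let ?x = "?p n (b + l) \<omega>0" and ?y = "?p n (b + l) \<omega>1"
          have "ennreal (norm (?w * (?x + ?y)) powr q) = ennreal (norm ?w powr q) * ennreal (norm (?x + ?y) powr q)"
            by (simp add: norm_mult powr_mult ennreal_mult)
          also have "ennreal (norm (?x + ?y) powr q) \<le> ennreal (4 * (norm ?x powr q + norm ?y powr q))"
            using q by (intro ennreal_leI norm_add_powr_le4) auto
          also have "... = 4 * (ennreal (norm ?x powr q) + ennreal (norm ?y powr q))"
            by (simp add: ennreal_mult)
          finally show "indicator I l * ennreal (norm (?p (Suc n) b (node (l, x) \<omega>0 \<omega>1)) powr q)
            \<le> ennreal (norm ?w powr q) * (4 * (ennreal (norm ?x powr q) + ennreal (norm ?y powr q)))"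
            using True \<open>\<not> T < b + l\<close> by (simp add: part_node mult_left_mono)
        qed
        also have "... = ennreal (norm ?w powr q) * (4 * ((\<integral>\<^sup>+\<omega>. ennreal (norm (?p n (b + l) \<omega>) powr q) \<partial>trees) + (\<integral>\<^sup>+\<omega>. ennreal (norm (?p n (b + l) \<omega>) powr q) \<partial>trees)))"
          using P.emeasure_space_1 by (simp add: nn_integral_cmult nn_integral_add)
        also have "... \<le> ennreal (norm ?w powr q) * (4 * (ennreal ((1 + 500 / c * exp 1) * full_mean \<beta> (b + l) powr q) + ennreal ((1 + 500 / c * exp 1) * full_mean \<beta> (b + l) powr q)))"
          by (intro mult_left_mono add_mono local_moment[OF q c \<kappa> c1 c2 C1 bl]) auto
        also have "4 * (ennreal ((1 + 500 / c * exp 1) * full_mean \<beta> (b + l) powr q) + ennreal ((1 + 500 / c * exp 1) * full_mean \<beta> (b + l) powr q)) = ennreal (A * full_mean \<beta> (b + l) powr q)"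
          using ennreal_mult_double[of 4 "(1 + 500 / c * exp 1) * full_mean \<beta> (b + l) powr q"] c by (simp add: A_def algebra_simps)
        finally show ?thesis using True by (simp add: m)
      qed (simp add: m)
    qed
    also have "... = (\<integral>\<^sup>+l. indicator I l * (ennreal (A * full_mean \<beta> (b + l) powr q) * (\<integral>\<^sup>+x. ennreal (norm (wt \<beta> (disp \<rho> (dispvar T B b l) x)) powr q) \<partial>gauss2)) \<partial>expo)"
    proof (subst nn_integral_mark)
      have [measurable]: "full_mean \<beta> \<in> borel_measurable borel" unfolding full_mean_def[abs_def] by measurable
      show "(\<lambda>m. indicator I (fst m) * (ennreal (norm (wt \<beta> (disp \<rho> (dispvar T B b (fst m)) (snd m))) powr q) * ennreal (A * full_mean \<beta> (b + fst m) powr q))) \<in> borel_measurable mark"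
        unfolding I_def by measurable
      show "(\<integral>\<^sup>+l. \<integral>\<^sup>+x. indicator I (fst (l, x)) * (ennreal (norm (wt \<beta> (disp \<rho> (dispvar T B b (fst (l, x))) (snd (l, x)))) powr q) * ennreal (A * full_mean \<beta> (b + fst (l, x)) powr q)) \<partial>gauss2 \<partial>expo)
        = (\<integral>\<^sup>+l. indicator I l * (ennreal (A * full_mean \<beta> (b + l) powr q) * (\<integral>\<^sup>+x. ennreal (norm (wt \<beta> (disp \<rho> (dispvar T B b l) x)) powr q) \<partial>gauss2)) \<partial>expo)"
        by (intro nn_integral_cong) (simp add: nn_integral_cmult nn_integral_multc mult.commute)
    qed
    also have "... \<le> (\<integral>\<^sup>+l. ennreal (A * exp 1 * exp (- k) * ?M powr q) * indicator I l \<partial>expo)"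
    proof (rule nn_integral_mono)
      fix l
      show "indicator I l * (ennreal (A * full_mean \<beta> (b + l) powr q) * (\<integral>\<^sup>+x. ennreal (norm (wt \<beta> (disp \<rho> (dispvar T B b l) x)) powr q) \<partial>gauss2))
        \<le> ennreal (A * exp 1 * exp (- k) * ?M powr q) * indicator I l"
      proof (cases "l \<in> I")
        case True
        then have bl: "0 \<le> l" "k \<le> l" "b + l \<le> C1" using b k by (auto simp: I_def C1_def)
        define v where "v = B (b + l) - B b"
        have dv: "dispvar T B b l = v" using bl C1T by (simp add: dispvar_def v_def)
        have v: "0 \<le> v" "v \<le> l + 1"
          using monoD[OF mono_B, of b "b + l"] C1(2)[unfolded flat_on_def, rule_format, of b "b + l"] bl C1T b
          by (auto simp: v_def)
        have "norm (wt \<beta> (disp \<rho> v x)) powr q = exp (q * Re \<beta> * fst (disp \<rho> v x))" for x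
          by (simp add: norm_wt powr_def)
        then have "(\<integral>\<^sup>+x. ennreal (norm (wt \<beta> (disp \<rho> (dispvar T B b l) x)) powr q) \<partial>gauss2) = ennreal (exp ((q * Re \<beta>)^2 / 2 * v))"
          unfolding dv using gauss_disp_exp[OF v(1), of "q * Re \<beta>" \<rho>] by simp
        then have "ennreal (A * full_mean \<beta> (b + l) powr q) * (\<integral>\<^sup>+x. ennreal (norm (wt \<beta> (disp \<rho> (dispvar T B b l) x)) powr q) \<partial>gauss2)
          = ennreal (A * full_mean \<beta> (b + l) powr q * exp ((q * Re \<beta>)^2 / 2 * v))"
          using A0 by (simp add: ennreal_mult)
        also have "... \<le> ennreal (A * exp 1 * exp (- k) * ?M powr q)"
        proof (rule ennreal_leI)
          \<comment> \<open>Waiting for a time \<open>l\<close> costs q l in the q-th power of the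
            mean and gains at most (q - 1) (l + 1) by displacement. A net loss of at least l - 1
            remains.\<close>
          have "\<kappa> * v \<le> (q - 1) * (l + 1)"
          proof (cases "\<kappa> \<le> 0")
            case True
            then have "\<kappa> * v \<le> 0" using v by (simp add: mult_nonpos_nonneg)
            also have "0 \<le> (q - 1) * (l + 1)" using q bl by (intro mult_nonneg_nonneg) auto
            finally show ?thesis .
          next
            case False
            then show ?thesis using c2 c v bl by (intro mult_mono) auto
          qed
          moreover have "(q - 1) * 1 \<le> 1" using q by simp
          ultimately have "\<kappa> * v - q * l \<le> 1 - k" using bl by (simp add: algebra_simps)
          then have "exp (\<kappa> * v - q * l) \<le> exp 1 * exp (- k)" by (simp add: mult_exp_exp)
          moreover have "full_mean \<beta> (b + l) powr q * exp ((q * Re \<beta>)^2 / 2 * v) = ?M powr q * exp (\<kappa> * v - q * l)"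
            unfolding full_mean_powr mult_exp_exp \<kappa> by (rule arg_cong[where f = exp]) (simp add: v_def field_simps)
          ultimately have "full_mean \<beta> (b + l) powr q * exp ((q * Re \<beta>)^2 / 2 * v) \<le> ?M powr q * (exp 1 * exp (- k))"
            by (simp add: mult_left_mono)
          then have "A * (full_mean \<beta> (b + l) powr q * exp ((q * Re \<beta>)^2 / 2 * v)) \<le> A * (?M powr q * (exp 1 * exp (- k)))"
            using A0 by (intro mult_left_mono) auto
          then show "A * full_mean \<beta> (b + l) powr q * exp ((q * Re \<beta>)^2 / 2 * v) \<le> A * exp 1 * exp (- k) * ?M powr q"
            by (simp add: mult.assoc mult.commute mult.left_commute)
        qed
        finally show ?thesis using True by simp
      qed simp
    qed
    also have "... = ennreal (A * exp 1 * exp (- k) * ?M powr q) * emeasure expo I"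
      by (subst nn_integral_cmult) (auto simp: I_def)
    finally show ?thesis .
  qed
  define pI where "pI = exp (- k) - exp (- (k + 1))"
  have pI: "0 \<le> pI" "emeasure expo I = ennreal pI"
    using measure_expo_Ioc[OF k(1)] by (simp_all add: pI_def I_def E.emeasure_eq_measure)
  have root: "measure trees {\<omega>. fst (\<omega> []) \<in> I} = pI"
  proof -
    have "emeasure trees {\<omega>. fst (\<omega> []) \<in> I} = (\<integral>\<^sup>+\<omega>. indicator I (fst (\<omega> [])) \<partial>trees)"
    proof -
      have "{\<omega>. fst (\<omega> []) \<in> I} \<in> sets trees"
        using measurable_sets[OF \<open>(\<lambda>\<omega>. fst (\<omega> [])) \<in> _\<close>, of I] by (simp add: vimage_def I_def)
      then have "emeasure trees {\<omega>. fst (\<omega> []) \<in> I} = (\<integral>\<^sup>+\<omega>. indicator {\<omega>. fst (\<omega> []) \<in> I} \<omega> \<partial>trees)"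
        by (rule nn_integral_indicator[symmetric])
      also have "... = (\<integral>\<^sup>+\<omega>. indicator I (fst (\<omega> [])) \<partial>trees)"
        by (intro nn_integral_cong) (auto split: split_indicator)
      finally show ?thesis .
    qed
    also have "... = (\<integral>\<^sup>+m. indicator I (fst m) \<partial>mark)"
      using P.emeasure_space_1 by (subst nn_integral_tree_space[OF prob_space_mark]) (auto simp: I_def)
    also have "... = emeasure expo I"
      using G.emeasure_space_1 by (subst nn_integral_mark) (auto simp: I_def space_pair_measure)
    finally show ?thesis using pI by (simp add: measure_def)
  qed
  define W where "W = {\<omega>. fst (\<omega> []) \<in> I \<and> ?M / 16 < norm (?p (Suc n) b \<omega>)}"
  define L where "L = {\<omega>. norm (?p (Suc n) b \<omega>) \<le> ?M / 16}"
  have rm: "{\<omega>. fst (\<omega> []) \<in> I} \<in> sets trees"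
    using measurable_sets[OF \<open>(\<lambda>\<omega>. fst (\<omega> [])) \<in> _\<close>, of I] by (simp add: vimage_def I_def)
  have Lm: "L \<in> sets trees"
  proof -
    have "{\<omega> \<in> space trees. norm (?p (Suc n) b \<omega>) \<le> ?M / 16} \<in> sets trees" by measurable
    then show ?thesis by (simp add: L_def)
  qed
  have Weq: "W = {\<omega>. fst (\<omega> []) \<in> I} - L" by (auto simp: W_def L_def)
  then have Wm: "W \<in> sets trees" using rm Lm by auto
  have "ennreal ((?M / 16) powr q) * emeasure trees W = (\<integral>\<^sup>+\<omega>. ennreal ((?M / 16) powr q) * indicator W \<omega> \<partial>trees)"
    using Wm by (simp add: nn_integral_cmult)
  also have "... \<le> (\<integral>\<^sup>+\<omega>. indicator I (fst (\<omega> [])) * ennreal (norm (?p (Suc n) b \<omega>) powr q) \<partial>trees)"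
    using q full_mean_pos[of \<beta> b] by (intro nn_integral_mono) (auto simp: W_def split: split_indicator intro!: ennreal_leI powr_mono2)
  also note bd
  also have "ennreal (A * exp 1 * exp (- k) * ?M powr q) * emeasure expo I = ennreal (A * exp 1 * exp (- k) * ?M powr q * pI)"
    using A0 pI by (simp add: ennreal_mult)
  finally have "(?M / 16) powr q * measure trees W \<le> A * exp 1 * exp (- k) * ?M powr q * pI"
    using A0 pI by (simp add: P.emeasure_eq_measure flip: ennreal_mult)
  then have "?M powr q * measure trees W \<le> ?M powr q * (16 powr q * (A * exp 1) * exp (- k) * pI)"
    using full_mean_pos[of \<beta> b] by (simp add: powr_divide field_simps)
  then have "measure trees W \<le> 16 powr q * (A * exp 1) * exp (- k) * pI"
    using full_mean_pos[of \<beta> b] by simp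
  also have "... \<le> 1 / 2 * pI"
  proof (intro mult_right_mono pI)
    have "2 * (16 powr q * (A * exp 1)) \<le> exp k" using k(2) by (simp add: A_def mult.assoc)
    then show "16 powr q * (A * exp 1) * exp (- k) \<le> 1 / 2" by (simp add: exp_minus field_simps)
  qed
  finally have Wle: "measure trees W \<le> pI / 2" by simp
  have "pI \<le> measure trees (W \<union> L)"
    unfolding root[symmetric] using rm Lm by (intro P.finite_measure_mono) (auto simp: Weq)
  also have "... \<le> measure trees W + measure trees L"
    by (rule measure_Un_le[OF Wm Lm])
  finally show ?thesis using Wle by (simp add: L_def pI_def)
qed

end

text \<open>
  At the scale of its mean, the partition function started from an early time is uniformly
  non-degenerate: it is of the order of the mean with positive probability, and a long first
  lifetime makes it much smaller.
\<close>

theorem nondegenerate: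
  assumes s2: "(Re \<beta>)^2 < 2" and ph: "fluct_rate (Re \<beta>) < 1 + ((Re \<beta>)^2 - (Im \<beta>)\<^sup>2) / 2"
  obtains \<theta> K where "0 < \<theta>" "0 < K"
    "\<And>C. 0 \<le> C \<Longrightarrow> \<exists>C'. \<forall>T B \<rho>. profile T B \<rho> \<longrightarrow> C' \<le> T \<longrightarrow> flat_on B C' \<longrightarrow>
      (\<exists>n0. \<forall>n\<ge>n0. \<forall>b. 0 \<le> b \<and> b \<le> C \<longrightarrow> (\<exists>Q. qform Q \<and> \<theta> * (profile.full_mean T B \<beta> b)^2 \<le> qtrace Q \<and>
        (\<forall>\<xi>. norm \<xi> \<le> 1 / (K * profile.full_mean T B \<beta> b) \<longrightarrow>
          norm (cf trees (part T B \<rho> \<beta> n b) \<xi>) \<le> exp (- Q \<xi>))))"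
proof -
  define q where "q = crit_exp (Re \<beta>)"
  have q: "1 < q" "q \<le> 2" using crit_exp_gt_1[OF s2] crit_exp_le_2 by (simp_all add: q_def)
  define \<kappa> where "\<kappa> = (q * Re \<beta>)^2 / 2 - q * (((Re \<beta>)^2 - (Im \<beta>)\<^sup>2) / 2)"
  \<comment> \<open>At the critical exponent the left-hand side equals q times
    \<open>fluct_rate\<close>, so that \<open>ph\<close> becomes precisely \<kappa> < q - 1.\<close>
  have "1 + (q * Re \<beta>)^2 / 2 < q * (1 + ((Re \<beta>)^2 - (Im \<beta>)\<^sup>2) / 2)"
    unfolding q_def crit_exp_fluct using ph crit_exp_pos by (intro mult_strict_left_mono)
  then have \<kappa>q: "\<kappa> < q - 1" by (simp add: \<kappa>_def algebra_simps)
  \<comment> \<open>Half of the available gap; the maximum with 0 keeps 2 c \<le> q - 1 when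
    \<kappa> is negative.\<close>
  define c where "c = (q - 1 - max \<kappa> 0) / 2"
  have "2 * c = q - 1 - max \<kappa> 0" by (simp add: c_def)
  then have c: "0 < c" "c \<le> 1" "2 * c \<le> q - 1" "2 * c + \<kappa> \<le> q - 1" using q \<kappa>q by linarith+
  define A where "A = 1 + 500 / c * exp 1"
  have A: "1 \<le> A" using c by (simp add: A_def)
  define k where "k = ln (2 * 16 powr q * (8 * A * exp 1))"
  have arg: "1 \<le> 2 * 16 powr q * (8 * A * exp 1)"
  proof -
    have "1 \<le> (16 :: real) powr q" using q by (intro ge_one_powr_ge_zero) auto
    moreover have "1 \<le> 8 * A * exp 1"
    proof -
      have "1 * 1 \<le> (8 * A) * exp 1" using A by (intro mult_mono) auto
      then show ?thesis by simp
    qed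
    ultimately have "1 * 1 \<le> 16 powr q * (8 * A * exp 1)" by (intro mult_mono) auto
    then show ?thesis by simp
  qed
  have k: "0 \<le> k" "exp k \<ge> 2 * 16 powr q * (8 * (1 + 500 / c * exp 1) * exp 1)"
    unfolding A_def[symmetric] k_def using arg by auto
  define c1 where "c1 = (exp (- k) - exp (- (k + 1))) / 2"
  define c2 where "c2 = 1 / (8 * (8 * (1 + A)) powr (1 / (q - 1)))"
  have c12: "0 < c1" "0 < c2" using A by (auto simp: c1_def c2_def)
  \<comment> \<open>Large enough for Markov's inequality to give the bound c1 c2 / 4 on values above
    K / 2 times the mean. Since K / 2 \<ge> 1, its exponent q may be lowered to 1.\<close>
  define K where "K = 2 * (4 * A / (c1 * c2) + 1)"
  have K: "0 < K" "1 \<le> K / 2" "A \<le> c1 * c2 / 4 * (K / 2)"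
    using A c12 by (auto simp: K_def field_simps intro!: add_nonneg_pos)
  define \<theta> where "\<theta> = c1 * c2 / 1000"
  have "\<exists>C'. \<forall>T B \<rho>. profile T B \<rho> \<longrightarrow> C' \<le> T \<longrightarrow> flat_on B C' \<longrightarrow>
      (\<exists>n0. \<forall>n\<ge>n0. \<forall>b. 0 \<le> b \<and> b \<le> C \<longrightarrow> (\<exists>Q. qform Q \<and> \<theta> * (profile.full_mean T B \<beta> b)^2 \<le> qtrace Q \<and>
        (\<forall>\<xi>. norm \<xi> \<le> 1 / (K * profile.full_mean T B \<beta> b) \<longrightarrow>
          norm (cf trees (part T B \<rho> \<beta> n b) \<xi>) \<le> exp (- Q \<xi>))))" if C: "0 \<le> C" for C
  proof (rule exI[of _ "(C + k + 1) + (C + k + 1) / c + 1"], intro allI impI)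
    fix T B \<rho> assume prof: "profile T B \<rho>" and T: "(C + k + 1) + (C + k + 1) / c + 1 \<le> T"
      and flat: "flat_on B ((C + k + 1) + (C + k + 1) / c + 1)"
    interpret profile T B \<rho> by fact
    interpret P: prob_space "trees" by (rule prob_space_tree)
    have T': "(C + k + 1) + (C + k + 1) / c < T" "C + C / c < T"
    proof -
      show 1: "(C + k + 1) + (C + k + 1) / c < T" using T by simp
      have "C / c \<le> (C + k + 1) / c" using c k by (intro divide_right_mono) auto
      then show "C + C / c < T" using 1 k by simp
    qed
    have CT: "C < T" using T' C c by (smt (verit) divide_nonneg_pos)
    have flat': "flat_on B ((C + k + 1) + (C + k + 1) / c)" "flat_on B (C + C / c)"
    proof -
      show "flat_on B ((C + k + 1) + (C + k + 1) / c)" by (rule flat_on_mono[OF flat]) simp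
      have "C / c \<le> (C + k + 1) / c" using c k by (intro divide_right_mono) auto
      then show "flat_on B (C + C / c)" using k by (intro flat_on_mono[OF flat]) simp
    qed
    obtain n0 where n0: "\<forall>n\<ge>n0. \<forall>r. 0 \<le> r \<and> r \<le> T \<longrightarrow> exp r / 2 \<le> poiss n r" using poiss_ge_half by blast
    show "\<exists>n0. \<forall>n\<ge>n0. \<forall>b. 0 \<le> b \<and> b \<le> C \<longrightarrow> (\<exists>Q. qform Q \<and> \<theta> * (full_mean \<beta> b)^2 \<le> qtrace Q \<and>
        (\<forall>\<xi>. norm \<xi> \<le> 1 / (K * full_mean \<beta> b) \<longrightarrow>
          norm (cf trees (part T B \<rho> \<beta> n b) \<xi>) \<le> exp (- Q \<xi>)))"
    proof (intro exI[of _ "Suc n0"] allI impI)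
      fix n b assume n: "Suc n0 \<le> n" and b: "0 \<le> b \<and> b \<le> C"
      then obtain n' where n': "n = Suc n'" by (cases n) auto
      have bT: "b \<le> T" using b CT by simp
      let ?M = "full_mean \<beta> b" and ?X = "part T B \<rho> \<beta> n b"
      have M: "0 < ?M" by (rule full_mean_pos)
      have mom: "(\<integral>\<^sup>+\<omega>. ennreal (norm (?X \<omega>) powr q) \<partial>trees) \<le> ennreal (A * ?M powr q)"
        unfolding A_def using b by (intro local_moment[OF q c(1,2) \<kappa>_def c(3,4) T'(2) flat'(2)]) auto
      have lo: "c1 \<le> measure trees {\<omega> \<in> space trees. norm (?X \<omega>) \<le> ?M / 16}"
        unfolding c1_def n' using low_scale[OF q c(1,2) \<kappa>_def c(3,4) k T'(1) flat'(1), of b] b by simp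
      have mid: "c2 \<le> measure trees {\<omega> \<in> space trees. ?M / 4 \<le> norm (?X \<omega>)}"
        unfolding c2_def
      proof (rule P.mid_scale)
        show "integrable trees ?X" using b bT by (intro integrable_part) auto
        have "exp (T - b) / 2 \<le> poiss n (T - b)" using n0 n b bT by simp
        then have "exp (((Re \<beta>)^2 - (Im \<beta>)\<^sup>2) / 2 * (T - B b)) * (exp (T - b) / 2) \<le> exp (((Re \<beta>)^2 - (Im \<beta>)\<^sup>2) / 2 * (T - B b)) * poiss n (T - b)"
          by (intro mult_left_mono) auto
        then show "?M / 2 \<le> norm (P.expectation ?X)"
          using b bT by (simp add: part_mean norm_mean full_mean_def exp_add)
      qed (use M q A mom in auto)
      have hi: "measure trees {\<omega> \<in> space trees. K * ?M / 2 \<le> norm (?X \<omega>)} \<le> c1 * c2 / 4"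
      proof -
        have "measure trees {\<omega> \<in> space trees. K / 2 * ?M \<le> norm (?X \<omega>)} \<le> A * ?M powr q / (K / 2 * ?M) powr q"
          using M K q A by (intro P.markov_powr mom) auto
        also have "... = A / (K / 2) powr q" unfolding powr_mult using M by simp
        also have "... \<le> A / (K / 2) powr 1" using K q A by (intro divide_left_mono powr_mono) auto
        also have "... \<le> c1 * c2 / 4" using K by (simp add: field_simps)
        finally show ?thesis by simp
      qed
      from P.cf_nondegenerate_two_scales[OF measurable_part_0 M K(1) c12 lo mid hi] obtain Q where
        "qform Q" "c1 * c2 / 1000 * ?M\<^sup>2 \<le> qtrace Q"
        "\<And>\<xi>. norm \<xi> \<le> 1 / (K * ?M) \<Longrightarrow> norm (cf trees ?X \<xi>) \<le> exp (- Q \<xi>)" by blast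
      then show "\<exists>Q. qform Q \<and> \<theta> * ?M\<^sup>2 \<le> qtrace Q \<and> (\<forall>\<xi>. norm \<xi> \<le> 1 / (K * ?M) \<longrightarrow> norm (cf trees ?X \<xi>) \<le> exp (- Q \<xi>))"
        unfolding \<theta>_def by blast
    qed
  qed
  moreover have "0 < \<theta>" using c12 by (simp add: \<theta>_def)
  ultimately show ?thesis using K(1) by (intro that[of \<theta> K]) auto
qed

section \<open>Decomposition at generation m\<close>

fun vbirth :: "real \<Rightarrow> (bool list \<Rightarrow> real \<times> real \<times> real) \<Rightarrow> bool list \<Rightarrow> real" where
  "vbirth b \<omega> [] = b"
| "vbirth b \<omega> (i # v) = vbirth (b + fst (\<omega> [])) (\<lambda>u. \<omega> (i # u)) v"

text \<open>Position at the birth of the particle, so its own displacement is left to the subtree.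
  It is meaningful when all proper ancestors die before the horizon.\<close>

fun vpos :: "real \<Rightarrow> (real \<Rightarrow> real) \<Rightarrow> real \<Rightarrow> real \<Rightarrow> (bool list \<Rightarrow> real \<times> real \<times> real) \<Rightarrow> bool list \<Rightarrow> real \<times> real" where
  "vpos T B \<rho> b \<omega> [] = (0, 0)"
| "vpos T B \<rho> b \<omega> (i # v) = disp \<rho> (dispvar T B b (fst (\<omega> []))) (snd (\<omega> [])) + vpos T B \<rho> (b + fst (\<omega> [])) (\<lambda>u. \<omega> (i # u)) v"

text \<open>Bounded lifetimes make all of generation \<open>m\<close> born before the horizon;
  bounded first Gaussians keep the moduli of the weights comparable. The second Gaussian changes
  only the y-coordinate, hence phases.\<close>

definition tame :: "real \<Rightarrow> nat \<Rightarrow> (bool list \<Rightarrow> real \<times> real \<times> real) \<Rightarrow> bool" where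
  "tame J m \<omega> \<longleftrightarrow> (\<forall>w. length w < m \<longrightarrow> 0 \<le> fst (\<omega> w) \<and> fst (\<omega> w) \<le> J \<and> \<bar>fst (snd (\<omega> w))\<bar> \<le> J)"

lemma tame_subtree: "tame J (Suc m) \<omega> \<Longrightarrow> tame J m (\<lambda>u. \<omega> (i # u))"
  by (auto simp: tame_def)

lemma tame_root: "tame J (Suc m) \<omega> \<Longrightarrow> 0 \<le> fst (\<omega> []) \<and> fst (\<omega> []) \<le> J \<and> \<bar>fst (snd (\<omega> []))\<bar> \<le> J"
  by (auto simp: tame_def)

lemma vbirth_bounds:
  assumes "tame J (length v) \<omega>" "0 \<le> b"
  shows "b \<le> vbirth b \<omega> v \<and> vbirth b \<omega> v \<le> b + real (length v) * J"
  using assms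
proof (induction v arbitrary: b \<omega>)
  case (Cons i v)
  then have "tame J (length v) (\<lambda>u. \<omega> (i # u))" using tame_subtree by auto
  from Cons.IH[OF this, of "b + fst (\<omega> [])"] Cons.prems tame_root[of J "length v" \<omega>] show ?case
    by (auto simp: algebra_simps)
qed simp

lemma length_lists_Suc: "{v :: bool list. length v = Suc m} = (#) False ` {v. length v = m} \<union> (#) True ` {v. length v = m}"
proof (intro set_eqI iffI)
  fix v :: "bool list" assume "v \<in> {v. length v = Suc m}"
  then show "v \<in> (#) False ` {v. length v = m} \<union> (#) True ` {v. length v = m}"
    by (cases v; cases "hd v") auto
qed auto

lemma finite_length_lists: "finite {v :: bool list. length v = m}"
  using finite_lists_length_eq[of "UNIV :: bool set" m] by simp

lemma card_length_lists: "card {v :: bool list. length v = m} = 2 ^ m"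
  using card_lists_length_eq[of "UNIV :: bool set" m] by simp

lemma graft_subtree: "(\<lambda>u. graft (Suc m) \<omega> \<eta> (i # u)) = graft m (\<lambda>u. \<omega> (i # u)) (\<lambda>v. \<eta> (i # v))"
  by (auto simp: graft_def fun_eq_iff)

context profile
begin

text \<open>With the first generations fixed the partition function is a linear combination of 2^m
  independent ones. The condition on \<open>b + real m * J\<close> ensures that no particle before
  generation \<open>m\<close> is a leaf.\<close>

lemma part_graft:
  assumes "tame J m \<omega>" "0 \<le> b" "b + real m * J \<le> T"
  shows "part T B \<rho> \<beta> (m + n) b (graft m \<omega> \<eta>) =
    (\<Sum>v\<in>{v. length v = m}. wt \<beta> (vpos T B \<rho> b \<omega> v) * part T B \<rho> \<beta> n (vbirth b \<omega> v) (\<eta> v))"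
  using assms
proof (induction m arbitrary: b \<omega> \<eta>)
  case 0
  have "(0, 0) = (0 :: real \<times> real)" by (simp add: zero_prod_def)
  then show ?case by (simp add: graft_def[abs_def] wt_def)
next
  case (Suc m)
  define l x where "l = fst (\<omega> [])" and "x = snd (\<omega> [])"
  let ?d = "disp \<rho> (dispvar T B b l) x"
  have l: "0 \<le> l" "l \<le> J" using tame_root[OF Suc.prems(1)] by (simp_all add: l_def)
  have root: "graft (Suc m) \<omega> \<eta> [] = \<omega> []" by (simp add: graft_def)
  have "0 \<le> real m * J" using l by simp
  moreover have "b + (J + real m * J) \<le> T" using Suc.prems(3) by (simp add: distrib_right add.commute)
  ultimately have nl: "\<not> T < b + l" using l by linarith
  have IH: "part T B \<rho> \<beta> (m + n) (b + l) (graft m (\<lambda>u. \<omega> (i # u)) (\<lambda>v. \<eta> (i # v))) =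
    (\<Sum>v\<in>{v. length v = m}. wt \<beta> (vpos T B \<rho> (b + l) (\<lambda>u. \<omega> (i # u)) v) * part T B \<rho> \<beta> n (vbirth (b + l) (\<lambda>u. \<omega> (i # u)) v) (\<eta> (i # v)))" for i
    using Suc.prems l by (intro Suc.IH tame_subtree) (auto simp: algebra_simps)
  have "part T B \<rho> \<beta> (Suc m + n) b (graft (Suc m) \<omega> \<eta>) = wt \<beta> ?d *
    (part T B \<rho> \<beta> (m + n) (b + l) (graft m (\<lambda>u. \<omega> (False # u)) (\<lambda>v. \<eta> (False # v))) +
     part T B \<rho> \<beta> (m + n) (b + l) (graft m (\<lambda>u. \<omega> (True # u)) (\<lambda>v. \<eta> (True # v))))"
    using nl by (simp add: part_Suc root Let_def graft_subtree l_def x_def)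
  also have "... = (\<Sum>v\<in>(#) False ` {v. length v = m}. wt \<beta> (vpos T B \<rho> b \<omega> v) * part T B \<rho> \<beta> n (vbirth b \<omega> v) (\<eta> v)) +
    (\<Sum>v\<in>(#) True ` {v. length v = m}. wt \<beta> (vpos T B \<rho> b \<omega> v) * part T B \<rho> \<beta> n (vbirth b \<omega> v) (\<eta> v))"
    unfolding IH by (simp add: distrib_left sum_distrib_left sum.reindex wt_add mult.assoc l_def x_def)
  also have "... = (\<Sum>v\<in>{v. length v = Suc m}. wt \<beta> (vpos T B \<rho> b \<omega> v) * part T B \<rho> \<beta> n (vbirth b \<omega> v) (\<eta> v))"
    unfolding length_lists_Suc using finite_length_lists by (subst sum.union_disjoint) auto
  finally show ?case .
qed

text \<open>Variances up to time \<open>C\<close> are at most \<open>C\<close>, and sqrt C \<le> 1 +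
  C is enough, because a bound polynomial in the number of generations is the aim.\<close>

lemma vpos_bound:
  assumes "tame J (length v) \<omega>" "0 \<le> b" "b + real (length v) * J \<le> C" "C \<le> T" "0 \<le> J"
  shows "\<bar>fst (vpos T B \<rho> b \<omega> v)\<bar> \<le> real (length v) * ((1 + C) * J)"
  using assms
proof (induction v arbitrary: b \<omega>)
  case (Cons i v)
  define l where "l = fst (\<omega> [])"
  have l: "0 \<le> l" "l \<le> J" "\<bar>fst (snd (\<omega> []))\<bar> \<le> J" using tame_root[of J "length v" \<omega>] Cons.prems(1) by (simp_all add: l_def)
  have "0 \<le> real (length v) * J" using Cons.prems by simp
  moreover have "b + (J + real (length v) * J) \<le> C" using Cons.prems(3) by (simp add: distrib_right add.commute)
  ultimately have bl: "b + l \<le> C" using l by linarith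
  have bl': "b + l \<le> T" using bl Cons.prems by simp
  then have v: "dispvar T B b l = B (b + l) - B b" by (simp add: dispvar_def)
  have v0: "0 \<le> dispvar T B b l" using l Cons.prems bl' by (intro dispvar_nonneg) auto
  have C0: "0 \<le> C" using Cons.prems l bl by linarith
  have "B (b + l) \<le> C" using B_le[of "b + l"] bl l Cons.prems by simp
  then have "dispvar T B b l \<le> C" unfolding v using B_nonneg[of b] Cons.prems by simp
  then have "sqrt (dispvar T B b l) \<le> sqrt ((1 + C)^2)"
    using Cons.prems v0 by (intro real_sqrt_le_mono) (simp add: power2_eq_square algebra_simps add_increasing)
  then have s: "sqrt (dispvar T B b l) \<le> 1 + C" using Cons.prems v0 \<open>dispvar T B b l \<le> C\<close> by simp
  have d: "\<bar>fst (disp \<rho> (dispvar T B b l) (snd (\<omega> [])))\<bar> \<le> (1 + C) * J"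
    unfolding disp_def using s l v0 C0 by (auto simp: abs_mult intro!: mult_mono)
  have "\<bar>fst (vpos T B \<rho> (b + l) (\<lambda>u. \<omega> (i # u)) v)\<bar> \<le> real (length v) * ((1 + C) * J)"
    using Cons.prems l by (intro Cons.IH tame_subtree) (auto simp: algebra_simps)
  with d show ?case
    unfolding vpos.simps l_def fst_add length_Cons of_nat_Suc distrib_right using abs_triangle_ineq by (smt (verit) mult_1)
qed simp

end

text \<open>Chernoff's bound with the exponents 1 and -1; 2 sqrt e \<le> 4.\<close>

lemma gauss_tail: "measure gauss {x. J < \<bar>x\<bar>} \<le> 4 * exp (- J)"
proof -
  interpret N: prob_space gauss by (rule prob_space_gauss)
  have b: "(\<integral>\<^sup>+x. ennreal (exp (s * x)) \<partial>gauss) = ennreal (exp (s^2 / 2))" for s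
  proof -
    have "has_bochner_integral gauss (\<lambda>x. exp (complex_of_real s * x)) (exp ((complex_of_real s)^2 / 2))" by (rule gauss_mgf)
    moreover have "exp (complex_of_real s * complex_of_real x) = complex_of_real (exp (s * x))" for x by (simp flip: exp_of_real of_real_mult)
    moreover have "exp ((complex_of_real s)^2 / 2) = complex_of_real (exp (s^2 / 2))" by (simp flip: exp_of_real)
    ultimately have "has_bochner_integral gauss (\<lambda>x. complex_of_real (exp (s * x))) (complex_of_real (exp (s^2 / 2)))" by simp
    from has_bochner_integral_Re[OF this] have "has_bochner_integral gauss (\<lambda>x. exp (s * x)) (exp (s^2 / 2))" by simp
    then show ?thesis by (subst nn_integral_eq_integral) (auto simp: has_bochner_integral_iff)
  qed
  have "emeasure gauss {x. J < \<bar>x\<bar>} = (\<integral>\<^sup>+x. indicator {x. J < \<bar>x\<bar>} x \<partial>gauss)"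
    by (rule nn_integral_indicator[symmetric]) simp
  also have "... \<le> (\<integral>\<^sup>+x. ennreal (exp (- J)) * (ennreal (exp (1 * x)) + ennreal (exp ((- 1) * x))) \<partial>gauss)"
  proof (rule nn_integral_mono)
    fix x :: real
    have "1 \<le> exp (- J) * (exp x + exp (- x))" if "J < \<bar>x\<bar>"
    proof -
      have "1 \<le> exp (- J) * exp \<bar>x\<bar>" using that by (simp add: mult_exp_exp)
      also have "... \<le> exp (- J) * (exp x + exp (- x))" by (intro mult_left_mono) (auto simp: abs_if)
      finally show ?thesis .
    qed
    then have "ennreal 1 \<le> ennreal (exp (- J) * (exp x + exp (- x)))" if "J < \<bar>x\<bar>" using that by (intro ennreal_leI)
    moreover have "ennreal (exp (- J) * (exp x + exp (- x))) = ennreal (exp (- J)) * (ennreal (exp (1 * x)) + ennreal (exp ((- 1) * x)))"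
      by (simp add: ennreal_mult)
    ultimately show "indicator {x. J < \<bar>x\<bar>} x \<le> ennreal (exp (- J)) * (ennreal (exp (1 * x)) + ennreal (exp ((- 1) * x)))"
      by (auto split: split_indicator)
  qed
  also have "... = ennreal (exp (- J)) * ((\<integral>\<^sup>+x. ennreal (exp (1 * x)) \<partial>gauss) + (\<integral>\<^sup>+x. ennreal (exp ((- 1) * x)) \<partial>gauss))"
    by (simp add: nn_integral_cmult nn_integral_add)
  also have "... = ennreal (exp (- J)) * (ennreal (exp (1\<^sup>2 / 2)) + ennreal (exp ((- 1)^2 / 2)))"
    by (simp only: b)
  also have "... = ennreal (exp (- J) * (2 * exp (1 / 2)))"
    using ennreal_mult_double[of "exp (- J)" "exp (1 / 2)"] by simp
  also have "... \<le> ennreal (4 * exp (- J))"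
  proof (rule ennreal_leI)
    have "exp (1 / 2 :: real) \<le> 2"
    proof -
      have "(exp (1 / 2 :: real))^2 = exp 1" by (simp add: power2_eq_square mult_exp_exp)
      also have "... \<le> 2\<^sup>2" using exp_le by simp
      finally show ?thesis by (rule power2_le_imp_le) simp
    qed
    then show "exp (- J) * (2 * exp (1 / 2)) \<le> 4 * exp (- J)" by simp
  qed
  finally show ?thesis by (simp add: N.emeasure_eq_measure)
qed

lemma measure_component:
  assumes A: "A \<in> sets mark"
  shows "measure trees {\<omega>. \<omega> w \<in> A} = measure mark A"
proof -
  interpret M: prob_space mark by (rule prob_space_mark)
  interpret product_prob_space "\<lambda>_. mark" "UNIV :: bool list set" by unfold_locales
  show ?thesis
    using emeasure_PiM_Collect_single[of w A] A by (simp add: tree_space_def[symmetric] measure_def)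
qed

text \<open>Union bound over fewer than 2^m nodes; 5 is 1 for the lifetime and 4 for the Gaussian.
  The rate 1 of the tails exceeds ln 2, so J growing like m beats the number of nodes.\<close>

lemma sets_tame: "{\<omega>. tame J m \<omega>} \<in> sets trees"
  and measure_not_tame: "0 \<le> J \<Longrightarrow> measure trees {\<omega>. \<not> tame J m \<omega>} \<le> 2 ^ m * (5 * exp (- J))"
proof -
  interpret M: prob_space mark by (rule prob_space_mark)
  interpret P: prob_space "trees" by (rule prob_space_tree)
  interpret G: prob_space gauss2 by (rule prob_space_gauss2)
  interpret E: prob_space expo by (rule prob_space_expo)
  interpret N: prob_space gauss by (rule prob_space_gauss)
  define A where "A = {x :: real \<times> real \<times> real. \<not> (0 \<le> fst x \<and> fst x \<le> J \<and> \<bar>fst (snd x)\<bar> \<le> J)}"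
  have [measurable]: "(\<lambda>x. fst (snd x)) \<in> borel_measurable mark" by measurable
  have A: "A \<in> sets mark"
  proof -
    have "{x \<in> space mark. \<not> (0 \<le> fst x \<and> fst x \<le> J \<and> \<bar>fst (snd x)\<bar> \<le> J)} \<in> sets mark" by measurable
    then show ?thesis by (simp add: A_def)
  qed
  define I where "I = {w :: bool list. length w < m}"
  have Ieq: "I = (\<Union>k<m. {w. length w = k})" by (auto simp: I_def)
  have finI: "finite I" unfolding Ieq using finite_length_lists by simp
  have cardI: "card I \<le> 2 ^ m"
  proof -
    have "card I \<le> (\<Sum>k<m. card {w :: bool list. length w = k})"
      unfolding Ieq by (rule card_UN_le) simp
    also have "... = (\<Sum>k<m. 2 ^ k)" by (simp add: card_length_lists)
    also have "... \<le> 2 ^ m" by (induction m) auto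
    finally show ?thesis .
  qed
  have nt: "{\<omega>. \<not> tame J m \<omega>} = (\<Union>w\<in>I. {\<omega>. \<omega> w \<in> A})" by (auto simp: tame_def A_def I_def)
  have comp: "{\<omega>. \<omega> w \<in> A} \<in> sets trees" for w
  proof -
    have "(\<lambda>\<omega>. \<omega> w) \<in> trees \<rightarrow>\<^sub>M mark" by (simp add: tree_space_def)
    from measurable_sets[OF this A] show ?thesis by (simp add: vimage_def)
  qed
  have "{\<omega>. \<not> tame J m \<omega>} \<in> sets trees" unfolding nt using finI comp by auto
  then have "space trees - {\<omega>. \<not> tame J m \<omega>} \<in> sets trees" by (rule sets.compl_sets)
  moreover have "space trees - {\<omega>. \<not> tame J m \<omega>} = {\<omega>. tame J m \<omega>}" by auto
  ultimately show "{\<omega>. tame J m \<omega>} \<in> sets trees" by simp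
  assume J: "0 \<le> J"
  have "measure mark A \<le> 5 * exp (- J)"
  proof -
    have "emeasure mark A = (\<integral>\<^sup>+x. indicator A x \<partial>mark)" using A by simp
    also have "... = (\<integral>\<^sup>+l. \<integral>\<^sup>+x. indicator A (l, x) \<partial>gauss2 \<partial>expo)" using A by (intro nn_integral_mark) auto
    also have "... \<le> (\<integral>\<^sup>+l. \<integral>\<^sup>+x. indicator {J<..} l + indicator {x. J < \<bar>x\<bar>} (fst x) \<partial>gauss2 \<partial>expo)"
      by (rule nn_integral_mono_AE, use AE_expo in eventually_elim, rule nn_integral_mono)
         (auto simp: A_def split: split_indicator)
    also have "... = emeasure expo {J<..} + emeasure gauss {x. J < \<bar>x\<bar>}"
    proof -
      have "(\<integral>\<^sup>+x. indicator {x. J < \<bar>x\<bar>} (fst x) \<partial>gauss2) = emeasure gauss {x. J < \<bar>x\<bar>}"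
        using N.emeasure_space_1 by (subst N.nn_integral_fst[symmetric]) auto
      then have "(\<integral>\<^sup>+x. indicator {J<..} l + indicator {x. J < \<bar>x\<bar>} (fst x) \<partial>gauss2) = indicator {J<..} l + emeasure gauss {x. J < \<bar>x\<bar>}" for l
        using G.emeasure_space_1 by (subst nn_integral_add) auto
      then show ?thesis using E.emeasure_space_1 by (simp add: nn_integral_add)
    qed
    also have "... \<le> ennreal (exp (- J)) + ennreal (4 * exp (- J))"
      using emeasure_expo_gt[OF J] gauss_tail[of J] by (intro add_mono) (auto simp: N.emeasure_eq_measure ennreal_leI)
    also have "... = ennreal (5 * exp (- J))" by (subst ennreal_plus[symmetric]) auto
    finally show ?thesis by (simp add: M.emeasure_eq_measure)
  qed
  have "measure trees {\<omega>. \<not> tame J m \<omega>} \<le> (\<Sum>w\<in>I. measure trees {\<omega>. \<omega> w \<in> A})"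
    unfolding nt using finI comp by (intro P.finite_measure_subadditive_finite) auto
  also have "... = real (card I) * measure mark A" by (simp add: measure_component[OF A])
  also have "... \<le> 2 ^ m * (5 * exp (- J))"
  proof -
    have "real (card I) \<le> 2 ^ m" using cardI by (metis of_nat_le_iff of_nat_numeral of_nat_power)
    then show ?thesis using \<open>measure mark A \<le> _\<close> by (intro mult_mono) auto
  qed
  finally show "measure trees {\<omega>. \<not> tame J m \<omega>} \<le> 2 ^ m * (5 * exp (- J))" .
qed


text \<open>The interval from - \<Lambda> to \<Lambda> meets at most 2 \<Lambda> + 2 unit
  cells.\<close>

lemma pigeonhole_real:
  assumes A: "finite A" and f: "\<And>x. x \<in> A \<Longrightarrow> \<bar>f x\<bar> \<le> \<Lambda>" and \<Lambda>: "0 \<le> \<Lambda>" and le: "N * (2 * \<Lambda> + 2) \<le> real (card A)"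
  obtains j :: int where "N \<le> real (card {x\<in>A. \<lfloor>f x :: real\<rfloor> = j})"
proof (rule ccontr)
  assume "\<not> thesis"
  have lt: "real (card {x\<in>A. \<lfloor>f x\<rfloor> = j}) < N" for j
  proof (rule ccontr)
    assume "\<not> real (card {x\<in>A. \<lfloor>f x\<rfloor> = j}) < N"
    then have "N \<le> real (card {x\<in>A. \<lfloor>f x\<rfloor> = j})" by simp
    from that[OF this] \<open>\<not> thesis\<close> show False by contradiction
  qed
  define I where "I = {\<lfloor>- \<Lambda>\<rfloor>..\<lfloor>\<Lambda>\<rfloor>}"
  have I: "finite I" "I \<noteq> {}" using \<Lambda> by (auto simp: I_def floor_mono)
  have fI: "\<lfloor>f x\<rfloor> \<in> I" if "x \<in> A" for x
    using f[OF that] by (auto simp: I_def abs_le_iff intro!: floor_mono)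
  have "card A = card (\<Union>j\<in>I. {x\<in>A. \<lfloor>f x\<rfloor> = j})"
    using fI by (intro arg_cong[where f = card]) auto
  also have "... \<le> (\<Sum>j\<in>I. card {x\<in>A. \<lfloor>f x\<rfloor> = j})" by (rule card_UN_le[OF I(1)])
  finally have "real (card A) \<le> (\<Sum>j\<in>I. real (card {x\<in>A. \<lfloor>f x\<rfloor> = j}))"
    by (metis of_nat_le_iff of_nat_sum)
  also have "... < (\<Sum>j\<in>I. N)" using I lt by (intro sum_strict_mono) auto
  also have "... = real (card I) * N" by simp
  also have "... \<le> (2 * \<Lambda> + 2) * N"
  proof (rule mult_right_mono)
    have "real (card I) = real_of_int \<lfloor>\<Lambda>\<rfloor> - real_of_int \<lfloor>- \<Lambda>\<rfloor> + 1"
      using \<Lambda> by (simp add: I_def floor_mono of_nat_nat)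
    then show "real (card I) \<le> 2 * \<Lambda> + 2" by linarith
    show "0 \<le> N" using lt[of 0] by linarith
  qed
  finally show False using le by (simp add: mult.commute)
qed

text \<open>\<open>nondegenerate\<close> supplies quadratic decay for one subtree; averaging over
  2^m frozen subtrees raises the probability to 1 - \<eta>. Logarithms of their relative
  contributions are bounded by \<Lambda>, polynomial in m, so R^4 of them agree up to a factor e by
  the pigeonhole principle. Their characteristic functions alone then spread the sum over a scale of
  order R^2 \<kappa>.\<close>

theorem lower_mean:
  assumes s2: "(Re \<beta>)^2 < 2" and ph: "fluct_rate (Re \<beta>) < 1 + ((Re \<beta>)^2 - (Im \<beta>)\<^sup>2) / 2" and \<eta>: "0 < \<eta>"
  shows "\<exists>\<delta>>0. \<exists>C'. \<forall>T B \<rho>. profile T B \<rho> \<longrightarrow> C' \<le> T \<longrightarrow> flat_on B C' \<longrightarrow>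
    (\<exists>n0. \<forall>n\<ge>n0. measure trees {\<omega>. norm (part T B \<rho> \<beta> n 0 \<omega>) \<le> \<delta> * profile.full_mean T B \<beta> 0} \<le> \<eta>)"
proof -
  from nondegenerate[OF s2 ph] obtain \<theta> K where \<theta>: "0 < \<theta>" and K: "0 < K" and
    nd: "\<And>C. 0 \<le> C \<Longrightarrow> \<exists>C'. \<forall>T B \<rho>. profile T B \<rho> \<longrightarrow> C' \<le> T \<longrightarrow> flat_on B C' \<longrightarrow>
      (\<exists>n0. \<forall>n\<ge>n0. \<forall>b. 0 \<le> b \<and> b \<le> C \<longrightarrow> (\<exists>Q. qform Q \<and> \<theta> * (profile.full_mean T B \<beta> b)^2 \<le> qtrace Q \<and>
        (\<forall>\<xi>. norm \<xi> \<le> 1 / (K * profile.full_mean T B \<beta> b) \<longrightarrow>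
          norm (cf trees (part T B \<rho> \<beta> n b) \<xi>) \<le> exp (- Q \<xi>))))" by blast
  define c' where "c' = ((Re \<beta>)^2 - (Im \<beta>)\<^sup>2) / 2"
  \<comment> \<open>The two terms of \<open>gauss_anticoncentration\<close> are each a constant over
    a power of R; L collects the constants, and R \<ge> 4 L / \<eta> makes their sum small.\<close>
  define L where "L = 1 / sqrt \<theta> + 2 * (K * exp 1)^2"
  have L: "0 < L" using \<theta> by (simp add: L_def add_pos_nonneg)
  define R where "R = max 1 (4 * L / \<eta>)"
  have R: "1 \<le> R" "2 * (L / R) \<le> \<eta> / 2"
  proof -
    show "1 \<le> R" by (simp add: R_def)
    have "4 * L / \<eta> \<le> R" by (simp add: R_def)
    then have "4 * L \<le> R * \<eta>" using \<eta> by (simp add: pos_divide_le_eq)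
    then show "2 * (L / R) \<le> \<eta> / 2" using \<open>1 \<le> R\<close> by (simp add: field_simps)
  qed
  define J0 where "J0 = max 0 (ln (10 / \<eta>))"
  have J0: "0 \<le> J0" "exp (- J0) \<le> \<eta> / 10"
  proof -
    have "ln (10 / \<eta>) \<le> J0" by (simp add: J0_def)
    then have "exp (- J0) \<le> exp (- ln (10 / \<eta>))" by simp
    then show "exp (- J0) \<le> \<eta> / 10" using \<eta> by (simp add: exp_minus)
  qed (simp add: J0_def)
  \<comment> \<open>2 \<Lambda> + 2 grows at most like the fourth power of m + 1, and D is its
    coefficient. Hence some m has 2^m above R^4 (2 \<Lambda> + 2).\<close>
  define D where "D = 2 * (\<bar>Re \<beta>\<bar> * (2 * (1 + J0)^2) + (1 + \<bar>c'\<bar>) * (1 + J0)) + 2"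
  have D: "0 < D" using J0 by (simp add: D_def add_nonneg_pos)
  have "filterlim (\<lambda>m. 2 ^ m / (D * (real m + 1) ^ 4)) at_top at_top"
    using D by real_asymp
  then have "\<forall>\<^sub>F m in at_top. R ^ 4 \<le> 2 ^ m / (D * (real m + 1) ^ 4)" by (auto simp: filterlim_at_top)
  then obtain m where m: "R ^ 4 \<le> 2 ^ m / (D * (real m + 1) ^ 4)" by (auto simp: eventually_sequentially)
  \<comment> \<open>exp (- J) = exp (- m) exp (- J0): the first factor outweighs 2^m nodes, the
    second makes the exceptional probability small.\<close>
  define J where "J = real m + J0"
  define C where "C = real m * J"
  define \<Lambda> where "\<Lambda> = \<bar>Re \<beta>\<bar> * (real m * ((1 + C) * J)) + (1 + \<bar>c'\<bar>) * C"
  have J: "0 \<le> J" and C: "0 \<le> C" using J0 by (auto simp: J_def C_def)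
  have \<Lambda>: "0 \<le> \<Lambda>" using J C by (simp add: \<Lambda>_def)
  have H: "R ^ 4 * (2 * \<Lambda> + 2) \<le> 2 ^ m"
  proof -
    let ?x = "real m + 1"
    have Jx: "J \<le> (1 + J0) * ?x" using J0 by (simp add: J_def algebra_simps)
    have "C \<le> ?x * ((1 + J0) * ?x)" unfolding C_def using Jx J by (intro mult_mono) auto
    then have Cx: "C \<le> (1 + J0) * ?x ^ 2" by (simp add: power2_eq_square algebra_simps)
    have x1: "1 \<le> ?x" by simp
    have "1 * 1 \<le> (1 + J0) * ?x ^ 2" using J0 x1 by (intro mult_mono one_le_power) auto
    then have "1 + C \<le> 2 * ((1 + J0) * ?x ^ 2)" using Cx by simp
    then have "(1 + C) * J \<le> (2 * ((1 + J0) * ?x ^ 2)) * ((1 + J0) * ?x)" using Jx J C J0 by (rule_tac mult_mono) auto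
    then have "real m * ((1 + C) * J) \<le> ?x * ((2 * ((1 + J0) * ?x ^ 2)) * ((1 + J0) * ?x))" using J C by (rule_tac mult_mono) auto
    also have "... = 2 * (1 + J0)^2 * ?x ^ 4" by (simp add: power2_eq_square power4_eq_xxxx)
    finally have 1: "\<bar>Re \<beta>\<bar> * (real m * ((1 + C) * J)) \<le> \<bar>Re \<beta>\<bar> * (2 * (1 + J0)^2 * ?x ^ 4)" by (intro mult_left_mono) auto
    have "?x ^ 2 \<le> ?x ^ 4" using x1 by (intro power_increasing) auto
    then have "C \<le> (1 + J0) * ?x ^ 4" using Cx J0 by (smt (verit) mult_left_mono)
    then have 2: "(1 + \<bar>c'\<bar>) * C \<le> (1 + \<bar>c'\<bar>) * ((1 + J0) * ?x ^ 4)" by (intro mult_left_mono) auto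
    have 3: "1 \<le> ?x ^ 4" using x1 by (intro one_le_power)
    have gen: "2 * (a + b) + 2 \<le> 2 * (x + y) + 2 * z" if "a \<le> x" "b \<le> y" "1 \<le> z" for a b x y z :: real
    proof -
      have "2 * (a + b) \<le> 2 * (x + y)" using that by (intro mult_left_mono add_mono) auto
      moreover have "2 * 1 \<le> 2 * z" using that by (intro mult_left_mono) auto
      ultimately have "2 * (a + b) + 2 * 1 \<le> 2 * (x + y) + 2 * z" by (rule add_mono)
      then show ?thesis by (simp only: mult_1_right)
    qed
    have "2 * \<Lambda> + 2 \<le> 2 * (\<bar>Re \<beta>\<bar> * (2 * (1 + J0)^2 * ?x ^ 4) + (1 + \<bar>c'\<bar>) * ((1 + J0) * ?x ^ 4)) + 2 * ?x ^ 4"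
      unfolding \<Lambda>_def by (rule gen[OF 1 2 3])
    also have "... = D * ?x ^ 4" unfolding D_def distrib_right by (simp only: mult.assoc mult.left_commute mult.commute distrib_left distrib_right)
    finally have "2 * \<Lambda> + 2 \<le> D * ?x ^ 4" .
    then have "R ^ 4 * (2 * \<Lambda> + 2) \<le> R ^ 4 * (D * ?x ^ 4)" using R by (intro mult_left_mono) auto
    also have "... \<le> 2 ^ m" using m D by (simp add: field_simps)
    finally show ?thesis .
  qed
  from nd[OF C] obtain C' where C': "\<forall>T B \<rho>. profile T B \<rho> \<longrightarrow> C' \<le> T \<longrightarrow> flat_on B C' \<longrightarrow>
      (\<exists>n0. \<forall>n\<ge>n0. \<forall>b. 0 \<le> b \<and> b \<le> C \<longrightarrow> (\<exists>Q. qform Q \<and> \<theta> * (profile.full_mean T B \<beta> b)^2 \<le> qtrace Q \<and>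
        (\<forall>\<xi>. norm \<xi> \<le> 1 / (K * profile.full_mean T B \<beta> b) \<longrightarrow>
          norm (cf trees (part T B \<rho> \<beta> n b) \<xi>) \<le> exp (- Q \<xi>))))" by blast
  \<comment> \<open>The cell found by the pigeonhole principle has j > - \<Lambda> - 1, so \<kappa>
    is at least \<delta> times the mean.\<close>
  define \<delta> where "\<delta> = exp (- \<Lambda> - 1)"
  show ?thesis
  proof (rule exI[of _ \<delta>], intro conjI exI[of _ "max C C'"] allI impI)
    show "0 < \<delta>" by (simp add: \<delta>_def)
    fix T B \<rho> assume prof: "profile T B \<rho>" and CT: "max C C' \<le> T" and fl: "flat_on B (max C C')"
    interpret profile T B \<rho> by fact
    interpret P: prob_space "trees" by (rule prob_space_tree)
    let ?M0 = "full_mean \<beta> 0"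
    have "flat_on B C'" by (rule flat_on_mono[OF fl]) simp
    with C' prof CT obtain n0 where n0: "\<And>n b. n0 \<le> n \<Longrightarrow> 0 \<le> b \<Longrightarrow> b \<le> C \<Longrightarrow> (\<exists>Q. qform Q \<and> \<theta> * (full_mean \<beta> b)^2 \<le> qtrace Q \<and>
        (\<forall>\<xi>. norm \<xi> \<le> 1 / (K * full_mean \<beta> b) \<longrightarrow> norm (cf trees (part T B \<rho> \<beta> n b) \<xi>) \<le> exp (- Q \<xi>)))"
      by (metis max.bounded_iff)
    show "\<exists>n0. \<forall>n\<ge>n0. measure trees {\<omega>. norm (part T B \<rho> \<beta> n 0 \<omega>) \<le> \<delta> * ?M0} \<le> \<eta>"
    proof (intro exI[of _ "m + n0"] allI impI)
      fix N assume "m + n0 \<le> N"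
      then obtain n where N: "N = m + n" and n: "n0 \<le> n" by (metis le_add_diff_inverse add_le_imp_le_diff add_leD1 add.commute)
      let ?V = "{v :: bool list. length v = m}"
      let ?PV = "\<Pi>\<^sub>M v\<in>?V. trees"
      interpret PV: product_prob_space "\<lambda>_. trees" ?V by unfold_locales
      interpret PVf: finite_product_prob_space "\<lambda>_. trees" ?V by unfold_locales (rule finite_length_lists)
      interpret TP: pair_prob_space "trees" ?PV ..
      define E where "E = {\<omega>. norm (part T B \<rho> \<beta> N 0 \<omega>) \<le> \<delta> * ?M0}"
      have E: "E \<in> sets trees"
      proof -
        have "{\<omega> \<in> space trees. norm (part T B \<rho> \<beta> N 0 \<omega>) \<le> \<delta> * ?M0} \<in> sets trees" by measurable
        then show ?thesis by (simp add: E_def)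
      qed
      have frozen: "emeasure ?PV {\<eta> \<in> space ?PV. graft m \<omega> \<eta> \<in> E} \<le> ennreal (\<eta> / 2)" if tm: "tame J m \<omega>" for \<omega>
      proof -
        define cw where "cw v = wt \<beta> (vpos T B \<rho> 0 \<omega> v)" for v
        define bv where "bv v = vbirth 0 \<omega> v" for v
        define X where "X v = part T B \<rho> \<beta> n (bv v)" for v
        have [measurable]: "X v \<in> borel_measurable trees" for v unfolding X_def by (rule measurable_part_0)
        have bv: "0 \<le> bv v" "bv v \<le> C" if "v \<in> ?V" for v
          using vbirth_bounds[of J v \<omega> 0] tm that by (auto simp: bv_def C_def)
        define S where "S \<eta> = (\<Sum>v\<in>?V. cw v * X v (\<eta> v))" for \<eta>
        have Sm [measurable]: "S \<in> borel_measurable ?PV"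
          unfolding S_def[abs_def]
        proof (intro borel_measurable_sum borel_measurable_times borel_measurable_const)
          fix v assume "v \<in> ?V"
          then show "(\<lambda>\<eta>. X v (\<eta> v)) \<in> borel_measurable ?PV"
            by (intro measurable_compose[OF measurable_component_singleton]) auto
        qed
        have gr: "part T B \<rho> \<beta> N 0 (graft m \<omega> \<eta>) = S \<eta>" for \<eta>
          unfolding N S_def cw_def X_def bv_def using tm CT by (intro part_graft) (auto simp: C_def)
        \<comment> \<open>Logarithm of the size expected from subtree v, its frozen weight times the
          mean from its birth time on, relative to the mean of the whole.\<close>
        define z where "z v = ln (norm (cw v) * full_mean \<beta> (bv v) / ?M0)" for v
        have ez: "norm (cw v) * full_mean \<beta> (bv v) = ?M0 * exp (z v)" for v
        proof -
          have "0 < norm (cw v) * full_mean \<beta> (bv v) / ?M0" using full_mean_pos by (simp add: cw_def)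
          then have "exp (z v) = norm (cw v) * full_mean \<beta> (bv v) / ?M0" unfolding z_def by (rule exp_ln)
          then show ?thesis using full_mean_pos[of \<beta> 0] by simp
        qed
        have zb: "\<bar>z v\<bar> \<le> \<Lambda>" if v: "v \<in> ?V" for v
        proof -
          have "norm (cw v) * full_mean \<beta> (bv v) / ?M0 = exp (Re \<beta> * fst (vpos T B \<rho> 0 \<omega> v) - bv v - c' * B (bv v))"
            by (simp add: cw_def norm_wt full_mean_def c'_def[symmetric] mult_exp_exp exp_diff[symmetric] algebra_simps)
          then have "z v = Re \<beta> * fst (vpos T B \<rho> 0 \<omega> v) - bv v - c' * B (bv v)" by (simp add: z_def)
          also have "\<bar>\<dots>\<bar> \<le> \<bar>Re \<beta>\<bar> * \<bar>fst (vpos T B \<rho> 0 \<omega> v)\<bar> + bv v + \<bar>c'\<bar> * B (bv v)"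
            using bv[OF v] B_nonneg[of "bv v"] by (intro order_trans[OF abs_triangle_ineq4] add_mono) (auto simp: abs_mult)
          also have "... \<le> \<bar>Re \<beta>\<bar> * (real m * ((1 + C) * J)) + C + \<bar>c'\<bar> * C"
            using bv[OF v] B_le[of "bv v"] vpos_bound[of J v \<omega> 0 C] v tm CT J
            by (intro add_mono mult_left_mono) (auto simp: C_def)
          also have "... = \<Lambda>" by (simp add: \<Lambda>_def algebra_simps)
          finally show ?thesis .
        qed
        have cV: "R ^ 4 * (2 * \<Lambda> + 2) \<le> real (card ?V)" using H by (simp add: card_length_lists)
        obtain j where j: "R ^ 4 \<le> real (card {v\<in>?V. \<lfloor>z v\<rfloor> = j})"
          by (rule pigeonhole_real[where A = ?V and f = z and \<Lambda> = \<Lambda> and N = "R ^ 4"]; (rule finite_length_lists zb \<Lambda> cV; assumption?)?) blast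
        define W where "W = {v\<in>?V. \<lfloor>z v\<rfloor> = j}"
        have WV: "W \<subseteq> ?V" "finite W" using finite_length_lists by (auto simp: W_def intro: finite_subset)
        define \<kappa> where "\<kappa> = ?M0 * exp (real_of_int j)"
        have \<kappa>: "0 < \<kappa>" using full_mean_pos by (simp add: \<kappa>_def)
        have zW: "\<kappa> \<le> norm (cw v) * full_mean \<beta> (bv v)" "norm (cw v) * full_mean \<beta> (bv v) \<le> \<kappa> * exp 1" if "v \<in> W" for v
        proof -
          have "\<lfloor>z v\<rfloor> = j" using that by (simp add: W_def)
          then have "real_of_int j \<le> z v" "z v \<le> real_of_int j + 1"
            using of_int_floor_le[of "z v"] real_of_int_floor_add_one_ge[of "z v"] by simp_all
          then show "\<kappa> \<le> norm (cw v) * full_mean \<beta> (bv v)" "norm (cw v) * full_mean \<beta> (bv v) \<le> \<kappa> * exp 1"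
            unfolding ez \<kappa>_def using full_mean_pos[of \<beta> 0] by (auto simp: mult.assoc mult_exp_exp)
        qed
        have "1 \<le> real (card W)" using j one_le_power[OF R(1), of 4] unfolding W_def by (rule order_trans[rotated])
        then have "W \<noteq> {}" by auto
        then obtain v0 where v0: "v0 \<in> W" by blast
        have \<delta>\<kappa>: "\<delta> * ?M0 \<le> \<kappa>"
        proof -
          have "\<lfloor>z v0\<rfloor> = j" "v0 \<in> ?V" using v0 by (simp_all add: W_def)
          then have "z v0 < real_of_int j + 1" "- \<Lambda> \<le> z v0"
            using real_of_int_floor_add_one_gt[of "z v0"] zb[of v0] by (simp_all add: abs_le_iff)
          then show ?thesis using full_mean_pos[of \<beta> 0] by (simp add: \<delta>_def \<kappa>_def mult.commute)
        qed
        have "\<exists>Q. \<forall>v\<in>W. qform (Q v) \<and> \<theta> * (full_mean \<beta> (bv v))^2 \<le> qtrace (Q v) \<and>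
            (\<forall>\<xi>. norm \<xi> \<le> 1 / (K * full_mean \<beta> (bv v)) \<longrightarrow> norm (cf trees (X v) \<xi>) \<le> exp (- Q v \<xi>))"
          unfolding X_def using WV bv n0[OF n] by (intro bchoice) blast
        then obtain Q where Q: "\<And>v. v \<in> W \<Longrightarrow> qform (Q v)" "\<And>v. v \<in> W \<Longrightarrow> \<theta> * (full_mean \<beta> (bv v))^2 \<le> qtrace (Q v)"
          "\<And>v \<xi>. v \<in> W \<Longrightarrow> norm \<xi> \<le> 1 / (K * full_mean \<beta> (bv v)) \<Longrightarrow> norm (cf trees (X v) \<xi>) \<le> exp (- Q v \<xi>)"
          by blast
        define f where "f \<xi> = (\<Prod>v\<in>?V. norm (cf trees (X v) (\<xi> * cw v)))" for \<xi>
        have cfS: "norm (cf ?PV S \<xi>) = f \<xi>" for \<xi>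
        proof -
          have "iexp (Re (\<xi> * S \<eta>)) = (\<Prod>v\<in>?V. iexp (Re ((\<xi> * cw v) * X v (\<eta> v))))" for \<eta>
            unfolding S_def sum_distrib_left Re_sum of_real_sum using finite_length_lists
            by (subst exp_sum[symmetric]) (auto simp: sum_distrib_left mult.assoc)
          then have "cf ?PV S \<xi> = (\<integral>\<eta>. (\<Prod>v\<in>?V. iexp (Re ((\<xi> * cw v) * X v (\<eta> v)))) \<partial>?PV)"
            by (simp only: cf_def)
          also have "... = (\<Prod>v\<in>?V. \<integral>x. iexp (Re ((\<xi> * cw v) * X v x)) \<partial>trees)"
            by (rule PV.product_integral_prod[OF finite_length_lists], rule P.integrable_const_bound[of _ 1]) auto
          finally show ?thesis by (simp only: f_def cf_def prod_norm)
        qed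
        have f1: "f \<xi> \<le> 1" for \<xi> unfolding f_def by (intro prod_le_1) (auto intro!: P.norm_cf_le_1)
        have fm [measurable]: "f \<in> borel_measurable borel"
          unfolding f_def[abs_def] by (intro borel_measurable_prod borel_measurable_norm measurable_compose[OF _ P.measurable_cf]) auto
        define Q' where "Q' \<xi> = (\<Sum>v\<in>W. Q v (\<xi> * cw v))" for \<xi>
        have Q': "qform Q'" "qtrace Q' = (\<Sum>v\<in>W. (norm (cw v))^2 * qtrace (Q v))"
          unfolding Q'_def[abs_def] using qform_sum[of W "\<lambda>v \<xi>. Q v (\<xi> * cw v)"] qform_mult[OF Q(1)] by simp_all
        have tr: "R ^ 4 * (\<theta> * \<kappa>^2) \<le> qtrace Q'"
        proof -
          have "R ^ 4 * (\<theta> * \<kappa>^2) \<le> real (card W) * (\<theta> * \<kappa>^2)" using j \<theta> by (intro mult_right_mono) (auto simp: W_def)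
          also have "... = (\<Sum>v\<in>W. \<theta> * \<kappa>^2)" by simp
          also have "... \<le> qtrace Q'"
            unfolding Q'
          proof (rule sum_mono)
            fix v assume v: "v \<in> W"
            have "\<theta> * \<kappa>^2 \<le> \<theta> * (norm (cw v) * full_mean \<beta> (bv v))^2" using zW(1)[OF v] \<kappa> \<theta> by (intro mult_left_mono power_mono) auto
            also have "... = (norm (cw v))^2 * (\<theta> * (full_mean \<beta> (bv v))^2)" by (simp add: power_mult_distrib)
            also have "... \<le> (norm (cw v))^2 * qtrace (Q v)" using Q(2)[OF v] by (intro mult_left_mono) auto
            finally show "\<theta> * \<kappa>^2 \<le> (norm (cw v))^2 * qtrace (Q v)" .
          qed
          finally show ?thesis .
        qed
        have fle: "f \<xi> \<le> exp (- Q' \<xi>)" if \<xi>: "norm \<xi> \<le> 1 / (K * exp 1 * \<kappa>)" for \<xi>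
        proof -
          have "f \<xi> = (\<Prod>v\<in>?V - W. norm (cf trees (X v) (\<xi> * cw v))) * (\<Prod>v\<in>W. norm (cf trees (X v) (\<xi> * cw v)))"
            unfolding f_def by (rule prod.subset_diff[OF WV(1) finite_length_lists])
          also have "... \<le> 1 * (\<Prod>v\<in>W. exp (- Q v (\<xi> * cw v)))"
          proof (intro mult_mono prod_mono prod_le_1 conjI)
            fix v assume v: "v \<in> W"
            have "norm (\<xi> * cw v) * (K * full_mean \<beta> (bv v)) = norm \<xi> * K * (norm (cw v) * full_mean \<beta> (bv v))" by (simp add: norm_mult)
            also have "... \<le> 1 / (K * exp 1 * \<kappa>) * K * (\<kappa> * exp 1)"
            proof -
              have "norm \<xi> * K \<le> 1 / (K * exp 1 * \<kappa>) * K" using K by (intro mult_right_mono \<xi>) simp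
              from mult_mono[OF this zW(2)[OF v]] show ?thesis using K \<kappa> full_mean_pos[of \<beta> "bv v"] by simp
            qed
            also have "... = 1" using K \<kappa> by simp
            finally have "norm (\<xi> * cw v) \<le> 1 / (K * full_mean \<beta> (bv v))"
              using K full_mean_pos[of \<beta> "bv v"] by (simp add: pos_le_divide_eq)
            then show "norm (cf trees (X v) (\<xi> * cw v)) \<le> exp (- Q v (\<xi> * cw v))" by (rule Q(3)[OF v])
          qed (auto intro!: P.norm_cf_le_1 prod_nonneg)
          also have "... = exp (- Q' \<xi>)" using WV by (simp add: Q'_def exp_sum sum_negf[symmetric])
          finally show ?thesis .
        qed
        \<comment> \<open>The radius must be large against \<kappa>, because the decay is known for
          \<xi> up to order 1 / \<kappa>, and small against the spread R^2 \<kappa>. The geometric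
          mean R \<kappa> makes both errors at most of order 1 / R.\<close>
        define r where "r = \<kappa> * R"
        have r: "0 < r" "\<delta> * ?M0 \<le> r"
        proof -
          show "0 < r" using \<kappa> R by (simp add: r_def)
          have "\<kappa> * 1 \<le> \<kappa> * R" using \<kappa> R by (intro mult_left_mono) auto
          then show "\<delta> * ?M0 \<le> r" using \<delta>\<kappa> by (simp add: r_def)
        qed
        have "emeasure ?PV {\<eta> \<in> space ?PV. graft m \<omega> \<eta> \<in> E} \<le> emeasure ?PV {\<eta> \<in> space ?PV. norm (S \<eta>) \<le> r}"
          using r by (intro emeasure_mono) (auto simp: E_def gr)
        also have "... = ennreal (measure ?PV {\<eta> \<in> space ?PV. norm (S \<eta>) \<le> r})" by (rule PV.P.emeasure_eq_measure)
        also have "... \<le> 2 * (\<integral>\<^sup>+g. ennreal (f (Complex (fst g) (snd g) / complex_of_real r)) \<partial>gauss2)"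
          using PV.P.small_ball_le[OF Sm r(1)] by (simp only: cfS)
        also have "... \<le> 2 * ennreal (r / sqrt (R ^ 4 * (\<theta> * \<kappa>^2)) + 2 / (1 / (K * exp 1 * \<kappa>) * r)^2)"
          using R \<theta> \<kappa> K r by (intro mult_left_mono gauss_anticoncentration[OF fm f1 Q'(1) _ tr _ _ fle]) auto
        also have "... \<le> ennreal (\<eta> / 2)"
        proof -
          have "sqrt (R ^ 4 * (\<theta> * \<kappa>^2)) = R^2 * sqrt \<theta> * \<kappa>"
          proof -
            have "R ^ 4 = (R^2)^2" by simp
            then show ?thesis using \<kappa> by (simp only: real_sqrt_mult real_sqrt_abs) simp
          qed
          then have 1: "r / sqrt (R ^ 4 * (\<theta> * \<kappa>^2)) = 1 / sqrt \<theta> / R"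
            using R \<kappa> \<theta> by (simp add: r_def power2_eq_square)
          have "2 / (1 / (K * exp 1 * \<kappa>) * r)^2 = 2 * (K * exp 1)^2 / R^2"
            using K \<kappa> R by (simp add: r_def power_divide power_mult_distrib)
          also have "... \<le> 2 * (K * exp 1)^2 / R"
            using R by (intro divide_left_mono) (auto simp: power2_eq_square)
          finally have "r / sqrt (R ^ 4 * (\<theta> * \<kappa>^2)) + 2 / (1 / (K * exp 1 * \<kappa>) * r)^2 \<le> L / R"
            unfolding 1 L_def add_divide_distrib by simp
          then have le: "2 * (r / sqrt (R ^ 4 * (\<theta> * \<kappa>^2)) + 2 / (1 / (K * exp 1 * \<kappa>) * r)^2) \<le> \<eta> / 2"
            by (rule order_trans[OF mult_left_mono R(2)]) simp
          have "0 \<le> r / sqrt (R ^ 4 * (\<theta> * \<kappa>^2)) + 2 / (1 / (K * exp 1 * \<kappa>) * r)^2"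
            using r R \<theta> by (intro add_nonneg_nonneg divide_nonneg_nonneg) auto
          from ennreal_mult[OF _ this, of 2] show ?thesis using ennreal_leI[OF le] by simp
        qed
        finally show ?thesis .
      qed
      have "emeasure trees E = emeasure (trees \<Otimes>\<^sub>M ?PV) ((\<lambda>(\<omega>, \<eta>). graft m \<omega> \<eta>) -` E \<inter> space (trees \<Otimes>\<^sub>M ?PV))"
        by (subst distr_graft[OF prob_space_mark, of m, symmetric], rule emeasure_distr[OF measurable_graft E])
      also have "... = (\<integral>\<^sup>+\<omega>. emeasure ?PV (Pair \<omega> -` ((\<lambda>(\<omega>, \<eta>). graft m \<omega> \<eta>) -` E \<inter> space (trees \<Otimes>\<^sub>M ?PV))) \<partial>trees)"
        by (rule PV.emeasure_pair_measure_alt[OF measurable_sets[OF measurable_graft E]])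
      also have "... \<le> (\<integral>\<^sup>+\<omega>. ennreal (\<eta> / 2) + indicator {\<omega>. \<not> tame J m \<omega>} \<omega> \<partial>trees)"
      proof (rule nn_integral_mono)
        fix \<omega> :: "bool list \<Rightarrow> real \<times> real \<times> real"
        have "Pair \<omega> -` ((\<lambda>(\<omega>, \<eta>). graft m \<omega> \<eta>) -` E \<inter> space (trees \<Otimes>\<^sub>M ?PV)) = {\<eta> \<in> space ?PV. graft m \<omega> \<eta> \<in> E}"
          by (auto simp: space_pair_measure)
        then show "emeasure ?PV (Pair \<omega> -` ((\<lambda>(\<omega>, \<eta>). graft m \<omega> \<eta>) -` E \<inter> space (trees \<Otimes>\<^sub>M ?PV)))
          \<le> ennreal (\<eta> / 2) + indicator {\<omega>. \<not> tame J m \<omega>} \<omega>"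
          using frozen[of \<omega>] PV.P.emeasure_le_1 by (cases "tame J m \<omega>") (auto intro: add_increasing)
      qed
      also have "... = ennreal (\<eta> / 2) + emeasure trees {\<omega>. \<not> tame J m \<omega>}"
      proof -
        have "space trees - {\<omega>. tame J m \<omega>} \<in> sets trees" using sets_tame by (rule sets.compl_sets)
        moreover have "space trees - {\<omega>. tame J m \<omega>} = {\<omega>. \<not> tame J m \<omega>}" by auto
        ultimately have "{\<omega>. \<not> tame J m \<omega>} \<in> sets trees" by simp
        then show ?thesis using P.emeasure_space_1 by (simp add: nn_integral_add)
      qed
      also have "... \<le> ennreal (\<eta> / 2) + ennreal (\<eta> / 2)"
      proof (rule add_left_mono)
        have "measure trees {\<omega>. \<not> tame J m \<omega>} \<le> 2 ^ m * (5 * exp (- J))" by (rule measure_not_tame[OF J])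
        also have "... = (2 ^ m * exp (- real m)) * (5 * exp (- J0))" by (simp add: J_def mult_exp_exp)
        also have "... \<le> 1 * (5 * (\<eta> / 10))"
        proof (intro mult_mono)
          have "2 ^ m \<le> exp (1 :: real) ^ m" using exp_ge_add_one_self[of 1] by (intro power_mono) auto
          also have "... = exp (real m)" by (simp flip: exp_of_nat_mult)
          finally show "2 ^ m * exp (- real m) \<le> 1" by (simp add: exp_minus field_simps)
        qed (use J0 in auto)
        finally show "emeasure trees {\<omega>. \<not> tame J m \<omega>} \<le> ennreal (\<eta> / 2)"
          by (simp add: P.emeasure_eq_measure ennreal_leI)
      qed
      also have "... = ennreal \<eta>" using \<eta> by (subst ennreal_plus[symmetric]) auto
      finally show "measure trees {\<omega>. norm (part T B \<rho> \<beta> N 0 \<omega>) \<le> \<delta> * ?M0} \<le> \<eta>"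
        using \<eta> by (simp add: P.emeasure_eq_measure E_def)
    qed
  qed
qed

section \<open>Lower bound at the scale of the fluctuations\<close>

lemma char_distr_scale:
  "char (distr gauss borel (\<lambda>x. s * x)) u = complex_of_real (exp (- (s^2 * u^2 / 2)))"
proof -
  have "char (distr gauss borel (\<lambda>x. s * x)) u = char gauss (s * u)"
    by (simp add: char_def integral_distr mult.assoc mult.left_commute mult.commute)
  then show ?thesis by (simp add: char_std_normal_distribution power_mult_distrib)
qed

text \<open>The identity in law needs v \<ge> 0 and is applied with the variance at horizon t - 1;
  what remains to horizon t is the standard summand.\<close>

lemma gauss_split:
  assumes v: "0 \<le> v"
  shows "distr gauss borel (\<lambda>x. sqrt (v + 1) * x) =
    distr gauss2 borel (\<lambda>z. sqrt v * fst z + snd z)"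
proof (rule Levy_uniqueness)
  interpret N: prob_space gauss by (rule prob_space_gauss)
  interpret G: prob_space gauss2 by (rule prob_space_gauss2)
  show "real_distribution (distr gauss borel (\<lambda>x. sqrt (v + 1) * x))" by (rule N.real_distribution_distr) simp
  show "real_distribution (distr gauss2 borel (\<lambda>z. sqrt v * fst z + snd z))" by (rule G.real_distribution_distr) simp
  show "char (distr gauss borel (\<lambda>x. sqrt (v + 1) * x)) = char (distr gauss2 borel (\<lambda>z. sqrt v * fst z + snd z))"
  proof
    fix u
    have "char (distr gauss2 borel (\<lambda>z. sqrt v * fst z + snd z)) u = (\<integral>z. exp ((\<i> * (u * sqrt v)) * complex_of_real (fst z)) * exp ((\<i> * u) * complex_of_real (snd z)) \<partial>gauss2)"
      by (simp add: char_def integral_distr mult_exp_exp algebra_simps)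
    also have "... = exp ((\<i> * (u * sqrt v))^2 / 2) * exp ((\<i> * u)^2 / 2)"
      using has_bochner_integral_pair_mult[OF prob_space_gauss prob_space_gauss gauss_mgf[of "\<i> * (u * sqrt v)"] gauss_mgf[of "\<i> * u"]]
      by (simp add: has_bochner_integral_iff)
    also have "... = complex_of_real (exp (- (u^2 * v / 2))) * complex_of_real (exp (- (u^2 / 2)))"
    proof -
      have "(complex_of_real (sqrt v))^2 = v" using v by (simp flip: of_real_power)
      then have "(\<i> * complex_of_real (u * sqrt v))^2 / 2 = complex_of_real (- (u^2 * v / 2))" "(\<i> * complex_of_real u)^2 / 2 = complex_of_real (- (u^2 / 2))"
        by (simp_all add: power_mult_distrib)
      then show ?thesis by (simp only: exp_of_real)
    qed
    also have "... = complex_of_real (exp (- ((sqrt (v + 1))^2 * u^2 / 2)))"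
      using v by (simp add: mult_exp_exp field_simps flip: of_real_mult)
    finally show "char (distr gauss borel (\<lambda>x. sqrt (v + 1) * x)) u = char (distr gauss2 borel (\<lambda>z. sqrt v * fst z + snd z)) u"
      by (simp add: char_distr_scale)
  qed
qed

lemma gauss2_split:
  assumes v: "0 \<le> v" and [measurable]: "f \<in> borel_measurable (borel \<Otimes>\<^sub>M borel)"
  shows "(\<integral>\<^sup>+x. f (sqrt (v + 1) * fst x, sqrt (v + 1) * snd x) \<partial>gauss2) =
    (\<integral>\<^sup>+x. \<integral>\<^sup>+y. f (sqrt v * fst x + fst y, sqrt v * snd x + snd y) \<partial>gauss2 \<partial>gauss2)"
proof -
  let ?N = gauss
  interpret N: prob_space gauss by (rule prob_space_gauss)
  interpret NN: pair_prob_space gauss gauss ..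
  interpret G: prob_space gauss2 by (rule prob_space_gauss2)
  have one: "(\<integral>\<^sup>+g. h (sqrt (v + 1) * g) \<partial>?N) = (\<integral>\<^sup>+a. \<integral>\<^sup>+b. h (sqrt v * a + b) \<partial>?N \<partial>?N)"
    if [measurable]: "h \<in> borel_measurable borel" for h :: "real \<Rightarrow> ennreal"
  proof -
    have "(\<integral>\<^sup>+g. h (sqrt (v + 1) * g) \<partial>?N) = (\<integral>\<^sup>+x. h x \<partial>distr ?N borel (\<lambda>x. sqrt (v + 1) * x))"
      by (simp add: nn_integral_distr)
    also have "... = (\<integral>\<^sup>+z. h (sqrt v * fst z + snd z) \<partial>gauss2)"
      unfolding gauss_split[OF v] by (simp add: nn_integral_distr)
    also have "... = (\<integral>\<^sup>+a. \<integral>\<^sup>+b. h (sqrt v * a + b) \<partial>?N \<partial>?N)"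
      by (subst N.nn_integral_fst[symmetric]) auto
    finally show ?thesis .
  qed
  let ?s = "sqrt v" and ?S = "sqrt (v + 1)"
  have "(\<integral>\<^sup>+x. f (?S * fst x, ?S * snd x) \<partial>gauss2) = (\<integral>\<^sup>+g. \<integral>\<^sup>+h. f (?S * g, ?S * h) \<partial>?N \<partial>?N)"
    by (subst N.nn_integral_fst[symmetric]) auto
  also have "... = (\<integral>\<^sup>+a. \<integral>\<^sup>+b. \<integral>\<^sup>+h. f (?s * a + b, ?S * h) \<partial>?N \<partial>?N \<partial>?N)"
    by (rule one) measurable
  also have "... = (\<integral>\<^sup>+a. \<integral>\<^sup>+b. \<integral>\<^sup>+c. \<integral>\<^sup>+d. f (?s * a + b, ?s * c + d) \<partial>?N \<partial>?N \<partial>?N \<partial>?N)"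
    by (intro nn_integral_cong one) measurable
  also have "... = (\<integral>\<^sup>+a. \<integral>\<^sup>+c. \<integral>\<^sup>+b. \<integral>\<^sup>+d. f (?s * a + b, ?s * c + d) \<partial>?N \<partial>?N \<partial>?N \<partial>?N)"
    by (intro nn_integral_cong NN.Fubini') measurable
  also have "... = (\<integral>\<^sup>+a. \<integral>\<^sup>+c. \<integral>\<^sup>+y. f (?s * a + fst y, ?s * c + snd y) \<partial>gauss2 \<partial>?N \<partial>?N)"
    by (intro nn_integral_cong, subst N.nn_integral_fst[symmetric]) auto
  also have "... = (\<integral>\<^sup>+x. \<integral>\<^sup>+y. f (?s * fst x + fst y, ?s * snd x + snd y) \<partial>gauss2 \<partial>gauss2)"
    by (subst N.nn_integral_fst[symmetric]) auto
  finally show ?thesis .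
qed

lemma distr_gauss2_split:
  assumes v: "0 \<le> v"
  shows "distr gauss2 (borel \<Otimes>\<^sub>M borel) (disp \<rho> (v + 1)) =
    distr (gauss2 \<Otimes>\<^sub>M gauss2) (borel \<Otimes>\<^sub>M borel) (\<lambda>z. disp \<rho> v (fst z) + disp \<rho> 1 (snd z))"
proof (rule measure_eqI)
  interpret G: prob_space gauss2 by (rule prob_space_gauss2)
  fix A assume "A \<in> sets (distr gauss2 (borel \<Otimes>\<^sub>M borel) (disp \<rho> (v + 1)))"
  then have [measurable]: "A \<in> sets (borel \<Otimes>\<^sub>M borel)" by simp
  define L where "L x = (fst x, \<rho> * fst x + sqrt (1 - \<rho>\<^sup>2) * snd x)" for x :: "real \<times> real"
  have [measurable]: "L \<in> borel \<Otimes>\<^sub>M borel \<rightarrow>\<^sub>M borel \<Otimes>\<^sub>M borel" unfolding L_def[abs_def] by measurable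
  have dL: "disp \<rho> w x = L (sqrt w * fst x, sqrt w * snd x)" for w x
    by (simp add: disp_def L_def algebra_simps)
  have dL2: "disp \<rho> v x + disp \<rho> 1 y = L (sqrt v * fst x + fst y, sqrt v * snd x + snd y)" for x y
    by (simp add: disp_def L_def algebra_simps)
  have addm: "(\<lambda>z. disp \<rho> v (fst z) + disp \<rho> 1 (snd z)) \<in> gauss2 \<Otimes>\<^sub>M gauss2 \<rightarrow>\<^sub>M borel \<Otimes>\<^sub>M borel"
    unfolding dL2 by measurable
  have "emeasure (distr gauss2 (borel \<Otimes>\<^sub>M borel) (disp \<rho> (v + 1))) A = (\<integral>\<^sup>+x. indicator A (L (sqrt (v + 1) * fst x, sqrt (v + 1) * snd x)) \<partial>gauss2)"
    by (subst nn_integral_indicator[symmetric], simp, subst nn_integral_distr) (auto simp: dL)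
  also have "... = (\<integral>\<^sup>+x. \<integral>\<^sup>+y. indicator A (L (sqrt v * fst x + fst y, sqrt v * snd x + snd y)) \<partial>gauss2 \<partial>gauss2)"
    by (rule gauss2_split[OF v, where f = "\<lambda>z. indicator A (L z)"]) measurable
  also have "... = (\<integral>\<^sup>+z. indicator A (disp \<rho> v (fst z) + disp \<rho> 1 (snd z)) \<partial>(gauss2 \<Otimes>\<^sub>M gauss2))"
    unfolding dL2 by (subst G.nn_integral_fst[symmetric]) auto
  also have "... = emeasure (distr (gauss2 \<Otimes>\<^sub>M gauss2) (borel \<Otimes>\<^sub>M borel) (\<lambda>z. disp \<rho> v (fst z) + disp \<rho> 1 (snd z))) A"
    by (subst nn_integral_indicator[symmetric], simp, subst nn_integral_distr[OF addm]) auto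
  finally show "emeasure (distr gauss2 (borel \<Otimes>\<^sub>M borel) (disp \<rho> (v + 1))) A = \<dots>" .
qed simp

definition leaf_cf :: "real \<Rightarrow> complex \<Rightarrow> real \<Rightarrow> complex \<Rightarrow> complex" where
  "leaf_cf \<rho> \<beta> v = cf gauss2 (\<lambda>x. wt \<beta> (disp \<rho> v x))"

lemma measurable_wt_disp [measurable]: "(\<lambda>x. wt \<beta> (disp \<rho> v x)) \<in> borel_measurable gauss2"
  by measurable

lemma measurable_leaf_cf [measurable]: "leaf_cf \<rho> \<beta> v \<in> borel_measurable borel"
  unfolding leaf_cf_def by (intro prob_space.measurable_cf prob_space_gauss2 measurable_wt_disp)

lemma norm_leaf_cf_le_1: "norm (leaf_cf \<rho> \<beta> v \<xi>) \<le> 1"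
  unfolding leaf_cf_def by (intro prob_space.norm_cf_le_1 prob_space_gauss2 measurable_wt_disp)

text \<open>Given the part of variance \<open>v\<close>, the weight is a frozen factor times the
  weight of an independent unit displacement. The modulus of the resulting mixture is at most the
  mixture of the moduli.\<close>

lemma leaf_cf_split:
  assumes v: "0 \<le> v"
  shows "ennreal (norm (leaf_cf \<rho> \<beta> (v + 1) \<xi>)) \<le> (\<integral>\<^sup>+x. ennreal (norm (leaf_cf \<rho> \<beta> 1 (\<xi> * wt \<beta> (disp \<rho> v x)))) \<partial>gauss2)"
proof -
  interpret G: prob_space gauss2 by (rule prob_space_gauss2)
  interpret GG: pair_prob_space gauss2 gauss2 ..
  let ?F = "\<lambda>p. iexp (Re (\<xi> * wt \<beta> p))"
  have [measurable]: "?F \<in> borel_measurable (borel \<Otimes>\<^sub>M borel)" by measurable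
  have [measurable]: "disp \<rho> w \<in> gauss2 \<rightarrow>\<^sub>M borel \<Otimes>\<^sub>M borel" for w
    using measurable_disp[of "\<lambda>_. w" gauss2 "\<lambda>x. x" \<rho>] by simp
  have addm: "(\<lambda>z. disp \<rho> v (fst z) + disp \<rho> 1 (snd z)) \<in> gauss2 \<Otimes>\<^sub>M gauss2 \<rightarrow>\<^sub>M borel \<Otimes>\<^sub>M borel"
    unfolding disp_def by simp
  have int: "integrable (gauss2 \<Otimes>\<^sub>M gauss2) (\<lambda>z. ?F (disp \<rho> v (fst z) + disp \<rho> 1 (snd z)))"
    using addm by (intro GG.integrable_const_bound[of _ 1]) auto
  have "leaf_cf \<rho> \<beta> (v + 1) \<xi> = (\<integral>p. ?F p \<partial>distr gauss2 (borel \<Otimes>\<^sub>M borel) (disp \<rho> (v + 1)))"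
    by (subst integral_distr) (auto simp: leaf_cf_def cf_def)
  also have "... = (\<integral>z. ?F (disp \<rho> v (fst z) + disp \<rho> 1 (snd z)) \<partial>(gauss2 \<Otimes>\<^sub>M gauss2))"
    unfolding distr_gauss2_split[OF v] by (rule integral_distr[OF addm]) simp
  also have "... = (\<integral>x. \<integral>y. ?F (disp \<rho> v x + disp \<rho> 1 y) \<partial>gauss2 \<partial>gauss2)"
    using GG.integral_fst'[OF int] by simp
  also have "... = (\<integral>x. leaf_cf \<rho> \<beta> 1 (\<xi> * wt \<beta> (disp \<rho> v x)) \<partial>gauss2)"
    by (simp only: leaf_cf_def cf_def wt_add mult.assoc)
  finally have eq: "leaf_cf \<rho> \<beta> (v + 1) \<xi> = (\<integral>x. leaf_cf \<rho> \<beta> 1 (\<xi> * wt \<beta> (disp \<rho> v x)) \<partial>gauss2)" .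
  show ?thesis
    unfolding eq by (rule integral_norm_bound_ennreal, rule G.integrable_const_bound[of _ 1]) (auto simp: norm_leaf_cf_le_1)
qed

text \<open>Bound for the factor that one particle alive at t - 1 contributes to the characteristic
  function: with probability 1 / e it survives to t and a unit displacement acts, otherwise the
  trivial bound 1 is taken for its descendants.\<close>

definition kern :: "real \<Rightarrow> complex \<Rightarrow> complex \<Rightarrow> real" where
  "kern \<rho> \<beta> \<xi> = exp (-1) * norm (leaf_cf \<rho> \<beta> 1 \<xi>) + (1 - exp (-1))"

lemma measurable_kern [measurable]: "kern \<rho> \<beta> \<in> borel_measurable borel"
  unfolding kern_def[abs_def] by measurable

lemma kern_bounds: "0 \<le> kern \<rho> \<beta> \<xi>" "kern \<rho> \<beta> \<xi> \<le> 1"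
proof -
  have e: "exp (-1 :: real) \<le> 1" by simp
  then show "0 \<le> kern \<rho> \<beta> \<xi>" unfolding kern_def by (intro add_nonneg_nonneg) auto
  have "exp (-1) * norm (leaf_cf \<rho> \<beta> 1 \<xi>) \<le> exp (-1) * 1" by (intro mult_left_mono norm_leaf_cf_le_1) auto
  then show "kern \<rho> \<beta> \<xi> \<le> 1" by (simp add: kern_def)
qed

text \<open>For a constant weight the a-th absolute moment equals the a-th power of the modulus of
  the mean. By the Gaussian formulas a = 1 gives Im \<beta> = 0, and then a = 2 gives Re \<beta> =
  0.\<close>

lemma wt_disp_not_const:
  assumes \<beta>: "\<beta> \<noteq> 0" and \<rho>: "\<rho>^2 \<le> 1"
  shows "\<not> (AE x in gauss2. wt \<beta> (disp \<rho> 1 x) = w)"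
proof
  assume AE: "AE x in gauss2. wt \<beta> (disp \<rho> 1 x) = w"
  interpret G: prob_space gauss2 by (rule prob_space_gauss2)
  have m: "(\<integral>x. wt \<beta> (disp \<rho> 1 x) \<partial>gauss2) = exp (cumul \<rho> \<beta>)"
    using gauss_disp_mean[of 1 \<rho> \<beta>] \<rho> by (simp add: has_bochner_integral_iff)
  have "(\<integral>x. wt \<beta> (disp \<rho> 1 x) \<partial>gauss2) = (\<integral>x. w \<partial>gauss2)" by (rule integral_cong_AE) (use AE in auto)
  then have "exp (cumul \<rho> \<beta>) = w" using m G.prob_space by simp
  then have nw: "norm w = exp (((Re \<beta>)^2 - (Im \<beta>)\<^sup>2) / 2)" by (auto simp: Re_cumul)
  have pw: "norm w powr a = exp (a * (((Re \<beta>)^2 - (Im \<beta>)\<^sup>2) / 2))" for a by (simp add: nw powr_def)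
  have mom: "exp ((a * Re \<beta>)^2 / 2) = norm w powr a" for a
  proof -
    have "ennreal (exp ((a * Re \<beta>)^2 / 2 * 1)) = (\<integral>\<^sup>+x. ennreal (exp ((a * Re \<beta>) * fst (disp \<rho> 1 x))) \<partial>gauss2)"
      by (rule gauss_disp_exp[symmetric]) simp
    also have "... = (\<integral>\<^sup>+x. ennreal (norm w powr a) \<partial>gauss2)"
    proof (rule nn_integral_cong_AE, use AE in eventually_elim)
      fix x assume "wt \<beta> (disp \<rho> 1 x) = w"
      then have "norm w powr a = exp (a * (Re \<beta> * fst (disp \<rho> 1 x)))" by (auto simp: norm_wt powr_def)
      then show "ennreal (exp ((a * Re \<beta>) * fst (disp \<rho> 1 x))) = ennreal (norm w powr a)" by (simp add: mult.assoc)
    qed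
    also have "... = ennreal (norm w powr a)" using G.emeasure_space_1 by simp
    finally show ?thesis by simp
  qed
  from mom[of 1] have "(Im \<beta>)^2 = 0" unfolding pw by simp
  moreover from mom[of 2] have "(Re \<beta>)^2 = 0 \<or> (Im \<beta>)^2 \<noteq> 0" unfolding pw by (auto simp: power_mult_distrib)
  ultimately show False using \<beta> by (auto simp: complex_eq_iff)
qed

text \<open>As the weight is not almost surely constant, two independent copies have a positive
  truncated second moment at some level \<open>K\<close>. Mixing with the constant 1 in
  \<open>kern\<close> merely shrinks the form by the factor 1 / (2 e).\<close>

lemma kern_decay:
  assumes \<beta>: "\<beta> \<noteq> 0" and \<rho>: "\<rho>^2 \<le> 1"
  obtains Q R where "qform Q" "0 < qtrace Q" "0 < R" "\<And>\<xi>. norm \<xi> \<le> R \<Longrightarrow> kern \<rho> \<beta> \<xi> \<le> exp (- Q \<xi>)"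
proof -
  interpret G: prob_space gauss2 by (rule prob_space_gauss2)
  interpret GG: pair_prob_space gauss2 gauss2 ..
  let ?W = "\<lambda>x. wt \<beta> (disp \<rho> 1 x)"
  have Wm: "?W \<in> borel_measurable gauss2" by measurable
  let ?t = "\<lambda>K z. if norm (?W (fst z) - ?W (snd z)) \<le> K then (norm (?W (fst z) - ?W (snd z)))\<^sup>2 else 0"
  have "\<exists>n::nat. (\<integral>z. ?t (real (Suc n)) z \<partial>(gauss2 \<Otimes>\<^sub>M gauss2)) \<noteq> 0"
  proof (rule ccontr)
    assume "\<not> ?thesis"
    then have zero: "(\<integral>z. ?t (real (Suc n)) z \<partial>(gauss2 \<Otimes>\<^sub>M gauss2)) = 0" for n by blast
    have "AE z in gauss2 \<Otimes>\<^sub>M gauss2. ?t (real (Suc n)) z = 0" for n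
    proof -
      have "integrable (gauss2 \<Otimes>\<^sub>M gauss2) (?t (real (Suc n)))"
        by (rule GG.integrable_const_bound[of _ "(real (Suc n))^2"]) (auto intro!: power_mono)
      from integral_nonneg_eq_0_iff_AE[OF this] zero[of n] show ?thesis by auto
    qed
    then have "AE z in gauss2 \<Otimes>\<^sub>M gauss2. \<forall>n. ?t (real (Suc n)) z = 0" by (intro AE_all_countable[THEN iffD2] allI)
    then have "AE z in gauss2 \<Otimes>\<^sub>M gauss2. ?W (fst z) = ?W (snd z)"
    proof eventually_elim
      fix z assume a: "\<forall>n. ?t (real (Suc n)) z = 0"
      obtain n where "norm (?W (fst z) - ?W (snd z)) \<le> real n" using real_arch_simple by blast
      then have "norm (?W (fst z) - ?W (snd z)) \<le> real (Suc n)" by simp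
      then show "?W (fst z) = ?W (snd z)" using a[rule_format, of n] by simp
    qed
    then have "AE y in gauss2. AE x in gauss2. ?W y = ?W x"
      using GG.AE_pair[of "\<lambda>z. ?W (fst z) = ?W (snd z)"] by simp
    then have "\<exists>y. AE x in gauss2. ?W y = ?W x"
      by (metis (no_types, lifting) G.AE_False eventually_mono)
    then obtain y where "AE x in gauss2. ?W x = ?W y" by (auto simp: eq_commute)
    then show False using wt_disp_not_const[OF assms] by blast
  qed
  then obtain n :: nat where n: "(\<integral>z. ?t (real (Suc n)) z \<partial>(gauss2 \<Otimes>\<^sub>M gauss2)) \<noteq> 0" by blast
  define K where "K = real (Suc n)"
  have K: "0 < K" by (simp add: K_def)
  from G.cf_nondegenerate[OF Wm K] obtain Q where Q: "qform Q" "qtrace Q = (\<integral>z. ?t K z \<partial>(gauss2 \<Otimes>\<^sub>M gauss2)) / 8"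
    "\<And>\<xi>. norm \<xi> \<le> 1 / K \<Longrightarrow> norm (cf gauss2 ?W \<xi>) \<le> exp (- Q \<xi>)" by blast
  have "(\<integral>z. ?t K z \<partial>(gauss2 \<Otimes>\<^sub>M gauss2)) \<noteq> 0" using n unfolding K_def .
  then have "qtrace Q \<noteq> 0" unfolding Q(2) by simp
  then have tr: "0 < qtrace Q" using qtrace_nonneg[OF Q(1)] by simp
  \<comment> \<open>The second term of the minimum enforces Q \<xi> \<le> 1, the range in which exp
    (- Q) \<le> 1 - Q / 2.\<close>
  define R where "R = min (1 / K) (1 / sqrt (qtrace Q))"
  have R: "0 < R" "R \<le> 1 / K" using K tr by (auto simp: R_def)
  \<comment> \<open>The mixture of 1 - Q / 2 and 1 equals 1 - ?p Q. Writing ?p Q as Q evaluated at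
    \<xi> times sqrt ?p makes it a quadratic form by \<open>qform_mult\<close>.\<close>
  let ?p = "exp (-1) / 2 :: real"
  have a1: "qform (\<lambda>\<xi>. Q (\<xi> * complex_of_real (sqrt ?p)))" by (rule qform_mult[OF Q(1)])
  have a2: "qtrace (\<lambda>\<xi>. Q (\<xi> * complex_of_real (sqrt ?p))) = ?p * qtrace Q" by (simp add: qform_mult(2)[OF Q(1)])
  have a3: "Q (\<xi> * complex_of_real (sqrt ?p)) = ?p * Q \<xi>" for \<xi>
  proof -
    obtain a b c where Qd: "\<And>\<xi>. Q \<xi> = a * (Re \<xi>)^2 + 2 * b * (Re \<xi> * Im \<xi>) + c * (Im \<xi>)^2"
      using Q(1) unfolding qform_def by metis
    have "sqrt ?p * sqrt ?p = ?p" by simp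
    then show ?thesis unfolding Qd by (simp add: power_mult_distrib) (simp add: algebra_simps add_divide_distrib)
  qed
  have a4: "kern \<rho> \<beta> \<xi> \<le> exp (- (?p * Q \<xi>))" if \<xi>: "norm \<xi> \<le> R" for \<xi>
  proof -
    have "Q \<xi> \<le> qtrace (\<lambda>\<zeta>. Q (\<zeta> * \<xi>))" using qform_nonneg[OF Q(1)] by (simp add: qtrace_def)
    also have "... = (norm \<xi>)^2 * qtrace Q" by (rule qform_mult(2)[OF Q(1)])
    also have "... \<le> (1 / sqrt (qtrace Q))^2 * qtrace Q" using \<xi> tr by (intro mult_right_mono power_mono) (auto simp: R_def)
    also have "... = 1" using tr by (simp add: power_divide)
    finally have Q1: "Q \<xi> \<le> 1" .
    have Q0: "0 \<le> Q \<xi>" by (rule qform_nonneg[OF Q(1)])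
    have "exp (- Q \<xi>) \<le> 1 - Q \<xi> / 2"
    proof -
      have "1 + Q \<xi> \<le> exp (Q \<xi>)" by (rule exp_ge_add_one_self)
      then have "exp (- Q \<xi>) \<le> 1 / (1 + Q \<xi>)" using Q0 by (simp add: exp_minus field_simps)
      also have "... \<le> 1 - Q \<xi> / 2"
      proof -
        have "Q \<xi> * Q \<xi> \<le> 1 * Q \<xi>" using Q0 Q1 by (intro mult_right_mono)
        then have "1 \<le> (1 - Q \<xi> / 2) * (1 + Q \<xi>)" by (simp add: algebra_simps)
        then show ?thesis using Q0 by (simp add: pos_divide_le_eq)
      qed
      finally show ?thesis .
    qed
    then have "norm (leaf_cf \<rho> \<beta> 1 \<xi>) \<le> 1 - Q \<xi> / 2" using Q(3)[of \<xi>] \<xi> R by (simp add: leaf_cf_def)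
    then have "kern \<rho> \<beta> \<xi> \<le> exp (-1) * (1 - Q \<xi> / 2) + (1 - exp (-1))" unfolding kern_def by (intro add_right_mono mult_left_mono) auto
    also have "... = 1 + (- (?p * Q \<xi>))" by (simp add: algebra_simps)
    also have "... \<le> exp (- (?p * Q \<xi>))" by (rule exp_ge_add_one_self)
    finally show ?thesis .
  qed
  show ?thesis
  proof (rule that[OF a1])
    show "0 < qtrace (\<lambda>\<xi>. Q (\<xi> * complex_of_real (sqrt ?p)))" unfolding a2 using tr by simp
    show "kern \<rho> \<beta> \<xi> \<le> exp (- Q (\<xi> * complex_of_real (sqrt ?p)))" if "norm \<xi> \<le> R" for \<xi>
      unfolding a3 using that by (rule a4)
  qed (rule R(1))
qed


lemma prod_leaves_Suc:
  "(\<Prod>p\<leftarrow>leaves T B \<rho> (Suc n) b (node (l, x) \<omega>0 \<omega>1). k (\<xi> * wt \<beta> p)) =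
    (if T < b + l then k (\<xi> * wt \<beta> (disp \<rho> (dispvar T B b l) x) :: complex) :: real
     else (\<Prod>p\<leftarrow>leaves T B \<rho> n (b + l) \<omega>0. k (\<xi> * wt \<beta> (disp \<rho> (dispvar T B b l) x) * wt \<beta> p)) *
       (\<Prod>p\<leftarrow>leaves T B \<rho> n (b + l) \<omega>1. k (\<xi> * wt \<beta> (disp \<rho> (dispvar T B b l) x) * wt \<beta> p)))"
  by (simp add: Let_def o_def wt_add mult.assoc)

lemma prod_list_nonneg_real: "(\<And>x. x \<in> set xs \<Longrightarrow> 0 \<le> f x) \<Longrightarrow> 0 \<le> (\<Prod>x\<leftarrow>xs. f x :: real)"
  by (induction xs) auto

text \<open>
  Freezing everything up to time \<open>t - 1\<close>, each particle alive then survives to time \<open>t\<close> with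
  probability \<open>1 / e\<close>, and in that case its displacement has an independent part of variance \<open>1\<close>.
\<close>

lemma norm_cf_part_le:
  assumes t: "profile t B \<rho>" and T: "profile (t - 1) B \<rho>" and b: "0 \<le> b" "b \<le> t - 1"
  shows "ennreal (norm (cf trees (part t B \<rho> \<beta> n b) \<xi>)) \<le>
    (\<integral>\<^sup>+\<omega>. ennreal (\<Prod>p\<leftarrow>leaves (t - 1) B \<rho> n b \<omega>. kern \<rho> \<beta> (\<xi> * wt \<beta> p)) \<partial>trees)"
  using b
proof (induction n arbitrary: b \<xi>)
  case 0
  interpret P: prob_space "trees" by (rule prob_space_tree)
  show ?case using P.norm_cf_le_1[of "\<lambda>_. 0"] P.emeasure_space_1 by (simp add: part_def[abs_def])
next
  case (Suc n)
  interpret t: profile t B \<rho> by fact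
  interpret T: profile "t - 1" B \<rho> by fact
  interpret P: prob_space "trees" by (rule prob_space_tree)
  interpret PP: pair_prob_space "trees" "trees" ..
  interpret G: prob_space gauss2 by (rule prob_space_gauss2)
  interpret E: prob_space expo by (rule prob_space_expo)
  note b = Suc.prems
  let ?T = "t - 1"
  let ?TT = "trees \<Otimes>\<^sub>M trees"
  let ?p = "part t B \<rho> \<beta> n"
  let ?w = "\<lambda>v x. wt \<beta> (disp \<rho> v x)"
  let ?k = "kern \<rho> \<beta>"
  let ?H = "\<lambda>n b \<xi> \<omega>. \<Prod>p\<leftarrow>leaves ?T B \<rho> n b \<omega>. ?k (\<xi> * wt \<beta> p)"
  have Hm [measurable]: "(\<lambda>\<omega>. ?H n b \<xi> \<omega>) \<in> borel_measurable trees" for n b \<xi>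
    by (rule T.measurable_prod_leaves) auto
  have H0: "0 \<le> ?H n b \<xi> \<omega>" for n b \<xi> \<omega> by (intro prod_list_nonneg_real kern_bounds)
  have dm [measurable]: "disp \<rho> v \<in> gauss2 \<rightarrow>\<^sub>M borel \<Otimes>\<^sub>M borel" for v
    using measurable_disp[of "\<lambda>_. v" gauss2 "\<lambda>x. x" \<rho>] by simp
  let ?f = "\<lambda>\<omega>. iexp (Re (\<xi> * part t B \<rho> \<beta> (Suc n) b \<omega>))"
  have intf: "integrable trees ?f" by (rule P.integrable_const_bound[of _ 1]) auto
  define Z where "Z m = (\<integral>y. ?f (node m (fst y) (snd y)) \<partial>?TT)" for m
  have Zi: "integrable mark Z" unfolding Z_def by (rule integral_tree_space(2)[OF intf])
  have cfZ: "cf trees (part t B \<rho> \<beta> (Suc n) b) \<xi> = (\<integral>l. \<integral>x. Z (l, x) \<partial>gauss2 \<partial>expo)"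
    unfolding cf_def integral_tree_space(1)[OF intf] Z_def[symmetric] by (rule integral_mark[OF Zi])
  have Z1: "Z (l, x) = iexp (Re (\<xi> * ?w (dispvar t B b l) x))" if "t < b + l" for l x
    using that PP.P.prob_space by (simp add: Z_def part_node space_pair_measure)
  have Z2: "Z (l, x) = cf trees (?p (b + l)) (\<xi> * ?w (dispvar t B b l) x) * cf trees (?p (b + l)) (\<xi> * ?w (dispvar t B b l) x)" if "\<not> t < b + l" for l x
  proof -
    let ?\<zeta> = "\<xi> * ?w (dispvar t B b l) x"
    have i: "has_bochner_integral trees (\<lambda>\<omega>. iexp (Re (?\<zeta> * ?p (b + l) \<omega>))) (cf trees (?p (b + l)) ?\<zeta>)"
      unfolding cf_def by (rule has_bochner_integral_integrable, rule P.integrable_const_bound[of _ 1]) auto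
    from has_bochner_integral_pair_mult[OF prob_space_tree prob_space_tree i i]
    have "(\<integral>y. iexp (Re (?\<zeta> * ?p (b + l) (fst y))) * iexp (Re (?\<zeta> * ?p (b + l) (snd y))) \<partial>?TT) = cf trees (?p (b + l)) ?\<zeta> * cf trees (?p (b + l)) ?\<zeta>"
      by (simp only: has_bochner_integral_iff)
    moreover have "?f (node (l, x) (fst y) (snd y)) = iexp (Re (?\<zeta> * ?p (b + l) (fst y))) * iexp (Re (?\<zeta> * ?p (b + l) (snd y)))" for y
      unfolding mult_exp_exp using that
      by (intro arg_cong[where f = exp]) (simp add: part_node mult.assoc[symmetric] distrib_left del: plus_complex.sel times_complex.sel, simp add: distrib_left)
    ultimately show ?thesis by (simp only: Z_def)
  qed
  have "ennreal (norm (cf trees (part t B \<rho> \<beta> (Suc n) b) \<xi>)) \<le> (\<integral>\<^sup>+l. ennreal (norm (\<integral>x. Z (l, x) \<partial>gauss2)) \<partial>expo)"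
    unfolding cfZ
  proof (rule integral_norm_bound_ennreal)
    interpret EG: pair_prob_space expo gauss2 ..
    show "integrable expo (\<lambda>l. \<integral>x. Z (l, x) \<partial>gauss2)" using EG.integrable_fst'[of Z] Zi by (simp add: mark_def)
  qed
  \<comment> \<open>Three cases for the root: dead by t - 1, where the recursion goes on; dead in
    the last unit of time, where the modulus is bounded by 1; alive at t, where one leaf remains,
    with one unit of variance more than at horizon t - 1.\<close>
  also have "... \<le> (\<integral>\<^sup>+l. (if ?T < b + l then indicator {?T - b<..t - b} l + indicator {t - b<..} l * ennreal (norm (leaf_cf \<rho> \<beta> (?T - B b + 1) \<xi>))
      else (\<integral>\<^sup>+x. ennreal (norm (Z (l, x))) \<partial>gauss2)) \<partial>expo)"
  proof (rule nn_integral_mono)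
    fix l
    interpret EG: pair_prob_space expo gauss2 ..
    have Zm: "(\<lambda>x. Z (l, x)) \<in> borel_measurable gauss2"
      using Zi by (intro measurable_compose[OF measurable_Pair1' borel_measurable_integrable]) (auto simp: mark_def)
    have Zb: "norm (Z (l, x)) \<le> 1" for x
    proof (cases "t < b + l")
      case False
      show ?thesis unfolding Z2[OF False] norm_mult by (intro mult_le_one P.norm_cf_le_1) auto
    qed (simp add: Z1)
    have Zint: "integrable gauss2 (\<lambda>x. Z (l, x))" by (rule G.integrable_const_bound[of _ 1]) (use Zb Zm in auto)
    consider "\<not> ?T < b + l" | "?T < b + l" "b + l \<le> t" | "t < b + l" by linarith
    then show "ennreal (norm (\<integral>x. Z (l, x) \<partial>gauss2)) \<le> (if ?T < b + l then indicator {?T - b<..t - b} l + indicator {t - b<..} l * ennreal (norm (leaf_cf \<rho> \<beta> (?T - B b + 1) \<xi>))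
      else (\<integral>\<^sup>+x. ennreal (norm (Z (l, x))) \<partial>gauss2))"
    proof cases
      case 1
      then show ?thesis using integral_norm_bound_ennreal[OF Zint] by simp
    next
      case 2
      have "norm (\<integral>x. Z (l, x) \<partial>gauss2) \<le> (\<integral>x. norm (Z (l, x)) \<partial>gauss2)" by (rule integral_norm_bound)
      also have "... \<le> (\<integral>x. 1 \<partial>gauss2)" by (intro integral_mono integrable_norm Zint Zb) auto
      finally have "ennreal (norm (\<integral>x. Z (l, x) \<partial>gauss2)) \<le> 1" using G.prob_space by (simp add: space_pair_measure)
      then show ?thesis using 2 by auto
    next
      case 3
      have "dispvar t B b l = ?T - B b + 1" using 3 by (simp add: dispvar_def)
      then have "(\<integral>x. Z (l, x) \<partial>gauss2) = leaf_cf \<rho> \<beta> (?T - B b + 1) \<xi>"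
        by (simp only: Z1[OF 3] leaf_cf_def cf_def)
      then show ?thesis using 3 by auto
    qed
  qed
  also have "... \<le> (\<integral>\<^sup>+l. \<integral>\<^sup>+x. (if ?T < b + l then ennreal (?k (\<xi> * ?w (dispvar ?T B b l) x))
      else (\<integral>\<^sup>+\<omega>. ennreal (?H n (b + l) (\<xi> * ?w (dispvar ?T B b l) x) \<omega>) \<partial>trees) * (\<integral>\<^sup>+\<omega>. ennreal (?H n (b + l) (\<xi> * ?w (dispvar ?T B b l) x) \<omega>) \<partial>trees)) \<partial>gauss2 \<partial>expo)"
    (is "_ \<le> (\<integral>\<^sup>+l. ?R l \<partial>expo)")
  proof -
    \<comment> \<open>\<open>\<Phi>\<close> averages the unit displacement over the leaf position at
      horizon t - 1; \<open>\<Psi>\<close> is the same average of the full kernel, which is what the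
      leaf contributes to the right-hand side.\<close>
    define \<Phi> where "\<Phi> = (\<integral>\<^sup>+x. ennreal (norm (leaf_cf \<rho> \<beta> 1 (\<xi> * ?w (?T - B b) x))) \<partial>gauss2)"
    define \<Psi> where "\<Psi> = (\<integral>\<^sup>+x. ennreal (?k (\<xi> * ?w (?T - B b) x)) \<partial>gauss2)"
    have \<Psi>: "\<Psi> = ennreal (exp (-1)) * \<Phi> + ennreal (1 - exp (-1))"
    proof -
      have "\<Psi> = (\<integral>\<^sup>+x. ennreal (exp (-1)) * ennreal (norm (leaf_cf \<rho> \<beta> 1 (\<xi> * ?w (?T - B b) x))) + ennreal (1 - exp (-1)) \<partial>gauss2)"
        unfolding \<Psi>_def kern_def by (intro nn_integral_cong) (simp add: ennreal_plus ennreal_mult)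
      also have "... = ennreal (exp (-1)) * \<Phi> + ennreal (1 - exp (-1))"
        unfolding \<Phi>_def using G.emeasure_space_1 by (subst nn_integral_add) (auto simp: nn_integral_cmult)
      finally show ?thesis .
    qed
    define I where "I l = (if ?T < b + l then 0 else (\<integral>\<^sup>+x. ennreal (norm (Z (l, x))) \<partial>gauss2))" for l
    have Im: "I \<in> borel_measurable expo"
    proof -
      have [measurable]: "Z \<in> borel_measurable (expo \<Otimes>\<^sub>M gauss2)" using Zi by (auto simp: mark_def)
      show ?thesis unfolding I_def[abs_def] by measurable
    qed
    have "(\<integral>\<^sup>+l. (if ?T < b + l then indicator {?T - b<..t - b} l + indicator {t - b<..} l * ennreal (norm (leaf_cf \<rho> \<beta> (?T - B b + 1) \<xi>))
      else (\<integral>\<^sup>+x. ennreal (norm (Z (l, x))) \<partial>gauss2)) \<partial>expo)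
      \<le> (\<integral>\<^sup>+l. I l + (indicator {?T - b<..t - b} l + indicator {t - b<..} l * \<Phi>) \<partial>expo)"
    proof (rule nn_integral_mono)
      fix l
      have "ennreal (norm (leaf_cf \<rho> \<beta> (?T - B b + 1) \<xi>)) \<le> \<Phi>"
        unfolding \<Phi>_def using T.B_le_T[of b] b by (intro leaf_cf_split) simp
      then show "(if ?T < b + l then indicator {?T - b<..t - b} l + indicator {t - b<..} l * ennreal (norm (leaf_cf \<rho> \<beta> (?T - B b + 1) \<xi>))
      else (\<integral>\<^sup>+x. ennreal (norm (Z (l, x))) \<partial>gauss2)) \<le> I l + (indicator {?T - b<..t - b} l + indicator {t - b<..} l * \<Phi>)"
        by (auto simp: I_def intro!: add_left_mono split: split_indicator)
    qed
    also have "... = (\<integral>\<^sup>+l. I l \<partial>expo) + (emeasure expo {?T - b<..t - b} + emeasure expo {t - b<..} * \<Phi>)"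
      using Im by (simp add: nn_integral_add nn_integral_multc)
    \<comment> \<open>Lack of memory: given survival to t - 1, the last unit of time is survived
      with probability 1 / e. These are the two coefficients of \<open>kern\<close>.\<close>
    also have "emeasure expo {?T - b<..t - b} + emeasure expo {t - b<..} * \<Phi> = (\<integral>\<^sup>+l. indicator {?T - b<..} l * \<Psi> \<partial>expo)"
    proof -
      have e: "exp (- (t - b)) = exp (- (?T - b)) * exp (-1)" by (simp add: mult_exp_exp)
      have m1: "emeasure expo {?T - b<..t - b} = ennreal (exp (- (?T - b)) * (1 - exp (-1)))"
        using measure_expo_Ioc[of "?T - b"] b by (simp add: E.emeasure_eq_measure e right_diff_distrib mult_exp_exp)
      have m2: "emeasure expo {t - b<..} = ennreal (exp (- (?T - b)) * exp (-1))"
        unfolding e[symmetric] by (rule emeasure_expo_gt) (use b in simp)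
      have m3: "emeasure expo {?T - b<..} = ennreal (exp (- (?T - b)))" using emeasure_expo_gt[of "?T - b"] b by simp
      have "(\<integral>\<^sup>+l. indicator {?T - b<..} l * \<Psi> \<partial>expo) = ennreal (exp (- (?T - b))) * (ennreal (exp (-1)) * \<Phi> + ennreal (1 - exp (-1)))"
        by (simp add: nn_integral_multc m3 \<Psi>)
      also have "... = ennreal (exp (- (?T - b)) * (1 - exp (-1))) + ennreal (exp (- (?T - b)) * exp (-1)) * \<Phi>"
        by (simp add: distrib_left ennreal_mult'' ennreal_mult mult.assoc add.commute)
      finally show ?thesis by (simp only: m1 m2)
    qed
    also have "(\<integral>\<^sup>+l. I l \<partial>expo) + (\<integral>\<^sup>+l. indicator {?T - b<..} l * \<Psi> \<partial>expo) = (\<integral>\<^sup>+l. I l + indicator {?T - b<..} l * \<Psi> \<partial>expo)"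
      using Im by (intro nn_integral_add[symmetric]) auto
    also have "... \<le> (\<integral>\<^sup>+l. ?R l \<partial>expo)"
    proof (rule nn_integral_mono_AE, use AE_expo in eventually_elim)
      fix l :: real assume l: "0 \<le> l"
      show "I l + indicator {?T - b<..} l * \<Psi> \<le> ?R l"
      proof (cases "?T < b + l")
        case True
        then have d: "dispvar ?T B b l = ?T - B b" by (simp add: dispvar_def)
        have "I l + indicator {?T - b<..} l * \<Psi> \<le> \<Psi>" using True by (auto simp: I_def indicator_def)
        then show ?thesis unfolding d using True by (simp only: \<Psi>_def if_True)
      next
        case False
        then have d: "dispvar ?T B b l = dispvar t B b l" by (simp add: dispvar_def)
        have bl: "0 \<le> b + l" "b + l \<le> ?T" "\<not> t < b + l" using False l b by auto
        have "I l = (\<integral>\<^sup>+x. ennreal (norm (Z (l, x))) \<partial>gauss2)" using False by (simp add: I_def)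
        also have "... \<le> (\<integral>\<^sup>+x. (\<integral>\<^sup>+\<omega>. ennreal (?H n (b + l) (\<xi> * ?w (dispvar t B b l) x) \<omega>) \<partial>trees) * (\<integral>\<^sup>+\<omega>. ennreal (?H n (b + l) (\<xi> * ?w (dispvar t B b l) x) \<omega>) \<partial>trees) \<partial>gauss2)"
          unfolding Z2[OF bl(3)] norm_mult using Suc.IH[OF bl(1,2)] by (intro nn_integral_mono) (auto simp: ennreal_mult intro!: mult_mono)
        finally show ?thesis using False d by simp
      qed
    qed
    finally show ?thesis .
  qed
  also have "... = (\<integral>\<^sup>+\<omega>. ennreal (?H (Suc n) b \<xi> \<omega>) \<partial>trees)"
  proof -
    define h where "h \<omega> = ennreal (?H (Suc n) b \<xi> \<omega>)" for \<omega>
    have hm [measurable]: "h \<in> borel_measurable trees"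
      unfolding h_def[abs_def] by (rule measurable_compose[OF Hm]) simp
    let ?J = "\<lambda>m. \<integral>\<^sup>+\<omega>0. \<integral>\<^sup>+\<omega>1. h (node m \<omega>0 \<omega>1) \<partial>trees \<partial>trees"
    have Jm: "?J \<in> borel_measurable mark" by measurable
    have Jeq: "?J (l, x) = (if ?T < b + l then ennreal (?k (\<xi> * ?w (dispvar ?T B b l) x))
      else (\<integral>\<^sup>+\<omega>. ennreal (?H n (b + l) (\<xi> * ?w (dispvar ?T B b l) x) \<omega>) \<partial>trees) * (\<integral>\<^sup>+\<omega>. ennreal (?H n (b + l) (\<xi> * ?w (dispvar ?T B b l) x) \<omega>) \<partial>trees))" for l x
      unfolding h_def prod_leaves_Suc using P.emeasure_space_1 H0
      by (auto simp: ennreal_mult nn_integral_cmult nn_integral_multc)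
    have "(\<integral>\<^sup>+\<omega>. h \<omega> \<partial>trees) = (\<integral>\<^sup>+m. ?J m \<partial>mark)"
      by (rule nn_integral_tree_space[OF prob_space_mark hm])
    also have "... = (\<integral>\<^sup>+l. \<integral>\<^sup>+x. ?J (l, x) \<partial>gauss2 \<partial>expo)" by (rule nn_integral_mark[OF Jm])
    also have "... = (\<integral>\<^sup>+l. ?R l \<partial>expo)" by (simp only: Jeq)
    finally show ?thesis unfolding h_def by (rule sym)
  qed
  finally show ?case .
qed

text \<open>Near \<gamma> T there are about exp (T (1 - \<gamma>^2 / 2)) particles of weight exp
  (\<sigma> \<gamma> T), and independent phases add up like a square root. The resulting rate has
  its free maximum at \<gamma> = 2 \<sigma>; when that leaves the range \<gamma>^2 < 2, the end
  point of absolute value sqrt 2 is approached from inside.\<close>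

lemma fluct_rate_approx:
  assumes "0 < (\<epsilon> :: real)"
  obtains \<gamma> where "\<gamma>^2 < 2" "fluct_rate \<sigma> - \<epsilon> \<le> \<sigma> * \<gamma> + 1 / 2 - \<gamma>\<^sup>2 / 4"
proof (cases "2 * \<sigma>^2 < 1")
  case True
  then show ?thesis using assms by (intro that[of "2 * \<sigma>"]) (auto simp: fluct_rate_def power2_eq_square)
next
  case False
  define s where "s = min 1 (\<epsilon> / (\<bar>\<sigma>\<bar> + 1))"
  have s: "0 < s" "s \<le> 1" using assms by (auto simp: s_def)
  have "s \<le> \<epsilon> / (\<bar>\<sigma>\<bar> + 1)" by (simp add: s_def)
  then have "(\<bar>\<sigma>\<bar> + 1) * s \<le> \<epsilon>" by (simp add: pos_le_divide_eq add_nonneg_pos mult.commute)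
  then have s\<epsilon>: "\<bar>\<sigma>\<bar> * s \<le> \<epsilon>" using s by (simp add: distrib_right)
  have sq: "1 < sqrt 2" "(sqrt 2)^2 = (2 :: real)" by simp_all
  have \<sigma>: "\<sigma> \<noteq> 0" using False by auto
  define \<gamma> where "\<gamma> = sgn \<sigma> * (sqrt 2 - s)"
  have "\<gamma>^2 = (sqrt 2 - s)^2" using \<sigma> by (simp add: \<gamma>_def power_mult_distrib sgn_if)
  then have \<gamma>2: "\<gamma>^2 = 2 - 2 * (sqrt 2 * s) + s * s" by (simp add: power2_diff power2_eq_square[of s])
  have ss: "s * s \<le> sqrt 2 * s" "0 < sqrt 2 * s" using s order_trans[OF s(2) less_imp_le[OF sq(1)]] by (auto intro!: mult_right_mono)
  have "\<sigma> * \<gamma> = \<bar>\<sigma>\<bar> * (sqrt 2 - s)" by (simp add: \<gamma>_def abs_sgn mult.assoc)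
  then have \<sigma>\<gamma>: "\<sigma> * \<gamma> = sqrt 2 * \<bar>\<sigma>\<bar> - \<bar>\<sigma>\<bar> * s" by (simp add: algebra_simps)
  have fr: "fluct_rate \<sigma> = sqrt 2 * \<bar>\<sigma>\<bar>"
  proof (cases "2 * \<sigma>^2 \<le> 1")
    case True
    then have e: "\<sigma>^2 = 1 / 2" using False by simp
    have "sqrt 2 * \<bar>\<sigma>\<bar> = sqrt 2 * sqrt (\<sigma>^2)" by simp
    also have "... = sqrt (2 * \<sigma>^2)" by (rule real_sqrt_mult[symmetric])
    finally show ?thesis using e by (simp add: fluct_rate_def)
  qed (simp add: fluct_rate_def)
  have g: "\<gamma>^2 \<le> 2 - sqrt 2 * s" using \<gamma>2 ss(1) by linarith
  then have "\<gamma>^2 < 2" using ss(2) by simp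
  moreover from this have "\<gamma>^2 / 4 \<le> 1 / 2" by simp
  ultimately show ?thesis using \<sigma>\<gamma> s\<epsilon> by (intro that[of \<gamma>]) (simp_all add: fr)
qed

text \<open>Places the real parameter \<gamma> where \<open>lower_mean\<close> applies. For 2
  \<gamma>^2 > 1 the gap is half of the square of \<bar>\<gamma>\<bar> - sqrt 2.\<close>

lemma fluct_rate_less:
  assumes "\<gamma>^2 < 2"
  shows "fluct_rate \<gamma> < 1 + \<gamma>^2 / 2"
proof (cases "2 * \<gamma>^2 \<le> 1")
  case False
  have "\<bar>\<gamma>\<bar> \<noteq> sqrt 2" using assms by (metis less_irrefl power2_abs real_sqrt_pow2_iff zero_le_numeral)
  then have "0 < (\<bar>\<gamma>\<bar> - sqrt 2)^2" by simp
  then have "2 * (sqrt 2 * \<bar>\<gamma>\<bar>) < \<gamma>^2 + 2" by (simp add: power2_diff mult.assoc mult.left_commute mult.commute)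
  then show ?thesis using False by (simp add: fluct_rate_def)
qed (simp add: fluct_rate_def)

lemma exp_decay_small:
  assumes "0 < (k :: real)" "0 < \<epsilon>"
  obtains T0 where "\<And>T. T0 \<le> T \<Longrightarrow> c * exp (- k * T) \<le> \<epsilon>"
proof -
  have "((\<lambda>T. c * exp (- k * T)) \<longlongrightarrow> 0) at_top" using assms(1) by real_asymp
  then have "\<forall>\<^sub>F T in at_top. c * exp (- k * T) < \<epsilon>" using assms(2) by (auto dest: order_tendstoD)
  then show ?thesis using that unfolding eventually_at_top_linorder by (metis less_imp_le)
qed

text \<open>Exponential Chebyshev inequality, entry by entry: outside the window one of the tilts
  \<gamma> + h and \<gamma> - h, with its prefactor, dominates. On average both corrections are
  smaller than the main sum by exp (- h^2 T / 2).\<close>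

lemma window_sum_ge:
  fixes xs :: "(real \<times> real) list"
  assumes h: "0 < h"
  shows "(\<Sum>p\<leftarrow>xs. exp (\<gamma> * fst p)) \<le> (\<Sum>p\<leftarrow>filter (\<lambda>p. \<bar>fst p - \<gamma> * T\<bar> \<le> h * T) xs. exp (\<gamma> * fst p))
    + exp (- h * (\<gamma> + h) * T) * (\<Sum>p\<leftarrow>xs. exp ((\<gamma> + h) * fst p))
    + exp (h * (\<gamma> - h) * T) * (\<Sum>p\<leftarrow>xs. exp ((\<gamma> - h) * fst p))"
proof (induction xs)
  case (Cons p xs)
  let ?a = "exp (- h * (\<gamma> + h) * T) * exp ((\<gamma> + h) * fst p)"
  let ?b = "exp (h * (\<gamma> - h) * T) * exp ((\<gamma> - h) * fst p)"
  have "exp (\<gamma> * fst p) \<le> (if \<bar>fst p - \<gamma> * T\<bar> \<le> h * T then exp (\<gamma> * fst p) else 0) + ?a + ?b"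
  proof (cases "\<bar>fst p - \<gamma> * T\<bar> \<le> h * T")
    case False
    then consider "\<gamma> * T + h * T \<le> fst p" | "fst p \<le> \<gamma> * T - h * T" by linarith
    then show ?thesis
    proof cases
      case 1
      from mult_left_mono[OF this, of h] have "exp (\<gamma> * fst p) \<le> ?a" using h by (simp add: mult_exp_exp algebra_simps)
      moreover have "0 \<le> ?b" by simp
      ultimately show ?thesis using False by (simp only: if_False)
    next
      case 2
      from mult_left_mono[OF this, of h] have "exp (\<gamma> * fst p) \<le> ?b" using h by (simp add: mult_exp_exp algebra_simps)
      moreover have "0 \<le> ?a" by simp
      ultimately show ?thesis using False by (simp only: if_False)
    qed
  qed simp
  with Cons show ?case by (cases "\<bar>fst p - \<gamma> * T\<bar> \<le> h * T") (simp_all only: list.map sum_list.Cons filter.simps if_True if_False distrib_left)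
qed simp

lemma prod_list_le_exp:
  fixes k :: "complex \<Rightarrow> real"
  assumes "\<And>p. p \<in> set xs \<Longrightarrow> P p \<Longrightarrow> k (\<xi> * w p) \<le> exp (- Q (\<xi> * w p))" and "\<And>\<xi>. 0 \<le> k \<xi>" "\<And>\<xi>. k \<xi> \<le> 1"
  shows "(\<Prod>p\<leftarrow>xs. k (\<xi> * w p)) \<le> exp (- (\<Sum>p\<leftarrow>filter P xs. Q (\<xi> * w p)))"
  using assms(1)
proof (induction xs)
  case (Cons p xs)
  then have IH: "(\<Prod>p\<leftarrow>xs. k (\<xi> * w p)) \<le> exp (- (\<Sum>p\<leftarrow>filter P xs. Q (\<xi> * w p)))" by simp
  have n: "0 \<le> (\<Prod>p\<leftarrow>xs. k (\<xi> * w p))" using assms(2) by (rule prod_list_nonneg_real)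
  show ?case
  proof (cases "P p")
    case True
    have "k (\<xi> * w p) * (\<Prod>p\<leftarrow>xs. k (\<xi> * w p)) \<le> exp (- Q (\<xi> * w p)) * exp (- (\<Sum>p\<leftarrow>filter P xs. Q (\<xi> * w p)))"
      using True by (intro mult_mono Cons.prems IH n) auto
    then show ?thesis using True by (simp add: mult_exp_exp)
  next
    case False
    have "k (\<xi> * w p) * (\<Prod>p\<leftarrow>xs. k (\<xi> * w p)) \<le> 1 * exp (- (\<Sum>p\<leftarrow>filter P xs. Q (\<xi> * w p)))"
      by (intro mult_mono assms IH n) auto
    then show ?thesis using False by simp
  qed
qed simp

lemma qform_sum_list:
  assumes "qform Q"
  shows "qform (\<lambda>\<xi>. \<Sum>p\<leftarrow>xs. Q (\<xi> * w p))" "qtrace (\<lambda>\<xi>. \<Sum>p\<leftarrow>xs. Q (\<xi> * w p)) = qtrace Q * (\<Sum>p\<leftarrow>xs. (norm (w p))^2)"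
proof -
  show "qform (\<lambda>\<xi>. \<Sum>p\<leftarrow>xs. Q (\<xi> * w p))"
  proof (induction xs)
    case (Cons p xs)
    then show ?case using qform_add[OF qform_mult(1)[OF assms, of "w p"] Cons.IH] by simp
  qed (simp add: qform_zero)
  show "qtrace (\<lambda>\<xi>. \<Sum>p\<leftarrow>xs. Q (\<xi> * w p)) = qtrace Q * (\<Sum>p\<leftarrow>xs. (norm (w p))^2)"
  proof (induction xs)
    case (Cons p xs)
    then show ?case using qform_mult(2)[OF assms, of "w p"] by (simp add: qtrace_def algebra_simps)
  qed (simp add: qtrace_def)
qed

lemma prod_list_le_1_real:
  "(\<And>x. x \<in> set xs \<Longrightarrow> 0 \<le> f x \<and> f x \<le> 1) \<Longrightarrow> (\<Prod>x\<leftarrow>xs. f x :: real) \<le> 1"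
  by (induction xs) (auto intro!: mult_le_one prod_list_nonneg_real)

text \<open>
  Most of the sum of \<open>exp (\<gamma> * x)\<close> comes from the window \<open>\<bar>x - \<gamma> * T\<bar> \<le> h * T\<close>; there are so
  many particles in it that their independent last displacements smear out the partition function.
\<close>

lemma window_smoothing:
  fixes xs :: "(real \<times> real) list"
  assumes Q: "qform Q" "0 < qtrace Q" and R: "0 < R" and k: "\<And>\<xi>. norm \<xi> \<le> R \<Longrightarrow> kern \<rho> \<beta> \<xi> \<le> exp (- Q \<xi>)"
    and T: "0 \<le> T" and h: "0 < h" "\<bar>2 * Re \<beta> - \<gamma>\<bar> * h \<le> e" "e + \<bar>Re \<beta>\<bar> * h + d \<le> 1 / 2 - \<gamma>\<^sup>2 / 4"
    and \<delta>: "0 < \<delta>"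
    and win: "\<delta> * exp (T * (1 + \<gamma>^2 / 2)) \<le> (\<Sum>p\<leftarrow>filter (\<lambda>p. \<bar>fst p - \<gamma> * T\<bar> \<le> h * T) xs. exp (\<gamma> * fst p))"
    and r: "r = exp (T * (Re \<beta> * \<gamma> + 1 / 2 - \<gamma>\<^sup>2 / 4 - e))"
  shows "(\<integral>\<^sup>+g. ennreal (\<Prod>p\<leftarrow>xs. kern \<rho> \<beta> (Complex (fst g) (snd g) / complex_of_real r * wt \<beta> p)) \<partial>gauss2)
    \<le> ennreal (1 / sqrt (qtrace Q * \<delta>) * exp (- (e / 2) * T) + 2 / R^2 * exp (- (2 * d) * T))"
proof -
  define \<sigma> where "\<sigma> = Re \<beta>"
  define a where "a = \<sigma> * \<gamma> + 1 / 2 - \<gamma>\<^sup>2 / 4"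
  define W where "W = filter (\<lambda>p. \<bar>fst p - \<gamma> * T\<bar> \<le> h * T) xs"
  \<comment> \<open>Upper bound on the weights in the window; the decay of the kernel is thus
    available for norm \<xi> \<le> R / m.\<close>
  define m where "m = exp (T * (\<sigma> * \<gamma> + \<bar>\<sigma>\<bar> * h))"
  have W: "\<bar>c * fst p - c * (\<gamma> * T)\<bar> \<le> \<bar>c\<bar> * (h * T)" if "p \<in> set W" for p c
  proof -
    have "\<bar>c * (fst p - \<gamma> * T)\<bar> \<le> \<bar>c\<bar> * (h * T)" unfolding abs_mult using that by (intro mult_left_mono) (auto simp: W_def)
    then show ?thesis by (simp add: right_diff_distrib)
  qed
  have kern: "kern \<rho> \<beta> (\<xi> * wt \<beta> p) \<le> exp (- Q (\<xi> * wt \<beta> p))" if p: "p \<in> set W" and \<xi>: "norm \<xi> \<le> R / m" for p \<xi>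
  proof (rule k)
    have "\<sigma> * fst p \<le> T * (\<sigma> * \<gamma> + \<bar>\<sigma>\<bar> * h)" using W[OF p, of \<sigma>] by (simp add: abs_le_iff algebra_simps)
    then have "norm (wt \<beta> p) \<le> m" by (simp add: norm_wt m_def \<sigma>_def)
    then have "norm (\<xi> * wt \<beta> p) \<le> R / m * m" unfolding norm_mult using R by (intro mult_mono \<xi>) (auto simp: m_def)
    then show "norm (\<xi> * wt \<beta> p) \<le> R" by (simp add: m_def)
  qed
  define Q' where "Q' \<xi> = (\<Sum>p\<leftarrow>W. Q (\<xi> * wt \<beta> p))" for \<xi>
  have Q': "qform Q'" "qtrace Q' = qtrace Q * (\<Sum>p\<leftarrow>W. (norm (wt \<beta> p))^2)"
    unfolding Q'_def[abs_def] using qform_sum_list[OF Q(1)] by auto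
  \<comment> \<open>Lower bound for the trace, growing like exp (T (2 a - e)). Its root exceeds the
    radius r, which is exp (T (a - e)), by exp (e T / 2): the first error term.\<close>
  define \<theta> where "\<theta> = qtrace Q * \<delta> * exp (T * (2 * a - e))"
  have \<theta>: "0 < \<theta>" using Q \<delta> by (simp add: \<theta>_def)
  have tr: "\<theta> \<le> qtrace Q'"
  proof -
    \<comment> \<open>In the window exp ((2 \<sigma> - \<gamma>) x) is constant up to a factor exp
      (e T). This turns the sum of squared weights into the sum of exp (\<gamma> x), which
      \<open>win\<close> controls.\<close>
    define c where "c = exp (T * ((2 * \<sigma> - \<gamma>) * \<gamma> - e))"
    have pw: "c * exp (\<gamma> * fst p) \<le> (norm (wt \<beta> p))^2" if p: "p \<in> set W" for p
    proof -
      have "\<bar>2 * \<sigma> - \<gamma>\<bar> * (h * T) \<le> e * T" using mult_right_mono[OF h(2) T] by (simp add: \<sigma>_def mult.assoc)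
      with W[OF p, of "2 * \<sigma> - \<gamma>"] have "(2 * \<sigma> - \<gamma>) * (\<gamma> * T) - e * T \<le> (2 * \<sigma> - \<gamma>) * fst p" by linarith
      then have "T * ((2 * \<sigma> - \<gamma>) * \<gamma> - e) + \<gamma> * fst p \<le> 2 * (\<sigma> * fst p)" by (simp add: algebra_simps)
      then show ?thesis by (simp add: c_def norm_wt \<sigma>_def mult_exp_exp flip: exp_double)
    qed
    have "\<theta> = qtrace Q * (c * (\<delta> * exp (T * (1 + \<gamma>^2 / 2))))"
      by (simp add: \<theta>_def c_def a_def mult_exp_exp algebra_simps power2_eq_square)
    also have "... \<le> qtrace Q * (c * (\<Sum>p\<leftarrow>W. exp (\<gamma> * fst p)))"
      using win Q by (intro mult_left_mono) (auto simp: c_def W_def)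
    also have "... \<le> qtrace Q'"
      unfolding Q' sum_list_const_mult[symmetric] using pw Q by (intro mult_left_mono sum_list_mono) auto
    finally show ?thesis .
  qed
  define f where "f \<xi> = (\<Prod>p\<leftarrow>xs. kern \<rho> \<beta> (\<xi> * wt \<beta> p))" for \<xi>
  have fm: "f \<in> borel_measurable borel" unfolding f_def[abs_def] by (induction xs) auto
  have f1: "f \<xi> \<le> 1" for \<xi> unfolding f_def by (rule prod_list_le_1_real) (auto simp: kern_bounds)
  have fQ: "f \<xi> \<le> exp (- Q' \<xi>)" if "norm \<xi> \<le> R / m" for \<xi>
    unfolding f_def Q'_def W_def by (rule prod_list_le_exp) (use kern[OF _ that] in \<open>auto simp: W_def kern_bounds\<close>)
  have r0: "0 < r" and rm: "0 < R / m" using R by (simp_all add: r m_def)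
  have "(\<integral>\<^sup>+g. ennreal (f (Complex (fst g) (snd g) / complex_of_real r)) \<partial>gauss2) \<le> ennreal (r / sqrt \<theta> + 2 / (R / m * r)^2)"
    by (rule gauss_anticoncentration[OF fm f1 Q'(1) \<theta> tr r0 rm fQ])
  also have "... \<le> ennreal (1 / sqrt (qtrace Q * \<delta>) * exp (- (e / 2) * T) + 2 / R^2 * exp (- (2 * d) * T))"
  proof (intro ennreal_leI add_mono)
    have "sqrt \<theta> = sqrt (qtrace Q * \<delta>) * exp (T * (a - e / 2))"
    proof -
      have "exp (T * (2 * a - e)) = (exp (T * (a - e / 2)))^2" by (simp add: algebra_simps flip: exp_double)
      then show ?thesis by (simp add: \<theta>_def real_sqrt_mult)
    qed
    moreover have "r = exp (T * (a - e / 2)) * exp (- (e / 2) * T)"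
      by (simp add: r a_def \<sigma>_def mult_exp_exp algebra_simps)
    ultimately show "r / sqrt \<theta> \<le> 1 / sqrt (qtrace Q * \<delta>) * exp (- (e / 2) * T)" by simp
    have "r / m = exp (T * (1 / 2 - \<gamma>\<^sup>2 / 4 - e - \<bar>\<sigma>\<bar> * h))"
      by (simp add: r m_def \<sigma>_def exp_diff[symmetric] algebra_simps)
    also have "... \<ge> exp (T * d)" using h(3) T by (simp add: \<sigma>_def mult_left_mono)
    finally have "(exp (T * d))^2 \<le> (r / m)^2" by (intro power_mono) auto
    moreover have "exp (- (2 * d) * T) = 1 / (exp (T * d))^2" by (simp add: exp_minus field_simps flip: exp_double)
    moreover have "2 / (R / m * r)^2 = 2 / R^2 * (1 / (r / m)^2)" by (simp add: power_mult_distrib power_divide)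
    ultimately show "2 / (R / m * r)^2 \<le> 2 / R^2 * exp (- (2 * d) * T)"
      using R r0 by (auto intro!: mult_left_mono divide_left_mono simp: m_def)
  qed
  finally show ?thesis by (simp only: f_def)
qed

text \<open>\<open>norm_cf_part_le\<close> passes to horizon t - 1 with the same \<open>B\<close>.
  There the mass in the window comes from \<open>lower_mean\<close> for the real parameter \<gamma>,
  and \<open>window_smoothing\<close> bounds the integral of the product of kernels over the
  Gaussian frequencies.\<close>

theorem lower_fluct:
  assumes \<beta>: "\<beta> \<noteq> 0" and \<rho>: "\<rho>^2 \<le> 1" and \<epsilon>: "0 < \<epsilon>" and \<eta>: "0 < \<eta>"
  shows "\<exists>C. \<forall>t B. profile t B \<rho> \<longrightarrow> profile (t - 1) B \<rho> \<longrightarrow> C \<le> t \<longrightarrow> flat_on B C \<longrightarrow>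
    (\<exists>n0. \<forall>n\<ge>n0. measure trees {\<omega>. norm (part t B \<rho> \<beta> n 0 \<omega>) \<le> exp (t * (fluct_rate (Re \<beta>) - \<epsilon>))} \<le> \<eta>)"
proof -
  interpret P: prob_space "trees" by (rule prob_space_tree)
  interpret G: prob_space gauss2 by (rule prob_space_gauss2)
  interpret PG: pair_prob_space "trees" gauss2 ..
  define \<sigma> l where "\<sigma> = Re \<beta>" and "l = fluct_rate \<sigma>"
  have "0 < \<epsilon> / 4" using \<epsilon> by simp
  from fluct_rate_approx[OF this, of \<sigma>] obtain \<gamma> where \<gamma>: "\<gamma>^2 < 2" "l - \<epsilon> / 4 \<le> \<sigma> * \<gamma> + 1 / 2 - \<gamma>\<^sup>2 / 4"
    unfolding l_def by blast
  obtain Q R where Q: "qform Q" "0 < qtrace Q" and R: "0 < R" and k: "\<And>\<xi>. norm \<xi> \<le> R \<Longrightarrow> kern \<rho> \<beta> \<xi> \<le> exp (- Q \<xi>)"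
    by (rule kern_decay[OF \<beta> \<rho>]) blast
  \<comment> \<open>A quarter of half the growth rate of the particle number near \<gamma> T. The
    quantities e, \<bar>Re \<beta>\<bar> h and d consume at most one quarter each.\<close>
  define d where "d = (1 / 2 - \<gamma>\<^sup>2 / 4) / 4"
  define e where "e = min (\<epsilon> / 4) d"
  define h where "h = min (e / (\<bar>2 * \<sigma> - \<gamma>\<bar> + 1)) (d / (\<bar>\<sigma>\<bar> + 1))"
  have d: "0 < d" using \<gamma> by (simp add: d_def)
  have e: "0 < e" "e \<le> \<epsilon> / 4" "e \<le> d" using d \<epsilon> by (auto simp: e_def)
  have h: "0 < h" using d e by (auto simp: h_def intro!: divide_pos_pos)
  have aux: "c * h \<le> y" if "h \<le> y / (c + 1)" "0 \<le> c" for c y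
  proof -
    have "h * (c + 1) \<le> y" using that by (simp add: pos_le_divide_eq add_nonneg_pos)
    then show ?thesis using h by (simp add: distrib_left mult.commute)
  qed
  have h1: "\<bar>2 * Re \<beta> - \<gamma>\<bar> * h \<le> e" unfolding \<sigma>_def[symmetric] by (rule aux) (auto simp: h_def)
  have "\<bar>\<sigma>\<bar> * h \<le> d" by (rule aux) (auto simp: h_def)
  moreover have "1 / 2 - \<gamma>\<^sup>2 / 4 = 4 * d" by (simp add: d_def)
  ultimately have h2: "e + \<bar>Re \<beta>\<bar> * h + d \<le> 1 / 2 - \<gamma>\<^sup>2 / 4" using e(3) d by (simp add: \<sigma>_def)
  let ?g = "complex_of_real \<gamma>"
  have "\<exists>\<delta>>0. \<exists>C'. \<forall>T B \<rho>. profile T B \<rho> \<longrightarrow> C' \<le> T \<longrightarrow> flat_on B C' \<longrightarrow>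
      (\<exists>n0. \<forall>n\<ge>n0. measure trees {\<omega>. norm (part T B \<rho> ?g n 0 \<omega>) \<le> \<delta> * profile.full_mean T B ?g 0} \<le> \<eta> / 8)"
    using \<gamma>(1) \<eta> fluct_rate_less[OF \<gamma>(1)] by (intro lower_mean) auto
  then obtain \<delta> C1 where \<delta>: "0 < \<delta>" and C1: "\<And>T B. profile T B \<rho> \<Longrightarrow> C1 \<le> T \<Longrightarrow> flat_on B C1 \<Longrightarrow>
      \<exists>n0. \<forall>n\<ge>n0. measure trees {\<omega>. norm (part T B \<rho> ?g n 0 \<omega>) \<le> \<delta> * profile.full_mean T B ?g 0} \<le> \<eta> / 8"
    by blast
  have pos: "0 < h^2 / 2" "0 < e / 2" "0 < 2 * d" "0 < \<eta> / 16" "0 < \<eta> / 8" using h e d \<eta> by auto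
  obtain T1 where T1: "\<And>T. T1 \<le> T \<Longrightarrow> 4 / \<delta> * exp (- (h^2 / 2) * T) \<le> \<eta> / 16"
    by (rule exp_decay_small[OF pos(1,4)]) blast
  obtain T2 where T2: "\<And>T. T2 \<le> T \<Longrightarrow> 1 / sqrt (qtrace Q * (\<delta> / 2)) * exp (- (e / 2) * T) \<le> \<eta> / 8"
    by (rule exp_decay_small[OF pos(2,5)]) blast
  obtain T3 where T3: "\<And>T. T3 \<le> T \<Longrightarrow> 2 / R^2 * exp (- (2 * d) * T) \<le> \<eta> / 8"
    by (rule exp_decay_small[OF pos(3,5)]) blast
  \<comment> \<open>The entry 2 l / \<epsilon> pays for the change of horizon, t (l - \<epsilon>)
    \<le> T (l - \<epsilon> / 2). The final 1 turns t \<ge> C into lower bounds on T = t -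
    1.\<close>
  define C where "C = Max {C1, T1, T2, T3, 2 * l / \<epsilon>, 0} + 1"
  have "C1 \<le> C - 1" "T1 \<le> C - 1" "T2 \<le> C - 1" "T3 \<le> C - 1" "2 * l / \<epsilon> \<le> C - 1" "0 \<le> C - 1" by (simp_all add: C_def)
  note C = this
  show ?thesis
  proof (intro exI[of _ C] allI impI)
    fix t B
    assume t: "profile t B \<rho>" "profile (t - 1) B \<rho>" "C \<le> t" "flat_on B C"
    interpret t: profile t B \<rho> by (rule t)
    interpret T: profile "t - 1" B \<rho> by (rule t)
    define T where "T = t - 1"
    have T: "C1 \<le> T" "T1 \<le> T" "T2 \<le> T" "T3 \<le> T" "2 * l / \<epsilon> \<le> T" "0 \<le> T" using C t(3) by (simp_all add: T_def)
    have "flat_on B C1" using C by (intro flat_on_mono[OF t(4)]) simp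
    from C1[OF t(2) _ this] T obtain n0 where
      n0: "\<And>n. n0 \<le> n \<Longrightarrow> measure trees {\<omega>. norm (part T B \<rho> ?g n 0 \<omega>) \<le> \<delta> * T.full_mean ?g 0} \<le> \<eta> / 8"
      unfolding T_def by blast
    let ?m = "exp (T * (1 + \<gamma>^2 / 2))"
    have fm: "T.full_mean ?g 0 = ?m" unfolding T.full_mean_def by (simp add: T_def algebra_simps)
    define r where "r = exp (T * (Re \<beta> * \<gamma> + 1 / 2 - \<gamma>\<^sup>2 / 4 - e))"
    have r: "exp (t * (l - \<epsilon>)) \<le> r"
    proof -
      have "2 * l \<le> T * \<epsilon>" using T(5) \<epsilon> by (simp add: pos_divide_le_eq)
      then have "2 * (t * (l - \<epsilon>)) \<le> T * (2 * l - \<epsilon>)" using \<epsilon> by (simp add: T_def algebra_simps)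
      moreover have "T * (2 * l - \<epsilon>) = 2 * (T * (l - \<epsilon> / 2))" by (simp add: right_diff_distrib)
      ultimately have "t * (l - \<epsilon>) \<le> T * (l - \<epsilon> / 2)" by simp
      also have "... \<le> T * (Re \<beta> * \<gamma> + 1 / 2 - \<gamma>\<^sup>2 / 4 - e)" using \<gamma>(2) e T(6) by (intro mult_left_mono) (auto simp: \<sigma>_def)
      finally show ?thesis by (simp add: r_def)
    qed
    show "\<exists>n0. \<forall>n\<ge>n0. measure trees {\<omega>. norm (part t B \<rho> \<beta> n 0 \<omega>) \<le> exp (t * (fluct_rate (Re \<beta>) - \<epsilon>))} \<le> \<eta>"
    proof (intro exI[of _ n0] allI impI)
      fix n assume n: "n0 \<le> n"
      let ?L = "leaves T B \<rho> n 0"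
      let ?Z = "\<lambda>\<gamma>. part T B \<rho> (complex_of_real \<gamma>) n 0"
      have Zm [measurable]: "?Z \<gamma> \<in> borel_measurable trees" for \<gamma>
        unfolding T_def by (rule T.measurable_part_0)
      have nZ: "norm (?Z \<gamma> \<omega>) = (\<Sum>p\<leftarrow>?L \<omega>. exp (\<gamma> * fst p))" for \<gamma> \<omega>
        unfolding T_def by (simp add: T.part_of_real T.sum_list_exp_nonneg)
      \<comment> \<open>Too little mass at \<gamma>, or too much at one of the neighbouring tilts.
        Off this event the corrections in \<open>window_sum_ge\<close> take \<delta> / 4 each and
        leave \<delta> / 2 in the window.\<close>
      define bad where "bad = {\<omega>. norm (?Z \<gamma> \<omega>) \<le> \<delta> * ?m}
        \<union> {\<omega>. \<delta> / 4 * ?m * exp (h * (\<gamma> + h) * T) \<le> norm (?Z (\<gamma> + h) \<omega>)}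
        \<union> {\<omega>. \<delta> / 4 * ?m * exp (- h * (\<gamma> - h) * T) \<le> norm (?Z (\<gamma> - h) \<omega>)}"
      have sets: "{\<omega>. norm (?Z \<gamma> \<omega>) \<le> c} \<in> sets trees" "{\<omega>. c \<le> norm (?Z \<gamma> \<omega>)} \<in> sets trees" for c \<gamma>
      proof -
        have "{\<omega> \<in> space trees. norm (?Z \<gamma> \<omega>) \<le> c} \<in> sets trees"
          "{\<omega> \<in> space trees. c \<le> norm (?Z \<gamma> \<omega>)} \<in> sets trees" by measurable
        then show "{\<omega>. norm (?Z \<gamma> \<omega>) \<le> c} \<in> sets trees" "{\<omega>. c \<le> norm (?Z \<gamma> \<omega>)} \<in> sets trees" by simp_all
      qed
      have cancel: "exp (- u) * y \<le> K" if "y \<le> K * exp u" for y K u :: real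
        using that by (simp add: exp_minus field_simps)
      have bads [measurable]: "bad \<in> sets trees" unfolding bad_def by (intro sets.Un sets)
      have mk: "measure trees {\<omega>. \<delta> / 4 * ?m * c \<le> norm (?Z y \<omega>)} \<le> \<eta> / 16"
        if c: "exp (T * (1 + y^2 / 2)) = ?m * c * exp (- (h^2 / 2) * T)" "0 < c" for c y
      proof -
        have "measure trees {\<omega> \<in> space trees. \<delta> / 4 * ?m * c \<le> norm (?Z y \<omega>)}
            \<le> exp (T * (1 + y^2 / 2)) / (\<delta> / 4 * ?m * c) powr 1"
          using T.nn_integral_part_of_real[of y n] \<delta> c by (intro P.markov_powr) (auto simp: T_def)
        also have "... = 4 / \<delta> * exp (- (h^2 / 2) * T)" using \<delta> c by (simp add: c(1))
        also have "... \<le> \<eta> / 16" by (rule T1[OF T(2)])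
        finally show ?thesis by simp
      qed
      have "measure trees bad \<le> \<eta> / 8 + \<eta> / 16 + \<eta> / 16"
        unfolding bad_def
      proof (intro order_trans[OF measure_Un_le] add_mono sets sets.Un)
        show "measure trees {\<omega>. norm (?Z \<gamma> \<omega>) \<le> \<delta> * ?m} \<le> \<eta> / 8" using n0[OF n] by (simp only: fm)
        show "measure trees {\<omega>. \<delta> / 4 * ?m * exp (h * (\<gamma> + h) * T) \<le> norm (?Z (\<gamma> + h) \<omega>)} \<le> \<eta> / 16"
          by (rule mk) (simp_all add: mult_exp_exp algebra_simps power2_eq_square)
        show "measure trees {\<omega>. \<delta> / 4 * ?m * exp (- h * (\<gamma> - h) * T) \<le> norm (?Z (\<gamma> - h) \<omega>)} \<le> \<eta> / 16"
          by (rule mk) (simp_all add: mult_exp_exp field_simps power2_eq_square)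
      qed
      then have badm: "emeasure trees bad \<le> ennreal (\<eta> / 4)" by (simp add: P.emeasure_eq_measure ennreal_leI)
      define f where "f \<omega> \<xi> = (\<Prod>p\<leftarrow>?L \<omega>. kern \<rho> \<beta> (\<xi> * wt \<beta> p))" for \<omega> \<xi>
      let ?\<xi> = "\<lambda>g. Complex (fst g) (snd g) / complex_of_real r"
      have Cm [measurable]: "(\<lambda>g. Complex (fst g) (snd g)) \<in> borel_measurable (borel \<Otimes>\<^sub>M borel)"
        unfolding complex_eq by measurable
      have fm [measurable]: "(\<lambda>x. f (fst x) (?\<xi> (snd x))) \<in> borel_measurable (trees \<Otimes>\<^sub>M gauss2)"
        unfolding f_def T_def by (rule T.measurable_prod_leaves) measurable
      have good: "(\<integral>\<^sup>+g. ennreal (f \<omega> (?\<xi> g)) \<partial>gauss2) \<le> ennreal (\<eta> / 4)" if \<omega>: "\<omega> \<notin> bad" for \<omega>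
      proof -
        have "\<delta> / 2 * ?m \<le> (\<Sum>p\<leftarrow>filter (\<lambda>p. \<bar>fst p - \<gamma> * T\<bar> \<le> h * T) (?L \<omega>). exp (\<gamma> * fst p))"
        proof -
          have "\<delta> * ?m \<le> norm (?Z \<gamma> \<omega>)" using \<omega> by (simp add: bad_def)
          moreover have "exp (- h * (\<gamma> + h) * T) * norm (?Z (\<gamma> + h) \<omega>) \<le> \<delta> / 4 * ?m"
          proof -
            have "norm (?Z (\<gamma> + h) \<omega>) \<le> \<delta> / 4 * ?m * exp (h * (\<gamma> + h) * T)" using \<omega> by (simp add: bad_def)
            from cancel[OF this] show ?thesis by simp
          qed
          moreover have "exp (h * (\<gamma> - h) * T) * norm (?Z (\<gamma> - h) \<omega>) \<le> \<delta> / 4 * ?m"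
          proof -
            have "norm (?Z (\<gamma> - h) \<omega>) \<le> \<delta> / 4 * ?m * exp (- h * (\<gamma> - h) * T)" using \<omega> by (simp add: bad_def)
            from cancel[OF this] show ?thesis by simp
          qed
          moreover note window_sum_ge[OF h, of \<gamma> "?L \<omega>" T, folded nZ]
          ultimately show ?thesis by linarith
        qed
        then have "(\<integral>\<^sup>+g. ennreal (f \<omega> (?\<xi> g)) \<partial>gauss2) \<le> ennreal (1 / sqrt (qtrace Q * (\<delta> / 2)) * exp (- (e / 2) * T) + 2 / R^2 * exp (- (2 * d) * T))"
          unfolding f_def using \<delta> by (intro window_smoothing[OF Q R k T(6) h h1 h2 _ _ r_def]) auto
        also have "... \<le> ennreal (\<eta> / 8 + \<eta> / 8)" using T by (intro ennreal_leI add_mono T2 T3)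
        finally show ?thesis by simp
      qed
      have r0: "0 < r" by (simp add: r_def)
      have "ennreal (measure trees {\<omega> \<in> space trees. norm (part t B \<rho> \<beta> n 0 \<omega>) \<le> r})
          \<le> 2 * (\<integral>\<^sup>+g. ennreal (norm (cf trees (part t B \<rho> \<beta> n 0) (?\<xi> g))) \<partial>gauss2)"
        by (rule P.small_ball_le[OF t.measurable_part_0 r0])
      also have "... \<le> 2 * (\<integral>\<^sup>+g. \<integral>\<^sup>+\<omega>. ennreal (f \<omega> (?\<xi> g)) \<partial>trees \<partial>gauss2)"
        unfolding f_def T_def using T(6) by (intro mult_left_mono nn_integral_mono norm_cf_part_le t) (auto simp: T_def)
      also have "(\<integral>\<^sup>+g. \<integral>\<^sup>+\<omega>. ennreal (f \<omega> (?\<xi> g)) \<partial>trees \<partial>gauss2) = (\<integral>\<^sup>+\<omega>. \<integral>\<^sup>+g. ennreal (f \<omega> (?\<xi> g)) \<partial>gauss2 \<partial>trees)"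
        using PG.Fubini'[of "\<lambda>\<omega> g. ennreal (f \<omega> (?\<xi> g))"] fm by (simp add: split_beta')
      also have "... \<le> (\<integral>\<^sup>+\<omega>. ennreal (\<eta> / 4) + indicator bad \<omega> \<partial>trees)"
      proof (rule nn_integral_mono)
        fix \<omega>
        have "(\<integral>\<^sup>+g. ennreal (f \<omega> (?\<xi> g)) \<partial>gauss2) \<le> (\<integral>\<^sup>+g. ennreal 1 \<partial>gauss2)"
          unfolding f_def by (intro nn_integral_mono ennreal_leI prod_list_le_1_real) (auto simp: kern_bounds)
        also have "... = 1" using G.emeasure_space_1 by simp
        finally show "(\<integral>\<^sup>+g. ennreal (f \<omega> (?\<xi> g)) \<partial>gauss2) \<le> ennreal (\<eta> / 4) + indicator bad \<omega>"
          using good[of \<omega>] by (cases "\<omega> \<in> bad") (auto intro: add_increasing)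
      qed
      also have "... = ennreal (\<eta> / 4) + emeasure trees bad"
        using P.emeasure_space_1 by (simp add: nn_integral_add)
      also have "... \<le> ennreal (\<eta> / 4) + ennreal (\<eta> / 4)" by (rule add_left_mono[OF badm])
      finally have "ennreal (measure trees {\<omega>. norm (part t B \<rho> \<beta> n 0 \<omega>) \<le> r}) \<le> 2 * (ennreal (\<eta> / 4) + ennreal (\<eta> / 4))"
        by (simp add: mult_left_mono)
      also have "... = ennreal \<eta>" using \<eta> by (simp flip: ennreal_plus ennreal_numeral ennreal_mult)
      finally have le: "measure trees {\<omega>. norm (part t B \<rho> \<beta> n 0 \<omega>) \<le> r} \<le> \<eta>" using \<eta> by simp
      have "measure trees {\<omega>. norm (part t B \<rho> \<beta> n 0 \<omega>) \<le> exp (t * (l - \<epsilon>))} \<le> measure trees {\<omega>. norm (part t B \<rho> \<beta> n 0 \<omega>) \<le> r}"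
      proof (rule P.finite_measure_mono)
        show "{\<omega>. norm (part t B \<rho> \<beta> n 0 \<omega>) \<le> r} \<in> sets trees"
        proof -
          note [measurable] = t.measurable_part_0[of \<beta> n]
          have "{\<omega> \<in> space trees. norm (part t B \<rho> \<beta> n 0 \<omega>) \<le> r} \<in> sets trees" by measurable
          then show ?thesis by simp
        qed
      qed (use r in auto)
      with le show "measure trees {\<omega>. norm (part t B \<rho> \<beta> n 0 \<omega>) \<le> exp (t * (fluct_rate (Re \<beta>) - \<epsilon>))} \<le> \<eta>"
        by (simp add: l_def \<sigma>_def)
    qed
  qed
qed

section \<open>Gaussian vectors\<close>

text \<open>Divided by their common integral, which \<open>eq\<close> at s = 0 identifies, the
  weights become probability densities, and the one-dimensional uniqueness theorem applies. If that
  integral is 0, both sides vanish.\<close>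

lemma weighted_Levy_uniqueness:
  fixes W :: "'a \<Rightarrow> real" and V :: "'b \<Rightarrow> real"
  assumes M: "prob_space M" and N: "prob_space N"
    and [measurable]: "W \<in> borel_measurable M" "X \<in> borel_measurable M" "V \<in> borel_measurable N" "Y \<in> borel_measurable N"
    and W: "\<And>x. 0 \<le> W x \<and> W x \<le> C" and V: "\<And>y. 0 \<le> V y \<and> V y \<le> C"
    and eq: "\<And>s. (\<integral>x. W x *\<^sub>R iexp (s * X x) \<partial>M) = (\<integral>y. V y *\<^sub>R iexp (s * Y y) \<partial>N)"
    and A [measurable]: "A \<in> sets borel"
  shows "(\<integral>x. W x * indicator A (X x) \<partial>M) = (\<integral>y. V y * indicator A (Y y) \<partial>N)"
proof -
  interpret M: prob_space M by fact
  interpret N: prob_space N by fact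
  have Wi: "integrable M W" by (rule M.integrable_const_bound[of _ C]) (use W in auto)
  have Vi: "integrable N V" by (rule N.integrable_const_bound[of _ C]) (use V in auto)
  define c where "c = (\<integral>x. W x \<partial>M)"
  have c: "c = (\<integral>y. V y \<partial>N)" using eq[of 0] by (simp add: c_def scaleR_conv_of_real)
  have c0: "0 \<le> c" unfolding c_def using W by (intro integral_nonneg_AE) auto
  show ?thesis
  proof (cases "c = 0")
    case True
    have z: "(\<integral>x. W x * indicator A (X x) \<partial>M) = 0" if "prob_space M" "W \<in> borel_measurable M" "X \<in> borel_measurable M"
      "integrable M W" "\<And>x. 0 \<le> W x \<and> W x \<le> C" "(\<integral>x. W x \<partial>M) = 0" for M :: "'c measure" and W X
    proof -
      note [measurable] = that(2,3)
      have "integrable M (\<lambda>x. W x * indicator A (X x))"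
        by (rule Bochner_Integration.integrable_bound[OF that(4)]) (auto split: split_indicator)
      then have "(\<integral>x. W x * indicator A (X x) \<partial>M) \<le> (\<integral>x. W x \<partial>M)"
        using that(4,5) by (intro integral_mono) (auto split: split_indicator)
      moreover have "0 \<le> (\<integral>x. W x * indicator A (X x) \<partial>M)" using that by (intro integral_nonneg_AE) auto
      ultimately show ?thesis using that by simp
    qed
    show ?thesis using z[of M W X] z[of N V Y] True c by (simp add: c_def Wi Vi W V M N)
  next
    case False
    then have c1: "0 < c" using c0 by simp
    have D: "prob_space (density M (\<lambda>x. ennreal (W x / c)))" if "prob_space M" "W \<in> borel_measurable M" "integrable M W"
      "\<And>x. 0 \<le> W x \<and> W x \<le> C" "(\<integral>x. W x \<partial>M) = c" for M :: "'c measure" and W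
    proof (rule prob_spaceI)
      have "(\<integral>\<^sup>+x. ennreal (W x / c) \<partial>M) = ennreal (\<integral>x. W x / c \<partial>M)"
        using that c1 by (intro nn_integral_eq_integral) auto
      also have "... = 1" using that c1 by simp
      finally show "emeasure (density M (\<lambda>x. ennreal (W x / c))) (space (density M (\<lambda>x. ennreal (W x / c)))) = 1"
        using that by (simp add: emeasure_density cong: nn_integral_cong)
    qed
    let ?DM = "density M (\<lambda>x. ennreal (W x / c))"
    let ?DN = "density N (\<lambda>x. ennreal (V x / c))"
    interpret DM: prob_space ?DM using W by (intro D) (auto simp: M Wi c_def)
    interpret DN: prob_space ?DN using V by (intro D) (auto simp: N Vi c)
    have chM: "char (distr ?DM borel X) s = (\<integral>x. W x *\<^sub>R iexp (s * X x) \<partial>M) / c" for s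
    proof -
      have "char (distr ?DM borel X) s = (\<integral>x. (W x / c) *\<^sub>R iexp (s * X x) \<partial>M)"
        using W c1 unfolding char_def by (subst integral_distr) (auto simp: integral_density)
      then show ?thesis by (simp add: scaleR_conv_of_real)
    qed
    have chN: "char (distr ?DN borel Y) s = (\<integral>x. V x *\<^sub>R iexp (s * Y x) \<partial>N) / c" for s
    proof -
      have "char (distr ?DN borel Y) s = (\<integral>x. (V x / c) *\<^sub>R iexp (s * Y x) \<partial>N)"
        using V c1 unfolding char_def by (subst integral_distr) (auto simp: integral_density)
      then show ?thesis by (simp add: scaleR_conv_of_real)
    qed
    have "distr ?DM borel X = distr ?DN borel Y"
    proof (rule Levy_uniqueness)
      show "real_distribution (distr ?DM borel X)" by (rule DM.real_distribution_distr) simp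
      show "real_distribution (distr ?DN borel Y)" by (rule DN.real_distribution_distr) simp
      show "char (distr ?DM borel X) = char (distr ?DN borel Y)" by (rule ext) (simp only: chM chN eq)
    qed
    then have "(\<integral>x. (indicator A x :: real) \<partial>distr ?DM borel X) = (\<integral>x. (indicator A x :: real) \<partial>distr ?DN borel Y)" by simp
    moreover have "(\<integral>x. (indicator A x :: real) \<partial>distr ?DM borel X) = (\<integral>x. (W x / c) *\<^sub>R indicator A (X x) \<partial>M)"
      using W c1 by (subst integral_distr) (auto simp: integral_density)
    moreover have "(\<integral>x. (indicator A x :: real) \<partial>distr ?DN borel Y) = (\<integral>x. (V x / c) *\<^sub>R indicator A (Y x) \<partial>N)"
      using V c1 by (subst integral_distr) (auto simp: integral_density)
    ultimately have "(\<integral>x. (W x / c) *\<^sub>R (indicator A (X x) :: real) \<partial>M) = (\<integral>x. (V x / c) *\<^sub>R (indicator A (Y x) :: real) \<partial>N)" by (simp only:)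
    then show ?thesis using c1 by simp
  qed
qed

text \<open>
  The coordinates are turned one by one from exponentials into indicators; the weights
  \<open>1\<close>, \<open>1 + cos \<theta>\<close> and \<open>1 + sin \<theta>\<close> are nonnegative and span the real and imaginary part
  of the remaining exponential \<open>iexp \<theta>\<close>.
\<close>

lemma char_indicator_prod:
  fixes X :: "'i \<Rightarrow> 'a \<Rightarrow> real" and Y :: "'i \<Rightarrow> 'b \<Rightarrow> real"
  assumes M: "prob_space M" and N: "prob_space N" and I: "finite I"
    and Xm: "\<And>i. i \<in> I \<Longrightarrow> X i \<in> borel_measurable M" and Ym: "\<And>i. i \<in> I \<Longrightarrow> Y i \<in> borel_measurable N"
    and eq: "\<And>a. (\<integral>x. iexp (\<Sum>i\<in>I. a i * X i x) \<partial>M) = (\<integral>y. iexp (\<Sum>i\<in>I. a i * Y i y) \<partial>N)"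
    and J: "J \<subseteq> I" and A: "\<And>i. A i \<in> sets borel"
  shows "(\<integral>x. (\<Prod>j\<in>J. indicator (A j) (X j x)) *\<^sub>R iexp (\<Sum>i\<in>I - J. a i * X i x) \<partial>M) =
    (\<integral>y. (\<Prod>j\<in>J. indicator (A j) (Y j y)) *\<^sub>R iexp (\<Sum>i\<in>I - J. a i * Y i y) \<partial>N)"
  using finite_subset[OF J I] J
proof (induction J arbitrary: a rule: finite_induct)
  case empty
  then show ?case using eq by simp
next
  case (insert k J)
  interpret M: prob_space M by fact
  interpret N: prob_space N by fact
  have k: "k \<in> I" "J \<subseteq> I" using insert.prems by auto
  define w v where "w x = (\<Prod>j\<in>J. indicator (A j) (X j x) :: real)" and "v y = (\<Prod>j\<in>J. indicator (A j) (Y j y) :: real)" for x y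
  define \<theta> \<phi> where "\<theta> x = (\<Sum>i\<in>I - insert k J. a i * X i x)" and "\<phi> y = (\<Sum>i\<in>I - insert k J. a i * Y i y)" for x y
  note [measurable] = A
  have [measurable]: "X k \<in> borel_measurable M" "Y k \<in> borel_measurable N" using Xm Ym k by auto
  have [measurable]: "w \<in> borel_measurable M" "v \<in> borel_measurable N"
    unfolding w_def[abs_def] v_def[abs_def] using Xm Ym k by (auto intro!: borel_measurable_prod measurable_compose[OF Xm] measurable_compose[OF Ym])
  have [measurable]: "\<theta> \<in> borel_measurable M" "\<phi> \<in> borel_measurable N"
    unfolding \<theta>_def[abs_def] \<phi>_def[abs_def] using Xm Ym k by (auto intro!: borel_measurable_sum borel_measurable_times)
  have w: "0 \<le> w x \<and> w x \<le> 1" and v: "0 \<le> v y \<and> v y \<le> 1" for x y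
    unfolding w_def v_def by (auto intro!: prod_nonneg prod_le_1)
  have S: "I - J = insert k (I - insert k J)" using k insert.hyps by auto
  \<comment> \<open>The induction hypothesis with coefficient \<open>s\<close> at \<open>k\<close>
    and the remaining coefficients scaled by \<open>c\<close>; the values 0, 1 and -1 of c are
    needed.\<close>
  have H: "(\<integral>x. w x *\<^sub>R iexp (c * \<theta> x + s * X k x) \<partial>M) = (\<integral>y. v y *\<^sub>R iexp (c * \<phi> y + s * Y k y) \<partial>N)" for c s
  proof -
    let ?a = "\<lambda>i. if i = k then s else c * a i"
    have 1: "(\<Sum>i\<in>I - J. ?a i * Z i) = c * (\<Sum>i\<in>I - insert k J. a i * Z i) + s * Z k" for Z :: "'i \<Rightarrow> real"
    proof -
      have "(\<Sum>i\<in>I - insert k J. ?a i * Z i) = c * (\<Sum>i\<in>I - insert k J. a i * Z i)"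
        unfolding sum_distrib_left by (rule sum.cong) (auto simp: mult.assoc)
      then show ?thesis unfolding S using I by simp
    qed
    show ?thesis using insert.IH[OF k(2), of ?a] unfolding 1 w_def v_def \<theta>_def \<phi>_def by (simp only:)
  qed
  have iM: "integrable M (\<lambda>x. w x *\<^sub>R iexp (c * \<theta> x + s * X k x))" for c s
    by (rule M.integrable_const_bound[of _ 1]) (use w in auto)
  have iN: "integrable N (\<lambda>x. v x *\<^sub>R iexp (c * \<phi> x + s * Y k x))" for c s
    by (rule N.integrable_const_bound[of _ 1]) (use v in auto)
  \<comment> \<open>Euler's formulas, written with real weights: each nonnegative weight is a
    combination of the three scalings provided by \<open>H\<close>.\<close>
  have ex: "(W * (1 + cos t)) *\<^sub>R iexp r = W *\<^sub>R iexp (0 * t + r) + (1 / 2) * (W *\<^sub>R iexp (1 * t + r)) + (1 / 2) * (W *\<^sub>R iexp (- 1 * t + r))"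
    "(W * (1 + sin t)) *\<^sub>R iexp r = W *\<^sub>R iexp (0 * t + r) + (- \<i> / 2) * (W *\<^sub>R iexp (1 * t + r)) + (\<i> / 2) * (W *\<^sub>R iexp (- 1 * t + r))" for W t r :: real
    by (simp_all add: complex_eq_iff cos_add sin_add cos_diff sin_diff add_divide_distrib diff_divide_distrib Re_exp Im_exp algebra_simps)
  have 0: "(\<integral>x. w x * indicator (A k) (X k x) \<partial>M) = (\<integral>y. v y * indicator (A k) (Y k y) \<partial>N)"
    using H[of 0] by (intro weighted_Levy_uniqueness[OF M N _ _ _ _ w v]) (auto simp: A)
  have c: "(\<integral>x. (w x * (1 + cos (\<theta> x))) * indicator (A k) (X k x) \<partial>M) = (\<integral>y. (v y * (1 + cos (\<phi> y))) * indicator (A k) (Y k y) \<partial>N)"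
  proof (rule weighted_Levy_uniqueness[OF M N])
    have b: "0 \<le> 1 + cos t" "1 + cos t \<le> 2" for t :: real using cos_ge_minus_one[of t] cos_le_one[of t] by linarith+
    show "0 \<le> w x * (1 + cos (\<theta> x)) \<and> w x * (1 + cos (\<theta> x)) \<le> 1 * 2" for x using w[of x] b[of "\<theta> x"] by (intro conjI mult_mono mult_nonneg_nonneg) auto
    show "0 \<le> v x * (1 + cos (\<phi> x)) \<and> v x * (1 + cos (\<phi> x)) \<le> 1 * 2" for x using v[of x] b[of "\<phi> x"] by (intro conjI mult_mono mult_nonneg_nonneg) auto
    fix s
    show "(\<integral>x. (w x * (1 + cos (\<theta> x))) *\<^sub>R iexp (s * X k x) \<partial>M) = (\<integral>y. (v y * (1 + cos (\<phi> y))) *\<^sub>R iexp (s * Y k y) \<partial>N)"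
      unfolding ex by (simp only: Bochner_Integration.integral_add Bochner_Integration.integrable_add integrable_mult_right integral_mult_right_zero iM iN H)
  qed (auto simp: A)
  have s: "(\<integral>x. (w x * (1 + sin (\<theta> x))) * indicator (A k) (X k x) \<partial>M) = (\<integral>y. (v y * (1 + sin (\<phi> y))) * indicator (A k) (Y k y) \<partial>N)"
  proof (rule weighted_Levy_uniqueness[OF M N])
    have b: "0 \<le> 1 + sin t" "1 + sin t \<le> 2" for t :: real using sin_ge_minus_one[of t] sin_le_one[of t] by linarith+
    show "0 \<le> w x * (1 + sin (\<theta> x)) \<and> w x * (1 + sin (\<theta> x)) \<le> 1 * 2" for x using w[of x] b[of "\<theta> x"] by (intro conjI mult_mono mult_nonneg_nonneg) auto
    show "0 \<le> v x * (1 + sin (\<phi> x)) \<and> v x * (1 + sin (\<phi> x)) \<le> 1 * 2" for x using v[of x] b[of "\<phi> x"] by (intro conjI mult_mono mult_nonneg_nonneg) auto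
    fix s
    show "(\<integral>x. (w x * (1 + sin (\<theta> x))) *\<^sub>R iexp (s * X k x) \<partial>M) = (\<integral>y. (v y * (1 + sin (\<phi> y))) *\<^sub>R iexp (s * Y k y) \<partial>N)"
      unfolding ex by (simp only: Bochner_Integration.integral_add Bochner_Integration.integrable_add integrable_mult_right integral_mult_right_zero iM iN H)
  qed (auto simp: A)
  have split: "(\<integral>x. (w x * indicator B (Z x)) *\<^sub>R iexp (\<theta> x) \<partial>M) =
      complex_of_real ((\<integral>x. (w x * (1 + cos (\<theta> x))) * indicator B (Z x) \<partial>M) - (\<integral>x. w x * indicator B (Z x) \<partial>M)) +
      \<i> * complex_of_real ((\<integral>x. (w x * (1 + sin (\<theta> x))) * indicator B (Z x) \<partial>M) - (\<integral>x. w x * indicator B (Z x) \<partial>M))"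
    if M: "prob_space M" and [measurable]: "w \<in> borel_measurable M" "Z \<in> borel_measurable M" "\<theta> \<in> borel_measurable M" "B \<in> sets borel"
      and w: "\<And>x. 0 \<le> w x \<and> w x \<le> 1"
    for M :: "'c measure" and w Z \<theta> and B :: "real set"
  proof -
    interpret P: prob_space M by fact
    have i: "integrable M (\<lambda>x. w x * indicator B (Z x))" "integrable M (\<lambda>x. w x * indicator B (Z x) * cos (\<theta> x))" "integrable M (\<lambda>x. w x * indicator B (Z x) * sin (\<theta> x))"
    proof -
      have "\<bar>w x * indicator B (Z x)\<bar> \<le> 1" for x using w[of x] by (auto split: split_indicator)
      moreover from this have "\<bar>w x * indicator B (Z x) * cos (\<theta> x)\<bar> \<le> 1" "\<bar>w x * indicator B (Z x) * sin (\<theta> x)\<bar> \<le> 1" for x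
        by (subst abs_mult, auto intro!: mult_le_one)+
      ultimately show "integrable M (\<lambda>x. w x * indicator B (Z x))" "integrable M (\<lambda>x. w x * indicator B (Z x) * cos (\<theta> x))" "integrable M (\<lambda>x. w x * indicator B (Z x) * sin (\<theta> x))"
        by (auto intro!: P.integrable_const_bound[of _ 1])
    qed
    have "(\<integral>x. (w x * indicator B (Z x)) *\<^sub>R iexp (\<theta> x) \<partial>M) = (\<integral>x. complex_of_real (w x * indicator B (Z x) * cos (\<theta> x)) + \<i> * complex_of_real (w x * indicator B (Z x) * sin (\<theta> x)) \<partial>M)"
      by (intro Bochner_Integration.integral_cong refl) (simp add: complex_eq_iff Re_exp Im_exp)
    also have "... = complex_of_real (\<integral>x. w x * indicator B (Z x) * cos (\<theta> x) \<partial>M) + \<i> * complex_of_real (\<integral>x. w x * indicator B (Z x) * sin (\<theta> x) \<partial>M)"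
      by (simp only: Bochner_Integration.integral_add[OF integrable_of_real[OF i(2)] integrable_mult_right[OF integrable_of_real[OF i(3)]]]
        integral_mult_right_zero integral_complex_of_real)
    also have "(\<integral>x. w x * indicator B (Z x) * cos (\<theta> x) \<partial>M) = (\<integral>x. (w x * (1 + cos (\<theta> x))) * indicator B (Z x) \<partial>M) - (\<integral>x. w x * indicator B (Z x) \<partial>M)"
    proof -
      have "(\<lambda>x. (w x * (1 + cos (\<theta> x))) * indicator B (Z x)) = (\<lambda>x. w x * indicator B (Z x) + w x * indicator B (Z x) * cos (\<theta> x))"
        by (auto simp: algebra_simps)
      then show ?thesis using i by simp
    qed
    also have "(\<integral>x. w x * indicator B (Z x) * sin (\<theta> x) \<partial>M) = (\<integral>x. (w x * (1 + sin (\<theta> x))) * indicator B (Z x) \<partial>M) - (\<integral>x. w x * indicator B (Z x) \<partial>M)"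
    proof -
      have "(\<lambda>x. (w x * (1 + sin (\<theta> x))) * indicator B (Z x)) = (\<lambda>x. w x * indicator B (Z x) + w x * indicator B (Z x) * sin (\<theta> x))"
        by (auto simp: algebra_simps)
      then show ?thesis using i by simp
    qed
    finally show ?thesis .
  qed
  have p: "(\<Prod>j\<in>insert k J. indicator (A j) (X j x)) = w x * indicator (A k) (X k x)" for x
    using insert.hyps by (simp add: w_def mult.commute)
  have p': "(\<Prod>j\<in>insert k J. indicator (A j) (Y j x)) = v x * indicator (A k) (Y k x)" for x
    using insert.hyps by (simp add: v_def mult.commute)
  have 1: "(\<integral>x. (w x * indicator (A k) (X k x)) *\<^sub>R iexp (\<theta> x) \<partial>M) = (\<integral>x. (v x * indicator (A k) (Y k x)) *\<^sub>R iexp (\<phi> x) \<partial>N)"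
    using split[of M w "X k" \<theta> "A k"] split[of N v "Y k" \<phi> "A k"] w v by (simp only: 0 c s) (simp add: M N A)
  show ?case unfolding p p' \<theta>_def[symmetric] \<phi>_def[symmetric] by (rule 1)
qed

text \<open>With all coordinates turned into indicators, \<open>char_indicator_prod\<close> gives
  equality on rectangles, and these determine a finite measure on a finite product.\<close>

theorem char_uniqueness_finite:
  fixes X :: "'i \<Rightarrow> 'a \<Rightarrow> real" and Y :: "'i \<Rightarrow> 'b \<Rightarrow> real"
  assumes M: "prob_space M" and N: "prob_space N" and I: "finite I"
    and Xm: "\<And>i. i \<in> I \<Longrightarrow> X i \<in> borel_measurable M" and Ym: "\<And>i. i \<in> I \<Longrightarrow> Y i \<in> borel_measurable N"
    and eq: "\<And>a. (\<integral>x. iexp (\<Sum>i\<in>I. a i * X i x) \<partial>M) = (\<integral>y. iexp (\<Sum>i\<in>I. a i * Y i y) \<partial>N)"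
  shows "distr M (\<Pi>\<^sub>M i\<in>I. borel) (\<lambda>x. \<lambda>i\<in>I. X i x) = distr N (\<Pi>\<^sub>M i\<in>I. borel) (\<lambda>y. \<lambda>i\<in>I. Y i y)"
proof (rule measure_eqI_PiM_finite[OF I, of _ "\<lambda>_. borel" _ "\<lambda>_. space (\<Pi>\<^sub>M i\<in>I. borel)"])
  interpret M: prob_space M by fact
  interpret N: prob_space N by fact
  have [measurable]: "(\<lambda>x. \<lambda>i\<in>I. X i x) \<in> M \<rightarrow>\<^sub>M (\<Pi>\<^sub>M i\<in>I. borel)" "(\<lambda>x. \<lambda>i\<in>I. Y i x) \<in> N \<rightarrow>\<^sub>M (\<Pi>\<^sub>M i\<in>I. borel)"
    using Xm Ym by (auto intro: measurable_restrict)
  fix A :: "'i \<Rightarrow> real set" assume A: "\<And>i. i \<in> I \<Longrightarrow> A i \<in> sets borel"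
  define A' where "A' i = (if i \<in> I then A i else {})" for i
  have A': "A' i \<in> sets borel" for i using A by (auto simp: A'_def)
  have S: "Pi\<^sub>E I A \<in> sets (\<Pi>\<^sub>M i\<in>I. borel)" using I A by (intro sets_PiM_I_finite) auto
  have ind: "measure (distr M (\<Pi>\<^sub>M i\<in>I. borel) (\<lambda>x. \<lambda>i\<in>I. X i x)) (Pi\<^sub>E I A) = (\<integral>x. (\<Prod>j\<in>I. indicator (A' j) (X j x)) \<partial>M)"
    if "prob_space M" "(\<lambda>x. \<lambda>i\<in>I. X i x) \<in> M \<rightarrow>\<^sub>M (\<Pi>\<^sub>M i\<in>I. borel)" for M :: "'c measure" and X :: "'i \<Rightarrow> 'c \<Rightarrow> real"
  proof -
    have "measure (distr M (\<Pi>\<^sub>M i\<in>I. borel) (\<lambda>x. \<lambda>i\<in>I. X i x)) (Pi\<^sub>E I A) = (\<integral>x. indicator (Pi\<^sub>E I A) (\<lambda>i\<in>I. X i x) \<partial>M)"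
    proof -
      have "measure (distr M (\<Pi>\<^sub>M i\<in>I. borel) (\<lambda>x. \<lambda>i\<in>I. X i x)) (Pi\<^sub>E I A) = (\<integral>x. indicator (Pi\<^sub>E I A) x \<partial>distr M (\<Pi>\<^sub>M i\<in>I. borel) (\<lambda>x. \<lambda>i\<in>I. X i x))"
        using S sets.sets_into_space[OF S] by (simp add: Int_absorb2)
      also have "... = (\<integral>x. indicator (Pi\<^sub>E I A) (\<lambda>i\<in>I. X i x) \<partial>M)" using that S by (intro integral_distr) auto
      finally show ?thesis .
    qed
    also have "... = (\<integral>x. (\<Prod>j\<in>I. indicator (A' j) (X j x)) \<partial>M)"
    proof (intro Bochner_Integration.integral_cong refl)
      fix x
      show "indicator (Pi\<^sub>E I A) (\<lambda>i\<in>I. X i x) = (\<Prod>j\<in>I. indicator (A' j) (X j x) :: real)"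
        using I by (auto simp: indicator_def A'_def PiE_iff prod_zero_iff)
    qed
    finally show ?thesis .
  qed
  have "(\<integral>x. (\<Prod>j\<in>I. indicator (A' j) (X j x)) \<partial>M) = (\<integral>x. (\<Prod>j\<in>I. indicator (A' j) (Y j x) :: real) \<partial>N)"
    using char_indicator_prod[OF M N I Xm Ym eq order_refl, of A'] A' by (simp add: scaleR_conv_of_real del: of_real_prod)
  then have "measure (distr M (\<Pi>\<^sub>M i\<in>I. borel) (\<lambda>x. \<lambda>i\<in>I. X i x)) (Pi\<^sub>E I A) = measure (distr N (\<Pi>\<^sub>M i\<in>I. borel) (\<lambda>y. \<lambda>i\<in>I. Y i y)) (Pi\<^sub>E I A)"
    using ind[OF M] ind[OF N] by simp
  then show "emeasure (distr M (\<Pi>\<^sub>M i\<in>I. borel) (\<lambda>x. \<lambda>i\<in>I. X i x)) (Pi\<^sub>E I A) = emeasure (distr N (\<Pi>\<^sub>M i\<in>I. borel) (\<lambda>y. \<lambda>i\<in>I. Y i y)) (Pi\<^sub>E I A)"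
  proof -
    interpret DM: prob_space "distr M (\<Pi>\<^sub>M i\<in>I. borel) (\<lambda>x. \<lambda>i\<in>I. X i x)" by (rule M.prob_space_distr) measurable
    interpret DN: prob_space "distr N (\<Pi>\<^sub>M i\<in>I. borel) (\<lambda>x. \<lambda>i\<in>I. Y i x)" by (rule N.prob_space_distr) measurable
    show ?thesis if "measure (distr M (\<Pi>\<^sub>M i\<in>I. borel) (\<lambda>x. \<lambda>i\<in>I. X i x)) (Pi\<^sub>E I A) = measure (distr N (\<Pi>\<^sub>M i\<in>I. borel) (\<lambda>y. \<lambda>i\<in>I. Y i y)) (Pi\<^sub>E I A)"
      using that by (simp only: DM.emeasure_eq_measure DN.emeasure_eq_measure)
  qed
next
  show "range (\<lambda>_ :: nat. space (\<Pi>\<^sub>M i\<in>I. borel)) \<subseteq> prod_algebra I (\<lambda>_. borel :: real measure)"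
    using I by (auto simp: space_PiM intro!: prod_algebraI_finite)
  have "(\<lambda>x. \<lambda>i\<in>I. X i x) \<in> M \<rightarrow>\<^sub>M (\<Pi>\<^sub>M i\<in>I. borel)" using Xm by (auto intro: measurable_restrict)
  then interpret D: prob_space "distr M (\<Pi>\<^sub>M i\<in>I. borel) (\<lambda>x. \<lambda>i\<in>I. X i x)" by (rule prob_space.prob_space_distr[OF M])
  show "emeasure (distr M (\<Pi>\<^sub>M i\<in>I. borel) (\<lambda>x. \<lambda>i\<in>I. X i x)) (space (\<Pi>\<^sub>M i\<in>I. borel)) \<noteq> \<infinity>" using D.emeasure_finite by (simp only: infinity_ennreal_def not_False_eq_True)
qed simp_all

text \<open>A linear combination has the law of m + s g with unknown m and s. The first moment gives
  m = 0 and the second gives s^2 as the quadratic form of the covariances, which is all that the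
  characteristic function involves.\<close>

lemma gaussian_char:
  assumes P: "prob_space P" and X: "centered_gaussian_process P I C X" and J: "finite J" "J \<subseteq> I"
  shows "(\<integral>\<eta>. iexp (\<Sum>j\<in>J. c j * X j \<eta>) \<partial>P) = exp (- (\<Sum>i\<in>J. \<Sum>j\<in>J. c i * c j * C i j) / 2)"
proof -
  interpret P: prob_space P by fact
  interpret N: prob_space gauss by (rule prob_space_gauss)
  have Xm: "X i \<in> borel_measurable P" if "i \<in> I" for i
    using X that by (simp add: centered_gaussian_process_def gaussian_process_def)
  have lin: "\<exists>m s. distr P borel (\<lambda>\<eta>. \<Sum>j\<in>K. a j * X j \<eta>) = distr gauss borel (\<lambda>g. m + s * g)"
    if "finite K" "K \<subseteq> I" for K a
    using X that by (simp add: centered_gaussian_process_def gaussian_process_def)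
  have n1: "integrable gauss (\<lambda>g. g)" "(\<integral>g. g \<partial>gauss) = 0"
    "integrable gauss (\<lambda>g. g^2)" "(\<integral>g. g^2 \<partial>gauss) = 1"
    using std_normal_moment_odd[of 0] std_normal_moment_even[of 1]
    by (auto simp: integrable_density integral_density has_bochner_integral_iff)
  have sqi: "integrable P (\<lambda>\<eta>. (X i \<eta>)^2)" "integrable P (X i)" if i: "i \<in> I" for i
  proof -
    obtain m s where "distr P borel (\<lambda>\<eta>. \<Sum>j\<in>{i}. 1 * X j \<eta>) = distr gauss borel (\<lambda>g. m + s * g)"
      using lin[of "{i}" "\<lambda>_. 1"] i by auto
    then have d: "distr P borel (X i) = distr gauss borel (\<lambda>g. m + s * g)" by simp
    have "integrable gauss (\<lambda>g. (m + s * g)^2)" "integrable gauss (\<lambda>g. m + s * g)"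
      using n1 by (simp_all add: power2_sum power_mult_distrib)
    then have d2: "integrable (distr P borel (X i)) (\<lambda>x. x^2)" "integrable (distr P borel (X i)) (\<lambda>x. x)"
      unfolding d by (simp_all add: integrable_distr_eq)
    show "integrable P (\<lambda>\<eta>. (X i \<eta>)^2)" "integrable P (X i)"
      by (rule integrable_distr[OF Xm[OF i] d2(1)], rule integrable_distr[OF Xm[OF i] d2(2)])
  qed
  have pri: "integrable P (\<lambda>\<eta>. X i \<eta> * X j \<eta>)" if ij: "i \<in> I" "j \<in> I" for i j
  proof (rule Bochner_Integration.integrable_bound)
    show "integrable P (\<lambda>\<eta>. (X i \<eta>)^2 + (X j \<eta>)^2)" using sqi ij by simp
    show "AE \<eta> in P. norm (X i \<eta> * X j \<eta>) \<le> norm ((X i \<eta>)^2 + (X j \<eta>)^2)"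
    proof (rule AE_I2)
      fix \<eta>
      have "2 * (\<bar>X i \<eta>\<bar> * \<bar>X j \<eta>\<bar>) \<le> (X i \<eta>)^2 + (X j \<eta>)^2" using sum_squares_bound[of "\<bar>X i \<eta>\<bar>" "\<bar>X j \<eta>\<bar>"] by (simp add: mult.assoc)
      moreover have "0 \<le> \<bar>X i \<eta>\<bar> * \<bar>X j \<eta>\<bar>" by simp
      ultimately have "\<bar>X i \<eta>\<bar> * \<bar>X j \<eta>\<bar> \<le> (X i \<eta>)^2 + (X j \<eta>)^2" by linarith
      then show "norm (X i \<eta> * X j \<eta>) \<le> norm ((X i \<eta>)^2 + (X j \<eta>)^2)" by (simp add: abs_mult)
    qed
  qed (use Xm ij in auto)
  let ?L = "\<lambda>\<eta>. \<Sum>j\<in>J. c j * X j \<eta>"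
  have Lm [measurable]: "?L \<in> borel_measurable P" using Xm J by (auto intro!: borel_measurable_sum borel_measurable_times)
  obtain m s where d: "distr P borel ?L = distr gauss borel (\<lambda>g. m + s * g)" using lin[OF J] by blast
  have "(\<integral>x. x \<partial>distr P borel ?L) = (\<integral>\<eta>. ?L \<eta> \<partial>P)" by (rule integral_distr) auto
  also have "... = (\<Sum>j\<in>J. c j * (\<integral>\<eta>. X j \<eta> \<partial>P))" using sqi J by (subst Bochner_Integration.integral_sum) auto
  also have "... = 0" using X J by (auto simp: centered_gaussian_process_def intro!: sum.neutral)
  finally have m0: "(\<integral>x. x \<partial>distr P borel ?L) = 0" .
  have "(\<integral>x. x \<partial>distr P borel ?L) = (\<integral>g. m + s * g \<partial>gauss)" unfolding d by (rule integral_distr) auto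
  then have m: "m = 0" unfolding m0 using n1(1,2) N.prob_space by simp
  have "(\<integral>x. x^2 \<partial>distr P borel ?L) = (\<integral>\<eta>. (?L \<eta>)^2 \<partial>P)" by (rule integral_distr) auto
  also have "... = (\<integral>\<eta>. (\<Sum>i\<in>J. \<Sum>j\<in>J. c i * c j * (X i \<eta> * X j \<eta>)) \<partial>P)"
    unfolding power2_eq_square sum_product
    by (intro Bochner_Integration.integral_cong sum.cong refl) (simp only: mult.assoc mult.left_commute)
  also have "... = (\<Sum>i\<in>J. \<Sum>j\<in>J. c i * c j * (\<integral>\<eta>. X i \<eta> * X j \<eta> \<partial>P))"
    using pri J by (simp add: Bochner_Integration.integral_sum Bochner_Integration.integrable_sum subset_iff)
  also have "... = (\<Sum>i\<in>J. \<Sum>j\<in>J. c i * c j * C i j)"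
    using X J by (intro sum.cong refl) (auto simp: centered_gaussian_process_def)
  finally have s0: "(\<integral>x. x^2 \<partial>distr P borel ?L) = (\<Sum>i\<in>J. \<Sum>j\<in>J. c i * c j * C i j)" .
  have "(\<integral>x. x^2 \<partial>distr P borel ?L) = (\<integral>g. (m + s * g)^2 \<partial>gauss)" unfolding d by (rule integral_distr) auto
  then have s: "s^2 = (\<Sum>i\<in>J. \<Sum>j\<in>J. c i * c j * C i j)" unfolding s0 m using n1(3,4) by (simp add: power_mult_distrib)
  have "(\<integral>\<eta>. iexp (?L \<eta>) \<partial>P) = char (distr P borel ?L) 1" unfolding char_def by (subst integral_distr) auto
  also have "... = complex_of_real (exp (- (s^2 / 2)))" using char_distr_scale[of s 1] unfolding d m by simp
  finally show ?thesis by (simp add: s)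
qed

lemma gaussian_pair_char:
  assumes P: "prob_space P" and X: "centered_gaussian_process P I C X" and Z: "centered_gaussian_process P I C Z"
    and ind: "indep_processes P I X Z" and J: "finite J" "J \<subseteq> I"
  shows "(\<integral>\<eta>. iexp ((\<Sum>j\<in>J. a j * X j \<eta>) + (\<Sum>j\<in>J. b j * Z j \<eta>)) \<partial>P) =
    exp (- (\<Sum>i\<in>J. \<Sum>j\<in>J. a i * a j * C i j) / 2) * exp (- (\<Sum>i\<in>J. \<Sum>j\<in>J. b i * b j * C i j) / 2)"
proof -
  interpret P: prob_space P by fact
  have Xm: "X i \<in> borel_measurable P" "Z i \<in> borel_measurable P" if "i \<in> I" for i
    using X Z that by (simp_all add: centered_gaussian_process_def gaussian_process_def)
  let ?f = "\<lambda>c x. iexp (\<Sum>j\<in>J. c j * x j)"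
  have fm: "?f c \<in> borel_measurable (\<Pi>\<^sub>M i\<in>I. borel)" for c :: "_ \<Rightarrow> real"
  proof -
    have "(\<lambda>x. \<Sum>j\<in>J. c j * x j) \<in> borel_measurable (\<Pi>\<^sub>M i\<in>I. borel)"
      using J by (intro borel_measurable_sum borel_measurable_times measurable_component_singleton) auto
    then show ?thesis by measurable
  qed
  have iv0: "P.indep_var borel (?f a \<circ> (\<lambda>\<eta>. \<lambda>i\<in>I. X i \<eta>)) borel (?f b \<circ> (\<lambda>\<eta>. \<lambda>i\<in>I. Z i \<eta>))"
    by (rule P.indep_var_compose[OF ind[unfolded indep_processes_def] fm fm])
  have cX: "?f a \<circ> (\<lambda>\<eta>. \<lambda>i\<in>I. X i \<eta>) = (\<lambda>\<eta>. iexp (\<Sum>j\<in>J. a j * X j \<eta>))"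
    using J by (auto simp: fun_eq_iff subset_iff intro!: arg_cong[where f = exp] sum.cong)
  have cZ: "?f b \<circ> (\<lambda>\<eta>. \<lambda>i\<in>I. Z i \<eta>) = (\<lambda>\<eta>. iexp (\<Sum>j\<in>J. b j * Z j \<eta>))"
    using J by (auto simp: fun_eq_iff subset_iff intro!: arg_cong[where f = exp] sum.cong)
  note iv = iv0[unfolded cX cZ]
  have i: "integrable P (\<lambda>\<eta>. iexp (\<Sum>j\<in>J. a j * X j \<eta>))" "integrable P (\<lambda>\<eta>. iexp (\<Sum>j\<in>J. b j * Z j \<eta>))"
  proof -
    have ie: "integrable P (\<lambda>\<eta>. iexp (f \<eta>))" if [measurable]: "f \<in> borel_measurable P" for f
      by (rule P.integrable_const_bound[of _ 1]) auto
    show "integrable P (\<lambda>\<eta>. iexp (\<Sum>j\<in>J. a j * X j \<eta>))"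
      by (rule ie) (use Xm J in \<open>auto intro!: borel_measurable_sum borel_measurable_times\<close>)
    show "integrable P (\<lambda>\<eta>. iexp (\<Sum>j\<in>J. b j * Z j \<eta>))"
      by (rule ie) (use Xm J in \<open>auto intro!: borel_measurable_sum borel_measurable_times\<close>)
  qed
  have "(\<integral>\<eta>. iexp ((\<Sum>j\<in>J. a j * X j \<eta>) + (\<Sum>j\<in>J. b j * Z j \<eta>)) \<partial>P) = (\<integral>\<eta>. iexp (\<Sum>j\<in>J. a j * X j \<eta>) * iexp (\<Sum>j\<in>J. b j * Z j \<eta>) \<partial>P)"
    by (simp only: of_real_add distrib_left exp_add)
  also have "... = (\<integral>\<eta>. iexp (\<Sum>j\<in>J. a j * X j \<eta>) \<partial>P) * (\<integral>\<eta>. iexp (\<Sum>j\<in>J. b j * Z j \<eta>) \<partial>P)"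
    by (rule P.indep_var_lebesgue_integral[OF iv i])
  finally show ?thesis by (simp only: gaussian_char[OF P X J] gaussian_char[OF P Z J] of_real_mult)
qed

section \<open>Reduction of the model to marked trees\<close>

text \<open>Attaching fresh Gaussians to the lifetimes of the model produces the law of the marked
  tree. Given the lifetimes the Gaussian coordinates are independent, and the resulting functions of
  single lifetimes factorise by independence.\<close>

lemma distr_zip_marks:
  fixes L :: "bool list \<Rightarrow> 'a \<Rightarrow> real"
  assumes M: "prob_space M" and ind: "prob_space.indep_vars M (\<lambda>_. borel) L UNIV"
    and L: "\<And>v. distr M borel (L v) = expo"
  shows "distr (M \<Otimes>\<^sub>M (\<Pi>\<^sub>M v\<in>UNIV. gauss2)) trees (\<lambda>(x, g) v. (L v x, g v)) = trees"
    and "(\<lambda>(x, g) v. (L v x, g v)) \<in> M \<Otimes>\<^sub>M (\<Pi>\<^sub>M v\<in>UNIV. gauss2) \<rightarrow>\<^sub>M trees"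
proof -
  interpret M: prob_space M by fact
  interpret G: prob_space gauss2 by (rule prob_space_gauss2)
  interpret E: prob_space expo by (rule prob_space_expo)
  interpret EG: pair_prob_space expo gauss2 ..
  interpret mk: prob_space mark by (rule prob_space_mark)
  interpret PG: product_prob_space "\<lambda>_. gauss2" "UNIV :: bool list set" by unfold_locales
  interpret T: product_prob_space "\<lambda>_. mark" "UNIV :: bool list set" by unfold_locales
  let ?G = "\<Pi>\<^sub>M v\<in>(UNIV :: bool list set). gauss2"
  interpret MG: pair_prob_space M ?G ..
  have Lm [measurable]: "L v \<in> borel_measurable M" for v
    using ind by (simp add: M.indep_vars_def)
  show zm: "(\<lambda>(x, g) v. (L v x, g v)) \<in> M \<Otimes>\<^sub>M ?G \<rightarrow>\<^sub>M trees"
    unfolding tree_space_def split_beta'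
  proof (rule measurable_PiM_single')
    fix v :: "bool list"
    show "(\<lambda>x. (L v (fst x), snd x v)) \<in> M \<Otimes>\<^sub>M ?G \<rightarrow>\<^sub>M mark" by measurable
  qed auto
  show "distr (M \<Otimes>\<^sub>M ?G) trees (\<lambda>(x, g) v. (L v x, g v)) = trees"
    unfolding tree_space_def[of mark]
  proof (rule T.PiM_eq, fold tree_space_def[of mark])
    fix J :: "bool list set" and E
    assume J: "finite J" "\<And>j. j \<in> J \<Longrightarrow> E j \<in> sets mark"
    let ?X = "prod_emb UNIV (\<lambda>_. mark) J (\<Pi>\<^sub>E j\<in>J. E j)"
    have Xs: "?X \<in> sets trees" using J unfolding tree_space_def by (intro sets_PiM_I) auto
    have Ep2: "E j \<in> sets (expo \<Otimes>\<^sub>M gauss2)" if "j \<in> J" for j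
      using J(2)[OF that] by (simp only: mark_def)
    have "sets (expo \<Otimes>\<^sub>M gauss2) = sets (borel \<Otimes>\<^sub>M gauss2)" by (intro sets_pair_measure_cong) auto
    then have Ep1: "E j \<in> sets (borel \<Otimes>\<^sub>M gauss2)" if "j \<in> J" for j using Ep2[OF that] by simp
    define f where "f j l = emeasure gauss2 (Pair l -` E j)" for j l
    have fm: "f j \<in> borel_measurable borel" if "j \<in> J" for j
      unfolding f_def[abs_def] by (rule G.measurable_emeasure_Pair[OF Ep1[OF that]])
    have pre: "Pair x -` ((\<lambda>(x, g) v. (L v x, g v)) -` ?X \<inter> space (M \<Otimes>\<^sub>M ?G)) = prod_emb UNIV (\<lambda>_. gauss2) J (\<Pi>\<^sub>E j\<in>J. Pair (L j x) -` E j)"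
      if "x \<in> space M" for x
      using that by (auto simp: prod_emb_def space_pair_measure space_PiM PiE_iff)
    have "emeasure (distr (M \<Otimes>\<^sub>M ?G) trees (\<lambda>(x, g) v. (L v x, g v))) ?X =
        (\<integral>\<^sup>+x. emeasure ?G (Pair x -` ((\<lambda>(x, g) v. (L v x, g v)) -` ?X \<inter> space (M \<Otimes>\<^sub>M ?G))) \<partial>M)"
      by (simp only: emeasure_distr[OF zm Xs] PG.P.emeasure_pair_measure_alt[OF measurable_sets[OF zm Xs]])
    also have "... = (\<integral>\<^sup>+x. (\<Prod>j\<in>J. f j (L j x)) \<partial>M)"
    proof (rule nn_integral_cong)
      fix x assume x: "x \<in> space M"
      show "emeasure ?G (Pair x -` ((\<lambda>(x, g) v. (L v x, g v)) -` ?X \<inter> space (M \<Otimes>\<^sub>M ?G))) = (\<Prod>j\<in>J. f j (L j x))"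
        unfolding pre[OF x] f_def using J(1) sets_Pair1[OF Ep1] by (intro PG.emeasure_PiM_emb) auto
    qed
    also have "... = (\<Prod>j\<in>J. \<integral>\<^sup>+x. f j (L j x) \<partial>M)"
    proof (rule M.indep_vars_nn_integral[OF J(1)])
      show "M.indep_vars (\<lambda>_. borel) (\<lambda>j x. f j (L j x)) J"
        using fm by (intro M.indep_vars_compose2[OF M.indep_vars_subset[OF ind]]) auto
    qed simp
    also have "... = (\<Prod>j\<in>J. emeasure mark (E j))"
    proof (rule prod.cong[OF refl])
      fix j assume j: "j \<in> J"
      have "(\<integral>\<^sup>+x. f j (L j x) \<partial>M) = (\<integral>\<^sup>+l. f j l \<partial>distr M borel (L j))"
        by (rule nn_integral_distr[symmetric]) (auto intro: fm j)
      also have "... = emeasure mark (E j)"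
        unfolding L f_def mark_def by (rule G.emeasure_pair_measure_alt[OF Ep2[OF j], symmetric])
      finally show "(\<integral>\<^sup>+x. f j (L j x) \<partial>M) = emeasure mark (E j)" .
    qed
    finally show "emeasure (distr (M \<Otimes>\<^sub>M ?G) trees (\<lambda>(x, g) v. (L v x, g v))) ?X = (\<Prod>j\<in>J. emeasure mark (E j))" .
  qed simp_all
qed

section \<open>Leaves as sums along lines of descent\<close>

definition tbirth :: "(bool list \<Rightarrow> real) \<Rightarrow> bool list \<Rightarrow> real" where
  "tbirth L v = (\<Sum>i<length v. L (take i v))"

definition tvar :: "real \<Rightarrow> (real \<Rightarrow> real) \<Rightarrow> real \<Rightarrow> (bool list \<Rightarrow> real) \<Rightarrow> bool list \<Rightarrow> real" where
  "tvar T B b L v = dispvar T B (b + tbirth L v) (L v)"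

text \<open>The nonrecursive form of the entries of \<open>leaves\<close>. All prefixes contribute,
  the particle itself included, so this is the position at the horizon if the particle is alive
  then.\<close>

definition tpos :: "real \<Rightarrow> (real \<Rightarrow> real) \<Rightarrow> real \<Rightarrow> real \<Rightarrow> (bool list \<Rightarrow> real) \<Rightarrow> (bool list \<Rightarrow> real \<times> real) \<Rightarrow> bool list \<Rightarrow> real \<times> real" where
  "tpos T B \<rho> b L g v = (\<Sum>w\<in>set (prefixes v). disp \<rho> (tvar T B b L w) (g w))"

definition talive :: "real \<Rightarrow> real \<Rightarrow> (bool list \<Rightarrow> real) \<Rightarrow> bool list set" where
  "talive T b L = {v. b + tbirth L v \<le> T \<and> T < b + tbirth L v + L v}"

lemma tbirth_Nil [simp]: "tbirth L [] = 0"
  by (simp add: tbirth_def)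

lemma tbirth_Cons [simp]: "tbirth L (i # v) = L [] + tbirth (\<lambda>w. L (i # w)) v"
  by (simp add: tbirth_def sum.lessThan_Suc_shift del: sum.lessThan_Suc)

lemma tbirth_snoc [simp]: "tbirth L (v @ [i]) = tbirth L v + L v"
  by (simp add: tbirth_def)

lemma tbirth_nonneg: "(\<And>w. 0 \<le> L w) \<Longrightarrow> 0 \<le> tbirth L v"
  by (simp add: tbirth_def sum_nonneg)

lemma tbirth_prefix:
  assumes "\<And>w. 0 \<le> L w" "strict_prefix v u"
  shows "tbirth L v + L v \<le> tbirth L u"
proof -
  obtain i w where u: "u = (v @ [i]) @ w" using assms(2) by (auto elim: strict_prefixE')
  have "tbirth L v' \<le> tbirth L (v' @ w)" for v'
  proof (induction w rule: rev_induct)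
    case (snoc x xs)
    then show ?case using assms(1)[of "v' @ xs"] tbirth_snoc[of L "v' @ xs" x] by simp
  qed simp
  from this[of "v @ [i]"] show ?thesis by (simp add: u)
qed

lemma tpos_Nil [simp]: "tpos T B \<rho> b L g [] = disp \<rho> (dispvar T B b (L [])) (g [])"
  by (simp add: tpos_def tvar_def)

lemma tpos_Cons [simp]:
  "tpos T B \<rho> b L g (i # v) = disp \<rho> (dispvar T B b (L [])) (g []) + tpos T B \<rho> (b + L []) (\<lambda>w. L (i # w)) (\<lambda>w. g (i # w)) v"
proof -
  have "tpos T B \<rho> b L g (i # v) = disp \<rho> (tvar T B b L []) (g []) + (\<Sum>w\<in>(#) i ` set (prefixes v). disp \<rho> (tvar T B b L w) (g w))"
    unfolding tpos_def prefixes.simps list.set set_map by (subst sum.insert) auto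
  also have "(\<Sum>w\<in>(#) i ` set (prefixes v). disp \<rho> (tvar T B b L w) (g w)) = tpos T B \<rho> (b + L []) (\<lambda>w. L (i # w)) (\<lambda>w. g (i # w)) v"
    unfolding tpos_def by (subst sum.reindex) (auto simp: tvar_def inj_on_def add.assoc intro!: sum.cong)
  finally show ?thesis by (simp add: tvar_def)
qed

text \<open>Links the recursion to the set of living particles. Fuel \<open>n\<close> corresponds to
  labels of length below \<open>n\<close>. Nonnegative lifetimes enter because a descendant of a
  particle alive at \<open>T\<close> must not be alive at \<open>T\<close>.\<close>

lemma sum_leaves:
  fixes F :: "real \<times> real \<Rightarrow> complex"
  assumes "\<And>w. 0 \<le> L w" "b \<le> T"
  shows "(\<Sum>p\<leftarrow>leaves T B \<rho> n b (\<lambda>v. (L v, g v)). F p) = (\<Sum>v\<in>{v \<in> talive T b L. length v < n}. F (tpos T B \<rho> b L g v))"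
  using assms
proof (induction n arbitrary: b L g F)
  case (Suc n)
  let ?d = "disp \<rho> (dispvar T B b (L [])) (g [])"
  show ?case
  proof (cases "T < b + L []")
    case True
    have "{v \<in> talive T b L. length v < Suc n} = {[]}"
    proof (intro set_eqI iffI)
      fix v assume "v \<in> {v \<in> talive T b L. length v < Suc n}"
      then show "v \<in> {[]}" using True tbirth_nonneg[of "\<lambda>w. L (hd v # w)" "tl v"] Suc.prems
        by (cases v) (auto simp: talive_def)
    qed (use True Suc.prems in \<open>auto simp: talive_def\<close>)
    then show ?thesis using True by simp
  next
    case False
    let ?A = "\<lambda>i. {v \<in> talive T (b + L []) (\<lambda>w. L (i # w)). length v < n}"
    have fin: "finite (?A i)" for i
      by (rule finite_subset[OF _ finite_lists_length_le[OF finite[of UNIV], of n]]) auto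
    have A: "{v \<in> talive T b L. length v < Suc n} = (#) False ` ?A False \<union> (#) True ` ?A True"
    proof (intro set_eqI iffI)
      fix v assume v: "v \<in> {v \<in> talive T b L. length v < Suc n}"
      then obtain i u where "v = i # u" using False by (cases v) (auto simp: talive_def)
      then show "v \<in> (#) False ` ?A False \<union> (#) True ` ?A True" using v by (cases i) (auto simp: talive_def add.assoc)
    qed (auto simp: talive_def add.assoc)
    have "(\<Sum>p\<leftarrow>leaves T B \<rho> (Suc n) b (\<lambda>v. (L v, g v)). F p) =
        (\<Sum>p\<leftarrow>leaves T B \<rho> n (b + L []) (\<lambda>v. (L (False # v), g (False # v))). F (?d + p)) +
        (\<Sum>p\<leftarrow>leaves T B \<rho> n (b + L []) (\<lambda>v. (L (True # v), g (True # v))). F (?d + p))"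
      using False by (simp add: o_def Let_def)
    also have "... = (\<Sum>v\<in>?A False. F (tpos T B \<rho> b L g (False # v))) + (\<Sum>v\<in>?A True. F (tpos T B \<rho> b L g (True # v)))"
      using Suc.IH[of "\<lambda>v. L (False # v)" "b + L []" "\<lambda>p. F (?d + p)" "\<lambda>v. g (False # v)"]
        Suc.IH[of "\<lambda>v. L (True # v)" "b + L []" "\<lambda>p. F (?d + p)" "\<lambda>v. g (True # v)"] Suc.prems False by simp
    also have "... = (\<Sum>v\<in>{v \<in> talive T b L. length v < Suc n}. F (tpos T B \<rho> b L g v))"
      unfolding A using fin by (subst sum.union_disjoint) (auto simp: sum.reindex)
    finally show ?thesis .
  qed
qed simp

text \<open>The variances along a line of descent telescope: to the profile at the time of death, or
  to the full horizon for a survivor.\<close>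

lemma sum_tvar:
  assumes L: "\<And>w. 0 \<le> L w" and v: "tbirth L v \<le> T" and B: "B 0 = 0"
  shows "(\<Sum>w\<in>set (prefixes v). tvar T B 0 L w) = (if tbirth L v + L v \<le> T then B (tbirth L v + L v) else T)"
  using v
proof (induction v rule: rev_induct)
  case Nil
  then show ?case by (simp add: tvar_def dispvar_def B)
next
  case (snoc i v)
  have "set (prefixes (v @ [i])) = insert (v @ [i]) (set (prefixes v))" "v @ [i] \<notin> set (prefixes v)" by auto
  then have "(\<Sum>w\<in>set (prefixes (v @ [i])). tvar T B 0 L w) = tvar T B 0 L (v @ [i]) + (\<Sum>w\<in>set (prefixes v). tvar T B 0 L w)" by simp
  also have "... = tvar T B 0 L (v @ [i]) + B (tbirth L v + L v)" using snoc L[of v] by simp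
  also have "... = (if tbirth L (v @ [i]) + L (v @ [i]) \<le> T then B (tbirth L (v @ [i]) + L (v @ [i])) else T)"
    by (simp add: tvar_def dispvar_def)
  finally show ?case .
qed

section \<open>Characteristic functions of Gaussian sums on trees\<close>

lemma gauss_prod_char:
  assumes W: "finite W"
  shows "(\<integral>g. iexp (\<Sum>w\<in>W. c w * fst (g w) + d w * snd (g w)) \<partial>(\<Pi>\<^sub>M v\<in>(UNIV :: 'i set). gauss2)) =
    exp (- (\<Sum>w\<in>W. (c w)^2) / 2) * exp (- (\<Sum>w\<in>W. (d w)^2) / 2)"
proof -
  interpret G: prob_space gauss2 by (rule prob_space_gauss2)
  interpret PG: product_prob_space "\<lambda>_. gauss2" "UNIV :: 'i set" by unfold_locales
  let ?f = "\<lambda>w x. iexp (c w * fst x + d w * snd x)"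
  have f: "(\<integral>x. ?f w x \<partial>gauss2) = complex_of_real (exp (- ((c w)^2 + (d w)^2) / 2))" for w
  proof -
    have "(\<integral>x. ?f w x \<partial>gauss2) = (\<integral>x. exp ((\<i> * c w) * complex_of_real (fst x)) * exp ((\<i> * d w) * complex_of_real (snd x)) \<partial>gauss2)"
      by (simp add: mult_exp_exp algebra_simps)
    also have "... = exp ((\<i> * c w)^2 / 2) * exp ((\<i> * d w)^2 / 2)"
      using has_bochner_integral_pair_mult[OF prob_space_gauss prob_space_gauss gauss_mgf[of "\<i> * c w"] gauss_mgf[of "\<i> * d w"]]
      by (simp add: has_bochner_integral_iff)
    also have "... = complex_of_real (exp (- ((c w)^2 + (d w)^2) / 2))"
    proof -
      have "(\<i> * complex_of_real (c w))^2 / 2 + (\<i> * complex_of_real (d w))^2 / 2 = complex_of_real (- ((c w)^2 + (d w)^2) / 2)"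
        by (simp add: power_mult_distrib diff_divide_distrib)
      then show ?thesis by (simp only: mult_exp_exp exp_of_real)
    qed
    finally show ?thesis .
  qed
  have "(\<integral>g. iexp (\<Sum>w\<in>W. c w * fst (g w) + d w * snd (g w)) \<partial>(\<Pi>\<^sub>M v\<in>(UNIV :: 'i set). gauss2)) =
      (\<integral>g. (\<Prod>w\<in>W. ?f w (restrict g W w)) \<partial>(\<Pi>\<^sub>M v\<in>(UNIV :: 'i set). gauss2))"
  proof (intro Bochner_Integration.integral_cong refl)
    fix g :: "'i \<Rightarrow> real \<times> real"
    show "iexp (\<Sum>w\<in>W. c w * fst (g w) + d w * snd (g w)) = (\<Prod>w\<in>W. ?f w (restrict g W w))"
      unfolding of_real_sum sum_distrib_left exp_sum[OF W] by (intro prod.cong) auto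
  qed
  also have "... = (\<integral>g. (\<Prod>w\<in>W. ?f w (g w)) \<partial>distr (\<Pi>\<^sub>M v\<in>(UNIV :: 'i set). gauss2) (\<Pi>\<^sub>M w\<in>W. gauss2) (\<lambda>g. restrict g W))"
  proof (rule integral_distr[symmetric])
    show "(\<lambda>g. \<Prod>w\<in>W. ?f w (g w)) \<in> borel_measurable (\<Pi>\<^sub>M w\<in>W. gauss2)"
    proof (rule borel_measurable_prod)
      fix w assume w: "w \<in> W"
      have "?f w \<in> borel_measurable gauss2" by measurable
      then show "(\<lambda>g. ?f w (g w)) \<in> borel_measurable (\<Pi>\<^sub>M w\<in>W. gauss2)"
        by (rule measurable_compose[OF measurable_component_singleton[OF w]])
    qed
  qed (rule measurable_restrict_subset, simp)
  also have "distr (\<Pi>\<^sub>M v\<in>(UNIV :: 'i set). gauss2) (\<Pi>\<^sub>M w\<in>W. gauss2) (\<lambda>g. restrict g W) = (\<Pi>\<^sub>M w\<in>W. gauss2)"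
    by (rule PG.distr_PiM_restrict_finite[OF W]) simp
  also have "(\<integral>g. (\<Prod>w\<in>W. ?f w (g w)) \<partial>(\<Pi>\<^sub>M w\<in>W. gauss2)) = (\<Prod>w\<in>W. \<integral>x. ?f w x \<partial>gauss2)"
    by (rule PG.product_integral_prod[OF W], rule G.integrable_const_bound[of _ 1]) auto
  also have "... = complex_of_real (\<Prod>w\<in>W. exp (- ((c w)^2 + (d w)^2) / 2))" by (simp only: f of_real_prod)
  also have "(\<Prod>w\<in>W. exp (- ((c w)^2 + (d w)^2) / 2)) = exp (\<Sum>w\<in>W. - ((c w)^2 + (d w)^2) / 2)" by (rule exp_sum[OF W, symmetric])
  also have "(\<Sum>w\<in>W. - ((c w)^2 + (d w)^2) / 2) = - (\<Sum>w\<in>W. (c w)^2) / 2 + - (\<Sum>w\<in>W. (d w)^2) / 2"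
    by (simp add: sum.distrib sum_negf sum_divide_distrib[symmetric] diff_divide_distrib sum_subtractf)
  finally show ?thesis by (simp only: exp_add)
qed

lemma sum_prefixes_swap:
  assumes I: "finite I" and W: "W = (\<Union>v\<in>I. set (prefixes v))"
  shows "(\<Sum>v\<in>I. a v * (\<Sum>w\<in>set (prefixes v). s w * x w :: real)) = (\<Sum>w\<in>W. (s w * (\<Sum>v\<in>I. if prefix w v then a v else 0)) * x w)"
proof -
  have fW: "finite W" using I by (simp add: W)
  have "(\<Sum>w\<in>set (prefixes v). s w * x w) = (\<Sum>w\<in>W. if prefix w v then s w * x w else 0)" if "v \<in> I" for v
    using fW that by (intro sum.mono_neutral_cong_left) (auto simp: W)
  then have "(\<Sum>v\<in>I. a v * (\<Sum>w\<in>set (prefixes v). s w * x w)) = (\<Sum>v\<in>I. \<Sum>w\<in>W. a v * (if prefix w v then s w * x w else 0))"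
    by (simp add: sum_distrib_left)
  also have "... = (\<Sum>w\<in>W. \<Sum>v\<in>I. a v * (if prefix w v then s w * x w else 0))" by (rule sum.swap)
  also have "... = (\<Sum>w\<in>W. (s w * (\<Sum>v\<in>I. if prefix w v then a v else 0)) * x w)"
    by (intro sum.cong refl) (auto simp: sum_distrib_left sum_distrib_right intro!: sum.cong)
  finally show ?thesis .
qed

lemma prefix_longest_common_prefix: "prefix w (longest_common_prefix u v) \<longleftrightarrow> prefix w u \<and> prefix w v"
  using longest_common_prefix_max_prefix longest_common_prefix_prefix1 longest_common_prefix_prefix2 prefix_order.order_trans by metis

text \<open>A node enters the covariance of \<open>u\<close> and \<open>v\<close> exactly if it is a
  prefix of both, hence of their longest common prefix. Expanding the squares node by node therefore
  yields the branching covariance.\<close>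

lemma sum_prefixes_square:
  assumes I: "finite I" and W: "W = (\<Union>v\<in>I. set (prefixes v))" and V: "\<And>w. w \<in> W \<Longrightarrow> 0 \<le> V w"
  shows "(\<Sum>w\<in>W. (sqrt (V w) * (\<Sum>v\<in>I. if prefix w v then a v else 0))^2) =
    (\<Sum>u\<in>I. \<Sum>v\<in>I. a u * a v * (\<Sum>w\<in>set (prefixes (longest_common_prefix u v)). V w))"
proof -
  have fW: "finite W" using I by (simp add: W)
  have "(\<Sum>w\<in>W. (sqrt (V w) * (\<Sum>v\<in>I. if prefix w v then a v else 0))^2) =
      (\<Sum>w\<in>W. \<Sum>u\<in>I. \<Sum>v\<in>I. a u * a v * (if prefix w u \<and> prefix w v then V w else 0))"
  proof (rule sum.cong[OF refl])
    fix w assume "w \<in> W"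
    then have "(sqrt (V w) * (\<Sum>v\<in>I. if prefix w v then a v else 0))^2 = V w * ((\<Sum>v\<in>I. if prefix w v then a v else 0) * (\<Sum>v\<in>I. if prefix w v then a v else 0))"
      using V by (simp add: power_mult_distrib power2_eq_square[of "sum _ _"])
    also have "... = (\<Sum>u\<in>I. \<Sum>v\<in>I. a u * a v * (if prefix w u \<and> prefix w v then V w else 0))"
      unfolding sum_product unfolding sum_distrib_left by (intro sum.cong refl) auto
    finally show "(sqrt (V w) * (\<Sum>v\<in>I. if prefix w v then a v else 0))^2 = (\<Sum>u\<in>I. \<Sum>v\<in>I. a u * a v * (if prefix w u \<and> prefix w v then V w else 0))" .
  qed
  also have "... = (\<Sum>u\<in>I. \<Sum>v\<in>I. \<Sum>w\<in>W. a u * a v * (if prefix w u \<and> prefix w v then V w else 0))"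
    by (subst sum.swap, rule sum.cong[OF refl], rule sum.swap)
  also have "... = (\<Sum>u\<in>I. \<Sum>v\<in>I. a u * a v * (\<Sum>w\<in>set (prefixes (longest_common_prefix u v)). V w))"
  proof (intro sum.cong refl)
    fix u v assume "u \<in> I" "v \<in> I"
    then have "(\<Sum>w\<in>set (prefixes (longest_common_prefix u v)). V w) = (\<Sum>w\<in>W. if prefix w u \<and> prefix w v then V w else 0)"
      using fW by (intro sum.mono_neutral_cong_left) (auto simp: W prefix_longest_common_prefix)
    then show "(\<Sum>w\<in>W. a u * a v * (if prefix w u \<and> prefix w v then V w else 0)) = a u * a v * (\<Sum>w\<in>set (prefixes (longest_common_prefix u v)). V w)"
      by (simp only: sum_distrib_left)
  qed
  finally show ?thesis .
qed

lemma gauss_tree_char: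
  assumes I: "finite I" and V: "\<And>v w. v \<in> I \<Longrightarrow> prefix w v \<Longrightarrow> 0 \<le> V w"
  shows "(\<integral>g. iexp ((\<Sum>v\<in>I. a v * (\<Sum>w\<in>set (prefixes v). sqrt (V w) * fst (g w))) + (\<Sum>v\<in>I. b v * (\<Sum>w\<in>set (prefixes v). sqrt (V w) * snd (g w))))
      \<partial>(\<Pi>\<^sub>M v\<in>(UNIV :: bool list set). gauss2)) =
    exp (- (\<Sum>u\<in>I. \<Sum>v\<in>I. a u * a v * (\<Sum>w\<in>set (prefixes (longest_common_prefix u v)). V w)) / 2) *
    exp (- (\<Sum>u\<in>I. \<Sum>v\<in>I. b u * b v * (\<Sum>w\<in>set (prefixes (longest_common_prefix u v)). V w)) / 2)"
proof -
  define W where "W = (\<Union>v\<in>I. set (prefixes v))"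
  have fW: "finite W" using I by (simp add: W_def)
  have V': "0 \<le> V w" if "w \<in> W" for w using that V by (auto simp: W_def)
  note sq = sum_prefixes_square[OF I W_def V']
  let ?c = "\<lambda>a w. sqrt (V w) * (\<Sum>v\<in>I. if prefix w v then a v else 0)"
  have "(\<integral>g. iexp ((\<Sum>v\<in>I. a v * (\<Sum>w\<in>set (prefixes v). sqrt (V w) * fst (g w))) + (\<Sum>v\<in>I. b v * (\<Sum>w\<in>set (prefixes v). sqrt (V w) * snd (g w))))
      \<partial>(\<Pi>\<^sub>M v\<in>(UNIV :: bool list set). gauss2)) = (\<integral>g. iexp (\<Sum>w\<in>W. ?c a w * fst (g w) + ?c b w * snd (g w)) \<partial>(\<Pi>\<^sub>M v\<in>(UNIV :: bool list set). gauss2))"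
    by (simp only: sum_prefixes_swap[OF I W_def] sum.distrib)
  also have "... = exp (- (\<Sum>w\<in>W. (?c a w)^2) / 2) * exp (- (\<Sum>w\<in>W. (?c b w)^2) / 2)" by (rule gauss_prod_char[OF fW])
  finally show ?thesis by (simp only: sq)
qed

section \<open>The model in terms of binary labels\<close>

abbreviation ulam :: "bool list \<Rightarrow> nat list" where
  "ulam v \<equiv> map of_bool v"

lemma inj_ulam: "inj ulam"
  by (rule inj_mapI) (auto simp: inj_def split: if_splits)

lemma birth_ulam: "birth L (ulam v) = tbirth (\<lambda>w. L (ulam w)) v"
  by (simp add: birth_def tbirth_def take_map)

lemma alive_ulam:
  assumes "\<And>u. k u = 2"
  shows "alive L k t = ulam ` talive t 0 (\<lambda>w. L (ulam w))"
proof (intro set_eqI iffI)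
  fix u assume u: "u \<in> alive L k t"
  then have "\<forall>i<length u. u ! i < 2" by (simp add: alive_def assms)
  then have "i = of_bool (i = 1)" if "i \<in> set u" for i
    using that by (auto simp: in_set_conv_nth less_2_cases_iff)
  then have "u = ulam (map (\<lambda>i. i = 1) u)" by (simp add: map_idI o_def)
  then obtain v where v: "u = ulam v" by blast
  then have "v \<in> talive t 0 (\<lambda>w. L (ulam w))" using u by (simp add: talive_def alive_def birth_ulam)
  with v show "u \<in> ulam ` talive t 0 (\<lambda>w. L (ulam w))" by blast
next
  fix u assume "u \<in> ulam ` talive t 0 (\<lambda>w. L (ulam w))"
  then show "u \<in> alive L k t" by (auto simp: alive_def talive_def assms birth_ulam)
qed

lemma longest_common_prefix_map: "inj f \<Longrightarrow> longest_common_prefix (map f u) (map f v) = map f (longest_common_prefix u v)"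
  by (induction u v rule: longest_common_prefix.induct) (auto dest: injD)

lemma longest_common_prefix_self [simp]: "longest_common_prefix u u = u"
  by (induction u) auto

text \<open>The accumulated variance in unscaled time. The argument is clamped to the unit interval
  so that the function is monotone on the whole line, as \<open>profile\<close> demands.\<close>

definition prof :: "(real \<Rightarrow> real) \<Rightarrow> real \<Rightarrow> real \<Rightarrow> real" where
  "prof A t s = t * A (max 0 (min 1 (s / t)))"

text \<open>Both cases are instances of \<open>sum_tvar\<close>: on the diagonal the line of descent
  ends in a survivor and gives t, off the diagonal it ends in the last common ancestor and gives the
  profile at the time of its death, which is the time of separation.\<close>

lemma crem_cov_ulam:
  assumes t: "0 < t" and A: "A 0 = 0" "A 1 = 1" and L: "\<And>w. 0 \<le> L (ulam w)"
    and u: "u \<in> talive t 0 (\<lambda>w. L (ulam w))" and v: "v \<in> talive t 0 (\<lambda>w. L (ulam w))"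
  shows "crem_cov A t L (ulam u, t) (ulam v, t) =
    (\<Sum>w\<in>set (prefixes (longest_common_prefix u v)). tvar t (prof A t) 0 (\<lambda>w. L (ulam w)) w)"
proof -
  let ?L = "\<lambda>w. L (ulam w)"
  have B0: "prof A t 0 = 0" by (simp add: prof_def A)
  note S = sum_tvar[of ?L _ t "prof A t", OF L _ B0]
  show ?thesis
  proof (cases "u = v")
    case True
    have "(\<Sum>w\<in>set (prefixes u). tvar t (prof A t) 0 ?L w) = t" using S[of u] u by (auto simp: talive_def)
    then show ?thesis using True t A by (simp add: crem_cov_def mrca_time_def)
  next
    case False
    define w where "w = longest_common_prefix u v"
    have "prefix w u" "prefix w v" by (simp_all add: w_def longest_common_prefix_prefix1 longest_common_prefix_prefix2)
    \<comment> \<open>If the common prefix were \<open>u\<close> itself, \<open>v\<close> would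
      descend from \<open>u\<close> and be born only after the death of \<open>u\<close>, so both
      could not be alive at t.\<close>
    have sp: "strict_prefix w u"
    proof (rule ccontr)
      assume "\<not> strict_prefix w u"
      then have "w = u" using \<open>prefix w u\<close> by (simp add: strict_prefix_def)
      then have "strict_prefix u v" using \<open>prefix w v\<close> False by (simp add: strict_prefix_def)
      from tbirth_prefix[of ?L, OF L this] u v show False by (simp add: talive_def)
    qed
    have d: "tbirth ?L w + L (ulam w) \<le> t" using tbirth_prefix[of ?L, OF L sp] u by (simp add: talive_def)
    have d0: "0 \<le> tbirth ?L w" by (rule tbirth_nonneg) (rule L)
    have ne: "ulam u \<noteq> ulam v" using False inj_ulam by (auto dest: injD)
    have "inj (of_bool :: bool \<Rightarrow> nat)" by (auto simp: inj_def split: if_splits)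
    from longest_common_prefix_map[OF this, of u v] have "mrca_time L t (ulam u) (ulam v) = tbirth ?L w + L (ulam w)"
      using ne by (simp add: mrca_time_def Let_def w_def birth_ulam)
    then have "crem_cov A t L (ulam u, t) (ulam v, t) = prof A t (tbirth ?L w + L (ulam w))"
      using t d d0 L[of w] by (simp add: crem_cov_def prof_def min_def max_def)
    moreover have "(\<Sum>w\<in>set (prefixes w). tvar t (prof A t) 0 ?L w) = prof A t (tbirth ?L w + L (ulam w))"
    proof -
      have "tbirth ?L w \<le> t" using d L[of w] by simp
      from S[OF this] d show ?thesis by simp
    qed
    ultimately show ?thesis by (simp add: w_def)
  qed
qed

lemma tpos_eq:
  "tpos T B \<rho> b L g v = (let x = \<Sum>w\<in>set (prefixes v). sqrt (tvar T B b L w) * fst (g w); z = \<Sum>w\<in>set (prefixes v). sqrt (tvar T B b L w) * snd (g w)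
    in (x, \<rho> * x + sqrt (1 - \<rho>\<^sup>2) * z))"
  by (rule prod_eqI) (simp_all add: Let_def tpos_def disp_def fst_sum snd_sum sum_distrib_left sum.distrib[symmetric] algebra_simps)

text \<open>Given the tree, the finitely many positions in \<open>X\<close> and \<open>Z\<close> and
  the sums of node Gaussians have the same joint characteristic function, hence the same law, and
  the partition function depends on them measurably.\<close>

lemma quenched_law:
  fixes X Z :: "nat list \<times> real \<Rightarrow> 'b \<Rightarrow> real" and \<beta> :: complex
  assumes P: "prob_space P" and t: "0 < t" and A: "A 0 = 0" "A 1 = 1" and prof: "profile t (prof A t) \<rho>"
    and L: "\<And>w. 0 \<le> L (ulam w)"
    and S: "S = talive t 0 (\<lambda>w. L (ulam w))" "finite S" and I: "(\<lambda>v. (ulam v, t)) ` S \<subseteq> I"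
    and X: "centered_gaussian_process P I (crem_cov A t L) X" and Z: "centered_gaussian_process P I (crem_cov A t L) Z"
    and ind: "indep_processes P I X Z" and U: "U \<in> sets borel"
  shows "measure P {\<eta> \<in> space P. norm (\<Sum>v\<in>S. wt \<beta> (X (ulam v, t) \<eta>, \<rho> * X (ulam v, t) \<eta> + sqrt (1 - \<rho>\<^sup>2) * Z (ulam v, t) \<eta>)) \<in> U} =
    measure (\<Pi>\<^sub>M v\<in>(UNIV :: bool list set). gauss2) {g. norm (\<Sum>v\<in>S. wt \<beta> (tpos t (prof A t) \<rho> 0 (\<lambda>w. L (ulam w)) g v)) \<in> U}"
proof -
  interpret P: prob_space P by fact
  interpret G: prob_space gauss2 by (rule prob_space_gauss2)
  interpret B: profile t "prof A t" \<rho> by fact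
  let ?G = "\<Pi>\<^sub>M v\<in>(UNIV :: bool list set). gauss2"
  interpret PG: product_prob_space "\<lambda>_. gauss2" "UNIV :: bool list set" by unfold_locales
  let ?L = "\<lambda>w. L (ulam w)"
  let ?V = "tvar t (prof A t) 0 ?L"
  have V: "0 \<le> ?V w" if "v \<in> S" "prefix w v" for v w
  proof -
    have "tbirth ?L w \<le> tbirth ?L v"
    proof (cases "w = v")
      case False
      then have "strict_prefix w v" using that by (simp add: strict_prefix_def)
      from tbirth_prefix[of ?L, OF L this] L[of w] show ?thesis by simp
    qed simp
    then have "tbirth ?L w \<le> t" using that by (simp add: S talive_def)
    then show ?thesis using B.dispvar_nonneg[of "L (ulam w)" "tbirth ?L w"] tbirth_nonneg[of ?L w, OF L] L by (simp add: tvar_def)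
  qed
  let ?I = "S \<times> (UNIV :: bool set)"
  \<comment> \<open>The two processes are merged into one vector, \<open>True\<close> marking
    \<open>X\<close> and \<open>False\<close> marking \<open>Z\<close>, so that independence and
    covariances are captured by a single characteristic function.\<close>
  define X' where "X' i = (if snd i then X (ulam (fst i), t) else Z (ulam (fst i), t))" for i
  define Y' where "Y' i g = (\<Sum>w\<in>set (prefixes (fst i)). sqrt (?V w) * (if snd i then fst (g w) else snd (g w)))" for i :: "bool list \<times> bool" and g :: "bool list \<Rightarrow> real \<times> real"
  have Xm: "X' i \<in> borel_measurable P" if "i \<in> ?I" for i
  proof -
    have "(ulam (fst i), t) \<in> I" using I that by (auto simp: mem_Times_iff)
    then have "X (ulam (fst i), t) \<in> borel_measurable P" "Z (ulam (fst i), t) \<in> borel_measurable P"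
      using X Z by (simp_all add: centered_gaussian_process_def gaussian_process_def)
    then show ?thesis by (simp add: X'_def)
  qed
  have Ym: "Y' i \<in> borel_measurable ?G" for i
  proof -
    have c: "(\<lambda>g. g w) \<in> ?G \<rightarrow>\<^sub>M gauss2" for w :: "bool list"
      by (rule measurable_component_singleton) simp
    have "(\<lambda>g. fst (g w)) \<in> borel_measurable ?G" "(\<lambda>g. snd (g w)) \<in> borel_measurable ?G" for w :: "bool list"
      by (rule measurable_compose[OF c], simp)+
    then show ?thesis unfolding Y'_def[abs_def] by (cases "snd i") (simp_all add: borel_measurable_sum)
  qed
  let ?f = "\<lambda>y. norm (\<Sum>v\<in>S. wt \<beta> (y (v, True), \<rho> * y (v, True) + sqrt (1 - \<rho>\<^sup>2) * y (v, False)))"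
  have sumI: "(\<Sum>i\<in>?I. h i) = (\<Sum>v\<in>S. h (v, True)) + (\<Sum>v\<in>S. h (v, False))" for h :: "bool list \<times> bool \<Rightarrow> real"
  proof -
    have "(\<Sum>i\<in>?I. h i) = (\<Sum>v\<in>S. \<Sum>c\<in>UNIV. h (v, c))" by (simp add: sum.cartesian_product)
    then show ?thesis by (simp add: UNIV_bool sum.distrib add.commute)
  qed
  have dist: "distr P (\<Pi>\<^sub>M i\<in>?I. borel) (\<lambda>x. \<lambda>i\<in>?I. X' i x) = distr ?G (\<Pi>\<^sub>M i\<in>?I. borel) (\<lambda>y. \<lambda>i\<in>?I. Y' i y)"
  proof (rule char_uniqueness_finite[OF P PG.P.prob_space_axioms _ Xm Ym])
    fix a :: "bool list \<times> bool \<Rightarrow> real"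
    let ?e = "\<lambda>v. (ulam v, t)"
    \<comment> \<open>The coefficients must be a function of the indices of the process, so the
      binary label is read back from the numerical one.\<close>
    define b where "b c j = a (map (\<lambda>i. i = 1) (fst j), c)" for c and j :: "nat list \<times> real"
    have b: "b c (?e v) = a (v, c)" for c v by (simp add: b_def o_def)
    have e: "inj_on ?e S" using inj_ulam by (auto simp: inj_on_def inj_def)
    have C: "(\<Sum>i\<in>?e ` S. \<Sum>j\<in>?e ` S. b c i * b c j * crem_cov A t L i j) =
      (\<Sum>u\<in>S. \<Sum>v\<in>S. a (u, c) * a (v, c) * (\<Sum>w\<in>set (prefixes (longest_common_prefix u v)). ?V w))" for c
      unfolding sum.reindex[OF e] o_def b using crem_cov_ulam[of t A L, OF t A L] by (intro sum.cong refl) (simp add: S(1))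
    have "(\<integral>x. iexp (\<Sum>i\<in>?I. a i * X' i x) \<partial>P) = (\<integral>x. iexp ((\<Sum>j\<in>?e ` S. b True j * X j x) + (\<Sum>j\<in>?e ` S. b False j * Z j x)) \<partial>P)"
      unfolding sumI sum.reindex[OF e] o_def b by (simp add: X'_def)
    also have "... = exp (- (\<Sum>u\<in>S. \<Sum>v\<in>S. a (u, True) * a (v, True) * (\<Sum>w\<in>set (prefixes (longest_common_prefix u v)). ?V w)) / 2) *
      exp (- (\<Sum>u\<in>S. \<Sum>v\<in>S. a (u, False) * a (v, False) * (\<Sum>w\<in>set (prefixes (longest_common_prefix u v)). ?V w)) / 2)"
      using gaussian_pair_char[OF P X Z ind _ I, of "b True" "b False"] S(2) by (simp only: C finite_imageI)
    also have "... = (\<integral>g. iexp ((\<Sum>v\<in>S. a (v, True) * (\<Sum>w\<in>set (prefixes v). sqrt (?V w) * fst (g w))) + (\<Sum>v\<in>S. a (v, False) * (\<Sum>w\<in>set (prefixes v). sqrt (?V w) * snd (g w)))) \<partial>?G)"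
      by (rule gauss_tree_char[OF S(2) V, symmetric])
    also have "... = (\<integral>g. iexp (\<Sum>i\<in>?I. a i * Y' i g) \<partial>?G)"
      unfolding sumI by (simp only: Y'_def fst_conv snd_conv if_True if_False simp_thms)
    finally show "(\<integral>x. iexp (\<Sum>i\<in>?I. a i * X' i x) \<partial>P) = (\<integral>g. iexp (\<Sum>i\<in>?I. a i * Y' i g) \<partial>?G)" .
  qed (simp add: S(2))
  have fm: "?f \<in> borel_measurable (\<Pi>\<^sub>M i\<in>?I. borel)"
  proof -
    have "(\<lambda>y. \<Sum>v\<in>S. wt \<beta> (y (v, True), \<rho> * y (v, True) + sqrt (1 - \<rho>\<^sup>2) * y (v, False))) \<in> borel_measurable (\<Pi>\<^sub>M i\<in>?I. borel)"
    proof (rule borel_measurable_sum)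
      fix v assume "v \<in> S"
      then have [measurable]: "(\<lambda>y. y (v, c)) \<in> borel_measurable (\<Pi>\<^sub>M i\<in>?I. borel :: real measure)" for c
        by (intro measurable_component_singleton) auto
      show "(\<lambda>y. wt \<beta> (y (v, True), \<rho> * y (v, True) + sqrt (1 - \<rho>\<^sup>2) * y (v, False))) \<in> borel_measurable (\<Pi>\<^sub>M i\<in>?I. borel)"
        by measurable
    qed
    then show ?thesis by simp
  qed
  let ?E = "{y \<in> space (\<Pi>\<^sub>M i\<in>?I. borel). ?f y \<in> U}"
  have Es: "?E \<in> sets (\<Pi>\<^sub>M i\<in>?I. borel)" using measurable_sets[OF fm U] by (simp add: vimage_def Int_def conj_commute)
  have Xmm: "(\<lambda>x. \<lambda>i\<in>?I. X' i x) \<in> P \<rightarrow>\<^sub>M (\<Pi>\<^sub>M i\<in>?I. borel)" using Xm by (rule measurable_restrict)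
  have Ymm: "(\<lambda>x. \<lambda>i\<in>?I. Y' i x) \<in> ?G \<rightarrow>\<^sub>M (\<Pi>\<^sub>M i\<in>?I. borel)" using Ym by (rule measurable_restrict)
  have "{\<eta> \<in> space P. norm (\<Sum>v\<in>S. wt \<beta> (X (ulam v, t) \<eta>, \<rho> * X (ulam v, t) \<eta> + sqrt (1 - \<rho>\<^sup>2) * Z (ulam v, t) \<eta>)) \<in> U} = (\<lambda>x. \<lambda>i\<in>?I. X' i x) -` ?E \<inter> space P"
    by (auto simp: X'_def space_PiM)
  then have "measure P {\<eta> \<in> space P. norm (\<Sum>v\<in>S. wt \<beta> (X (ulam v, t) \<eta>, \<rho> * X (ulam v, t) \<eta> + sqrt (1 - \<rho>\<^sup>2) * Z (ulam v, t) \<eta>)) \<in> U}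
      = measure (distr P (\<Pi>\<^sub>M i\<in>?I. borel) (\<lambda>x. \<lambda>i\<in>?I. X' i x)) ?E"
    using measure_distr[OF Xmm Es] by simp
  also have "... = measure ?G ((\<lambda>x. \<lambda>i\<in>?I. Y' i x) -` ?E \<inter> space ?G)" unfolding dist by (rule measure_distr[OF Ymm Es])
  also have "(\<lambda>x. \<lambda>i\<in>?I. Y' i x) -` ?E \<inter> space ?G = {g. norm (\<Sum>v\<in>S. wt \<beta> (tpos t (prof A t) \<rho> 0 ?L g v)) \<in> U}"
    by (auto simp: Y'_def space_PiM space_pair_measure tpos_eq Let_def)
  finally show ?thesis .
qed

section \<open>Kernels and random index sets\<close>

lemma (in prob_space) indep_vars_reindex_inj:
  assumes X: "indep_vars M' X UNIV" and f: "inj f"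
  shows "indep_vars (\<lambda>i. M' (f i)) (\<lambda>i. X (f i)) UNIV"
  unfolding indep_vars_def2
proof (intro conjI ballI indep_setsI)
  fix i show "random_variable (M' (f i)) (X (f i))" using X by (simp add: indep_vars_def2)
  show "{X (f i) -` A \<inter> space M | A. A \<in> sets (M' (f i))} \<subseteq> events" using X by (auto simp: indep_vars_def2 intro: measurable_sets)
next
  fix A J assume J: "J \<noteq> {}" "J \<subseteq> UNIV" "finite J" and A: "\<forall>j\<in>J. A j \<in> {X (f j) -` A \<inter> space M | A. A \<in> sets (M' (f j))}"
  have "prob (\<Inter>j\<in>f ` J. A (inv f j)) = (\<Prod>j\<in>f ` J. prob (A (inv f j)))"
    using X J A f by (intro indep_setsD[of "\<lambda>i. {X i -` A \<inter> space M | A. A \<in> sets (M' i)}" UNIV]) (auto simp: indep_vars_def2)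
  then show "prob (\<Inter>j\<in>J. A j) = (\<Prod>j\<in>J. prob (A j))" using f by (simp add: prod.reindex inj_on_subset)
qed

lemma annealed_kernel:
  assumes M: "prob_space M" and Q: "Q \<in> M \<rightarrow>\<^sub>M prob_algebra S"
  shows "sets (annealed M S Q) = sets (M \<Otimes>\<^sub>M S)" "prob_space (annealed M S Q)"
    and "E \<in> sets (M \<Otimes>\<^sub>M S) \<Longrightarrow> emeasure (annealed M S Q) E = (\<integral>\<^sup>+\<omega>. emeasure (Q \<omega>) {\<eta> \<in> space S. (\<omega>, \<eta>) \<in> E} \<partial>M)"
proof -
  interpret M: prob_space M by fact
  have K: "(\<lambda>\<omega>. distr (Q \<omega>) (M \<Otimes>\<^sub>M S) (\<lambda>\<eta>. (\<omega>, \<eta>))) \<in> M \<rightarrow>\<^sub>M subprob_algebra (M \<Otimes>\<^sub>M S)"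
    by (rule measurable_distr2[OF _ measurable_prob_algebraD[OF Q]]) simp
  have Q': "sets (Q \<omega>) = sets S" "prob_space (Q \<omega>)" if "\<omega> \<in> space M" for \<omega>
    using measurable_space[OF Q that] by (auto simp: space_prob_algebra)
  show s: "sets (annealed M S Q) = sets (M \<Otimes>\<^sub>M S)"
    unfolding annealed_def by (rule sets_bind_measurable[OF K M.not_empty])
  show e: "emeasure (annealed M S Q) E = (\<integral>\<^sup>+\<omega>. emeasure (Q \<omega>) {\<eta> \<in> space S. (\<omega>, \<eta>) \<in> E} \<partial>M)" if E: "E \<in> sets (M \<Otimes>\<^sub>M S)" for E
    unfolding annealed_def emeasure_bind[OF M.not_empty K E]
  proof (rule nn_integral_cong)
    fix \<omega> assume \<omega>: "\<omega> \<in> space M"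
    have "Pair \<omega> \<in> Q \<omega> \<rightarrow>\<^sub>M M \<Otimes>\<^sub>M S"
      unfolding measurable_cong_sets[OF Q'(1)[OF \<omega>] refl] by (rule measurable_Pair1'[OF \<omega>])
    from emeasure_distr[OF this E] show "emeasure (distr (Q \<omega>) (M \<Otimes>\<^sub>M S) (Pair \<omega>)) E = emeasure (Q \<omega>) {\<eta> \<in> space S. (\<omega>, \<eta>) \<in> E}"
      using sets_eq_imp_space_eq[OF Q'(1)[OF \<omega>]] by (simp add: vimage_def Int_def conj_commute)
  qed
  show "prob_space (annealed M S Q)"
  proof (rule prob_spaceI)
    have "emeasure (annealed M S Q) (space (M \<Otimes>\<^sub>M S)) = (\<integral>\<^sup>+\<omega>. 1 \<partial>M)"
      unfolding e[OF sets.top]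
    proof (rule nn_integral_cong)
      fix \<omega> assume \<omega>: "\<omega> \<in> space M"
      then show "emeasure (Q \<omega>) {\<eta> \<in> space S. (\<omega>, \<eta>) \<in> space (M \<Otimes>\<^sub>M S)} = 1"
        using prob_space.emeasure_space_1[OF Q'(2)[OF \<omega>]] sets_eq_imp_space_eq[OF Q'(1)[OF \<omega>]] by (simp add: space_pair_measure)
    qed
    then show "emeasure (annealed M S Q) (space (annealed M S Q)) = 1"
      using sets_eq_imp_space_eq[OF s] M.emeasure_space_1 by simp
  qed
qed

text \<open>A countable type has only countably many finite subsets, so the sum is measurable on
  each piece where the index set is constant.\<close>

lemma borel_measurable_random_sum:
  fixes f :: "'u :: countable \<Rightarrow> 'a \<Rightarrow> complex"
  assumes f: "\<And>u. f u \<in> borel_measurable N" and S: "\<And>u. {x \<in> space N. u \<in> S x} \<in> sets N"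
  shows "(\<lambda>x. \<Sum>u\<in>S x. f u x) \<in> borel_measurable N"
proof -
  \<comment> \<open>A sum over an infinite set is 0 by convention, as is the sum over the empty set,
    so the replacement changes nothing.\<close>
  define S' where "S' x = (if finite (S x) then S x else {})" for x
  have eq: "{x \<in> space N. S x = F} \<in> sets N" for F
  proof -
    have "{x \<in> space N. S x = F} = {x \<in> space N. \<forall>u. if u \<in> F then u \<in> S x else \<not> u \<in> S x}" by auto
    also have "... \<in> sets N"
    proof (rule sets.sets_Collect_countable_All)
      fix u show "{x \<in> space N. if u \<in> F then u \<in> S x else \<not> u \<in> S x} \<in> sets N"
        using S[of u] sets.sets_Collect_neg[OF S[of u]] by simp
    qed
    finally show ?thesis .
  qed
  have fin: "{x \<in> space N. finite (S x)} \<in> sets N"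
  proof -
    have "{x \<in> space N. finite (S x)} = (\<Union>F\<in>Collect finite. {x \<in> space N. S x = F})" by auto
    also have "... \<in> sets N" by (intro sets.countable_UN' countable_Collect_finite) (auto simp: eq)
    finally show ?thesis .
  qed
  have S'm: "S' \<in> N \<rightarrow>\<^sub>M count_space (Collect finite)"
    unfolding measurable_count_space_eq_countable[OF countable_Collect_finite]
  proof (intro conjI ballI)
    show "S' \<in> space N \<rightarrow> Collect finite" by (auto simp: S'_def)
    fix F :: "'u set" assume F: "F \<in> Collect finite"
    show "S' -` {F} \<inter> space N \<in> sets N"
    proof (cases "F = {}")
      case True
      have "S' -` {F} \<inter> space N = {x \<in> space N. S x = {}} \<union> (space N - {x \<in> space N. finite (S x)})"
        using True by (auto simp: S'_def)
      then show ?thesis using eq fin by auto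
    next
      case False
      then have "S' -` {F} \<inter> space N = {x \<in> space N. S x = F}" using F by (auto simp: S'_def split: if_splits)
      then show ?thesis using eq by simp
    qed
  qed
  have "(\<lambda>x. \<Sum>u\<in>S' x. f u x) \<in> borel_measurable N"
    by (rule measurable_compose_countable'[OF _ S'm countable_Collect_finite]) (intro borel_measurable_sum f)
  moreover have "(\<Sum>u\<in>S' x. f u x) = (\<Sum>u\<in>S x. f u x)" for x by (simp add: S'_def)
  ultimately show ?thesis by simp
qed

section \<open>The binary model under the annealed law\<close>

locale binary_crem =
  fixes A :: "real \<Rightarrow> real" and p :: "nat pmf" and M :: "'a measure"
    and life :: "nat list \<Rightarrow> 'a \<Rightarrow> real" and offs :: "nat list \<Rightarrow> 'a \<Rightarrow> nat"
  assumes gw: "galton_watson M p life offs" and p2: "pmf p 2 = 1"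
begin

sublocale M: prob_space M
  using gw by (simp add: galton_watson_def)

lemma pair_indep: "M.indep_vars (\<lambda>_. borel \<Otimes>\<^sub>M count_space UNIV) (\<lambda>u \<omega>. (life u \<omega>, offs u \<omega>)) UNIV"
  and pair_distr: "distr M (borel \<Otimes>\<^sub>M count_space UNIV) (\<lambda>\<omega>. (life u \<omega>, offs u \<omega>)) = expo \<Otimes>\<^sub>M measure_pmf p"
  using gw by (simp_all add: galton_watson_def)

lemma pair_measurable: "(\<lambda>\<omega>. (life u \<omega>, offs u \<omega>)) \<in> M \<rightarrow>\<^sub>M borel \<Otimes>\<^sub>M count_space UNIV"
  using pair_indep by (simp add: M.indep_vars_def)

lemma life_measurable [measurable]: "life u \<in> borel_measurable M"
  using measurable_compose[OF pair_measurable measurable_fst] by simp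

lemma offs_measurable [measurable]: "offs u \<in> M \<rightarrow>\<^sub>M count_space UNIV"
  using measurable_compose[OF pair_measurable measurable_snd] by simp

lemma life_indep: "M.indep_vars (\<lambda>_. borel) life UNIV"
  using M.indep_vars_compose2[OF pair_indep, of "\<lambda>_. fst" "\<lambda>_. borel"] by simp

lemma life_distr: "distr M borel (life u) = expo"
proof -
  have "distr M borel (life u) = distr (distr M (borel \<Otimes>\<^sub>M count_space UNIV) (\<lambda>\<omega>. (life u \<omega>, offs u \<omega>))) borel fst"
    by (subst distr_distr[OF _ pair_measurable]) (auto simp: o_def)
  also have "... = distr (expo \<Otimes>\<^sub>M measure_pmf p) expo fst"
    unfolding pair_distr by (rule distr_cong) auto
  also have "... = expo" by (rule prob_space.distr_pair_fst[OF prob_space_measure_pmf])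
  finally show ?thesis .
qed

lemma AE_binary: "AE \<omega> in M. \<forall>u. offs u \<omega> = 2 \<and> 0 \<le> life u \<omega>"
  unfolding AE_all_countable
proof
  fix u
  interpret E: prob_space expo by (rule prob_space_expo)
  interpret Ep: pair_prob_space expo "measure_pmf p" ..
  have "measure (measure_pmf p) {2} = 1" using p2 by (simp add: pmf.rep_eq)
  then have "AE y in measure_pmf p. y = 2" by (subst (asm) measure_pmf.prob_eq_1) auto
  then have ae: "AE x in expo. AE y in measure_pmf p. snd (x, y) = 2 \<and> 0 \<le> fst (x, y)"
    using AE_expo by (auto elim!: eventually_mono)
  have m: "{x \<in> space (borel \<Otimes>\<^sub>M count_space UNIV). snd x = (2 :: nat) \<and> 0 \<le> (fst x :: real)} \<in> sets (borel \<Otimes>\<^sub>M count_space UNIV)"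
    by measurable
  have sp: "sets (expo \<Otimes>\<^sub>M measure_pmf p) = sets (borel \<Otimes>\<^sub>M count_space UNIV)" by (intro sets_pair_measure_cong) auto
  have "AE x in expo \<Otimes>\<^sub>M measure_pmf p. snd x = 2 \<and> 0 \<le> fst x"
    using m ae unfolding sp[symmetric] sets_eq_imp_space_eq[OF sp, symmetric] by (rule Ep.AE_pair_measure)
  then have "AE x in distr M (borel \<Otimes>\<^sub>M count_space UNIV) (\<lambda>\<omega>. (life u \<omega>, offs u \<omega>)). snd x = 2 \<and> 0 \<le> fst x"
    unfolding pair_distr .
  then show "AE \<omega> in M. offs u \<omega> = 2 \<and> 0 \<le> life u \<omega>"
    by (subst (asm) AE_distr_iff[OF pair_measurable m]) simp
qed

text \<open>Chernoff's bound with exponent 2: the mean of exp (- 2 l) for a lifetime l is 1 / 3,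
  small enough to beat the 2^n labels of length n.\<close>

lemma deep_bound:
  assumes n: "length v = n"
  shows "emeasure M {\<omega> \<in> space M. tbirth (\<lambda>w. life (ulam w) \<omega>) v \<le> t} \<le> ennreal (exp (2 * t) * (1 / 3) ^ n)"
proof -
  let ?u = "\<lambda>i. ulam (take i v)"
  have inj: "inj_on ?u {..<n}"
  proof (rule inj_onI)
    fix i j assume ij: "i \<in> {..<n}" "j \<in> {..<n}" "?u i = ?u j"
    from arg_cong[OF ij(3), of length] show "i = j" using ij(1,2) n by simp
  qed
  have "emeasure M {\<omega> \<in> space M. tbirth (\<lambda>w. life (ulam w) \<omega>) v \<le> t} = (\<integral>\<^sup>+\<omega>. indicator {\<omega> \<in> space M. tbirth (\<lambda>w. life (ulam w) \<omega>) v \<le> t} \<omega> \<partial>M)"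
    unfolding tbirth_def by (rule nn_integral_indicator[symmetric]) measurable
  also have "... \<le> (\<integral>\<^sup>+\<omega>. ennreal (exp (2 * t)) * (\<Prod>u\<in>?u ` {..<n}. ennreal (exp (- 2 * life u \<omega>))) \<partial>M)"
  proof (rule nn_integral_mono)
    fix \<omega>
    have "(\<Prod>u\<in>?u ` {..<n}. ennreal (exp (- 2 * life u \<omega>))) = ennreal (exp (- 2 * tbirth (\<lambda>w. life (ulam w) \<omega>) v))"
      unfolding prod.reindex[OF inj] o_def
      by (simp add: prod_ennreal tbirth_def n exp_sum[symmetric] sum_distrib_left sum_negf)
    then have "ennreal (exp (2 * t)) * (\<Prod>u\<in>?u ` {..<n}. ennreal (exp (- 2 * life u \<omega>))) = ennreal (exp (2 * t) * exp (- 2 * tbirth (\<lambda>w. life (ulam w) \<omega>) v))"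
      by (simp add: ennreal_mult)
    also have "... \<ge> indicator {\<omega> \<in> space M. tbirth (\<lambda>w. life (ulam w) \<omega>) v \<le> t} \<omega>"
      by (auto simp: mult_exp_exp split: split_indicator simp flip: ennreal_1 intro!: ennreal_leI)
    finally show "indicator {\<omega> \<in> space M. tbirth (\<lambda>w. life (ulam w) \<omega>) v \<le> t} \<omega> \<le> ennreal (exp (2 * t)) * (\<Prod>u\<in>?u ` {..<n}. ennreal (exp (- 2 * life u \<omega>)))" .
  qed
  also have "... = ennreal (exp (2 * t)) * (\<integral>\<^sup>+\<omega>. (\<Prod>u\<in>?u ` {..<n}. ennreal (exp (- 2 * life u \<omega>))) \<partial>M)"
    by (rule nn_integral_cmult) measurable
  also have "(\<integral>\<^sup>+\<omega>. (\<Prod>u\<in>?u ` {..<n}. ennreal (exp (- 2 * life u \<omega>))) \<partial>M) = (\<Prod>u\<in>?u ` {..<n}. \<integral>\<^sup>+\<omega>. ennreal (exp (- 2 * life u \<omega>)) \<partial>M)"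
  proof (rule M.indep_vars_nn_integral)
    show "M.indep_vars (\<lambda>_. borel) (\<lambda>u \<omega>. ennreal (exp (- 2 * life u \<omega>))) (?u ` {..<n})"
      by (rule M.indep_vars_compose2[OF M.indep_vars_subset[OF life_indep]]) auto
  qed auto
  also have "... = (\<Prod>u\<in>?u ` {..<n}. ennreal (1 / 3))"
  proof (rule prod.cong[OF refl])
    fix u
    have "(\<integral>\<^sup>+\<omega>. ennreal (exp (- 2 * life u \<omega>)) \<partial>M) = (\<integral>\<^sup>+x. ennreal (exp (- 2 * x)) \<partial>distr M borel (life u))"
      by (rule nn_integral_distr[symmetric]) auto
    then show "(\<integral>\<^sup>+\<omega>. ennreal (exp (- 2 * life u \<omega>)) \<partial>M) = ennreal (1 / 3)" using nn_integral_expo_exp[of 1] by (simp add: life_distr)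
  qed
  also have "... = ennreal ((1 / 3) ^ n)" using inj by (simp add: card_image ennreal_power)
  finally show ?thesis by (simp add: ennreal_mult)
qed

text \<open>Off this event every particle alive at \<open>t\<close> has a label shorter than
  \<open>n\<close>. The population is then finite and the cut-off at generation \<open>n\<close>
  loses nothing.\<close>

definition deep :: "real \<Rightarrow> nat \<Rightarrow> 'a set" where
  "deep t n = {\<omega> \<in> space M. \<exists>v. length v = n \<and> tbirth (\<lambda>w. life (ulam w) \<omega>) v \<le> t}"

lemma deep_le: "deep t n \<in> sets M" "emeasure M (deep t n) \<le> ennreal (exp (2 * t) * (2 / 3) ^ n)"
proof -
  let ?D = "\<lambda>v. {\<omega> \<in> space M. tbirth (\<lambda>w. life (ulam w) \<omega>) v \<le> t}"
  have D: "?D v \<in> sets M" for v unfolding tbirth_def by measurable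
  have eq: "deep t n = (\<Union>v\<in>{v. length v = n}. ?D v)" by (auto simp: deep_def)
  show "deep t n \<in> sets M" unfolding eq using D finite_length_lists by (intro sets.finite_UN) auto
  have "emeasure M (deep t n) \<le> (\<Sum>v\<in>{v :: bool list. length v = n}. emeasure M (?D v))"
    unfolding eq using D by (intro emeasure_subadditive_finite finite_length_lists) auto
  also have "... \<le> (\<Sum>v\<in>{v :: bool list. length v = n}. ennreal (exp (2 * t) * (1 / 3) ^ n))"
    by (intro sum_mono deep_bound) simp
  also have "... = ennreal (2 ^ n * (exp (2 * t) * (1 / 3) ^ n))"
    using card_lists_length_eq[of "UNIV :: bool set" n] by (simp add: ennreal_mult ennreal_power[symmetric])
  also have "2 ^ n * (exp (2 * t) * (1 / 3) ^ n) = exp (2 * t) * (2 / 3) ^ n" by (simp add: power_divide)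
  finally show "emeasure M (deep t n) \<le> ennreal (exp (2 * t) * (2 / 3) ^ n)" .
qed

lemma measurable_partition_function:
  assumes t: "0 < t" and c: "crem A t M life offs S Q x z"
  shows "partition_function \<beta> \<rho> t life offs x z \<in> borel_measurable (M \<Otimes>\<^sub>M S)"
  unfolding partition_function_def[abs_def] Let_def
proof (rule borel_measurable_random_sum)
  fix u
  have [measurable]: "x u t \<in> borel_measurable (M \<Otimes>\<^sub>M S)" "z u t \<in> borel_measurable (M \<Otimes>\<^sub>M S)"
    using c t by (simp_all add: crem_def)
  show "(\<lambda>\<xi>. exp (complex_of_real (Re \<beta> * x u t \<xi>) + \<i> * complex_of_real (Im \<beta> * (\<rho> * x u t \<xi> + sqrt (1 - \<rho>\<^sup>2) * z u t \<xi>)))) \<in> borel_measurable (M \<Otimes>\<^sub>M S)"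
    by measurable
  have "{\<omega> \<in> space M. u \<in> alive (\<lambda>u. life u \<omega>) (\<lambda>u. offs u \<omega>) t} \<in> sets M"
    unfolding alive_def birth_def mem_Collect_eq by measurable
  from measurable_sets[OF measurable_fst this, of S] show "{\<xi> \<in> space (M \<Otimes>\<^sub>M S). u \<in> alive (\<lambda>u. life u (fst \<xi>)) (\<lambda>u. offs u (fst \<xi>)) t} \<in> sets (M \<Otimes>\<^sub>M S)"
    by (rule back_subst[where P = "\<lambda>E. E \<in> sets (M \<Otimes>\<^sub>M S)"]) (auto simp: space_pair_measure)
qed

text \<open>For a tree outside \<open>deep\<close> the conditional law of the partition function is
  that of \<open>part\<close> with the lifetimes fixed and the Gaussians resampled. Averaging over
  the tree gives the marked tree of \<open>distr_zip_marks\<close>. The first summand vanishes as n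
  grows.\<close>

theorem annealed_le:
  assumes t: "0 < t" and A: "A 0 = 0" "A 1 = 1" and prof: "profile t (prof A t) \<rho>"
    and c: "crem A t M life offs S Q x z" and U: "U \<in> sets borel"
  shows "measure (annealed M S Q) {\<xi> \<in> space (annealed M S Q). norm (partition_function \<beta> \<rho> t life offs x z \<xi>) \<in> U}
    \<le> exp (2 * t) * (2 / 3) ^ n + measure trees {\<omega>. norm (part t (prof A t) \<rho> \<beta> n 0 \<omega>) \<in> U}"
proof -
  interpret B: profile t "prof A t" \<rho> by fact
  interpret T: prob_space "trees" by (rule prob_space_tree)
  interpret G: prob_space gauss2 by (rule prob_space_gauss2)
  interpret PG: product_prob_space "\<lambda>_. gauss2" "UNIV :: bool list set" by unfold_locales
  let ?G = "\<Pi>\<^sub>M v\<in>(UNIV :: bool list set). gauss2"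
  let ?Z = "\<lambda>(x, g) v. (life (ulam v) x, g v)"
  have Q: "Q \<in> M \<rightarrow>\<^sub>M prob_algebra S" using c by (simp add: crem_def)
  note an = annealed_kernel[OF M.prob_space_axioms Q]
  interpret An: prob_space "annealed M S Q" by (rule an(2))
  define E where "E = {\<xi> \<in> space (M \<Otimes>\<^sub>M S). norm (partition_function \<beta> \<rho> t life offs x z \<xi>) \<in> U}"
  define E' where "E' = {\<omega> :: bool list \<Rightarrow> real \<times> real \<times> real. norm (part t (prof A t) \<rho> \<beta> n 0 \<omega>) \<in> U}"
  have Es: "E \<in> sets (M \<Otimes>\<^sub>M S)"
  proof -
    have "(\<lambda>\<xi>. norm (partition_function \<beta> \<rho> t life offs x z \<xi>)) \<in> borel_measurable (M \<Otimes>\<^sub>M S)"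
      using measurable_partition_function[OF t c] by simp
    from measurable_sets[OF this U] show ?thesis by (simp add: E_def vimage_def Int_def conj_commute)
  qed
  have E's: "E' \<in> sets trees"
  proof -
    have "(\<lambda>\<omega>. norm (part t (prof A t) \<rho> \<beta> n 0 \<omega>)) \<in> borel_measurable trees"
      using B.measurable_part_0 by simp
    from measurable_sets[OF this U] show ?thesis by (simp add: E'_def vimage_def)
  qed
  have ind: "M.indep_vars (\<lambda>_. borel) (\<lambda>v. life (ulam v)) UNIV"
    using M.indep_vars_reindex_inj[OF life_indep inj_ulam] .
  note zip = distr_zip_marks[OF M.prob_space_axioms ind life_distr]
  \<comment> \<open>The second summand is the probability, for fixed lifetimes, that the marked tree
    with fresh Gaussians lies in \<open>E'\<close>.\<close>
  have key: "AE \<omega> in M. emeasure (Q \<omega>) {\<eta> \<in> space S. (\<omega>, \<eta>) \<in> E} \<le> indicator (deep t n) \<omega> + emeasure ?G (Pair \<omega> -` (?Z -` E' \<inter> space (M \<Otimes>\<^sub>M ?G)))"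
    using AE_binary c[unfolded crem_def, THEN conjunct2, THEN conjunct2] AE_space
  proof eventually_elim
    case (elim \<omega>)
    have \<omega>: "\<omega> \<in> space M" by (rule elim(3))
    have Q\<omega>: "sets (Q \<omega>) = sets S" "prob_space (Q \<omega>)" using measurable_space[OF Q \<omega>] by (auto simp: space_prob_algebra)
    interpret Q\<omega>: prob_space "Q \<omega>" by (rule Q\<omega>)
    have sp: "space (Q \<omega>) = space S" by (rule sets_eq_imp_space_eq[OF Q\<omega>(1)])
    let ?L = "\<lambda>u. life u \<omega>"
    let ?V = "talive t 0 (\<lambda>w. ?L (ulam w))"
    let ?X = "\<lambda>(u, s) \<eta>. x u s (\<omega>, \<eta>)" and ?Y = "\<lambda>(u, s) \<eta>. z u s (\<omega>, \<eta>)"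
    have L: "0 \<le> ?L (ulam w)" for w using elim(1) by simp
    have al: "alive ?L (\<lambda>u. offs u \<omega>) t = ulam ` ?V" using elim(1) by (intro alive_ulam) simp
    show ?case
    proof (cases "\<omega> \<in> deep t n")
      case True
      then show ?thesis using Q\<omega>.emeasure_le_1 by (auto intro: add_increasing2)
    next
      case False
      \<comment> \<open>The ancestor in generation \<open>n\<close> of a longer living label would
        have been born by \<open>t\<close>, which puts the tree into \<open>deep\<close>.\<close>
      have short: "length v < n" if "v \<in> ?V" for v
      proof (rule ccontr)
        assume "\<not> length v < n"
        then have "length (take n v) = n" by simp
        moreover have "tbirth (\<lambda>w. ?L (ulam w)) (take n v) \<le> t"
        proof (cases "take n v = v")
          case True
          then show ?thesis using that by (simp add: talive_def)
        next
          case False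
          then have "strict_prefix (take n v) v" by (simp add: strict_prefix_def take_is_prefix)
          from tbirth_prefix[of "\<lambda>w. ?L (ulam w)", OF L this] L[of "take n v"] that show ?thesis by (simp add: talive_def)
        qed
        ultimately show False using False \<omega> by (auto simp: deep_def)
      qed
      have V: "{v \<in> ?V. length v < n} = ?V" using short by auto
      have finV: "finite ?V"
        by (rule finite_subset[OF _ finite_lists_length_le[OF finite[of UNIV], of n]]) (use short in \<open>auto intro: less_imp_le\<close>)
      have cg: "centered_gaussian_process (Q \<omega>) (ulam ` ?V \<times> {0..t}) (crem_cov A t ?L) ?X"
        "centered_gaussian_process (Q \<omega>) (ulam ` ?V \<times> {0..t}) (crem_cov A t ?L) ?Y"
        "indep_processes (Q \<omega>) (ulam ` ?V \<times> {0..t}) ?X ?Y"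
        using elim(2) unfolding Let_def al by auto
      have sub: "(\<lambda>v. (ulam v, t)) ` ?V \<subseteq> ulam ` ?V \<times> {0..t}" using t by auto
      have pf: "partition_function \<beta> \<rho> t life offs x z (\<omega>, \<eta>) = (\<Sum>v\<in>?V. wt \<beta> (?X (ulam v, t) \<eta>, \<rho> * ?X (ulam v, t) \<eta> + sqrt (1 - \<rho>\<^sup>2) * ?Y (ulam v, t) \<eta>))" for \<eta>
        unfolding partition_function_def fst_conv al by (simp add: sum.reindex inj_on_subset[OF inj_ulam] wt_def Let_def)
      have "{\<eta> \<in> space S. (\<omega>, \<eta>) \<in> E} = {\<eta> \<in> space (Q \<omega>). norm (\<Sum>v\<in>?V. wt \<beta> (?X (ulam v, t) \<eta>, \<rho> * ?X (ulam v, t) \<eta> + sqrt (1 - \<rho>\<^sup>2) * ?Y (ulam v, t) \<eta>)) \<in> U}"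
        using \<omega> by (auto simp: E_def pf sp space_pair_measure)
      then have "measure (Q \<omega>) {\<eta> \<in> space S. (\<omega>, \<eta>) \<in> E} = measure ?G {g. norm (\<Sum>v\<in>?V. wt \<beta> (tpos t (prof A t) \<rho> 0 (\<lambda>w. ?L (ulam w)) g v)) \<in> U}"
        using quenched_law[of "Q \<omega>" t A \<rho> ?L ?V "ulam ` ?V \<times> {0..t}" ?X ?Y U \<beta>, OF Q\<omega>(2) t A prof L refl finV sub cg U] by simp
      also have "{g. norm (\<Sum>v\<in>?V. wt \<beta> (tpos t (prof A t) \<rho> 0 (\<lambda>w. ?L (ulam w)) g v)) \<in> U} = Pair \<omega> -` (?Z -` E' \<inter> space (M \<Otimes>\<^sub>M ?G))"
        using \<omega> sum_leaves[where L = "\<lambda>w. ?L (ulam w)" and b = 0 and T = t and B = "prof A t" and \<rho> = \<rho> and n = n and F = "wt \<beta>", OF L] t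
        by (auto simp: E'_def part_def V space_pair_measure space_PiM)
      finally show ?thesis using False by (simp add: Q\<omega>.emeasure_eq_measure PG.P.emeasure_eq_measure)
    qed
  qed
  have "emeasure (annealed M S Q) E = (\<integral>\<^sup>+\<omega>. emeasure (Q \<omega>) {\<eta> \<in> space S. (\<omega>, \<eta>) \<in> E} \<partial>M)" by (rule an(3)[OF Es])
  also have "... \<le> (\<integral>\<^sup>+\<omega>. indicator (deep t n) \<omega> + emeasure ?G (Pair \<omega> -` (?Z -` E' \<inter> space (M \<Otimes>\<^sub>M ?G))) \<partial>M)"
    by (rule nn_integral_mono_AE[OF key])
  also have "... = emeasure M (deep t n) + (\<integral>\<^sup>+\<omega>. emeasure ?G (Pair \<omega> -` (?Z -` E' \<inter> space (M \<Otimes>\<^sub>M ?G))) \<partial>M)"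
    using deep_le(1) PG.P.measurable_emeasure_Pair[OF measurable_sets[OF zip(2) E's]] by (subst nn_integral_add) auto
  also have "(\<integral>\<^sup>+\<omega>. emeasure ?G (Pair \<omega> -` (?Z -` E' \<inter> space (M \<Otimes>\<^sub>M ?G))) \<partial>M) = emeasure trees E'"
    by (simp only: PG.P.emeasure_pair_measure_alt[OF measurable_sets[OF zip(2) E's], symmetric] emeasure_distr[OF zip(2) E's, symmetric] zip(1))
  also have "emeasure M (deep t n) + emeasure trees E' \<le> ennreal (exp (2 * t) * (2 / 3) ^ n) + ennreal (measure trees E')"
    using deep_le(2) by (intro add_mono) (auto simp: T.emeasure_eq_measure)
  also have "... = ennreal (exp (2 * t) * (2 / 3) ^ n + measure trees E')" by (rule ennreal_plus[symmetric]) auto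
  finally have "measure (annealed M S Q) E \<le> exp (2 * t) * (2 / 3) ^ n + measure trees E'"
    unfolding An.emeasure_eq_measure by (subst (asm) ennreal_le_iff) auto
  then show ?thesis by (simp add: E_def E'_def sets_eq_imp_space_eq[OF an(1)])
qed

end

section \<open>Phases and convergence\<close>

text \<open>The horizon \<open>T\<close> may differ from the scaling parameter \<open>t\<close>; the
  cases T = t and T = t - 1 are both used with the same function.\<close>

lemma profile_prof:
  assumes A: "A ` {0..1} \<subseteq> {0..1}" "mono_on {0..1} A" "A 0 = 0" "A 1 = 1" "\<And>x. x \<in> {0<..<1} \<Longrightarrow> A x < x"
    and t: "0 < t" and T: "0 \<le> T" and \<rho>: "\<rho>^2 \<le> 1"
  shows "profile T (prof A t) \<rho>"
proof
  let ?c = "\<lambda>s. max 0 (min 1 (s / t)) :: real"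
  show "mono (prof A t)"
  proof (rule monoI)
    fix s r :: real assume "s \<le> r"
    then have "s / t \<le> r / t" using t by (simp add: divide_right_mono)
    then have "?c s \<le> ?c r" by (intro max.mono min.mono) auto
    then have "A (?c s) \<le> A (?c r)" by (intro mono_onD[OF A(2)]) auto
    then show "prof A t s \<le> prof A t r" using t by (simp add: prof_def)
  qed
  show "prof A t 0 = 0" by (simp add: prof_def A)
  fix s :: real assume s: "0 \<le> s"
  have "A x \<le> x" if "0 \<le> x" "x \<le> 1" for x
    using A(3,4) A(5)[of x] that by (cases "x = 0 \<or> x = 1") auto
  then have "prof A t s \<le> t * ?c s" unfolding prof_def using t by (intro mult_left_mono) auto
  also have "... \<le> t * (s / t)" using t s by (intro mult_left_mono) auto
  finally show "prof A t s \<le> s" using t by simp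
qed (use T \<rho> in auto)

text \<open>On a fixed window the profile is its tangent at 0 up to a small error, and A x < x keeps
  the slope of that tangent from exceeding 1.\<close>

lemma flat_prof:
  assumes A: "A 0 = 0" "\<And>x. x \<in> {0<..<1} \<Longrightarrow> A x < x" and D: "(A has_real_derivative D) (at 0 within {0..1})"
  shows "\<forall>\<^sub>F t in at_top. flat_on (prof A t) C"
proof -
  \<comment> \<open>Three errors of at most e \<bar>C\<bar> have to fit into the additive 1: the
    tangent error at each end point and the excess of the slope over 1.\<close>
  define e where "e = 1 / (3 * (\<bar>C\<bar> + 1))"
  have e: "0 < e" "3 * (e * \<bar>C\<bar>) \<le> 1" by (auto simp: e_def divide_simps)
  have "((\<lambda>x. (A x - A 0) / (x - 0)) \<longlongrightarrow> D) (at 0 within {0..1})" using D by (simp add: has_field_derivative_iff)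
  then have "\<forall>\<^sub>F x in at 0 within {0..1}. dist (A x / x) D < e" using e A by (auto dest: tendstoD)
  then obtain d where d: "0 < d" "\<And>x. x \<in> {0..1} \<Longrightarrow> x \<noteq> 0 \<Longrightarrow> \<bar>x\<bar> < d \<Longrightarrow> \<bar>A x / x - D\<bar> < e"
    unfolding eventually_at by (auto simp: dist_real_def)
  have Ad: "\<bar>A x - D * x\<bar> \<le> e * x" if "0 \<le> x" "x < d" "x < 1" for x
  proof (cases "x = 0")
    case False
    then have "\<bar>A x / x - D\<bar> * x \<le> e * x" using d(2)[of x] that by (intro mult_right_mono) auto
    moreover have "\<bar>A x / x - D\<bar> * x = \<bar>(A x / x - D) * x\<bar>" using that by (simp add: abs_mult)
    moreover have "(A x / x - D) * x = A x - D * x" using False by (simp add: left_diff_distrib)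
    ultimately show ?thesis by simp
  qed (simp add: A)
  \<comment> \<open>The slope is compared with A x / x < 1 at a single small x; the bound up to e is
    sufficient.\<close>
  have D1: "D \<le> 1 + e"
  proof -
    define x where "x = min d 1 / 2"
    have x: "0 < x" "x < d" "x < 1" using d(1) by (auto simp: x_def)
    have "D * x \<le> A x + e * x" using Ad[of x] x by (simp add: abs_le_iff)
    also have "... \<le> (1 + e) * x" using A(2)[of x] x by (simp add: distrib_right)
    finally show ?thesis using x by simp
  qed
  have "\<forall>\<^sub>F t in at_top. (\<bar>C\<bar> + 1) / min d 1 < t" by (rule eventually_gt_at_top)
  then show ?thesis
  proof eventually_elim
    case (elim t)
    have m: "0 < min d 1" using d by simp
    have t: "\<bar>C\<bar> + 1 < t * min d 1" using elim m by (simp add: pos_divide_less_eq)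
    then have "0 < t * min d 1" by (rule le_less_trans[rotated]) simp
    then have t0: "0 < t" using m by (simp add: zero_less_mult_iff)
    have P: "\<bar>prof A t s - D * s\<bar> \<le> e * \<bar>C\<bar>" if s: "0 \<le> s" "s \<le> C" for s
    proof -
      have "s < t * min d 1" using t s by simp
      then have sd: "s / t < min d 1" unfolding pos_divide_less_eq[OF t0] by (simp only: mult.commute)
      have "s / t < 1" using sd by simp
      then have "prof A t s = t * A (s / t)" using s t0 by (simp add: prof_def)
      then have "prof A t s - D * s = t * (A (s / t) - D * (s / t))" using t0 by (simp add: right_diff_distrib)
      then have "\<bar>prof A t s - D * s\<bar> = t * \<bar>A (s / t) - D * (s / t)\<bar>" using t0 by (simp only: abs_mult abs_of_pos)
      also have "... \<le> t * (e * (s / t))" using Ad[of "s / t"] sd s t0 by (intro mult_left_mono) auto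
      also have "... = e * s" using t0 by simp
      also have "... \<le> e * \<bar>C\<bar>" using e s by (intro mult_left_mono) auto
      finally show ?thesis .
    qed
    show ?case
      unfolding flat_on_def
    proof (intro allI impI, elim conjE)
      fix b s assume bs: "0 \<le> b" "b \<le> s" "s \<le> C"
      have "D * (s - b) \<le> (1 + e) * (s - b)" using D1 bs by (intro mult_right_mono) auto
      moreover have "e * (s - b) \<le> e * \<bar>C\<bar>" using e bs by (intro mult_left_mono) auto
      moreover have "D * s - D * b = D * (s - b)" "(1 + e) * (s - b) = (s - b) + e * (s - b)" by (simp_all add: algebra_simps)
      ultimately show "prof A t s - prof A t b \<le> s - b + 1"
        using P[of s] P[of b] bs e(2) unfolding abs_le_iff by linarith
    qed
  qed
qed

section \<open>Rates and phase boundaries\<close>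

lemma fluct_rate_half: "2 * \<sigma>^2 = 1 \<Longrightarrow> sqrt 2 * \<bar>\<sigma>\<bar> = 1 / 2 + \<sigma>^2"
proof -
  assume s: "2 * \<sigma>^2 = 1"
  have "sqrt 2 * \<bar>\<sigma>\<bar> = sqrt (2 * \<sigma>^2)" by (simp add: real_sqrt_mult)
  then show ?thesis using s by simp
qed

lemma continuous_fluct_rate: "continuous_on UNIV fluct_rate"
proof -
  have "continuous_on ({\<sigma>. 2 * \<sigma>^2 \<le> 1} \<union> {\<sigma>. 1 \<le> 2 * \<sigma>^2}) (\<lambda>\<sigma> :: real. if 2 * \<sigma>^2 \<le> 1 then 1 / 2 + \<sigma>^2 else sqrt 2 * \<bar>\<sigma>\<bar>)"
    by (rule continuous_on_cases) (auto intro!: closed_Collect_le continuous_intros simp: fluct_rate_half)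
  moreover have "{\<sigma>. 2 * \<sigma>^2 \<le> 1} \<union> {\<sigma> :: real. 1 \<le> 2 * \<sigma>^2} = UNIV" by auto
  ultimately show ?thesis by (simp add: fluct_rate_def[abs_def])
qed

definition mean_rate :: "complex \<Rightarrow> real" where
  "mean_rate \<beta> = 1 + ((Re \<beta>)^2 - (Im \<beta>)\<^sup>2) / 2"

text \<open>A dilation by 1 + d makes both weak inequalities strict and moves the point as little as
  desired.\<close>

lemma closure_phase2_iff: "\<beta> \<in> closure phase2 \<longleftrightarrow> 1 \<le> 2 * (Re \<beta>)^2 \<and> sqrt 2 \<le> \<bar>Re \<beta>\<bar> + \<bar>Im \<beta>\<bar>"
proof
  have "closure phase2 \<subseteq> {\<beta>. 1 \<le> 2 * (Re \<beta>)^2 \<and> sqrt 2 \<le> \<bar>Re \<beta>\<bar> + \<bar>Im \<beta>\<bar>}"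
    by (rule closure_minimal) (auto simp: phase2_def intro!: closed_Collect_conj closed_Collect_le continuous_intros)
  then show "\<beta> \<in> closure phase2 \<Longrightarrow> 1 \<le> 2 * (Re \<beta>)^2 \<and> sqrt 2 \<le> \<bar>Re \<beta>\<bar> + \<bar>Im \<beta>\<bar>" by blast
next
  assume b: "1 \<le> 2 * (Re \<beta>)^2 \<and> sqrt 2 \<le> \<bar>Re \<beta>\<bar> + \<bar>Im \<beta>\<bar>"
  show "\<beta> \<in> closure phase2"
    unfolding closure_approachable
  proof (intro allI impI)
    fix e :: real assume e: "0 < e"
    define d where "d = e / (norm \<beta> + 1)"
    have d: "0 < d" "d * norm \<beta> < e"
    proof -
      have "norm \<beta> + 1 > 0" by (rule add_nonneg_pos) auto
      then show "0 < d" "d * norm \<beta> < e" using e by (auto simp: d_def divide_simps distrib_left)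
    qed
    define y where "y = complex_of_real (1 + d) * \<beta>"
    have "1 < (1 + d)^2" using d by (simp add: power2_eq_square algebra_simps add_pos_pos)
    then have "2 * (Re \<beta>)^2 * 1 < 2 * (Re \<beta>)^2 * (1 + d)^2" using b by (intro mult_strict_left_mono) auto
    then have 1: "1 < 2 * (Re y)^2" using b by (simp add: y_def power_mult_distrib mult.commute mult.left_commute)
    have s: "0 < \<bar>Re \<beta>\<bar> + \<bar>Im \<beta>\<bar>" by (rule less_le_trans[of _ "sqrt 2"]) (use b in auto)
    have "\<bar>Re y\<bar> + \<bar>Im y\<bar> = (1 + d) * (\<bar>Re \<beta>\<bar> + \<bar>Im \<beta>\<bar>)" using d by (simp add: y_def abs_mult distrib_left)
    also have "... > sqrt 2" using b[THEN conjunct2] mult_pos_pos[OF d(1) s] unfolding distrib_right[of 1 d] by simp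
    finally have "y \<in> phase2" using 1 by (simp add: phase2_def)
    moreover have "dist y \<beta> = d * norm \<beta>" using d by (simp add: y_def dist_norm distrib_right norm_mult)
    ultimately show "\<exists>y\<in>phase2. dist y \<beta> < e" using d(2) by (intro bexI[of _ y]) simp_all
  qed
qed

text \<open>A dilation would violate the bound on the real part, so the real part is shrunk and the
  imaginary part stretched by the same relative amount.\<close>

lemma closure_phase3_iff: "\<beta> \<in> closure phase3 \<longleftrightarrow> 2 * (Re \<beta>)^2 \<le> 1 \<and> 1 \<le> (Re \<beta>)^2 + (Im \<beta>)^2"
proof
  have "closure phase3 \<subseteq> {\<beta>. 2 * (Re \<beta>)^2 \<le> 1 \<and> 1 \<le> (Re \<beta>)^2 + (Im \<beta>)^2}"
    by (rule closure_minimal) (auto simp: phase3_def intro!: closed_Collect_conj closed_Collect_le continuous_intros)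
  then show "\<beta> \<in> closure phase3 \<Longrightarrow> 2 * (Re \<beta>)^2 \<le> 1 \<and> 1 \<le> (Re \<beta>)^2 + (Im \<beta>)^2" by blast
next
  assume b: "2 * (Re \<beta>)^2 \<le> 1 \<and> 1 \<le> (Re \<beta>)^2 + (Im \<beta>)^2"
  show "\<beta> \<in> closure phase3"
    unfolding closure_approachable
  proof (intro allI impI)
    fix e :: real assume e: "0 < e"
    define d where "d = min (1 / 2) (e / (norm \<beta> + 1))"
    have d: "0 < d" "d \<le> 1 / 2" "d * norm \<beta> < e"
    proof -
      have n: "norm \<beta> + 1 > 0" by (rule add_nonneg_pos) auto
      then show "0 < d" using e by (auto simp: d_def)
      show "d \<le> 1 / 2" unfolding d_def by (rule min.cobounded1)
      have "d * norm \<beta> \<le> e / (norm \<beta> + 1) * norm \<beta>" by (intro mult_right_mono) (auto simp: d_def)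
      also have "... < e" using n e by (simp add: divide_simps distrib_left)
      finally show "d * norm \<beta> < e" .
    qed
    define y where "y = Complex ((1 - d) * Re \<beta>) ((1 + d) * Im \<beta>)"
    have "2 * (Re y)^2 < 1"
    proof (cases "Re \<beta> = 0")
      case False
      have "(1 - d)^2 < 1" using d by (simp add: power2_eq_square algebra_simps)
      then have "2 * (Re \<beta>)^2 * (1 - d)^2 < 2 * (Re \<beta>)^2 * 1" using False by (intro mult_strict_left_mono) auto
      then show ?thesis using b by (simp add: y_def power_mult_distrib mult.commute mult.left_commute)
    qed (simp add: y_def)
    moreover have "1 < (Re y)^2 + (Im y)^2"
    proof -
      define a c where "a = (Re \<beta>)^2" and "c = (Im \<beta>)^2"
      \<comment> \<open>c \<ge> a follows from a \<le> 1 / 2 and a + c \<ge> 1. The first-order term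
        vanishes at a = c, where the strict inequality rests on the term in d^2.\<close>
      have ac: "0 \<le> d * (c - a)" "0 < d^2 * (a + c)" "1 \<le> a + c" using b d by (auto simp: a_def c_def intro!: mult_nonneg_nonneg mult_pos_pos)
      have "(Re y)^2 + (Im y)^2 = (1 - d)^2 * a + (1 + d)^2 * c" by (simp add: y_def a_def c_def power_mult_distrib)
      also have "... = (a + c) + 2 * (d * (c - a)) + d^2 * (a + c)" by (simp add: power2_eq_square algebra_simps)
      finally show ?thesis using ac by linarith
    qed
    ultimately have "y \<in> phase3" by (simp add: phase3_def)
    moreover have "dist y \<beta> = d * norm \<beta>"
    proof -
      have "y - \<beta> = Complex (- d * Re \<beta>) (d * Im \<beta>)" by (simp add: y_def complex_eq_iff algebra_simps)
      then have "dist y \<beta> = sqrt (d^2 * ((Re \<beta>)^2 + (Im \<beta>)^2))" by (simp add: dist_norm cmod_def power_mult_distrib distrib_left)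
      then show ?thesis using d by (simp add: real_sqrt_mult cmod_def)
    qed
    ultimately show "\<exists>y\<in>phase3. dist y \<beta> < e" using d(3) by (intro bexI[of _ y]) simp_all
  qed
qed

text \<open>The difference of the two rates is a difference of squares, half of (sqrt 2 -
  \<bar>\<sigma>\<bar>)^2 - \<tau>^2; this is where the straight boundary \<bar>\<sigma>\<bar> +
  \<bar>\<tau>\<bar> = sqrt 2 comes from.\<close>

lemma mean_rate_le_sqrt_iff:
  "mean_rate \<beta> \<le> sqrt 2 * \<bar>Re \<beta>\<bar> \<longleftrightarrow> \<bar>sqrt 2 - \<bar>Re \<beta>\<bar>\<bar> \<le> \<bar>Im \<beta>\<bar>"
proof -
  have "mean_rate \<beta> \<le> sqrt 2 * \<bar>Re \<beta>\<bar> \<longleftrightarrow> (sqrt 2 - \<bar>Re \<beta>\<bar>)\<^sup>2 \<le> (Im \<beta>)^2"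
    by (simp add: mean_rate_def power2_diff mult.assoc field_simps)
  then show ?thesis by (simp add: abs_le_square_iff)
qed

text \<open>For \<bar>Re \<beta>\<bar> above sqrt 2 the mean can grow faster than the typical
  partition function, so the comparison of rates is restricted to (Re \<beta>)^2 \<le> 2.\<close>

lemma closure_phase2_rates:
  assumes "\<beta> \<in> closure phase2"
  shows "fluct_rate (Re \<beta>) = sqrt 2 * \<bar>Re \<beta>\<bar>" "(Re \<beta>)^2 \<le> 2 \<Longrightarrow> mean_rate \<beta> \<le> fluct_rate (Re \<beta>)" "\<beta> \<noteq> 0"
proof -
  have b: "1 \<le> 2 * (Re \<beta>)^2" "sqrt 2 \<le> \<bar>Re \<beta>\<bar> + \<bar>Im \<beta>\<bar>" using assms by (simp_all add: closure_phase2_iff)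
  show f: "fluct_rate (Re \<beta>) = sqrt 2 * \<bar>Re \<beta>\<bar>" using b(1) fluct_rate_half[of "Re \<beta>"] by (auto simp: fluct_rate_def)
  show "\<beta> \<noteq> 0" using b by auto
  assume "(Re \<beta>)^2 \<le> 2"
  then have "\<bar>Re \<beta>\<bar> \<le> sqrt 2" by (metis real_sqrt_le_mono real_sqrt_abs)
  then show "mean_rate \<beta> \<le> fluct_rate (Re \<beta>)" unfolding f mean_rate_le_sqrt_iff using b(2) by simp
qed

lemma closure_phase3_rates:
  assumes "\<beta> \<in> closure phase3"
  shows "fluct_rate (Re \<beta>) = 1 / 2 + (Re \<beta>)^2" "mean_rate \<beta> \<le> fluct_rate (Re \<beta>)" "\<beta> \<noteq> 0"
  using assms by (auto simp: closure_phase3_iff fluct_rate_def mean_rate_def field_simps)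

lemma phase1_rates:
  assumes "\<beta> \<in> phase1"
  shows "(Re \<beta>)^2 < 2" "fluct_rate (Re \<beta>) < mean_rate \<beta>"
proof -
  have n2: "\<beta> \<notin> closure phase2" and n3: "\<beta> \<notin> closure phase3" using assms by (auto simp: phase1_def closure_Un)
  show l: "(Re \<beta>)^2 < 2"
  proof (rule ccontr)
    assume "\<not> (Re \<beta>)\<^sup>2 < 2"
    then have "2 \<le> (Re \<beta>)^2" by simp
    then have "sqrt 2 \<le> \<bar>Re \<beta>\<bar>" by (metis real_sqrt_le_mono real_sqrt_abs)
    then show False using n2 \<open>2 \<le> (Re \<beta>)^2\<close> by (auto simp: closure_phase2_iff)
  qed
  show "fluct_rate (Re \<beta>) < mean_rate \<beta>"
  proof (cases "2 * (Re \<beta>)^2 \<le> 1")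
    case True
    then show ?thesis using n3 by (simp add: closure_phase3_iff fluct_rate_def mean_rate_def field_simps)
  next
    case False
    have "\<bar>Re \<beta>\<bar> \<le> sqrt 2" using l by (metis real_sqrt_le_mono real_sqrt_abs less_imp_le)
    then have "\<not> mean_rate \<beta> \<le> sqrt 2 * \<bar>Re \<beta>\<bar>" unfolding mean_rate_le_sqrt_iff using n2 False by (auto simp: closure_phase2_iff)
    then show ?thesis using False by (simp add: fluct_rate_def)
  qed
qed

text \<open>The weak inequality defines a closed set by continuity of the rates. A point of the
  closure outside \<open>phase1\<close> lies in the closure of another phase, where the reverse
  inequality holds; so the two rates coincide there.\<close>

lemma closure_phase1_rates:
  assumes "\<beta> \<in> closure phase1"
  shows "fluct_rate (Re \<beta>) \<le> mean_rate \<beta>"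
    and "\<beta> \<in> phase1 \<or> \<beta> \<noteq> 0 \<and> mean_rate \<beta> = fluct_rate (Re \<beta>)"
proof -
  have "closure phase1 \<subseteq> {\<beta>. (Re \<beta>)^2 \<le> 2 \<and> fluct_rate (Re \<beta>) \<le> mean_rate \<beta>}"
  proof (rule closure_minimal)
    show "phase1 \<subseteq> {\<beta>. (Re \<beta>)^2 \<le> 2 \<and> fluct_rate (Re \<beta>) \<le> mean_rate \<beta>}" using phase1_rates by (auto intro: less_imp_le)
    have "continuous_on UNIV (\<lambda>\<beta>. fluct_rate (Re \<beta>))"
      by (rule continuous_on_compose2[OF continuous_fluct_rate]) (auto intro!: continuous_intros)
    then show "closed {\<beta>. (Re \<beta>)^2 \<le> 2 \<and> fluct_rate (Re \<beta>) \<le> mean_rate \<beta>}"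
      unfolding mean_rate_def by (intro closed_Collect_conj closed_Collect_le continuous_intros) auto
  qed
  then have b: "(Re \<beta>)^2 \<le> 2" "fluct_rate (Re \<beta>) \<le> mean_rate \<beta>" using assms by auto
  then show "fluct_rate (Re \<beta>) \<le> mean_rate \<beta>" by simp
  show "\<beta> \<in> phase1 \<or> \<beta> \<noteq> 0 \<and> mean_rate \<beta> = fluct_rate (Re \<beta>)"
  proof (cases "\<beta> \<in> phase1")
    case False
    then consider "\<beta> \<in> closure phase2" | "\<beta> \<in> closure phase3" by (auto simp: phase1_def closure_Un)
    then show ?thesis
      by cases (use b closure_phase2_rates[of \<beta>] closure_phase3_rates[of \<beta>] in \<open>auto intro: antisym\<close>)
  qed simp
qed

text \<open>The comparison with the mean needs a strict gap between the rates. At points where the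
  rates agree, on the boundary of the first phase, the fluctuations already reach the common rate
  and the second alternative applies.\<close>

lemma lower_bound:
  assumes \<beta>: "(Re \<beta>)^2 < 2 \<and> fluct_rate (Re \<beta>) < mean_rate \<beta> \<and> l = mean_rate \<beta> \<or> \<beta> \<noteq> 0 \<and> l = fluct_rate (Re \<beta>)"
    and \<rho>: "\<rho>^2 \<le> 1" and \<epsilon>: "0 < \<epsilon>" and \<eta>: "0 < \<eta>"
  shows "\<exists>C. \<forall>t B. profile t B \<rho> \<longrightarrow> profile (t - 1) B \<rho> \<longrightarrow> C \<le> t \<longrightarrow> flat_on B C \<longrightarrow>
    (\<exists>n0. \<forall>n\<ge>n0. measure trees {\<omega>. norm (part t B \<rho> \<beta> n 0 \<omega>) \<le> exp (t * (l - \<epsilon>))} \<le> \<eta>)"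
  using \<beta>
proof
  assume "\<beta> \<noteq> 0 \<and> l = fluct_rate (Re \<beta>)"
  then show ?thesis using lower_fluct[of \<beta> \<rho> \<epsilon> \<eta>] \<rho> \<epsilon> \<eta> by simp
next
  interpret P: prob_space "trees" by (rule prob_space_tree)
  assume b: "(Re \<beta>)^2 < 2 \<and> fluct_rate (Re \<beta>) < mean_rate \<beta> \<and> l = mean_rate \<beta>"
  then have "\<exists>\<delta>>0. \<exists>C'. \<forall>T B \<rho>. profile T B \<rho> \<longrightarrow> C' \<le> T \<longrightarrow> flat_on B C' \<longrightarrow>
      (\<exists>n0. \<forall>n\<ge>n0. measure trees {\<omega>. norm (part T B \<rho> \<beta> n 0 \<omega>) \<le> \<delta> * profile.full_mean T B \<beta> 0} \<le> \<eta>)"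
    using \<eta> by (intro lower_mean) (auto simp: mean_rate_def)
  then obtain \<delta> C where \<delta>: "0 < \<delta>" and C: "\<And>T B. profile T B \<rho> \<Longrightarrow> C \<le> T \<Longrightarrow> flat_on B C \<Longrightarrow>
      \<exists>n0. \<forall>n\<ge>n0. measure trees {\<omega>. norm (part T B \<rho> \<beta> n 0 \<omega>) \<le> \<delta> * profile.full_mean T B \<beta> 0} \<le> \<eta>"
    by blast
  show ?thesis
  proof (intro exI[of _ "max C (- ln \<delta> / \<epsilon>)"] allI impI)
    fix t B assume t: "profile t B \<rho>" "max C (- ln \<delta> / \<epsilon>) \<le> t" "flat_on B (max C (- ln \<delta> / \<epsilon>))"
    interpret B: profile t B \<rho> by fact
    have "flat_on B C" by (rule flat_on_mono[OF t(3)]) simp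
    with C[OF t(1)] t(2) obtain n0 where n0: "\<And>n. n0 \<le> n \<Longrightarrow> measure trees {\<omega>. norm (part t B \<rho> \<beta> n 0 \<omega>) \<le> \<delta> * B.full_mean \<beta> 0} \<le> \<eta>"
      by auto
    have "- ln \<delta> / \<epsilon> \<le> t" using t(2) by (simp only: max.bounded_iff)
    then have "- ln \<delta> \<le> t * \<epsilon>" unfolding pos_divide_le_eq[OF \<epsilon>] .
    then have "exp (t * (l - \<epsilon>)) \<le> exp (ln \<delta> + t * l)" by (simp add: right_diff_distrib)
    also have "... = \<delta> * B.full_mean \<beta> 0"
      using \<delta> b by (simp add: exp_add B.full_mean_def mean_rate_def distrib_left mult.commute add.commute)
    finally have le: "exp (t * (l - \<epsilon>)) \<le> \<delta> * B.full_mean \<beta> 0" .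
    have "measure trees {\<omega>. norm (part t B \<rho> \<beta> n 0 \<omega>) \<le> exp (t * (l - \<epsilon>))} \<le> \<eta>" if "n0 \<le> n" for n
    proof (rule order_trans[OF P.finite_measure_mono n0[OF that]])
      note [measurable] = B.measurable_part_0[of \<beta> n]
      have "{\<omega> \<in> space trees. norm (part t B \<rho> \<beta> n 0 \<omega>) \<le> \<delta> * B.full_mean \<beta> 0} \<in> sets trees" by measurable
      then show "{\<omega>. norm (part t B \<rho> \<beta> n 0 \<omega>) \<le> \<delta> * B.full_mean \<beta> 0} \<in> sets trees" by simp
    qed (use le in auto)
    then show "\<exists>n0. \<forall>n\<ge>n0. measure trees {\<omega>. norm (part t B \<rho> \<beta> n 0 \<omega>) \<le> exp (t * (l - \<epsilon>))} \<le> \<eta>" by blast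
  qed
qed

section \<open>Convergence in probability\<close>

context binary_crem
begin

theorem conv_in_prob_rate:
  assumes wc: "weak_correlation A" and crem: "\<And>t. 0 < t \<Longrightarrow> crem A t M life offs (S t) (Q t) (x t) (z t)" and \<rho>: "\<rho>^2 \<le> 1"
    and up: "(Re \<beta>)^2 < 2 \<Longrightarrow> mean_rate \<beta> \<le> l" "fluct_rate (Re \<beta>) \<le> l"
    and low: "(Re \<beta>)^2 < 2 \<and> fluct_rate (Re \<beta>) < mean_rate \<beta> \<and> l = mean_rate \<beta> \<or> \<beta> \<noteq> 0 \<and> l = fluct_rate (Re \<beta>)"
  shows "conv_in_prob (\<lambda>t. annealed M (S t) (Q t)) (\<lambda>t. log_partition \<beta> \<rho> t life offs (x t) (z t)) l"
proof -
  interpret T: prob_space "trees" by (rule prob_space_tree)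
  have A: "A ` {0..1} \<subseteq> {0..1}" "mono_on {0..1} A" "A 0 = 0" "A 1 = 1" "\<And>x. x \<in> {0<..<1} \<Longrightarrow> A x < x"
    using wc by (simp_all add: weak_correlation_def)
  obtain D where D: "(A has_real_derivative D) (at 0 within {0..1})"
    using wc unfolding weak_correlation_def slope_at_start_def by blast
  let ?P = "\<lambda>t. annealed M (S t) (Q t)"
  let ?X = "\<lambda>t. partition_function \<beta> \<rho> t life offs (x t) (z t)"
  let ?F = "\<lambda>t. log_partition \<beta> \<rho> t life offs (x t) (z t)"
  have basic: "prob_space (?P t)" "?X t \<in> borel_measurable (?P t)" if t: "0 < t" for t
  proof -
    have Q: "Q t \<in> M \<rightarrow>\<^sub>M prob_algebra (S t)" using crem[OF t] by (simp add: crem_def)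
    note an = annealed_kernel[OF M.prob_space_axioms Q]
    show "prob_space (?P t)" by (rule an)
    show "?X t \<in> borel_measurable (?P t)"
      unfolding measurable_cong_sets[OF an(1) refl] by (rule measurable_partition_function[OF t crem[OF t]])
  qed
  show ?thesis
    unfolding conv_in_prob_def
  proof (intro conjI allI impI)
    show "\<forall>\<^sub>F t in at_top. prob_space (?P t) \<and> ?F t \<in> borel_measurable (?P t)"
      using eventually_gt_at_top[of 0]
    proof eventually_elim
      case (elim t)
      note [measurable] = basic(2)[OF elim]
      have "?F t \<in> borel_measurable (?P t)" unfolding log_partition_def[abs_def] by measurable
      with basic(1)[OF elim] show ?case by simp
    qed
    fix \<epsilon> :: real assume \<epsilon>: "0 < \<epsilon>"
    show "((\<lambda>t. measure (?P t) {\<xi> \<in> space (?P t). \<epsilon> < \<bar>?F t \<xi> - l\<bar>}) \<longlongrightarrow> 0) at_top"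
    proof (rule tendstoI)
      fix \<eta> :: real assume \<eta>: "0 < \<eta>"
      \<comment> \<open>Deep trees, the upper tail and the lower tail get one share each; three
        shares stay strictly below \<eta>.\<close>
      define \<theta> where "\<theta> = \<eta> / 4"
      have \<theta>: "0 < \<theta>" "3 * \<theta> < \<eta>" using \<eta> by (simp_all add: \<theta>_def)
      obtain C where C: "\<And>t B. profile t B \<rho> \<Longrightarrow> profile (t - 1) B \<rho> \<Longrightarrow> C \<le> t \<Longrightarrow> flat_on B C \<Longrightarrow>
          \<exists>n0. \<forall>n\<ge>n0. measure trees {\<omega>. norm (part t B \<rho> \<beta> n 0 \<omega>) \<le> exp (t * (l - \<epsilon>))} \<le> \<theta>"
        using lower_bound[OF low \<rho> \<epsilon> \<theta>(1)] by blast
      have ce: "0 < crit_exp (Re \<beta>) * \<epsilon>" using \<epsilon> crit_exp_pos by simp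
      have fl: "\<forall>\<^sub>F t in at_top. flat_on (prof A t) C" by (rule flat_prof[OF A(3) A(5)]) (use D in auto)
      have "((\<lambda>t. (1 + 1500 * t) * exp (- k * t)) \<longlongrightarrow> 0) at_top" if "0 < k" for k :: real
        using that by real_asymp
      from this[OF ce] have "\<forall>\<^sub>F t in at_top. (1 + 1500 * t) * exp (- (crit_exp (Re \<beta>) * \<epsilon>) * t) < \<theta>"
        using \<theta> by (auto dest: order_tendstoD)
      then show "\<forall>\<^sub>F t in at_top. dist (measure (?P t) {\<xi> \<in> space (?P t). \<epsilon> < \<bar>?F t \<xi> - l\<bar>}) 0 < \<eta>"
        using fl eventually_ge_at_top[of "max 1 C"]
      proof eventually_elim
        case (elim t)
        have t: "0 < t" "1 \<le> t" "C \<le> t" using elim(3) by auto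
        interpret P: prob_space "?P t" by (rule basic(1)[OF t(1)])
        have pr: "profile t (prof A t) \<rho>" "profile (t - 1) (prof A t) \<rho>"
          using t by (auto intro!: profile_prof[OF A] \<rho>)
        interpret B: profile t "prof A t" \<rho> by (rule pr)
        from C[OF pr t(3) elim(2)] obtain n0 where
          n0: "\<And>n. n0 \<le> n \<Longrightarrow> measure trees {\<omega>. norm (part t (prof A t) \<rho> \<beta> n 0 \<omega>) \<le> exp (t * (l - \<epsilon>))} \<le> \<theta>" by blast
        have "(\<lambda>n. exp (2 * t) * (2 / 3) ^ n) \<longlonglongrightarrow> exp (2 * t) * 0" by (intro tendsto_intros LIMSEQ_realpow_zero) auto
        from order_tendstoD(2)[OF this, of \<theta>] have "\<forall>\<^sub>F n in sequentially. exp (2 * t) * (2 / 3) ^ n < \<theta>" using \<theta> by simp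
        then obtain n1 where n1: "\<And>n. n1 \<le> n \<Longrightarrow> exp (2 * t) * (2 / 3) ^ n < \<theta>" unfolding eventually_sequentially by blast
        \<comment> \<open>Chosen after \<open>t\<close>: the lower tail holds for all large n at
          fixed t, the upper tail for every n, and the probability of a deep tree tends to 0 in
          n.\<close>
        define n where "n = max n0 n1"
        let ?p = "part t (prof A t) \<rho> \<beta> n 0"
        \<comment> \<open>The set contains 0, so a vanishing partition function is counted as a
          deviation irrespective of the value assigned to its logarithm.\<close>
        define U where "U = {exp (t * (l + \<epsilon>))..} \<union> {..exp (t * (l - \<epsilon>))}"
        have U: "U \<in> sets borel" by (simp add: U_def)
        have "measure (?P t) {\<xi> \<in> space (?P t). \<epsilon> < \<bar>?F t \<xi> - l\<bar>} \<le> measure (?P t) {\<xi> \<in> space (?P t). norm (?X t \<xi>) \<in> U}"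
        proof (rule P.finite_measure_mono)
          show "{\<xi> \<in> space (?P t). norm (?X t \<xi>) \<in> U} \<in> sets (?P t)"
          proof -
            have "(\<lambda>\<xi>. norm (?X t \<xi>)) \<in> borel_measurable (?P t)" using basic(2)[OF t(1)] by simp
            from measurable_sets[OF this U] show ?thesis by (simp add: vimage_def Int_def conj_commute)
          qed
          show "{\<xi> \<in> space (?P t). \<epsilon> < \<bar>?F t \<xi> - l\<bar>} \<subseteq> {\<xi> \<in> space (?P t). norm (?X t \<xi>) \<in> U}"
          proof safe
            fix \<xi> assume d: "\<epsilon> < \<bar>?F t \<xi> - l\<bar>"
            show "norm (?X t \<xi>) \<in> U"
            proof (cases "?X t \<xi> = 0")
              case False
              then have e: "norm (?X t \<xi>) = exp (t * ?F t \<xi>)" using t by (simp add: log_partition_def)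
              have "l + \<epsilon> \<le> ?F t \<xi> \<or> ?F t \<xi> \<le> l - \<epsilon>" using d by linarith
              then show ?thesis unfolding U_def e using t by auto
            qed (simp add: U_def)
          qed
        qed
        also have "... \<le> exp (2 * t) * (2 / 3) ^ n + measure trees {\<omega>. norm (?p \<omega>) \<in> U}"
          by (rule annealed_le[OF t(1) A(3,4) pr(1) crem[OF t(1)] U])
        also have "measure trees {\<omega>. norm (?p \<omega>) \<in> U} \<le> measure trees {\<omega>. exp (t * (l + \<epsilon>)) \<le> norm (?p \<omega>)} + measure trees {\<omega>. norm (?p \<omega>) \<le> exp (t * (l - \<epsilon>))}"
        proof -
          note [measurable] = B.measurable_part_0[of \<beta> n]
          have "{\<omega> \<in> space trees. exp (t * (l + \<epsilon>)) \<le> norm (?p \<omega>)} \<in> sets trees"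
            "{\<omega> \<in> space trees. norm (?p \<omega>) \<le> exp (t * (l - \<epsilon>))} \<in> sets trees" by measurable
          then have s: "{\<omega>. exp (t * (l + \<epsilon>)) \<le> norm (?p \<omega>)} \<in> sets trees" "{\<omega>. norm (?p \<omega>) \<le> exp (t * (l - \<epsilon>))} \<in> sets trees" by simp_all
          have "{\<omega>. norm (?p \<omega>) \<in> U} = {\<omega>. exp (t * (l + \<epsilon>)) \<le> norm (?p \<omega>)} \<union> {\<omega>. norm (?p \<omega>) \<le> exp (t * (l - \<epsilon>))}" by (auto simp: U_def)
          then show ?thesis using measure_Un_le[OF s] by simp
        qed
        also have "measure trees {\<omega>. exp (t * (l + \<epsilon>)) \<le> norm (?p \<omega>)} \<le> (1 + 1500 * t) * exp (- crit_exp (Re \<beta>) * \<epsilon> * t)"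
          using up by (intro B.upper_tail t \<epsilon>) (auto simp: mean_rate_def)
        also have "measure trees {\<omega>. norm (?p \<omega>) \<le> exp (t * (l - \<epsilon>))} \<le> \<theta>" by (rule n0) (simp add: n_def)
        finally have "measure (?P t) {\<xi> \<in> space (?P t). \<epsilon> < \<bar>?F t \<xi> - l\<bar>} < \<eta>"
          using elim(1) n1[of n] \<theta>(2) by (simp add: n_def)
        then show ?case by simp
      qed
    qed
  qed
qed

end

theorem theorem1p2:
  fixes A :: "real \<Rightarrow> real" and p :: "nat pmf"
    and M :: "'a measure"
    and life :: "nat list \<Rightarrow> 'a \<Rightarrow> real" and offs :: "nat list \<Rightarrow> 'a \<Rightarrow> nat"
    and S :: "real \<Rightarrow> 'b measure" and Q :: "real \<Rightarrow> 'a \<Rightarrow> 'b measure"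
    and x z :: "real \<Rightarrow> nat list \<Rightarrow> real \<Rightarrow> 'a \<times> 'b \<Rightarrow> real"
    and \<rho> :: real and \<beta> :: complex
  assumes "weak_correlation A"
    and "galton_watson M p life offs"
    and "pmf p 2 = 1"
    and "\<And>t. t > 0 \<Longrightarrow> crem A t M life offs (S t) (Q t) (x t) (z t)"
    and "\<rho> \<in> {-1..1}"
  defines "F \<equiv> \<lambda>t. log_partition \<beta> \<rho> t life offs (x t) (z t)"
    and "P \<equiv> \<lambda>t. annealed M (S t) (Q t)"
  shows "(\<beta> \<in> closure phase1 \<longrightarrow> conv_in_prob P F (1 + ((Re \<beta>)\<^sup>2 - (Im \<beta>)\<^sup>2) / 2)) \<and>
         (\<beta> \<in> closure phase2 \<longrightarrow> conv_in_prob P F (sqrt 2 * \<bar>Re \<beta>\<bar>)) \<and>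
         (\<beta> \<in> closure phase3 \<longrightarrow> conv_in_prob P F (1 / 2 + (Re \<beta>)\<^sup>2))"
proof -
  interpret binary_crem A p M life offs by unfold_locales fact+
  have \<rho>: "\<rho>\<^sup>2 \<le> 1" using assms(5) by (simp add: abs_square_le_1 abs_le_iff)
  have conv: "conv_in_prob P F l"
    if "(Re \<beta>)\<^sup>2 < 2 \<Longrightarrow> mean_rate \<beta> \<le> l" "fluct_rate (Re \<beta>) \<le> l"
      "(Re \<beta>)\<^sup>2 < 2 \<and> fluct_rate (Re \<beta>) < mean_rate \<beta> \<and> l = mean_rate \<beta> \<or> \<beta> \<noteq> 0 \<and> l = fluct_rate (Re \<beta>)" for l
    unfolding P_def F_def by (rule conv_in_prob_rate[OF assms(1,4) \<rho> that])
  show ?thesis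
  proof (intro conjI impI)
    assume b: "\<beta> \<in> closure phase1"
    show "conv_in_prob P F (1 + ((Re \<beta>)\<^sup>2 - (Im \<beta>)\<^sup>2) / 2)"
      unfolding mean_rate_def[symmetric] by (rule conv) (use closure_phase1_rates[OF b] phase1_rates[of \<beta>] in auto)
  next
    assume b: "\<beta> \<in> closure phase2"
    show "conv_in_prob P F (sqrt 2 * \<bar>Re \<beta>\<bar>)"
      by (rule conv) (use closure_phase2_rates[OF b] in auto)
  next
    assume b: "\<beta> \<in> closure phase3"
    show "conv_in_prob P F (1 / 2 + (Re \<beta>)\<^sup>2)"
      by (rule conv) (use closure_phase3_rates[OF b] in auto)
  qed
qed

end
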